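(* Let $p \in (1, \infty)$ and let $A$ be an approximately unital $L^p$-operator algebra. The following are equivalent: (1) $\mathfrak{r}_A$ is weak* dense in $\mathfrak{r}_{A^{**}}$. (2) $\mathfrak{r}_A \cap \mathrm{Ball}(A)$ is weak* dense in $\mathfrak{r}_{A^{**}} \cap \mathrm{Ball}(A^{**})$. (3) $\mathfrak{F}_A$ is weak* dense in $\mathfrak{F}_{A^{**}}$. (4) $A$ is scaled.
   Context: An $L^p$-operator algebra is a (complex) Banach algebra isometrically isomorphic to a norm closed subalgebra of $B(L^p(X,\mu))$ for some measure space $(X,\mu)$. A unital Banach algebra is one with an identity of norm $1$. A cai is a contractive approximate identity (a net $(e_t)$ with $\|e_t\|\le1$, $e_ta\to a$, $ae_t\to a$ for all $a$). Approximately unital means having a cai. $\mathrm{Ball}(E)$ is the closed unit ball of $E$. $L^p$-operator algebras ($1<p<\infty$) are Arens regular, and for $A$ approximately unital the bidual $A^{**}$, with the Arens product, is a unital Banach algebra. Multiplier unitization: for a nonunital approximately unital Banach algebra $A$, $A^1 = A + \mathbb{C}1$ with norm $\|a+\lambda 1\| = \sup\{\|ac+\lambda c\| : c \in A, \|c\|\le 1\}$; if $A$ is unital, $A^1 = A$. A state on a unital Banach algebra is a linear functional $\omega$ with $\|\omega\| = \omega(1)=1$. An element $a$ of a unital Banach algebra is real positive (accretive) if $\mathrm{Re}\,\omega(a)\ge 0$ for all states $\omega$. For $A$ approximately unital, $\mathfrak{r}_A$ is the set of $a\in A$ that are real positive in $A^1$, and $\mathfrak{F}_A = \{a\in A : \|1-a\|\le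 1\}$, where $1$ is the identity of $A^1$. Here $\mathfrak{r}_{A^{**}}$ and $\mathfrak{F}_{A^{**}}$ are the sets so defined for the unital Banach algebra $A^{**}$ (with its own identity). A state on an approximately unital Banach algebra $A$ is a functional of norm $1$ on $A$ which is the restriction to $A$ of a state on $A^1$. The quasistate space is $Q(A) = \{\lambda\varphi : \lambda\in[0,1],\ \varphi \text{ a state on } A\}$. A nonunital approximately unital Banach algebra $A$ is scaled if the set of restrictions to $A$ of states on $A^1$ equals $Q(A)$; all unital Banach algebras are (regarded as) scaled. (Equivalently, in all cases: every $\varphi\in A^*$ with $\mathrm{Re}\,\varphi\ge 0$ on $\mathfrak{r}_A$ is a nonnegative multiple of a state on $A$.) *)

theory Defs
  imports "HOL-Analysis.Analysis"
begin

section \<open>Complex normed spaces and complex Banach algebras\<close>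

class complex_vector = real_vector +
  fixes scaleC :: "complex \<Rightarrow> 'a \<Rightarrow> 'a"  (infixr "*\<^sub>C" 75)
  assumes scaleC_add_right: "c *\<^sub>C (x + y) = c *\<^sub>C x + c *\<^sub>C y"
    and scaleC_add_left: "(c + d) *\<^sub>C x = c *\<^sub>C x + d *\<^sub>C x"
    and scaleC_scaleC: "c *\<^sub>C (d *\<^sub>C x) = (c * d) *\<^sub>C x"
    and scaleR_scaleC: "r *\<^sub>R x = complex_of_real r *\<^sub>C x"

class complex_normed_vector = complex_vector + real_normed_vector +
  assumes norm_scaleC: "norm (c *\<^sub>C x) = cmod c * norm x"

text \<open>No multiplicative identity is required, as in the class \<^class>\<open>real_normed_algebra\<close>.\<close>

class complex_banach_algebra = complex_normed_vector + real_normed_algebra + banach +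
  assumes mult_scaleC_left: "(c *\<^sub>C x) * y = c *\<^sub>C (x * y)"
    and mult_scaleC_right: "x * (c *\<^sub>C y) = c *\<^sub>C (x * y)"

lemma vector_space_scaleC: "vector_space (scaleC :: complex \<Rightarrow> 'a::complex_vector \<Rightarrow> 'a)"
proof
  fix x :: 'a
  show "1 *\<^sub>C x = x"
    using scaleR_scaleC[of 1 x] by simp
qed (simp_all add: scaleC_add_right scaleC_add_left scaleC_scaleC)

instantiation prod :: (complex_vector, complex_vector) complex_vector
begin

definition scaleC_prod :: "complex \<Rightarrow> 'a \<times> 'b \<Rightarrow> 'a \<times> 'b"
  where "scaleC_prod c x = (c *\<^sub>C fst x, c *\<^sub>C snd x)"

instance
  by standard
    (simp_all add: scaleC_prod_def scaleC_add_right scaleC_add_left scaleC_scaleC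
      scaleR_scaleC prod_eq_iff)

end

instantiation complex :: complex_banach_algebra
begin

definition scaleC_complex :: "complex \<Rightarrow> complex \<Rightarrow> complex"
  where "scaleC_complex = (*)"

instance
  by standard
    (simp_all add: scaleC_complex_def algebra_simps norm_mult scaleR_conv_of_real)

end

definition clinear :: "('a::complex_vector \<Rightarrow> complex) \<Rightarrow> bool"
  where "clinear f \<longleftrightarrow>
    (\<forall>x y. f (x + y) = f x + f y) \<and> (\<forall>c x. f (c *\<^sub>C x) = c * f x)"


section \<open>Dual space, bidual, weak* topology, Arens product\<close>

typedef (overloaded) 'a cdual =
  "{f :: 'a::complex_normed_vector \<Rightarrow> complex. bounded_linear f \<and> clinear f}"
  morphisms cdual_apply Abs_cdual
  by (rule exI[of _ "\<lambda>x. 0"]) (simp add: clinear_def)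

setup_lifting type_definition_cdual

lemma bounded_linear_cdual_apply: "bounded_linear (cdual_apply f)"
  and cdual_apply_scaleC: "cdual_apply f (c *\<^sub>C x) = c * cdual_apply f x"
  using cdual_apply[of f] by (auto simp: clinear_def)

lemmas cdual_apply_add = linear_add[OF bounded_linear.linear[OF bounded_linear_cdual_apply]]

instantiation cdual :: (complex_normed_vector) complex_normed_vector
begin

lift_definition norm_cdual :: "'a cdual \<Rightarrow> real" is onorm .

lift_definition minus_cdual :: "'a cdual \<Rightarrow> 'a cdual \<Rightarrow> 'a cdual"
  is "\<lambda>f g x. f x - g x"
  by (auto simp: clinear_def algebra_simps intro: bounded_linear_sub)

definition dist_cdual :: "'a cdual \<Rightarrow> 'a cdual \<Rightarrow> real"
  where "dist_cdual f g = norm (f - g)"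

definition uniformity_cdual :: "('a cdual \<times> 'a cdual) filter"
  where "uniformity_cdual = (INF e\<in>{0 <..}. principal {(x, y). dist x y < e})"

definition open_cdual :: "'a cdual set \<Rightarrow> bool"
  where "open_cdual S = (\<forall>x\<in>S. \<forall>\<^sub>F (x', y) in uniformity. x' = x \<longrightarrow> y \<in> S)"

lift_definition uminus_cdual :: "'a cdual \<Rightarrow> 'a cdual" is "\<lambda>f x. - f x"
  by (auto simp: clinear_def intro: bounded_linear_minus)

lift_definition zero_cdual :: "'a cdual" is "\<lambda>x. 0"
  by (simp add: clinear_def)

lift_definition plus_cdual :: "'a cdual \<Rightarrow> 'a cdual \<Rightarrow> 'a cdual"
  is "\<lambda>f g x. f x + g x"
  by (auto simp: clinear_def algebra_simps intro: bounded_linear_add)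

lift_definition scaleR_cdual :: "real \<Rightarrow> 'a cdual \<Rightarrow> 'a cdual" is "\<lambda>r f x. r *\<^sub>R f x"
  by (auto simp: clinear_def algebra_simps
      intro: bounded_linear_compose[OF bounded_linear_scaleR_right])

lift_definition scaleC_cdual :: "complex \<Rightarrow> 'a cdual \<Rightarrow> 'a cdual" is "\<lambda>c f x. c * f x"
  by (auto simp: clinear_def algebra_simps intro: bounded_linear_const_mult)

definition sgn_cdual :: "'a cdual \<Rightarrow> 'a cdual"
  where "sgn_cdual f = inverse (norm f) *\<^sub>R f"

instance
proof
  fix f g h :: "'a cdual" and a b :: real and c d :: complex
  show "f + g + h = f + (g + h)" by transfer (simp add: algebra_simps)
  show "f + g = g + f" by transfer (simp add: algebra_simps)
  show "0 + f = f" by transfer (simp add: mult.assoc)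
  show "- f + f = 0" by transfer (simp add: mult.assoc)
  show "f - g = f + - g" by transfer (simp add: mult.assoc)
  show "a *\<^sub>R (f + g) = a *\<^sub>R f + a *\<^sub>R g" by transfer (simp add: algebra_simps)
  show "(a + b) *\<^sub>R f = a *\<^sub>R f + b *\<^sub>R f" by transfer (simp add: algebra_simps)
  show "a *\<^sub>R b *\<^sub>R f = (a * b) *\<^sub>R f" by transfer (simp add: mult.assoc)
  show "1 *\<^sub>R f = f" by transfer (simp add: mult.assoc)
  show "c *\<^sub>C (f + g) = c *\<^sub>C f + c *\<^sub>C g" by transfer (simp add: algebra_simps)
  show "(c + d) *\<^sub>C f = c *\<^sub>C f + d *\<^sub>C f" by transfer (simp add: algebra_simps)
  show "c *\<^sub>C d *\<^sub>C f = (c * d) *\<^sub>C f" by transfer (simp add: mult.assoc)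
  show "a *\<^sub>R f = complex_of_real a *\<^sub>C f" by transfer (simp add: scaleR_conv_of_real)
  show "sgn f = inverse (norm f) *\<^sub>R f" by (fact sgn_cdual_def)
  show "dist f g = norm (f - g)" by (fact dist_cdual_def)
  show "(uniformity :: ('a cdual \<times> 'a cdual) filter) =
      (INF e\<in>{0 <..}. principal {(x, y). dist x y < e})"
    by (fact uniformity_cdual_def)
  show "open U = (\<forall>x\<in>U. \<forall>\<^sub>F (x', y) in uniformity. x' = x \<longrightarrow> y \<in> U)" for U :: "'a cdual set"
    by (fact open_cdual_def)
  show "(norm f = 0) = (f = 0)" by transfer (auto simp: onorm_eq_0)
  show "norm (f + g) \<le> norm f + norm g" by transfer (auto intro: onorm_triangle)
  show "norm (a *\<^sub>R f) = \<bar>a\<bar> * norm f" by transfer (auto intro: onorm_scaleR)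
  have upper: "norm (c *\<^sub>C f) \<le> cmod c * norm f" for c :: complex and f :: "'a cdual"
  proof (transfer, elim conjE, rule onorm_bound)
    fix c :: complex and f :: "'a \<Rightarrow> complex" and x :: 'a
    assume f: "bounded_linear f"
    show "0 \<le> cmod c * onorm f" by (simp add: f onorm_pos_le)
    show "norm (c * f x) \<le> cmod c * onorm f * norm x"
      using onorm[OF f, of x] by (simp add: norm_mult mult.assoc mult_left_mono)
  qed
  have one: "1 *\<^sub>C f = f" by transfer (simp add: mult.assoc)
  have comp: "c *\<^sub>C d *\<^sub>C f = (c * d) *\<^sub>C f" for c d by transfer (simp add: mult.assoc)
  show "norm (c *\<^sub>C f) = cmod c * norm f"
  proof (cases "c = 0")
    case True
    have "0 *\<^sub>C f = 0" by transfer (simp add: mult.assoc)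
    moreover have "norm (0 :: 'a cdual) = 0" by transfer (simp add: onorm_zero)
    ultimately show ?thesis using True by simp
  next
    case False
    have "norm f = norm (inverse c *\<^sub>C c *\<^sub>C f)" using False by (simp add: comp one)
    also have "\<dots> \<le> cmod (inverse c) * norm (c *\<^sub>C f)" by (rule upper)
    finally have "cmod c * norm f \<le> norm (c *\<^sub>C f)"
      using False by (simp add: norm_inverse norm_divide divide_simps mult.commute)
    with upper[of c f] show ?thesis by simp
  qed
qed

end

lemma cdual_apply_bound: "cmod (cdual_apply f x) \<le> norm f * norm x"
  by transfer (auto intro: onorm)

definition weak_star :: "'a::complex_normed_vector cdual topology"
  where "weak_star = pullback_topology UNIV cdual_apply euclidean"

lift_definition canonical_embedding :: "'a::complex_normed_vector \<Rightarrow> 'a cdual cdual"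
  is "\<lambda>a f. cdual_apply f a"
proof (intro conjI)
  fix a :: 'a
  show "bounded_linear (\<lambda>f. cdual_apply f a)"
    by (rule bounded_linear_intro[where K = "norm a"])
      (simp_all add: plus_cdual.rep_eq scaleR_cdual.rep_eq cdual_apply_bound)
  show "clinear (\<lambda>f. cdual_apply f a)"
    by (simp add: clinear_def plus_cdual.rep_eq scaleC_cdual.rep_eq)
qed

text \<open>The first Arens product \<open>m \<box> n\<close>, built in the three usual steps
  \<open>\<langle>f \<cdot> a, b\<rangle> = \<langle>f, a b\<rangle>\<close>, \<open>\<langle>n \<cdot> f, a\<rangle> = \<langle>n, f \<cdot> a\<rangle>\<close> and \<open>\<langle>m \<box> n, f\<rangle> = \<langle>m, n \<cdot> f\<rangle>\<close>.
  The algebras considered below are Arens regular, so the choice between the two Arens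
  products is immaterial.\<close>

lift_definition dual_act :: "'a::complex_banach_algebra cdual \<Rightarrow> 'a \<Rightarrow> 'a cdual"
  is "\<lambda>f a b. f (a * b)"
proof -
  fix f :: "'a \<Rightarrow> complex" and a :: 'a
  assume "bounded_linear f \<and> clinear f"
  then show "bounded_linear (\<lambda>b. f (a * b)) \<and> clinear (\<lambda>b. f (a * b))"
    by (auto simp: clinear_def distrib_left mult_scaleC_right
        intro: bounded_linear_compose[OF _ bounded_linear_mult_right])
qed

lemma norm_dual_act: "norm (dual_act f a) \<le> norm f * norm a"
proof -
  have "cmod (cdual_apply f (a * b)) \<le> norm f * norm a * norm b" for b
    using cdual_apply_bound[of f "a * b"] norm_mult_ineq[of a b] norm_ge_zero[of f]
    by (smt (verit) mult.assoc mult_left_mono)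
  then have "onorm (\<lambda>b. cdual_apply f (a * b)) \<le> norm f * norm a"
    by (intro onorm_bound) auto
  then show ?thesis
    by (simp add: norm_cdual.rep_eq dual_act.rep_eq)
qed

lemma dual_act_linear:
  "dual_act (f + g) a = dual_act f a + dual_act g a"
  "dual_act (c *\<^sub>C f) a = c *\<^sub>C dual_act f a"
  "dual_act f (a + b) = dual_act f a + dual_act f b"
  "dual_act f (c *\<^sub>C a) = c *\<^sub>C dual_act f a"
  by (transfer, simp add: clinear_def distrib_right mult_scaleC_left)+

lemma dual_act_scaleR: "dual_act f (r *\<^sub>R a) = r *\<^sub>R dual_act f a"
  by (simp only: scaleR_scaleC dual_act_linear)

lift_definition bidual_act ::
    "'a::complex_banach_algebra cdual cdual \<Rightarrow> 'a cdual \<Rightarrow> 'a cdual"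
  is "\<lambda>n f a. cdual_apply n (dual_act f a)"
proof (intro conjI)
  fix n :: "'a cdual cdual" and f :: "'a cdual"
  show "bounded_linear (\<lambda>a. cdual_apply n (dual_act f a))"
  proof (rule bounded_linear_compose[OF bounded_linear_cdual_apply])
    show "bounded_linear (dual_act f)"
      by (rule bounded_linear_intro[where K = "norm f"])
        (simp_all add: dual_act_linear dual_act_scaleR norm_dual_act mult.commute[of _ "norm f"])
  qed
  show "clinear (\<lambda>a. cdual_apply n (dual_act f a))"
    by (simp add: clinear_def dual_act_linear cdual_apply_add cdual_apply_scaleC)
qed

lemma norm_bidual_act: "norm (bidual_act n f) \<le> norm n * norm f"
proof -
  have "cmod (cdual_apply n (dual_act f a)) \<le> norm n * norm f * norm a" for a
    using cdual_apply_bound[of n "dual_act f a"] norm_dual_act[of f a] norm_ge_zero[of n]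
    by (smt (verit) mult.assoc mult_left_mono)
  then have "onorm (\<lambda>a. cdual_apply n (dual_act f a)) \<le> norm n * norm f"
    by (intro onorm_bound) auto
  then show ?thesis
    by (simp add: norm_cdual.rep_eq bidual_act.rep_eq)
qed

lemma bidual_act_linear:
  "bidual_act n (f + g) = bidual_act n f + bidual_act n g"
  "bidual_act n (c *\<^sub>C f) = c *\<^sub>C bidual_act n f"
  "bidual_act n (r *\<^sub>R f) = r *\<^sub>R bidual_act n f"
proof -
  show "bidual_act n (f + g) = bidual_act n f + bidual_act n g"
    by (rule cdual_apply_inject[THEN iffD1], rule ext)
      (simp add: bidual_act.rep_eq dual_act_linear cdual_apply_add plus_cdual.rep_eq)
  show scale: "bidual_act n (c *\<^sub>C f) = c *\<^sub>C bidual_act n f" for c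
    by (rule cdual_apply_inject[THEN iffD1], rule ext)
      (simp add: bidual_act.rep_eq dual_act_linear cdual_apply_scaleC scaleC_cdual.rep_eq)
  show "bidual_act n (r *\<^sub>R f) = r *\<^sub>R bidual_act n f"
    by (simp only: scaleR_scaleC scale)
qed

lift_definition arens ::
    "'a::complex_banach_algebra cdual cdual \<Rightarrow> 'a cdual cdual \<Rightarrow> 'a cdual cdual"
  is "\<lambda>m n f. cdual_apply m (bidual_act n f)"
proof (intro conjI)
  fix m n :: "'a cdual cdual"
  show "bounded_linear (\<lambda>f. cdual_apply m (bidual_act n f))"
  proof (rule bounded_linear_compose[OF bounded_linear_cdual_apply])
    show "bounded_linear (bidual_act n)"
      by (rule bounded_linear_intro[where K = "norm n"])
        (simp_all add: bidual_act_linear norm_bidual_act mult.commute[of _ "norm n"])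
  qed
  show "clinear (\<lambda>f. cdual_apply m (bidual_act n f))"
    by (simp add: clinear_def bidual_act_linear cdual_apply_add cdual_apply_scaleC)
qed


section \<open>The algebra of bounded operators on \<open>L\<^sup>p(X,\<mu>)\<close> and \<open>L\<^sup>p\<close>-operator algebras\<close>

text \<open>Elements of \<open>L\<^sup>p(X,\<mu>)\<close> are almost-everywhere classes of \<open>p\<close>-integrable
  complex-valued functions; operators are extensional maps on the set of classes.\<close>

definition Lp_functions :: "real \<Rightarrow> 'x measure \<Rightarrow> ('x \<Rightarrow> complex) set"
  where "Lp_functions p M =
    {f \<in> borel_measurable M. integrable M (\<lambda>x. cmod (f x) powr p)}"

definition Lp_class :: "real \<Rightarrow> 'x measure \<Rightarrow> ('x \<Rightarrow> complex) \<Rightarrow> ('x \<Rightarrow> complex) set"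
  where "Lp_class p M f = {g \<in> Lp_functions p M. AE x in M. g x = f x}"

definition Lp_space :: "real \<Rightarrow> 'x measure \<Rightarrow> ('x \<Rightarrow> complex) set set"
  where "Lp_space p M = Lp_class p M ` Lp_functions p M"

definition Lp_add ::
    "real \<Rightarrow> 'x measure \<Rightarrow> ('x \<Rightarrow> complex) set \<Rightarrow> ('x \<Rightarrow> complex) set \<Rightarrow> ('x \<Rightarrow> complex) set"
  where "Lp_add p M u v =
    {h \<in> Lp_functions p M. \<exists>f\<in>u. \<exists>g\<in>v. AE x in M. h x = f x + g x}"

definition Lp_scale ::
    "real \<Rightarrow> 'x measure \<Rightarrow> complex \<Rightarrow> ('x \<Rightarrow> complex) set \<Rightarrow> ('x \<Rightarrow> complex) set"
  where "Lp_scale p M c u = {h \<in> Lp_functions p M. \<exists>f\<in>u. AE x in M. h x = c * f x}"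

definition Lp_norm :: "real \<Rightarrow> 'x measure \<Rightarrow> ('x \<Rightarrow> complex) set \<Rightarrow> real"
  where "Lp_norm p M u =
    (THE r. \<exists>f\<in>u. r = (LINT x|M. cmod (f x) powr p) powr (1 / p))"

type_synonym 'x Lp_map = "('x \<Rightarrow> complex) set \<Rightarrow> ('x \<Rightarrow> complex) set"

definition Lp_operators :: "real \<Rightarrow> 'x measure \<Rightarrow> 'x Lp_map set"
  where "Lp_operators p M = {T \<in> Lp_space p M \<rightarrow>\<^sub>E Lp_space p M.
    (\<forall>u\<in>Lp_space p M. \<forall>v\<in>Lp_space p M. T (Lp_add p M u v) = Lp_add p M (T u) (T v)) \<and>
    (\<forall>c. \<forall>u\<in>Lp_space p M. T (Lp_scale p M c u) = Lp_scale p M c (T u)) \<and>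
    (\<exists>K. \<forall>u\<in>Lp_space p M. Lp_norm p M (T u) \<le> K * Lp_norm p M u)}"

definition op_norm :: "real \<Rightarrow> 'x measure \<Rightarrow> 'x Lp_map \<Rightarrow> real"
  where "op_norm p M T = (SUP u\<in>{u \<in> Lp_space p M. Lp_norm p M u \<le> 1}. Lp_norm p M (T u))"

definition op_add :: "real \<Rightarrow> 'x measure \<Rightarrow> 'x Lp_map \<Rightarrow> 'x Lp_map \<Rightarrow> 'x Lp_map"
  where "op_add p M S T = (\<lambda>u\<in>Lp_space p M. Lp_add p M (S u) (T u))"

definition op_scale :: "real \<Rightarrow> 'x measure \<Rightarrow> complex \<Rightarrow> 'x Lp_map \<Rightarrow> 'x Lp_map"
  where "op_scale p M c T = (\<lambda>u\<in>Lp_space p M. Lp_scale p M c (T u))"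

definition op_mult :: "real \<Rightarrow> 'x measure \<Rightarrow> 'x Lp_map \<Rightarrow> 'x Lp_map \<Rightarrow> 'x Lp_map"
  where "op_mult p M S T = compose (Lp_space p M) S T"

definition closed_operator_subalgebra :: "real \<Rightarrow> 'x measure \<Rightarrow> 'x Lp_map set \<Rightarrow> bool"
  where "closed_operator_subalgebra p M B \<longleftrightarrow>
    B \<subseteq> Lp_operators p M \<and> B \<noteq> {} \<and>
    (\<forall>S\<in>B. \<forall>T\<in>B. op_add p M S T \<in> B \<and> op_mult p M S T \<in> B) \<and>
    (\<forall>c. \<forall>T\<in>B. op_scale p M c T \<in> B) \<and>
    (\<forall>X T. (\<forall>n::nat. X n \<in> B) \<and> T \<in> Lp_operators p M \<and>
       (\<lambda>n. op_norm p M (op_add p M (X n) (op_scale p M (- 1) T))) \<longlonglongrightarrow> 0 \<longrightarrow> T \<in> B)"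

text \<open>A Banach algebra is given as a type; \<open>TYPE('a)\<close> stands for the algebra \<open>'a\<close>.\<close>

definition Lp_operator_algebra ::
    "real \<Rightarrow> 'x measure \<Rightarrow> 'a::complex_banach_algebra itself \<Rightarrow> bool"
  where "Lp_operator_algebra p M A \<longleftrightarrow>
    (\<exists>B (\<pi> :: 'a \<Rightarrow> 'x Lp_map).
      closed_operator_subalgebra p M B \<and> bij_betw \<pi> UNIV B \<and>
      (\<forall>a b. \<pi> (a + b) = op_add p M (\<pi> a) (\<pi> b)) \<and>
      (\<forall>c a. \<pi> (c *\<^sub>C a) = op_scale p M c (\<pi> a)) \<and>
      (\<forall>a b. \<pi> (a * b) = op_mult p M (\<pi> a) (\<pi> b)) \<and>
      (\<forall>a. op_norm p M (\<pi> a) = norm a))"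


section \<open>Identities, approximate identities, multiplier unitization\<close>

definition is_identity :: "('b \<Rightarrow> 'b \<Rightarrow> 'b) \<Rightarrow> 'b \<Rightarrow> bool"
  where "is_identity m e \<longleftrightarrow> (\<forall>x. m e x = x \<and> m x e = x)"

definition identity_of :: "('b \<Rightarrow> 'b \<Rightarrow> 'b) \<Rightarrow> 'b"
  where "identity_of m = (THE e. is_identity m e)"

definition unital :: "'a::complex_banach_algebra itself \<Rightarrow> bool"
  where "unital A \<longleftrightarrow> (\<exists>e::'a. is_identity (*) e \<and> norm e = 1)"

text \<open>A contractive approximate identity \<open>(e\<^sub>t)\<close> enters only through the filter on the
  algebra generated by its tails; every proper filter arises from a net in this way.\<close>

definition approximately_unital :: "'a::complex_banach_algebra itself \<Rightarrow> bool"
  where "approximately_unital A \<longleftrightarrow>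
    (\<exists>F :: 'a filter. F \<noteq> bot \<and> (\<forall>\<^sub>F e in F. norm e \<le> 1) \<and>
      (\<forall>a. ((\<lambda>e. e * a) \<longlongrightarrow> a) F \<and> ((\<lambda>e. a * e) \<longlongrightarrow> a) F))"

text \<open>For nonunital \<open>A\<close>, the element \<open>a + \<lambda>1\<close> of \<open>A\<^sup>1\<close> is the pair \<open>(a, \<lambda>)\<close>. The product
  norm of the type \<open>'a \<times> complex\<close> is not used: \<open>A\<^sup>1\<close> carries \<open>multiplier_norm\<close>.\<close>

definition multiplier_norm :: "'a::complex_banach_algebra \<times> complex \<Rightarrow> real"
  where "multiplier_norm x = (SUP c\<in>cball 0 1. norm (fst x * c + snd x *\<^sub>C c))"


section \<open>States and real positivity\<close>

text \<open>A unital Banach algebra enters the following two notions through its vector space, its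
  norm \<open>\<nu>\<close> and its identity \<open>u\<close>; the norm is an argument because the norm of \<open>A\<^sup>1\<close> is not a
  type class norm.\<close>

definition has_functional_norm ::
    "('v::complex_vector \<Rightarrow> real) \<Rightarrow> ('v \<Rightarrow> complex) \<Rightarrow> real \<Rightarrow> bool"
  where "has_functional_norm \<nu> \<omega> r \<longleftrightarrow>
    bdd_above ((\<lambda>x. cmod (\<omega> x)) ` {x. \<nu> x \<le> 1}) \<and> (SUP x\<in>{x. \<nu> x \<le> 1}. cmod (\<omega> x)) = r"

definition is_state ::
    "('v::complex_vector \<Rightarrow> real) \<Rightarrow> 'v \<Rightarrow> ('v \<Rightarrow> complex) \<Rightarrow> bool"
  where "is_state \<nu> u \<omega> \<longleftrightarrow> clinear \<omega> \<and> has_functional_norm \<nu> \<omega> 1 \<and> \<omega> u = 1"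

definition real_positive :: "('v::complex_vector \<Rightarrow> real) \<Rightarrow> 'v \<Rightarrow> 'v \<Rightarrow> bool"
  where "real_positive \<nu> u a \<longleftrightarrow> (\<forall>\<omega>. is_state \<nu> u \<omega> \<longrightarrow> 0 \<le> Re (\<omega> a))"

text \<open>\<open>r_set\<close> and \<open>F_set\<close> are the sets written \<open>\<rr>\<^sub>A\<close> and \<open>\<FF>\<^sub>A\<close>. In the
  definitions for \<open>A\<close>, the first branch is the case \<open>A\<^sup>1 = A\<close>.\<close>

definition r_set :: "'a::complex_banach_algebra itself \<Rightarrow> 'a set"
  where "r_set A = (if unital A
    then {a. real_positive norm (identity_of (*)) a}
    else {a. real_positive multiplier_norm (0, 1) (a, 0)})"

definition F_set :: "'a::complex_banach_algebra itself \<Rightarrow> 'a set"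
  where "F_set A = (if unital A
    then {a. norm (identity_of (*) - a) \<le> 1}
    else {a. multiplier_norm ((0, 1) - (a, 0)) \<le> 1})"

definition r_set_bidual :: "'a::complex_banach_algebra itself \<Rightarrow> 'a cdual cdual set"
  where "r_set_bidual A = {m. real_positive norm (identity_of arens) m}"

definition F_set_bidual :: "'a::complex_banach_algebra itself \<Rightarrow> 'a cdual cdual set"
  where "F_set_bidual A = {m. norm (identity_of arens - m) \<le> 1}"

definition restricted_states :: "'a::complex_banach_algebra itself \<Rightarrow> ('a \<Rightarrow> complex) set"
  where "restricted_states A = (if unital A
    then {\<omega>. is_state norm (identity_of (*)) \<omega>}
    else {(\<lambda>a. \<omega> (a, 0)) |\<omega>. is_state multiplier_norm (0, 1) \<omega>})"

definition states :: "'a::complex_banach_algebra itself \<Rightarrow> ('a \<Rightarrow> complex) set"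
  where "states A = {\<phi> \<in> restricted_states A. has_functional_norm norm \<phi> 1}"

definition quasistates :: "'a::complex_banach_algebra itself \<Rightarrow> ('a \<Rightarrow> complex) set"
  where "quasistates A =
    {(\<lambda>a. complex_of_real t * \<phi> a) |t \<phi>. t \<in> {0..1} \<and> \<phi> \<in> states A}"

definition scaled :: "'a::complex_banach_algebra itself \<Rightarrow> bool"
  where "scaled A \<longleftrightarrow> unital A \<or> restricted_states A = quasistates A"

definition weak_star_dense ::
    "'a::complex_normed_vector cdual set \<Rightarrow> 'a cdual set \<Rightarrow> bool"
  where "weak_star_dense S T \<longleftrightarrow> S \<subseteq> T \<and> T \<subseteq> weak_star closure_of S"

end

theory Submission
  imports Defs "HOL-Real_Asymp.Real_Asymp"
begin

text \<open>By Hahn-Banach, each density statement says that a functional \<open>f\<close> on \<open>A\<close> has the same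
  supremum on the smaller and on the larger set. The implication from scaled to the density of
  \<open>\<FF>\<^sub>A\<close> is the substantial one. Here one needs \<open>x\<close> in the unit ball of \<open>A\<^sup>1\<close>, with scalar part
  \<open>1\<close>, whose value under the normal extension of \<open>f\<close> is almost \<open>- \<parallel>f\<parallel>\<close>. Let \<open>b\<close> in the unit ball
  of \<open>A\<close> almost attain \<open>- \<parallel>f\<parallel>\<close>. Scaledness makes every functional obtained by restricting a state
  take its norm at the identity of \<open>A\<^sup>*\<^sup>*\<close>. Separation arguments then give contractive approximate units
  \<open>h\<close>, \<open>l\<close> with \<open>h\<close> almost hermitian, \<open>l\<close> acting as an identity on \<open>h\<close>, and \<open>d = l - h\<close> almost
  accretive. So the resolvents of \<open>d\<close> are almost contractive, and with \<open>Q = (1 + k\<^sup>2 d)\<^sup>-\<^sup>1\<close>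
  the element \<open>x = (b + 1 - l) Q\<close> has the required value. On the range of \<open>Q\<close> the elements
  \<open>h\<close> and \<open>l\<close> almost coincide, so \<open>h\<close> acts like a hermitian idempotent; for \<open>p \<noteq> 2\<close> such an idempotent
  of an \<open>L\<^sup>p\<close> space is multiplication by an indicator function. Quantitatively, the vectors
  \<open>b h Q \<zeta>\<close> and \<open>(1 - l) Q \<zeta>\<close> are asymptotically disjoint, so that
  \<open>\<parallel>x \<zeta>\<parallel>\<^sup>p\<close> is almost at most \<open>\<parallel>h Q \<zeta>\<parallel>\<^sup>p + \<parallel>(1 - l) Q \<zeta>\<parallel>\<^sup>p\<close>, which is almost \<open>\<parallel>Q \<zeta>\<parallel>\<^sup>p\<close>.
  This bounds the norm of \<open>x\<close> by \<open>1 + \<epsilon>\<close>; a final iteration removes the \<open>\<epsilon>\<close>.\<close>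

section \<open>The Hahn-Banach theorem\<close>

text \<open>The obstacle is the norm of \<open>b + 1 - l\<close>: nothing forces
  \<open>b \<zeta>\<close> and \<open>(1 - l) \<zeta>\<close> to be disjoint, and \<open>A\<close>
  need not contain band projections that would arrange it. In the bidual of a nonunital
  \<open>A^1\<close> the identity of \<open>A\<^sup>*\<^sup>*\<close> is an idempotent different
  from 1; scaledness makes its values at all states real, hence makes it hermitian, and convexity of
  the sets of approximate units carries this down to some \<open>h\<close> in \<open>A\<close>. Such
  an \<open>h\<close> generates almost isometric rotations. Norms that are invariant under quarter
  turns have invariant derivatives, so along an orbit \<open>\<i>^k \<alpha> + \<beta>\<close> the
  duality map of L^p has only two Fourier modes left. For \<open>p \<noteq> 2\<close> the absence of
  the others forces disjointness; for \<open>p = 2\<close> the parallelogram law takes over. The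
  error can be removed at the end because almost norming elements with scalar part near 1 make the
  norms of the normal and the singular part of a functional add up, and this keeps the corrections
  summable. Conversely, density of the accretive cone is tested at \<open>E - y\<close>, where
  \<open>y\<close> in the bidual norms the given functional.\<close>

definition sublinear :: "('v::real_vector \<Rightarrow> real) \<Rightarrow> bool"
  where "sublinear q \<longleftrightarrow> (\<forall>x y. q (x + y) \<le> q x + q y) \<and> (\<forall>c x. 0 \<le> c \<longrightarrow> q (c *\<^sub>R x) = c * q x)"

lemma sublinearI:
  assumes "\<And>x y. q (x + y) \<le> q x + q y" "\<And>c x. 0 < c \<Longrightarrow> q (c *\<^sub>R x) \<le> c * q x" "q 0 = 0"
  shows "sublinear q"
  unfolding sublinear_def
proof (intro conjI allI impI)
  fix c :: real and x assume "0 \<le> c"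
  show "q (c *\<^sub>R x) = c * q x"
  proof (cases "c = 0")
    case False
    then have c: "0 < c" using \<open>0 \<le> c\<close> by simp
    have "q (inverse c *\<^sub>R c *\<^sub>R x) \<le> inverse c * q (c *\<^sub>R x)"
      using c by (intro assms(2)) simp
    then have "q x \<le> inverse c * q (c *\<^sub>R x)" using c by simp
    then have "c * q x \<le> q (c *\<^sub>R x)" using c by (simp add: field_simps)
    with assms(2)[OF c, of x] show ?thesis by simp
  qed (simp add: assms(3))
qed (rule assms(1))

lemma sublinear_add: "sublinear q \<Longrightarrow> q (x + y) \<le> q x + q y"
  and sublinear_scale: "sublinear q \<Longrightarrow> 0 \<le> c \<Longrightarrow> q (c *\<^sub>R x) = c * q x"
  by (auto simp: sublinear_def)

lemma sublinear_zero: "sublinear q \<Longrightarrow> q 0 = 0"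
  using sublinear_scale[of q 0 0] by simp

lemma sublinear_lower: "sublinear q \<Longrightarrow> - q (- x) \<le> q x"
  using sublinear_add[of q x "- x"] sublinear_zero[of q] by simp

text \<open>The infimum of \<open>q (x + s y) - s d\<close> over \<open>s \<ge> 0\<close> and
  \<open>y \<in> Y\<close> builds the constraint into the majorant: a linear functional below it is
  automatically at least \<open>d\<close> on \<open>Y\<close>. It stays finite because
  \<open>d \<le> q\<close> on \<open>Y\<close>.\<close>

lemma sublinear_reduce:
  fixes q :: "'v::real_vector \<Rightarrow> real"
  assumes q: "sublinear q" and Y: "convex Y" "y0 \<in> Y" and ge: "\<And>y. y \<in> Y \<Longrightarrow> d \<le> q y"
  obtains Q where "sublinear Q" "\<And>x. Q x \<le> q x" "\<And>y. y \<in> Y \<Longrightarrow> Q (- y) \<le> - d"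
proof -
  define B where "B x = {q (x + s *\<^sub>R y) - s * d |s y. 0 \<le> s \<and> y \<in> Y}" for x
  define Q where "Q x = Inf (B x)" for x
  have low: "- q (- x) \<le> b" if bB: "b \<in> B x" for b x
  proof -
    obtain s y where b: "b = q (x + s *\<^sub>R y) - s * d" and "0 \<le> s" "y \<in> Y"
      using bB unfolding B_def by blast
    then have "s * d \<le> q (s *\<^sub>R y)" by (simp add: sublinear_scale[OF q] ge mult_left_mono)
    also have "\<dots> \<le> q (x + s *\<^sub>R y) + q (- x)"
      using sublinear_add[OF q, of "x + s *\<^sub>R y" "- x"] by (simp add: algebra_simps)
    finally show ?thesis by (simp add: b)
  qed
  have bdd: "bdd_below (B x)" for x by (rule bdd_belowI[OF low])
  have ne: "B x \<noteq> {}" for x unfolding B_def using Y(2) by (force intro: exI[of _ 0])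
  have leQ: "Q x \<le> q (x + s *\<^sub>R y) - s * d" if "0 \<le> s" "y \<in> Y" for x s y
    unfolding Q_def using that by (intro cInf_lower bdd) (auto simp: B_def)
  have geQ: "z \<le> Q x" if "\<And>s y. 0 \<le> s \<Longrightarrow> y \<in> Y \<Longrightarrow> z \<le> q (x + s *\<^sub>R y) - s * d" for x z
    unfolding Q_def using that by (intro cInf_greatest ne) (auto simp: B_def)
  have le: "Q x \<le> q x" for x using leQ[of 0 y0 x] Y by simp
  have "sublinear Q"
  proof (rule sublinearI)
    fix x1 x2
    have "Q (x1 + x2) - (q (x1 + s *\<^sub>R y) - s * d) \<le> q (x2 + t *\<^sub>R z) - t * d"
      if st: "0 \<le> s" "y \<in> Y" "0 \<le> t" "z \<in> Y" for s t y z
    proof -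
      \<comment> \<open>Convexity merges two multiples of points of \<open>Y\<close> into one
        multiple of a single point, which is what subadditivity of the infimum needs. The case of
        total weight 0 is separate because it does not permit normalising.\<close>
      obtain w where w: "w \<in> Y" "s *\<^sub>R y + t *\<^sub>R z = (s + t) *\<^sub>R w"
      proof (cases "s + t = 0")
        case True
        then have "s = 0" "t = 0" using st by auto
        then show ?thesis using st(2) by (intro that[of y]) auto
      next
        case False
        then have pos: "0 < s + t" using st by simp
        have "(s / (s + t)) *\<^sub>R y + (t / (s + t)) *\<^sub>R z \<in> Y"
          using st pos by (intro convexD[OF Y(1)]) (auto simp: add_divide_distrib[symmetric])
        moreover have "s *\<^sub>R y + t *\<^sub>R z = (s + t) *\<^sub>R ((s / (s + t)) *\<^sub>R y + (t / (s + t)) *\<^sub>R z)"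
          using pos by (simp only: scaleR_add_right scaleR_scaleR) simp
        ultimately show ?thesis using that by blast
      qed
      have "Q (x1 + x2) \<le> q ((x1 + x2) + (s + t) *\<^sub>R w) - (s + t) * d"
        using that w by (intro leQ) auto
      also have "(x1 + x2) + (s + t) *\<^sub>R w = (x1 + s *\<^sub>R y) + (x2 + t *\<^sub>R z)"
        by (simp only: w(2)[symmetric]) (simp add: algebra_simps)
      also have "q \<dots> \<le> q (x1 + s *\<^sub>R y) + q (x2 + t *\<^sub>R z)" by (rule sublinear_add[OF q])
      finally show ?thesis by (simp add: algebra_simps)
    qed
    then have "Q (x1 + x2) - (q (x1 + s *\<^sub>R y) - s * d) \<le> Q x2" if "0 \<le> s" "y \<in> Y" for s y
      using that by (intro geQ) auto
    then have "Q (x1 + x2) - Q x2 \<le> Q x1" by (intro geQ) (auto simp: algebra_simps)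
    then show "Q (x1 + x2) \<le> Q x1 + Q x2" by simp
  next
    fix c :: real and x assume c: "0 < c"
    have "Q (c *\<^sub>R x) / c \<le> Q x"
    proof (rule geQ)
      fix s y assume sy: "0 \<le> (s::real)" "y \<in> Y"
      have "Q (c *\<^sub>R x) \<le> q (c *\<^sub>R x + (c * s) *\<^sub>R y) - (c * s) * d" using sy c by (intro leQ) auto
      also have "c *\<^sub>R x + (c * s) *\<^sub>R y = c *\<^sub>R (x + s *\<^sub>R y)" by (simp add: algebra_simps)
      also have "q \<dots> = c * q (x + s *\<^sub>R y)" using c by (intro sublinear_scale[OF q]) simp
      finally show "Q (c *\<^sub>R x) / c \<le> q (x + s *\<^sub>R y) - s * d" using c by (simp add: field_simps)
    qed
    then show "Q (c *\<^sub>R x) \<le> c * Q x" using c by (simp add: field_simps)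
  next
    have "0 \<le> Q 0"
    proof (rule geQ)
      fix s y assume "0 \<le> (s::real)" "y \<in> Y"
      then show "0 \<le> q (0 + s *\<^sub>R y) - s * d"
        using ge[of y] by (simp add: sublinear_scale[OF q] mult_left_mono)
    qed
    with le[of 0] sublinear_zero[OF q] show "Q 0 = 0" by simp
  qed
  moreover have "Q (- y) \<le> - d" if "y \<in> Y" for y
    using leQ[of 1 y "- y"] that sublinear_zero[OF q] by simp
  ultimately show thesis using le that by blast
qed

text \<open>A minimal sublinear functional is additive: otherwise the reduction above would lower it.\<close>

lemma sublinear_minimal:
  fixes q :: "'v::real_vector \<Rightarrow> real"
  assumes q: "sublinear q"
  obtains L where "linear L" "\<And>x. L x \<le> q x"
proof -
  define P where "P = {r. sublinear r \<and> (\<forall>x. r x \<le> q x)}"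
  \<comment> \<open>Zorn's lemma for the reversed pointwise order: a chain is bounded by its
    pointwise infimum, which is finite because every member lies above
    \<open>- q (- x)\<close>.\<close>
  have "\<exists>m\<in>P. \<forall>a\<in>P. (\<forall>x. a x \<le> m x) \<longrightarrow> a = m"
  proof (rule predicate_Zorn[where P="\<lambda>a b. \<forall>x. b x \<le> a x", simplified])
    show "partial_order_on P (relation_of (\<lambda>a b. \<forall>x. b x \<le> a x) P)"
      by (rule partial_order_on_relation_ofI) (auto intro: order_trans intro!: ext antisym)
    fix C assume C: "C \<in> Chains (relation_of (\<lambda>a b. \<forall>x. b x \<le> a x) P)"
    then have CP: "C \<subseteq> P" and tot: "\<And>a b. a \<in> C \<Longrightarrow> b \<in> C \<Longrightarrow> (\<forall>x. b x \<le> a x) \<or> (\<forall>x. a x \<le> b x)"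
      by (auto simp: Chains_def relation_of_def)
    show "\<exists>u\<in>P. \<forall>a\<in>C. \<forall>x. u x \<le> a x"
    proof (cases "C = {}")
      case True
      then show ?thesis using q by (auto simp: P_def)
    next
      case False
      define u where "u x = (INF a\<in>C. a x)" for x
      have subl: "sublinear a" "\<And>x. a x \<le> q x" if "a \<in> C" for a using that CP by (auto simp: P_def)
      have bdd: "bdd_below ((\<lambda>a. a x) ` C)" for x
      proof (rule bdd_belowI2)
        fix a assume "a \<in> C"
        then show "- q (- x) \<le> a x"
          using sublinear_lower[OF subl(1), of a x] subl(2)[of a "- x"] by simp
      qed
      have le: "u x \<le> a x" if "a \<in> C" for a x
        unfolding u_def by (rule cINF_lower[OF bdd that])
      have ge: "z \<le> u x" if "\<And>a. a \<in> C \<Longrightarrow> z \<le> a x" for z x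
        unfolding u_def using that by (intro cINF_greatest False)
      have "sublinear u"
      proof (rule sublinearI)
        fix x y
        have "u (x + y) - a x \<le> b y" if ab: "a \<in> C" "b \<in> C" for a b
        proof -
          obtain c where c: "c \<in> C" "c x \<le> a x" "c y \<le> b y"
            using tot[OF ab] ab by blast
          have "u (x + y) \<le> c x + c y" using le[OF c(1), of "x + y"] sublinear_add[OF subl(1)[OF c(1)], of x y]
            by simp
          then show ?thesis using c by simp
        qed
        then have "u (x + y) - a x \<le> u y" if "a \<in> C" for a using that by (intro ge)
        then have "u (x + y) - u y \<le> u x" by (intro ge) (auto simp: algebra_simps)
        then show "u (x + y) \<le> u x + u y" by simp
      next
        fix c :: real and x assume c: "0 < c"
        have "u (c *\<^sub>R x) / c \<le> u x"
        proof (rule ge)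
          fix a assume "a \<in> C"
          then show "u (c *\<^sub>R x) / c \<le> a x"
            using le[of a "c *\<^sub>R x"] sublinear_scale[OF subl(1), of a c x] c by (simp add: field_simps)
        qed
        then show "u (c *\<^sub>R x) \<le> c * u x" using c by (simp add: field_simps)
      next
        show "u 0 = 0" using sublinear_zero[OF subl(1)] False
          by (metis antisym ge le ex_in_conv order_refl)
      qed
      then show ?thesis using le subl(2) False unfolding P_def
        by (smt (verit) all_not_in_conv mem_Collect_eq)
    qed
  qed
  then obtain m where m: "m \<in> P" and min: "\<And>a. a \<in> P \<Longrightarrow> \<forall>x. a x \<le> m x \<Longrightarrow> a = m" by blast
  have sm: "sublinear m" using m by (simp add: P_def)
  have neg: "m (- y) = - m y" for y
  proof -
    obtain Q where Q: "sublinear Q" "\<And>x. Q x \<le> m x" "\<And>z. z \<in> {y} \<Longrightarrow> Q (- z) \<le> - m y"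
      by (rule sublinear_reduce[OF sm, of "{y}" y "m y"]) auto
    have "Q = m" using Q m by (intro min) (auto simp: P_def intro: order_trans)
    then have "m (- y) \<le> - m y" using Q(3)[of y] by simp
    with sublinear_lower[OF sm, of y] show ?thesis by simp
  qed
  have "linear m"
  proof (rule linearI)
    fix x y
    have "m (- (x + y)) \<le> m (- x) + m (- y)" using sublinear_add[OF sm, of "- x" "- y"] by simp
    then show "m (x + y) = m x + m y" using sublinear_add[OF sm, of x y] by (simp only: neg)
  next
    fix c :: real and x
    show "m (c *\<^sub>R x) = c *\<^sub>R m x"
    proof (cases "0 \<le> c")
      case True
      then show ?thesis by (simp add: sublinear_scale[OF sm])
    next
      case False
      then have "m ((- c) *\<^sub>R x) = (- c) * m x" by (intro sublinear_scale[OF sm]) simp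
      then show ?thesis using neg[of "c *\<^sub>R x"] by simp
    qed
  qed
  then show thesis using that m by (auto simp: P_def)
qed

text \<open>Used in two ways: with \<open>q\<close> a seminorm it separates a convex set from a
  ball, and with \<open>q\<close> a directional derivative of the norm at the unit it produces
  states.\<close>

theorem hahn_banach_convex:
  fixes q :: "'v::real_vector \<Rightarrow> real"
  assumes "sublinear q" "convex Y" "Y \<noteq> {}" "\<And>y. y \<in> Y \<Longrightarrow> d \<le> q y"
  obtains L where "linear L" "\<And>x. L x \<le> q x" "\<And>y. y \<in> Y \<Longrightarrow> d \<le> L y"
proof -
  obtain y0 where "y0 \<in> Y" using assms(3) by blast
  then obtain Q where Q: "sublinear Q" "\<And>x. Q x \<le> q x" "\<And>y. y \<in> Y \<Longrightarrow> Q (- y) \<le> - d"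
    using sublinear_reduce[OF assms(1,2) _ assms(4)] by metis
  obtain L where L: "linear L" "\<And>x. L x \<le> Q x" using sublinear_minimal[OF Q(1)] by blast
  have "d \<le> L y" if "y \<in> Y" for y
    using L(2)[of "- y"] Q(3)[OF that] linear_neg[OF L(1), of y] by simp
  then show thesis using that L Q(2) by (meson order_trans)
qed

section \<open>The duality map of the plane\<close>

text \<open>Up to the factor \<open>p\<close> this is the gradient of \<open>|x|^p\<close>, paired
  complex linearly. Applied pointwise it is the duality map from L^p to the dual exponent; for
  \<open>p = 2\<close> it is conjugation.\<close>

definition duality :: "real \<Rightarrow> complex \<Rightarrow> complex"
  where "duality p x = cnj x * complex_of_real (cmod x powr (p - 2))"

lemma norm_duality: "cmod (duality p x) = cmod x powr (p - 1)"
  by (cases "x = 0") (simp_all add: duality_def norm_mult powr_mult_base)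

lemma duality_mult: "duality p (x * y) = duality p x * duality p y"
  by (simp add: duality_def norm_mult powr_mult)

lemma duality_of_real: "0 \<le> c \<Longrightarrow> duality p (of_real c) = of_real (c powr (p - 1))"
  by (cases "c = 0") (simp_all add: duality_def powr_mult_base flip: of_real_mult)

lemma mult_duality: "1 < p \<Longrightarrow> x * duality p x = of_real (cmod x powr p)"
proof (cases "x = 0")
  case False
  have "x * duality p x = of_real ((cmod x)\<^sup>2 * cmod x powr (p - 2))"
    by (simp only: duality_def complex_norm_square of_real_mult mult.assoc)
  also have "(cmod x)\<^sup>2 * cmod x powr (p - 2) = cmod x powr p"
    using False powr_add[of "cmod x" 2 "p - 2"] by (simp add: powr_numeral)
  finally show ?thesis .
qed (simp add: duality_def)

lemma continuous_duality:
  assumes "1 < p"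
  shows "continuous_on UNIV (duality p)"
proof -
  have "isCont (duality p) x" for x
  proof (cases "x = 0")
    case True
    have "((\<lambda>y. cmod y powr (p - 1)) \<longlongrightarrow> 0) (at 0)"
      using assms by (intro tendsto_eq_intros tendsto_zero_powrI | simp)+
    then have "((\<lambda>y. duality p y) \<longlongrightarrow> 0) (at 0)"
      by (subst tendsto_norm_zero_iff[symmetric]) (simp add: norm_duality)
    moreover have "duality p 0 = 0" by (simp add: duality_def)
    ultimately show ?thesis by (simp add: True isCont_def)
  next
    case False
    then show ?thesis unfolding duality_def by (intro continuous_intros) auto
  qed
  then show ?thesis by (simp add: continuous_on_eq_continuous_at)
qed

lemma has_derivative_norm_powr:
  assumes "1 < p"
  shows "((\<lambda>z. cmod z powr p) has_derivative (\<lambda>h. p * Re (h * duality p z))) (at z)"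
proof (cases "z = 0")
  case True
  have "((\<lambda>h. cmod h powr (p - 1)) \<longlongrightarrow> 0) (at 0)"
    using assms by (intro tendsto_eq_intros tendsto_zero_powrI | simp)+
  moreover have "cmod h powr (p - 1) = norm (cmod (0 + h) powr p - cmod 0 powr p - 0) / norm h"
    if "h \<noteq> 0" for h
    using that by (simp add: powr_diff)
  note * = this
  from \<open>((\<lambda>h. cmod h powr (p - 1)) \<longlongrightarrow> 0) (at 0)\<close>
  have "((\<lambda>h. norm (cmod (0 + h) powr p - cmod 0 powr p - 0) / norm h) \<longlongrightarrow> 0) (at 0)"
    by (rule Lim_transform_eventually) (unfold eventually_at_filter, intro always_eventually allI impI *)
  then show ?thesis
    unfolding True has_derivative_at by (simp add: duality_def)
next
  case False
  have "((\<lambda>z. cmod z powr p) has_derivative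
      (\<lambda>h. cmod z powr p * (0 * ln (cmod z) + inner h (sgn z) * p / cmod z))) (at z)"
    using False by (intro has_derivative_powr has_derivative_norm has_derivative_const) auto
  moreover have "cmod z powr p * (0 * ln (cmod z) + inner h (sgn z) * p / cmod z) = p * Re (h * duality p z)"
    for h
  proof -
    have "inner h (sgn z) = Re (h * cnj z) / cmod z"
      by (simp add: sgn_eq inner_complex_def add_divide_distrib mult.commute)
    moreover have "Re (h * duality p z) = Re (h * cnj z) * cmod z powr (p - 2)"
      by (simp add: duality_def algebra_simps)
    moreover have "cmod z powr (p - 2) = cmod z powr p / (cmod z * cmod z)"
      using False by (simp add: powr_diff power2_eq_square)
    ultimately show ?thesis by simp
  qed
  ultimately show ?thesis by simp
qed

text \<open>Both sides are homogeneous of degree \<open>p\<close> in \<open>(a, b)\<close>, so it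
  suffices to treat the unit disc. There the mean value theorem applies, and
  \<open>duality p\<close> is uniformly continuous on a compact ball, which makes the error
  \<open>o(\<tau>)\<close> uniformly in \<open>a\<close> and \<open>b\<close>.\<close>

lemma norm_powr_expansion:
  assumes p: "1 < p" and \<epsilon>: "0 < \<epsilon>"
  shows "\<exists>\<tau>0>0. \<forall>\<tau> a b. 0 < \<tau> \<and> \<tau> \<le> \<tau>0 \<longrightarrow>
    \<bar>cmod (a + of_real \<tau> * b) powr p - cmod a powr p - p * \<tau> * Re (b * duality p a)\<bar>
      \<le> \<epsilon> * \<tau> * (cmod a powr p + cmod b powr p)"
proof -
  have "uniformly_continuous_on (cball 0 2) (duality p)"
    by (intro compact_uniformly_continuous continuous_on_subset[OF continuous_duality[OF p]]) auto
  then obtain \<delta> where \<delta>: "\<delta> > 0"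
    "\<And>x y. x \<in> cball 0 2 \<Longrightarrow> y \<in> cball 0 2 \<Longrightarrow> dist y x < \<delta> \<Longrightarrow> dist (duality p y) (duality p x) < \<epsilon> / p"
    unfolding uniformly_continuous_on_def using divide_pos_pos[OF \<epsilon>, of p] p by fastforce
  \<comment> \<open>Keeps every intermediate point \<open>a + s b\<close> in the ball of radius 2
    and closer than \<delta> to \<open>a\<close>.\<close>
  define \<tau>0 where "\<tau>0 = min 1 (\<delta> / 2)"
  have base: "\<bar>cmod (a + of_real \<tau> * b) powr p - cmod a powr p - p * \<tau> * Re (b * duality p a)\<bar> \<le> \<epsilon> * \<tau>"
    if \<tau>: "0 < \<tau>" "\<tau> \<le> \<tau>0" and ab: "cmod a \<le> 1" "cmod b \<le> 1" for a b \<tau>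
  proof -
    have "((\<lambda>s. cmod (a + of_real s * b) powr p) has_derivative
        (\<lambda>h. p * Re (of_real h * b * duality p (a + of_real s * b)))) (at s)" for s
      by (rule has_derivative_compose[OF _ has_derivative_norm_powr[OF p], of _ _ s UNIV])
        (auto intro!: derivative_eq_intros)
    then have der: "DERIV (\<lambda>s. cmod (a + of_real s * b) powr p) s :> p * Re (b * duality p (a + of_real s * b))" for s
      unfolding has_field_derivative_def
      by (rule has_derivative_eq_rhs) (auto simp: fun_eq_iff algebra_simps)
    obtain s where s: "0 < s" "s < \<tau>" "cmod (a + of_real \<tau> * b) powr p - cmod (a + of_real 0 * b) powr p
        = (\<tau> - 0) * (p * Re (b * duality p (a + of_real s * b)))"
      using MVT2[OF \<tau>(1), of "\<lambda>s. cmod (a + of_real s * b) powr p", OF der] by blast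
    have sb: "cmod (of_real s * b) \<le> s" using s ab by (simp add: norm_mult mult_left_le)
    have "s < \<delta>" "s \<le> 1" using s \<tau> \<delta>(1) by (auto simp: \<tau>0_def)
    then have "dist (duality p (a + of_real s * b)) (duality p a) < \<epsilon> / p"
      using sb ab norm_triangle_ineq[of a "of_real s * b"]
      by (intro \<delta>(2)) (auto simp: dist_norm simp del: norm_minus_cancel mem_cball simp add: mem_cball_0)
    then have "cmod (b * (duality p (a + of_real s * b) - duality p a)) \<le> 1 * (\<epsilon> / p)"
      unfolding norm_mult dist_norm using ab by (intro mult_mono) auto
    then have "\<bar>Re (b * (duality p (a + of_real s * b) - duality p a))\<bar> \<le> \<epsilon> / p"
      using abs_Re_le_cmod order_trans by fastforce
    then have "\<tau> * p * \<bar>Re (b * (duality p (a + of_real s * b) - duality p a))\<bar> \<le> \<tau> * p * (\<epsilon> / p)"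
      using \<tau> p by (intro mult_left_mono) auto
    moreover have "cmod (a + of_real \<tau> * b) powr p - cmod a powr p - p * \<tau> * Re (b * duality p a)
        = \<tau> * p * Re (b * (duality p (a + of_real s * b) - duality p a))"
      using s(3) by (simp add: algebra_simps)
    ultimately show ?thesis using \<tau> p by (simp add: abs_mult mult.commute)
  qed
  have "\<bar>cmod (a + of_real \<tau> * b) powr p - cmod a powr p - p * \<tau> * Re (b * duality p a)\<bar>
      \<le> \<epsilon> * \<tau> * (cmod a powr p + cmod b powr p)"
    if \<tau>: "0 < \<tau>" "\<tau> \<le> \<tau>0" for a b \<tau>
  proof (cases "a = 0 \<and> b = 0")
    case False
    define m where "m = max (cmod a) (cmod b)"
    have m: "0 < m" using False by (auto simp: m_def less_max_iff_disj)
    define a' b' where "a' = a / of_real m" and "b' = b / of_real m"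
    have ab: "a = of_real m * a'" "b = of_real m * b'" using m by (auto simp: a'_def b'_def)
    have "cmod a' \<le> 1" "cmod b' \<le> 1" using m by (auto simp: a'_def b'_def norm_divide m_def)
    note B = base[OF \<tau> this]
    have 1: "a + of_real \<tau> * b = of_real m * (a' + of_real \<tau> * b')" by (simp add: ab algebra_simps)
    have "b * duality p a = of_real m * of_real (m powr (p - 1)) * (b' * duality p a')"
      using m by (simp add: ab duality_mult duality_of_real)
    also have "of_real m * of_real (m powr (p - 1)) = complex_of_real (m powr p)"
      using m by (simp add: powr_mult_base flip: of_real_mult)
    finally have 2: "Re (b * duality p a) = m powr p * Re (b' * duality p a')" by simp
    have "\<bar>cmod (a + of_real \<tau> * b) powr p - cmod a powr p - p * \<tau> * Re (b * duality p a)\<bar>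
        = m powr p * \<bar>cmod (a' + of_real \<tau> * b') powr p - cmod a' powr p - p * \<tau> * Re (b' * duality p a')\<bar>"
    proof -
      have "cmod (a + of_real \<tau> * b) powr p = m powr p * cmod (a' + of_real \<tau> * b') powr p"
        unfolding 1 norm_mult using m by (simp add: powr_mult)
      moreover have "cmod a powr p = m powr p * cmod a' powr p"
        unfolding ab(1) norm_mult using m by (simp add: powr_mult)
      ultimately have "cmod (a + of_real \<tau> * b) powr p - cmod a powr p - p * \<tau> * Re (b * duality p a)
        = m powr p * (cmod (a' + of_real \<tau> * b') powr p - cmod a' powr p - p * \<tau> * Re (b' * duality p a'))"
        unfolding 2 by (simp add: algebra_simps)
      then show ?thesis by (simp only: abs_mult) simp
    qed
    also have "\<dots> \<le> m powr p * (\<epsilon> * \<tau>)" using B by (intro mult_left_mono) auto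
    also have "m powr p \<le> cmod a powr p + cmod b powr p"
      by (cases "cmod a \<le> cmod b") (auto simp: m_def)
    finally show ?thesis using \<tau> \<epsilon> by (simp add: mult_right_mono mult.commute)
  qed simp
  moreover have "\<tau>0 > 0" using \<delta> by (simp add: \<tau>0_def)
  ultimately show ?thesis by blast
qed

text \<open>Up to the factor 4, the part of $\theta \mapsto$ \<open>duality p (exp (\<i> \<theta>) a + b)\<close> in the Fourier
  modes congruent to 2 modulo 4. Its non-vanishing for nonzero \<open>a\<close>, \<open>b\<close> is what distinguishes
  \<open>p \<noteq> 2\<close> from the Hilbert space case.\<close>

definition mode_gap :: "real \<Rightarrow> complex \<Rightarrow> complex \<Rightarrow> complex"
  where "mode_gap p a b = duality p (a + b) + duality p (- a + b)
    - duality p (\<i> * a + b) - duality p (- \<i> * a + b)"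

lemma mode_gap_scale: "mode_gap p (b * a) (b * c) = duality p b * mode_gap p a c"
proof -
  have "b * a + b * c = b * (a + c)" "- (b * a) + b * c = b * (- a + c)"
    "\<i> * (b * a) + b * c = b * (\<i> * a + c)" "- \<i> * (b * a) + b * c = b * (- \<i> * a + c)"
    by (simp_all add: algebra_simps)
  then show ?thesis by (simp only: mode_gap_def duality_mult) (simp add: algebra_simps)
qed

lemma binomial_second_order:
  fixes \<beta> \<epsilon> :: real
  assumes "0 < \<epsilon>"
  shows "\<exists>\<eta>>0. \<forall>X. \<bar>X\<bar> \<le> \<eta> \<longrightarrow> \<bar>(1 + X) powr \<beta> - 1 - \<beta> * X - \<beta> * (\<beta> - 1) / 2 * X\<^sup>2\<bar> \<le> \<epsilon> * X\<^sup>2"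
proof -
  have r: "((\<lambda>X. ((1 + X) powr \<beta> - 1 - \<beta> * X - \<beta> * (\<beta> - 1) / 2 * X\<^sup>2) / X\<^sup>2) \<longlongrightarrow> 0) (at_right 0)"
    by real_asymp
  have l: "((\<lambda>X. ((1 + X) powr \<beta> - 1 - \<beta> * X - \<beta> * (\<beta> - 1) / 2 * X\<^sup>2) / X\<^sup>2) \<longlongrightarrow> 0) (at_left 0)"
    by real_asymp
  have "((\<lambda>X. ((1 + X) powr \<beta> - 1 - \<beta> * X - \<beta> * (\<beta> - 1) / 2 * X\<^sup>2) / X\<^sup>2) \<longlongrightarrow> 0) (at 0)"
    using l r by (rule filterlim_split_at)
  from tendstoD[OF this assms] obtain d where d: "d > 0"
    "\<And>X. X \<noteq> 0 \<Longrightarrow> \<bar>X\<bar> < d \<Longrightarrow>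
      \<bar>((1 + X) powr \<beta> - 1 - \<beta> * X - \<beta> * (\<beta> - 1) / 2 * X\<^sup>2) / X\<^sup>2\<bar> < \<epsilon>"
    by (auto simp: eventually_at dist_norm)
  have "\<bar>(1 + X) powr \<beta> - 1 - \<beta> * X - \<beta> * (\<beta> - 1) / 2 * X\<^sup>2\<bar> \<le> \<epsilon> * X\<^sup>2" if "\<bar>X\<bar> \<le> d / 2" for X
  proof (cases "X = 0")
    case False
    then show ?thesis using d(2)[of X] d(1) that by (simp add: abs_divide divide_simps)
  qed simp
  then show ?thesis using d(1) by (intro exI[of _ "d / 2"]) auto
qed

text \<open>With \<beta> = p/2 - 1 and \<open>X = 2 Re w + |w|^2\<close> one has
  \<open>|1 + w|^(p-2) = (1 + X)^\<beta>\<close>. In the alternating sum over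
  \<open>s, -s, \<i>s, -\<i>s\<close> the constant and linear terms of the expansion cancel; a
  quadratic term proportional to \<beta> survives, and \<beta> is nonzero exactly because
  \<open>p \<noteq> 2\<close>.\<close>

lemma mode_gap_lower:
  assumes p: "1 < p" "p \<noteq> 2"
  shows "\<exists>\<eta>>0. \<exists>c>0. \<forall>s. cmod s \<le> \<eta> \<longrightarrow> c * (cmod s)\<^sup>2 \<le> cmod (mode_gap p s 1)"
proof -
  define \<beta> where "\<beta> = p / 2 - 1"
  define k where "k = min \<bar>\<beta>\<bar> 1 / 2"
  have \<beta>: "\<beta> \<noteq> 0" using p by (simp add: \<beta>_def)
  have k: "0 < k" "2 * k \<le> \<bar>\<beta>\<bar>" "2 * k \<le> 1" using \<beta> by (auto simp: k_def)
  \<comment> \<open>Each of the four remainders is at most \<open>18 * \<epsilon> * r\<close> (a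
    factor 2 from \<open>|w + 1|\<close>, a factor 9 from \<open>X\<^sup>2\<close>). With 36 their
    sum is at most half of the lower bound \<open>4 * |\<beta>| * k * r\<close> for the main
    part.\<close>
  define \<epsilon> where "\<epsilon> = \<bar>\<beta>\<bar> * k / 36"
  have \<epsilon>: "0 < \<epsilon>" using \<beta> k by (simp add: \<epsilon>_def)
  obtain \<eta>0 where \<eta>0: "\<eta>0 > 0" and rem: "\<And>X. \<bar>X\<bar> \<le> \<eta>0 \<Longrightarrow>
      \<bar>(1 + X) powr \<beta> - 1 - \<beta> * X - \<beta> * (\<beta> - 1) / 2 * X\<^sup>2\<bar> \<le> \<epsilon> * X\<^sup>2"
    using binomial_second_order[OF \<epsilon>, of \<beta>] by blast
  define \<eta> where "\<eta> = Min {1, \<eta>0 / 3, k / (\<bar>\<beta> - 1\<bar> + 1)}"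
  have \<eta>: "0 < \<eta>" "\<eta> \<le> 1" "3 * \<eta> \<le> \<eta>0" "\<eta> \<le> k / (\<bar>\<beta> - 1\<bar> + 1)"
    using \<eta>0 k by (auto simp: \<eta>_def)
  define P where "P X = 1 + \<beta> * X + \<beta> * (\<beta> - 1) / 2 * X\<^sup>2" for X
  define R where "R X = (1 + X) powr \<beta> - P X" for X
  have "2 * \<bar>\<beta>\<bar> * k * (cmod s)\<^sup>2 \<le> cmod (mode_gap p s 1)" if s: "cmod s \<le> \<eta>" for s
  proof -
    define r where "r = (cmod s)\<^sup>2"
    have r: "r = (Re s)\<^sup>2 + (Im s)\<^sup>2" by (simp add: r_def cmod_power2)
    have r1: "r \<le> cmod s" "0 \<le> r" using s \<eta> by (auto simp: r_def power2_eq_square mult_left_le)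
    define X where "X w = 2 * Re w + r" for w
    have dual: "duality p (w + 1) = (cnj w + 1) * of_real (P (X w)) + (cnj w + 1) * of_real (R (X w))"
      if "cmod w = cmod s" for w
    proof -
      have "cmod (w + 1) powr (p - 2) = ((cmod (w + 1))\<^sup>2) powr \<beta>"
      proof (cases "w + 1 = 0")
        case False
        then have "((cmod (w + 1))\<^sup>2) powr \<beta> = (cmod (w + 1) powr 2) powr \<beta>" by (simp add: powr_numeral)
        also have "\<dots> = cmod (w + 1) powr (2 * \<beta>)" by (rule powr_powr)
        also have "2 * \<beta> = p - 2" by (simp add: \<beta>_def)
        finally show ?thesis by simp
      qed simp
      also have "(cmod (w + 1))\<^sup>2 = 1 + X w"
      proof -
        have "r = (Re w)\<^sup>2 + (Im w)\<^sup>2" by (simp add: r_def cmod_power2 flip: that)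
        then show ?thesis by (simp add: X_def cmod_power2) (simp add: power2_eq_square algebra_simps)
      qed
      finally show ?thesis
        by (simp add: duality_def R_def algebra_simps flip: of_real_add)
    qed
    define E where "E w = (cnj w + 1) * of_real (R (X w))" for w
    have E: "cmod (E w) \<le> 18 * \<epsilon> * r" if w: "cmod w = cmod s" for w
    proof -
      have X3: "\<bar>X w\<bar> \<le> 3 * cmod s"
        using abs_Re_le_cmod[of w] w r1 by (auto simp: X_def abs_if split: if_splits)
      then have "\<bar>R (X w)\<bar> \<le> \<epsilon> * (X w)\<^sup>2"
        using rem[of "X w"] s \<eta> by (simp add: R_def P_def diff_diff_eq)
      also have "(X w)\<^sup>2 \<le> (3 * cmod s)\<^sup>2" using X3 by (intro abs_le_square_iff[THEN iffD1]) simp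
      finally have "\<bar>R (X w)\<bar> \<le> \<epsilon> * (9 * r)" using \<epsilon> by (simp add: r_def power_mult_distrib)
      moreover have "cmod (cnj w + 1) \<le> 2"
        using norm_triangle_ineq[of "cnj w" 1] w s \<eta> by simp
      ultimately have "cmod (cnj w + 1) * \<bar>R (X w)\<bar> \<le> 2 * (\<epsilon> * (9 * r))"
        by (intro mult_mono) auto
      then show ?thesis by (simp add: E_def norm_mult)
    qed
    define Q where "Q = (cnj s + 1) * of_real (P (X s)) + (- cnj s + 1) * of_real (P (X (- s)))
        - (- \<i> * cnj s + 1) * of_real (P (X (\<i> * s))) - (\<i> * cnj s + 1) * of_real (P (X (- \<i> * s)))"
    have gap: "mode_gap p s 1 = Q + (E s + E (- s) - E (\<i> * s) - E (- \<i> * s))"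
      unfolding mode_gap_def Q_def
      by (subst (1 2 3 4) dual) (simp_all add: norm_mult E_def)
    have "cmod (E s + E (- s) - E (\<i> * s) - E (- \<i> * s)) \<le> cmod (E s) + cmod (E (- s)) + cmod (E (\<i> * s)) + cmod (E (- \<i> * s))"
      by (intro order_trans[OF norm_triangle_ineq4] add_mono order_trans[OF norm_triangle_ineq] order_refl)
    also have "\<dots> \<le> 72 * \<epsilon> * r"
      using E[of s] E[of "- s"] E[of "\<i> * s"] E[of "- \<i> * s"] by (simp add: norm_mult)
    finally have err: "cmod (E s + E (- s) - E (\<i> * s) - E (- \<i> * s)) \<le> 2 * \<bar>\<beta>\<bar> * k * r"
      by (simp add: \<epsilon>_def ac_simps)
    \<comment> \<open>The coefficients of the real and of the imaginary part of
      \<open>s\<^sup>2\<close> in \<open>Q\<close>. They tend to \<beta> and 1; both limits have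
      modulus at least \<open>2 * k\<close>, and the choice of \<eta> keeps the deviation below
      \<open>k\<close>.\<close>
    define A B where "A = \<beta> + (\<beta> - 1) * r" and "B = 1 + (\<beta> - 1) * r"
    have "Re Q = 4 * \<beta> * A * ((Re s)\<^sup>2 - (Im s)\<^sup>2)"
      unfolding Q_def P_def X_def A_def r by (simp add: power2_eq_square field_simps)
    moreover have "Im Q = - 4 * \<beta> * B * (2 * Re s * Im s)"
      unfolding Q_def P_def X_def B_def r by (simp add: power2_eq_square field_simps)
    ultimately have Q2: "(cmod Q)\<^sup>2 = 16 * \<beta>\<^sup>2 * (A\<^sup>2 * ((Re s)\<^sup>2 - (Im s)\<^sup>2)\<^sup>2 + B\<^sup>2 * (2 * Re s * Im s)\<^sup>2)"
      by (simp only: cmod_power2 power_mult_distrib power2_minus distrib_left mult.assoc) simp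
    have "\<bar>\<beta> - 1\<bar> * r \<le> (\<bar>\<beta> - 1\<bar> + 1) * cmod s" using r1 by (intro mult_mono) auto
    also have "\<dots> \<le> (\<bar>\<beta> - 1\<bar> + 1) * \<eta>" using s by (intro mult_left_mono) auto
    also have "\<dots> \<le> k" using \<eta>(4) by (simp add: field_simps add_pos_nonneg)
    finally have "\<bar>(\<beta> - 1) * r\<bar> \<le> k" using r1 by (simp add: abs_mult)
    then have "k \<le> \<bar>A\<bar>" "k \<le> \<bar>B\<bar>" using k by (auto simp: A_def B_def)
    then have "k\<^sup>2 \<le> \<bar>A\<bar>\<^sup>2" "k\<^sup>2 \<le> \<bar>B\<bar>\<^sup>2" using k by (simp_all only: power_mono less_imp_le)
    then have AB: "k\<^sup>2 \<le> A\<^sup>2" "k\<^sup>2 \<le> B\<^sup>2" by simp_all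
    have "(4 * b * k * r)\<^sup>2 = 16 * b\<^sup>2 * (k\<^sup>2 * ((Re s)\<^sup>2 - (Im s)\<^sup>2)\<^sup>2 + k\<^sup>2 * (2 * Re s * Im s)\<^sup>2)" for b
      unfolding r by (simp add: power2_eq_square algebra_simps)
    from this[of "\<bar>\<beta>\<bar>"] have "(4 * \<bar>\<beta>\<bar> * k * r)\<^sup>2
        = 16 * \<beta>\<^sup>2 * (k\<^sup>2 * ((Re s)\<^sup>2 - (Im s)\<^sup>2)\<^sup>2 + k\<^sup>2 * (2 * Re s * Im s)\<^sup>2)"
      by (simp only: power2_abs)
    also have "\<dots> \<le> (cmod Q)\<^sup>2"
      unfolding Q2 using AB by (intro mult_left_mono add_mono mult_right_mono) auto
    finally have "4 * \<bar>\<beta>\<bar> * k * r \<le> cmod Q" by (rule power2_le_imp_le) simp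
    moreover have "cmod Q \<le> cmod (mode_gap p s 1) + cmod (E s + E (- s) - E (\<i> * s) - E (- \<i> * s))"
      unfolding gap using norm_triangle_ineq4[of "Q + (E s + E (- s) - E (\<i> * s) - E (- \<i> * s))" "E s + E (- s) - E (\<i> * s) - E (- \<i> * s)"]
      by simp
    ultimately show ?thesis using err by (simp add: r_def)
  qed
  moreover have "0 < 2 * \<bar>\<beta>\<bar> * k" using \<beta> k by simp
  ultimately show ?thesis using \<eta>(1) by blast
qed

text \<open>Where $a$ and $b$ are of comparable size the mode gap dominates, elsewhere one of them is
  negligible.\<close>

lemma norm_powr_add_defect:
  assumes p: "1 < p" "p \<noteq> 2" and \<epsilon>: "0 < \<epsilon>"
  shows "\<exists>r>0. \<exists>C\<ge>0. \<forall>a b. \<bar>cmod (a + b) powr p - cmod a powr p - cmod b powr p\<bar>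
    \<le> \<epsilon> * (cmod a powr p + cmod b powr p) + C * cmod (mode_gap p (of_real r * a) b) powr (p / (p - 1))"
proof -
  have "continuous_on UNIV (\<lambda>t. cmod (1 + t) powr p - 1 - cmod t powr p)"
    using p by (intro continuous_intros continuous_on_powr') auto
  then have "((\<lambda>t. cmod (1 + t) powr p - 1 - cmod t powr p) \<longlongrightarrow> cmod (1 + 0) powr p - 1 - cmod 0 powr p) (at 0)"
    by (simp only: continuous_on_def) (metis UNIV_I)
  then have "((\<lambda>t. cmod (1 + t) powr p - 1 - cmod t powr p) \<longlongrightarrow> 0) (at 0)" by simp
  from tendstoD[OF this \<epsilon>] obtain d where d: "d > 0"
    "\<And>t. t \<noteq> 0 \<Longrightarrow> cmod t < d \<Longrightarrow> \<bar>cmod (1 + t) powr p - 1 - cmod t powr p\<bar> < \<epsilon>"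
    by (auto simp: eventually_at dist_norm)
  define \<kappa> where "\<kappa> = min 1 (d / 2)"
  have \<kappa>: "0 < \<kappa>" "\<kappa> \<le> 1" using d by (auto simp: \<kappa>_def)
  have near: "\<bar>cmod (a + b) powr p - cmod a powr p - cmod b powr p\<bar> \<le> \<epsilon> * cmod a powr p"
    if "cmod b \<le> \<kappa> * cmod a" for a b
  proof (cases "a = 0 \<or> b = 0")
    case True
    with that \<epsilon> show ?thesis by auto
  next
    case False
    define t where "t = b / a"
    have b: "b = a * t" using False by (simp add: t_def)
    have "cmod t \<le> \<kappa>" using that False by (simp add: t_def norm_divide field_simps)
    moreover have "\<kappa> < d" using d by (auto simp: \<kappa>_def)
    ultimately have "\<bar>cmod (1 + t) powr p - 1 - cmod t powr p\<bar> \<le> \<epsilon>"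
      using d(2)[of t] False by (auto simp: t_def)
    then have "cmod a powr p * \<bar>cmod (1 + t) powr p - 1 - cmod t powr p\<bar> \<le> cmod a powr p * \<epsilon>"
      by (rule mult_left_mono) simp
    moreover have "cmod (a + b) powr p - cmod a powr p - cmod b powr p
        = cmod a powr p * (cmod (1 + t) powr p - 1 - cmod t powr p)"
    proof -
      have "a + b = a * (1 + t)" by (simp add: b algebra_simps)
      then have "cmod (a + b) powr p = cmod a powr p * cmod (1 + t) powr p"
        by (simp only: norm_mult powr_mult norm_ge_zero)
      moreover have "cmod b powr p = cmod a powr p * cmod t powr p"
        unfolding b by (simp add: norm_mult powr_mult)
      ultimately show ?thesis by (simp add: algebra_simps)
    qed
    ultimately show ?thesis by (simp add: abs_mult mult.commute)
  qed
  obtain \<eta> c where \<eta>: "\<eta> > 0" and c: "c > 0"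
    and low: "\<And>s. cmod s \<le> \<eta> \<Longrightarrow> c * (cmod s)\<^sup>2 \<le> cmod (mode_gap p s 1)"
    using mode_gap_lower[OF p] by blast
  define q where "q = p / (p - 1)"
  have q: "0 < q" "(p - 1) * q = p" using p by (auto simp: q_def)
  \<comment> \<open>When \<open>a\<close> and \<open>b\<close> have ratio between \<kappa> and
    1/\<kappa>, the quotient \<open>s = r a / b\<close> has modulus at most \<eta>, so the lower
    bound for the mode gap applies, and at least \<open>r * \<kappa>\<close>, so that bound is a
    positive constant. The exponent \<open>q\<close> satisfies \<open>(p - 1) * q = p\<close>, which
    makes the power of the gap homogeneous of degree \<open>p\<close>.\<close>
  define r where "r = \<eta> * \<kappa>"
  define c' where "c' = (c * (r * \<kappa>)\<^sup>2) powr q"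
  have r: "0 < r" using \<eta> \<kappa> by (simp add: r_def)
  have c': "0 < c'" using c r \<kappa> by (simp add: c'_def)
  define C where "C = ((1 + 1 / \<kappa>) powr p + (1 / \<kappa>) powr p + 1) / c'"
  have "\<bar>cmod (a + b) powr p - cmod a powr p - cmod b powr p\<bar>
    \<le> \<epsilon> * (cmod a powr p + cmod b powr p) + C * cmod (mode_gap p (of_real r * a) b) powr q" for a b
  proof -
    have C: "0 \<le> C * cmod (mode_gap p (of_real r * a) b) powr q" using c' by (simp add: C_def)
    consider "cmod b \<le> \<kappa> * cmod a" | "cmod a \<le> \<kappa> * cmod b"
      | "\<kappa> * cmod a < cmod b" "\<kappa> * cmod b < cmod a" by linarith
    then show ?thesis
    proof cases
      case 1
      have "\<epsilon> * cmod a powr p \<le> \<epsilon> * (cmod a powr p + cmod b powr p)" using \<epsilon> by simp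
      then show ?thesis using near[OF 1] C by linarith
    next
      case 2
      have "\<epsilon> * cmod b powr p \<le> \<epsilon> * (cmod a powr p + cmod b powr p)" using \<epsilon> by simp
      then show ?thesis using near[OF 2] C by (simp add: add.commute)
    next
      case 3
      have b0: "b \<noteq> 0" using 3 \<kappa> by (auto simp: mult_less_0_iff)
      then have b1: "0 < cmod b" by simp
      define s where "s = of_real r * a / b"
      have "\<kappa> * cmod a \<le> cmod b" using 3 by simp
      then have "cmod s \<le> \<eta>"
        using b1 \<eta> \<kappa> by (simp add: s_def norm_mult norm_divide r_def divide_simps abs_mult mult.assoc)
      then have "c * (cmod s)\<^sup>2 \<le> cmod (mode_gap p s 1)" by (rule low)
      moreover have "r * \<kappa> \<le> cmod s"
        using b1 r 3(2) by (simp add: s_def norm_mult norm_divide divide_simps mult.assoc)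
      then have "c * (r * \<kappa>)\<^sup>2 \<le> c * (cmod s)\<^sup>2" using c r \<kappa> by (intro mult_left_mono power_mono) auto
      ultimately have "c * (r * \<kappa>)\<^sup>2 \<le> cmod (mode_gap p s 1)" by (rule order_trans[rotated])
      then have "c' \<le> cmod (mode_gap p s 1) powr q"
        unfolding c'_def using q c by (intro powr_mono2) auto
      then have "c' * cmod b powr p \<le> cmod (mode_gap p s 1) powr q * cmod b powr p"
        by (intro mult_right_mono) auto
      also have "\<dots> = cmod (mode_gap p (of_real r * a) b) powr q"
      proof -
        have "mode_gap p (of_real r * a) b = duality p b * mode_gap p s 1"
          using mode_gap_scale[of p b s 1] b0 by (simp add: s_def)
        then show ?thesis using q by (simp add: norm_mult norm_duality powr_mult powr_powr)
      qed
      finally have gap: "cmod b powr p \<le> cmod (mode_gap p (of_real r * a) b) powr q / c'"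
        using c' by (simp add: field_simps)
      have ab: "cmod a \<le> (1 / \<kappa>) * cmod b" using 3(1) \<kappa> by (simp add: field_simps)
      have "cmod (a + b) \<le> (1 + 1 / \<kappa>) * cmod b"
        using norm_triangle_ineq[of a b] ab by (simp add: algebra_simps)
      then have "cmod (a + b) powr p \<le> ((1 + 1 / \<kappa>) * cmod b) powr p" using p by (intro powr_mono2) auto
      moreover have "cmod a powr p \<le> ((1 / \<kappa>) * cmod b) powr p" using p ab by (intro powr_mono2) auto
      ultimately have "cmod (a + b) powr p + cmod a powr p + cmod b powr p
          \<le> ((1 + 1 / \<kappa>) powr p + (1 / \<kappa>) powr p + 1) * cmod b powr p"
        using \<kappa> powr_mult[of "1 + 1 / \<kappa>" "cmod b" p] powr_mult[of "1 / \<kappa>" "cmod b" p]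
        by (simp add: distrib_right)
      also have "\<dots> \<le> ((1 + 1 / \<kappa>) powr p + (1 / \<kappa>) powr p + 1) * (cmod (mode_gap p (of_real r * a) b) powr q / c')"
        by (intro mult_left_mono gap) (auto intro!: add_nonneg_nonneg)
      finally have "cmod (a + b) powr p + cmod a powr p + cmod b powr p \<le> C * cmod (mode_gap p (of_real r * a) b) powr q"
        by (simp add: C_def)
      moreover have "\<bar>cmod (a + b) powr p - cmod a powr p - cmod b powr p\<bar> \<le> cmod (a + b) powr p + cmod a powr p + cmod b powr p"
        using powr_ge_zero[of "cmod (a + b)" p] powr_ge_zero[of "cmod a" p] powr_ge_zero[of "cmod b" p] by linarith
      moreover have "0 \<le> \<epsilon> * (cmod a powr p + cmod b powr p)" using \<epsilon> by simp
      ultimately show ?thesis by linarith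
    qed
  qed
  moreover have "0 \<le> C" using c' by (simp add: C_def add_nonneg_nonneg)
  ultimately show ?thesis using r unfolding q_def by blast
qed

section \<open>The seminorm of $L^p$\<close>

lemma convex_powr_nonneg:
  assumes "1 \<le> p"
  shows "convex_on {0..} (\<lambda>x::real. x powr p)"
proof (rule convex_onI)
  have one: "(c * y) powr p \<le> c * y powr p" if "0 < c" "c < 1" for c y :: real
  proof -
    have "c powr p \<le> c powr 1" using that assms by (intro powr_mono') auto
    then show ?thesis using that by (simp add: powr_mult mult_right_mono)
  qed
  fix t x y :: real assume t: "0 < t" "t < 1" and xy: "x \<in> {0..}" "y \<in> {0..}"
  show "((1 - t) *\<^sub>R x + t *\<^sub>R y) powr p \<le> (1 - t) * x powr p + t * y powr p"
  proof (cases "x = 0 \<or> y = 0")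
    case True
    then show ?thesis using one[of t y] one[of "1 - t" x] t by auto
  next
    case False
    then show ?thesis using xy t assms by (intro convex_onD[OF powr_convex]) auto
  qed
qed simp

text \<open>Taken on functions instead of classes, so that pointwise inequalities can be integrated
  directly; identities in L^p become identities almost everywhere.\<close>

definition Lp_seminorm :: "real \<Rightarrow> 'x measure \<Rightarrow> ('x \<Rightarrow> complex) \<Rightarrow> real"
  where "Lp_seminorm p M f = (LINT x|M. cmod (f x) powr p) powr (1 / p)"

locale Lp_setting =
  fixes p :: real and M :: "'x measure"
  assumes p_gt_1: "1 < p"
begin

abbreviation "V \<equiv> Lp_functions p M"
abbreviation "N \<equiv> Lp_seminorm p M"

text \<open>The value at \<open>w\<close> of the image of \<xi> under the duality map. Its real
  part, times \<open>p\<close>, is the derivative of \<open>N \<xi> powr p\<close> in the direction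
  \<open>w\<close>.\<close>

definition pairing :: "('x \<Rightarrow> complex) \<Rightarrow> ('x \<Rightarrow> complex) \<Rightarrow> complex"
  where "pairing w \<xi> = (LINT x|M. w x * duality p (\<xi> x))"

lemma V_D: "f \<in> V \<Longrightarrow> f \<in> borel_measurable M" "f \<in> V \<Longrightarrow> integrable M (\<lambda>x. cmod (f x) powr p)"
  by (auto simp: Lp_functions_def)

lemma V_dominated:
  assumes "h \<in> borel_measurable M" "integrable M g" "\<And>x. cmod (h x) powr p \<le> g x"
  shows "h \<in> V"
  unfolding Lp_functions_def using assms
  by (auto intro!: Bochner_Integration.integrable_bound[OF assms(2)] AE_I2 order_trans[OF assms(3) abs_ge_self])

lemma V_zero: "(\<lambda>x. 0) \<in> V"
  by (simp add: Lp_functions_def)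

lemma norm_add_powr_le: "cmod (a + b) powr p \<le> 2 powr p * (cmod a powr p + cmod b powr p)"
proof -
  have "cmod (a + b) powr p \<le> (2 * max (cmod a) (cmod b)) powr p"
    using p_gt_1 norm_triangle_ineq[of a b] by (intro powr_mono2) auto
  also have "\<dots> = 2 powr p * max (cmod a) (cmod b) powr p" by (simp add: powr_mult)
  also have "max (cmod a) (cmod b) powr p \<le> cmod a powr p + cmod b powr p"
    by (cases "cmod a \<le> cmod b") auto
  finally show ?thesis by simp
qed

lemma V_add: "f \<in> V \<Longrightarrow> g \<in> V \<Longrightarrow> (\<lambda>x. f x + g x) \<in> V"
  by (rule V_dominated[where g = "\<lambda>x. 2 powr p * (cmod (f x) powr p + cmod (g x) powr p)"])
    (auto intro: norm_add_powr_le borel_measurable_add dest: V_D)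

lemma V_scale: "f \<in> V \<Longrightarrow> (\<lambda>x. c * f x) \<in> V"
  by (rule V_dominated[where g = "\<lambda>x. cmod c powr p * cmod (f x) powr p"])
    (auto simp: norm_mult powr_mult intro: borel_measurable_times dest: V_D)

lemma V_diff: "f \<in> V \<Longrightarrow> g \<in> V \<Longrightarrow> (\<lambda>x. f x - g x) \<in> V"
  using V_add[OF _ V_scale[of g "-1"], of f] by simp

lemma N_nonneg: "0 \<le> N f"
  by (simp add: Lp_seminorm_def)

lemma N_powr: "N f powr p = (LINT x|M. cmod (f x) powr p)"
  using p_gt_1 by (simp add: Lp_seminorm_def powr_powr)

lemma N_le_iff: "0 \<le> c \<Longrightarrow> N f \<le> c \<longleftrightarrow> (LINT x|M. cmod (f x) powr p) \<le> c powr p"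
  unfolding N_powr[symmetric] using p_gt_1 N_nonneg[of f]
  by (metis less_trans linorder_not_less powr_less_mono2 powr_mono2 zero_less_one order_less_imp_le)

lemma N_cong_AE:
  assumes "AE x in M. f x = g x" "f \<in> V" "g \<in> V"
  shows "N f = N g"
  unfolding Lp_seminorm_def using assms
  by (intro arg_cong2[where f = "(powr)"] integral_cong_AE) (auto dest: V_D(1))

lemma N_scale: "f \<in> V \<Longrightarrow> N (\<lambda>x. c * f x) = cmod c * N f"
  using p_gt_1 by (simp add: Lp_seminorm_def norm_mult powr_mult powr_powr)

text \<open>Minkowski's inequality from convexity of \<open>t^p\<close>: the sum is
  \<open>(\<alpha> + \<beta>)\<close> times a convex combination of \<open>f/\<alpha>\<close> and
  \<open>g/\<beta>\<close>. The extra \<open>e / 2\<close> keeps both denominators positive when a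
  seminorm is 0.\<close>

lemma N_triangle:
  assumes f: "f \<in> V" and g: "g \<in> V"
  shows "N (\<lambda>x. f x + g x) \<le> N f + N g"
proof (rule field_le_epsilon)
  fix e :: real assume e: "0 < e"
  define \<alpha> \<beta> where "\<alpha> = N f + e / 2" and "\<beta> = N g + e / 2"
  have ab: "0 < \<alpha>" "0 < \<beta>" using e N_nonneg[of f] N_nonneg[of g] by (auto simp: \<alpha>_def \<beta>_def)
  have fi: "(LINT x|M. cmod (f x) powr p) \<le> \<alpha> powr p" "(LINT x|M. cmod (g x) powr p) \<le> \<beta> powr p"
    using e ab by (auto simp: N_le_iff[symmetric] \<alpha>_def \<beta>_def)
  have pt: "cmod (f x + g x) powr p \<le> (\<alpha> + \<beta>) powr p *
      ((\<alpha> / (\<alpha> + \<beta>)) * (cmod (f x) powr p / \<alpha> powr p) + (\<beta> / (\<alpha> + \<beta>)) * (cmod (g x) powr p / \<beta> powr p))" for x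
  proof -
    define t where "t = \<beta> / (\<alpha> + \<beta>)"
    have t: "0 \<le> t" "t \<le> 1" "1 - t = \<alpha> / (\<alpha> + \<beta>)" using ab by (auto simp: t_def field_simps)
    have "((1 - t) *\<^sub>R (cmod (f x) / \<alpha>) + t *\<^sub>R (cmod (g x) / \<beta>)) powr p
        \<le> (1 - t) * (cmod (f x) / \<alpha>) powr p + t * (cmod (g x) / \<beta>) powr p"
      using p_gt_1 t ab by (intro convex_onD[OF convex_powr_nonneg]) auto
    moreover have "(1 - t) *\<^sub>R (cmod (f x) / \<alpha>) + t *\<^sub>R (cmod (g x) / \<beta>) = (cmod (f x) + cmod (g x)) / (\<alpha> + \<beta>)"
      unfolding t(3) unfolding t_def using ab by (simp add: add_divide_distrib)
    ultimately have "((cmod (f x) + cmod (g x)) / (\<alpha> + \<beta>)) powr p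
        \<le> (1 - t) * (cmod (f x) / \<alpha>) powr p + t * (cmod (g x) / \<beta>) powr p" by simp
    then have "(\<alpha> + \<beta>) powr p * ((cmod (f x) + cmod (g x)) / (\<alpha> + \<beta>)) powr p
        \<le> (\<alpha> + \<beta>) powr p * ((1 - t) * (cmod (f x) powr p / \<alpha> powr p) + t * (cmod (g x) powr p / \<beta> powr p))"
      using ab by (intro mult_left_mono) (auto simp: powr_divide)
    moreover have "(\<alpha> + \<beta>) powr p * ((cmod (f x) + cmod (g x)) / (\<alpha> + \<beta>)) powr p = (cmod (f x) + cmod (g x)) powr p"
      using ab by (simp add: powr_divide)
    moreover have "cmod (f x + g x) powr p \<le> (cmod (f x) + cmod (g x)) powr p"
      using p_gt_1 by (intro powr_mono2 norm_triangle_ineq) auto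
    ultimately show ?thesis unfolding t(3) unfolding t_def by linarith
  qed
  have "(LINT x|M. cmod (f x + g x) powr p) \<le> (LINT x|M. (\<alpha> + \<beta>) powr p *
      ((\<alpha> / (\<alpha> + \<beta>)) * (cmod (f x) powr p / \<alpha> powr p) + (\<beta> / (\<alpha> + \<beta>)) * (cmod (g x) powr p / \<beta> powr p)))"
    using f g by (intro integral_mono pt V_D(2)[OF V_add] Bochner_Integration.integrable_add
        integrable_mult_right integrable_divide) (auto dest: V_D)
  also have "\<dots> = (\<alpha> + \<beta>) powr p * ((\<alpha> / (\<alpha> + \<beta>)) * ((LINT x|M. cmod (f x) powr p) / \<alpha> powr p)
      + (\<beta> / (\<alpha> + \<beta>)) * ((LINT x|M. cmod (g x) powr p) / \<beta> powr p))"
    using f g by (simp add: V_D)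
  also have "\<dots> \<le> (\<alpha> + \<beta>) powr p * ((\<alpha> / (\<alpha> + \<beta>)) * 1 + (\<beta> / (\<alpha> + \<beta>)) * 1)"
    using ab fi by (intro mult_left_mono add_mono) auto
  also have "\<dots> = (\<alpha> + \<beta>) powr p" using ab by (simp add: add_divide_distrib[symmetric])
  finally have "N (\<lambda>x. f x + g x) \<le> \<alpha> + \<beta>" using ab by (simp add: N_le_iff)
  then show "N (\<lambda>x. f x + g x) \<le> N f + N g + e" by (simp add: \<alpha>_def \<beta>_def)
qed

lemma N_triangle_diff:
  assumes f: "f \<in> V" and g: "g \<in> V"
  shows "N (\<lambda>x. f x - g x) \<le> N f + N g" "N f \<le> N g + N (\<lambda>x. f x - g x)"
proof -
  show "N (\<lambda>x. f x - g x) \<le> N f + N g"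
    using N_triangle[OF f V_scale[OF g, of "-1"]] N_scale[OF g, of "-1"] by simp
  show "N f \<le> N g + N (\<lambda>x. f x - g x)"
    using N_triangle[OF g V_diff[OF f g]] by simp
qed

lemma duality_measurable [measurable]: "duality p \<in> borel_measurable borel"
  by (intro borel_measurable_continuous_onI continuous_duality p_gt_1)

text \<open>Both moduli are replaced by their maximum, a crude form of Young's inequality that makes
  the pairing integrable.\<close>

lemma norm_mult_duality_le: "cmod (w * duality p z) \<le> cmod w powr p + cmod z powr p"
proof -
  define m where "m = max (cmod w) (cmod z)"
  have "cmod (w * duality p z) = cmod w * cmod z powr (p - 1)" by (simp add: norm_mult norm_duality)
  also have "\<dots> \<le> m * m powr (p - 1)"
    using p_gt_1 by (intro mult_mono powr_mono2) (auto simp: m_def le_max_iff_disj)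
  also have "\<dots> = m powr p" by (cases "m = 0") (auto simp: powr_mult_base m_def le_max_iff_disj)
  also have "\<dots> \<le> cmod w powr p + cmod z powr p" by (cases "cmod w \<le> cmod z") (auto simp: m_def)
  finally show ?thesis .
qed

lemma pairing_integrable:
  assumes w: "w \<in> V" and \<xi>: "\<xi> \<in> V"
  shows "integrable M (\<lambda>x. w x * duality p (\<xi> x))"
proof (rule Bochner_Integration.integrable_bound)
  have [measurable]: "w \<in> borel_measurable M" "\<xi> \<in> borel_measurable M" using assms by (auto dest: V_D)
  show "integrable M (\<lambda>x. cmod (w x) powr p + cmod (\<xi> x) powr p)"
    using assms by (auto dest: V_D)
  show "(\<lambda>x. w x * duality p (\<xi> x)) \<in> borel_measurable M" by measurable
  show "AE x in M. cmod (w x * duality p (\<xi> x)) \<le> norm (cmod (w x) powr p + cmod (\<xi> x) powr p)"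
    using norm_mult_duality_le by (auto intro: order_trans)
qed

lemma pairing_add: "w \<in> V \<Longrightarrow> w' \<in> V \<Longrightarrow> \<xi> \<in> V \<Longrightarrow>
    pairing (\<lambda>x. w x + w' x) \<xi> = pairing w \<xi> + pairing w' \<xi>"
  unfolding pairing_def by (simp add: distrib_right pairing_integrable)

lemma pairing_scale: "pairing (\<lambda>x. c * w x) \<xi> = c * pairing w \<xi>"
  unfolding pairing_def by (simp add: mult.assoc)

lemma pairing_diff: "w \<in> V \<Longrightarrow> w' \<in> V \<Longrightarrow> \<xi> \<in> V \<Longrightarrow>
    pairing (\<lambda>x. w x - w' x) \<xi> = pairing w \<xi> - pairing w' \<xi>"
  unfolding pairing_def by (simp add: left_diff_distrib pairing_integrable)

lemma pairing_cong_AE: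
  assumes "AE x in M. w x = w' x" "w \<in> V" "w' \<in> V" "\<xi> \<in> V"
  shows "pairing w \<xi> = pairing w' \<xi>"
proof -
  have [measurable]: "w \<in> borel_measurable M" "\<xi> \<in> borel_measurable M" "w' \<in> borel_measurable M"
    using assms by (auto dest: V_D)
  show ?thesis unfolding pairing_def using assms(1) by (intro integral_cong_AE) auto
qed

text \<open>A substitute for Holder's inequality: the pairing is linear in \<open>w\<close>, so the
  crude estimate by a sum of p-th powers may be applied to \<open>w\<close> scaled into the unit
  ball. Only linearity of the bound in \<open>N w\<close> is used later.\<close>

lemma pairing_bound:
  assumes w: "w \<in> V" and \<xi>: "\<xi> \<in> V"
  shows "cmod (pairing w \<xi>) \<le> N w * (1 + N \<xi> powr p)"
proof (rule field_le_epsilon)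
  have crude: "cmod (pairing w \<xi>) \<le> N w powr p + N \<xi> powr p" if w: "w \<in> V" for w
  proof -
    have "cmod (pairing w \<xi>) \<le> (LINT x|M. cmod (w x * duality p (\<xi> x)))"
      unfolding pairing_def by (rule integral_norm_bound)
    also have "\<dots> \<le> (LINT x|M. cmod (w x) powr p + cmod (\<xi> x) powr p)"
      using w \<xi> norm_mult_duality_le
      by (intro integral_mono integrable_norm pairing_integrable) (auto dest: V_D)
    also have "\<dots> = N w powr p + N \<xi> powr p" using w \<xi> by (simp add: N_powr V_D)
    finally show ?thesis .
  qed
  fix e :: real assume e: "0 < e"
  define s where "s = N w + e / (1 + N \<xi> powr p)"
  have 1: "0 < 1 + N \<xi> powr p" by (simp add: add_pos_nonneg)
  then have s: "0 < s" "N w \<le> s" using e N_nonneg[of w] by (auto simp: s_def add_nonneg_pos)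
  have "cmod (pairing (\<lambda>x. of_real (1 / s) * w x) \<xi>) \<le> N (\<lambda>x. of_real (1 / s) * w x) powr p + N \<xi> powr p"
    by (intro crude V_scale w)
  moreover have "N (\<lambda>x. of_real (1 / s) * w x) powr p \<le> 1 powr p"
    using s N_nonneg[of w] p_gt_1 unfolding N_scale[OF w] by (intro powr_mono2) (auto simp: norm_divide)
  ultimately have "(1 / s) * cmod (pairing w \<xi>) \<le> 1 + N \<xi> powr p"
    unfolding pairing_scale using s by (simp add: norm_mult norm_divide)
  then have "cmod (pairing w \<xi>) \<le> s * (1 + N \<xi> powr p)" using s by (simp add: field_simps)
  also have "\<dots> = N w * (1 + N \<xi> powr p) + e" using 1 by (simp add: s_def distrib_right)
  finally show "cmod (pairing w \<xi>) \<le> N w * (1 + N \<xi> powr p) + e" .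
qed

text \<open>The pointwise expansion integrates because its threshold does not depend on the two
  numbers. This uniform smoothness is what turns comparisons of norms into comparisons of
  pairings.\<close>

lemma N_expansion:
  assumes "0 < \<epsilon>"
  shows "\<exists>\<tau>0>0. \<forall>\<tau> \<xi> w. 0 < \<tau> \<and> \<tau> \<le> \<tau>0 \<and> \<xi> \<in> V \<and> w \<in> V \<longrightarrow>
    \<bar>N (\<lambda>x. \<xi> x + of_real \<tau> * w x) powr p - N \<xi> powr p - p * \<tau> * Re (pairing w \<xi>)\<bar>
      \<le> \<epsilon> * \<tau> * (N \<xi> powr p + N w powr p)"
proof -
  obtain \<tau>0 where "\<tau>0 > 0" and *: "\<And>\<tau> a b. 0 < \<tau> \<Longrightarrow> \<tau> \<le> \<tau>0 \<Longrightarrow>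
    \<bar>cmod (a + of_real \<tau> * b) powr p - cmod a powr p - p * \<tau> * Re (b * duality p a)\<bar>
      \<le> \<epsilon> * \<tau> * (cmod a powr p + cmod b powr p)"
    using norm_powr_expansion[OF p_gt_1 assms] by blast
  have "\<bar>N (\<lambda>x. \<xi> x + of_real \<tau> * w x) powr p - N \<xi> powr p - p * \<tau> * Re (pairing w \<xi>)\<bar>
      \<le> \<epsilon> * \<tau> * (N \<xi> powr p + N w powr p)"
    if \<tau>: "0 < \<tau>" "\<tau> \<le> \<tau>0" and V: "\<xi> \<in> V" "w \<in> V" for \<tau> \<xi> w
  proof -
    note [simp] = V_D(2)[OF V_add[OF V(1) V_scale[OF V(2)]]] V_D(2)[OF V(1)] V_D(2)[OF V(2)]
      pairing_integrable[OF V(2,1)]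
    have "N (\<lambda>x. \<xi> x + of_real \<tau> * w x) powr p - N \<xi> powr p - p * \<tau> * Re (pairing w \<xi>)
      = (LINT x|M. cmod (\<xi> x + of_real \<tau> * w x) powr p - cmod (\<xi> x) powr p - p * \<tau> * Re (w x * duality p (\<xi> x)))"
      by (simp add: N_powr pairing_def del: times_complex.sel)
    also have "\<bar>\<dots>\<bar> \<le> (LINT x|M. \<bar>cmod (\<xi> x + of_real \<tau> * w x) powr p - cmod (\<xi> x) powr p - p * \<tau> * Re (w x * duality p (\<xi> x))\<bar>)"
      by (rule integral_abs_bound)
    also have "\<dots> \<le> (LINT x|M. \<epsilon> * \<tau> * (cmod (\<xi> x) powr p + cmod (w x) powr p))"
      by (intro integral_mono * \<tau>) (auto simp del: times_complex.sel)
    also have "\<dots> = \<epsilon> * \<tau> * (N \<xi> powr p + N w powr p)" by (simp add: N_powr)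
    finally show ?thesis .
  qed
  then show ?thesis using \<open>\<tau>0 > 0\<close> by blast
qed

end

section \<open>Contractive approximate identities\<close>

text \<open>These sets replace the net. They are convex, so separation arguments can single out
  units with additional properties.\<close>

definition approx_units :: "'a::complex_banach_algebra set \<Rightarrow> real \<Rightarrow> 'a set"
  where "approx_units S \<delta> = {e. norm e \<le> 1 \<and> (\<forall>a\<in>S. norm (e * a - a) \<le> \<delta> \<and> norm (a * e - a) \<le> \<delta>)}"

lemma approx_unitsD:
  assumes "e \<in> approx_units S \<delta>"
  shows "norm e \<le> 1" "a \<in> S \<Longrightarrow> norm (e * a - a) \<le> \<delta>" "a \<in> S \<Longrightarrow> norm (a * e - a) \<le> \<delta>"
  using assms by (auto simp: approx_units_def)

lemma approx_units_mono: "S \<subseteq> S' \<Longrightarrow> \<delta>' \<le> \<delta> \<Longrightarrow> approx_units S' \<delta>' \<subseteq> approx_units S \<delta>"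
  by (clarsimp simp: approx_units_def) (meson order_trans subsetD)

lemma approx_units_nonempty:
  assumes "approximately_unital TYPE('a::complex_banach_algebra)" "finite S" "0 < \<delta>"
  shows "\<exists>e::'a. e \<in> approx_units S \<delta>"
proof -
  obtain F :: "'a filter" where F: "F \<noteq> bot" "\<forall>\<^sub>F e in F. norm e \<le> 1"
    "\<And>a. ((\<lambda>e. e * a) \<longlongrightarrow> a) F" "\<And>a. ((\<lambda>e. a * e) \<longlongrightarrow> a) F"
    using assms(1) unfolding approximately_unital_def by blast
  have "\<forall>\<^sub>F e in F. norm (e * a - a) \<le> \<delta> \<and> norm (a * e - a) \<le> \<delta>" for a
    using tendstoD[OF F(3) assms(3), of a] tendstoD[OF F(4) assms(3), of a]
    by eventually_elim (simp add: dist_norm)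
  then have "\<forall>\<^sub>F e in F. \<forall>a\<in>S. norm (e * a - a) \<le> \<delta> \<and> norm (a * e - a) \<le> \<delta>"
    using assms(2) by (simp add: eventually_ball_finite)
  with F(2) have "\<forall>\<^sub>F e in F. e \<in> approx_units S \<delta>"
    by eventually_elim (simp add: approx_units_def)
  then show ?thesis using F(1) eventually_happens' by blast
qed

lemma convex_approx_units: "convex (approx_units S \<delta>)"
proof (rule convexI)
  fix x y :: 'a and u v :: real assume xy: "x \<in> approx_units S \<delta>" "y \<in> approx_units S \<delta>"
    and uv: "0 \<le> u" "0 \<le> v" "u + v = 1"
  have comb: "norm (u *\<^sub>R z1 + v *\<^sub>R z2) \<le> r" if "norm z1 \<le> r" "norm z2 \<le> r" for z1 z2 :: 'a and r
    using that uv norm_triangle_ineq[of "u *\<^sub>R z1" "v *\<^sub>R z2"] convex_bound_le[of "norm z1" r "norm z2" u v] by simp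
  have a: "a = u *\<^sub>R a + v *\<^sub>R a" for a :: 'a using uv by (simp flip: scaleR_add_left)
  show "u *\<^sub>R x + v *\<^sub>R y \<in> approx_units S \<delta>"
    unfolding approx_units_def
  proof (intro CollectI conjI ballI)
    show "norm (u *\<^sub>R x + v *\<^sub>R y) \<le> 1" using xy by (intro comb) (auto dest: approx_unitsD)
    fix a assume "a \<in> S"
    have "(u *\<^sub>R x + v *\<^sub>R y) * a - (u *\<^sub>R a + v *\<^sub>R a) = u *\<^sub>R (x * a - a) + v *\<^sub>R (y * a - a)"
      by (simp add: algebra_simps)
    then show "norm ((u *\<^sub>R x + v *\<^sub>R y) * a - a) \<le> \<delta>"
      using comb[of "x * a - a" \<delta> "y * a - a"] xy \<open>a \<in> S\<close> by (simp add: approx_unitsD flip: a)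
    have "a * (u *\<^sub>R x + v *\<^sub>R y) - (u *\<^sub>R a + v *\<^sub>R a) = u *\<^sub>R (a * x - a) + v *\<^sub>R (a * y - a)"
      by (simp add: algebra_simps)
    then show "norm (a * (u *\<^sub>R x + v *\<^sub>R y) - a) \<le> \<delta>"
      using comb[of "a * x - a" \<delta> "a * y - a"] xy \<open>a \<in> S\<close> by (simp add: approx_unitsD flip: a)
  qed
qed

section \<open>Actions on $L^p$\<close>

text \<open>Passes from norms to p-th powers: on the interval from 0 to \<open>K\<close> the
  derivative of the power is at most \<open>p * K powr (p - 1)\<close>.\<close>

lemma powr_diff_le:
  fixes x y K p :: real
  assumes "1 < p" "0 \<le> y" "x \<le> K" "0 \<le> K" "0 \<le> \<eta>" "x \<le> y + \<eta>" "0 \<le> x"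
  shows "x powr p \<le> y powr p + p * K powr (p - 1) * \<eta>"
proof (cases "x \<le> y")
  case True
  then have "x powr p \<le> y powr p" using assms by (intro powr_mono2) auto
  then show ?thesis using assms by (simp add: add_increasing2)
next
  case False
  then have yx: "y < x" by simp
  have der: "((\<lambda>x. x powr p) has_real_derivative p * z powr (p - 1)) (at z)" if "y < z" for z
    using that assms(2) by (intro has_real_derivative_powr) auto
  have "continuous_on {y..x} (\<lambda>x. x powr p)"
    using assms by (intro continuous_on_powr' continuous_intros) auto
  then obtain l z where z: "y < z" "z < x" "DERIV (\<lambda>x. x powr p) z :> l" "x powr p - y powr p = (x - y) * l"
    using MVT[OF yx, of "\<lambda>x. x powr p"] der real_differentiable_def by blast
  then have l: "l = p * z powr (p - 1)" using DERIV_unique der by blast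
  have "(x - y) * (p * z powr (p - 1)) \<le> \<eta> * (p * K powr (p - 1))"
    using z yx assms by (intro mult_mono powr_mono2) auto
  then show ?thesis using z(4) by (simp add: l algebra_simps)
qed

text \<open>An isometric representation by maps on functions: the algebraic laws hold almost
  everywhere, and \<open>T_attain\<close> expresses that the operator norm is at least the norm in
  \<open>A\<close> without assuming that it is attained.\<close>

locale Lp_action = Lp_setting p M
  for p :: real and M :: "'x measure" +
  fixes T :: "'a::complex_banach_algebra \<Rightarrow> ('x \<Rightarrow> complex) \<Rightarrow> ('x \<Rightarrow> complex)"
  assumes T_V: "f \<in> V \<Longrightarrow> T a f \<in> V"
    and T_fun_add: "f \<in> V \<Longrightarrow> g \<in> V \<Longrightarrow> AE x in M. T a (\<lambda>x. f x + g x) x = T a f x + T a g x"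
    and T_fun_scale: "f \<in> V \<Longrightarrow> AE x in M. T a (\<lambda>x. c * f x) x = c * T a f x"
    and T_add: "f \<in> V \<Longrightarrow> AE x in M. T (a + b) f x = T a f x + T b f x"
    and T_scale: "f \<in> V \<Longrightarrow> AE x in M. T (c *\<^sub>C a) f x = c * T a f x"
    and T_mult: "f \<in> V \<Longrightarrow> AE x in M. T (a * b) f x = T a (T b f) x"
    and T_bound: "f \<in> V \<Longrightarrow> N (T a f) \<le> norm a * N f"
    and T_attain: "r < norm a \<Longrightarrow> \<exists>f\<in>V. N f \<le> 1 \<and> r < N (T a f)"
begin

lemma T_diff:
  assumes f: "f \<in> V"
  shows "AE x in M. T (a - b) f x = T a f x - T b f x"
proof -
  have "AE x in M. T (a - b + b) f x = T (a - b) f x + T b f x" by (rule T_add[OF f])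
  then show ?thesis by (auto elim: AE_mp)
qed

lemma T_fun_diff:
  assumes "f \<in> V" "g \<in> V"
  shows "AE x in M. T a (\<lambda>x. f x - g x) x = T a f x - T a g x"
proof -
  have "AE x in M. T a (\<lambda>x. (f x - g x) + g x) x = T a (\<lambda>x. f x - g x) x + T a g x"
    by (intro T_fun_add V_diff assms)
  then show ?thesis by (auto elim: AE_mp)
qed

lemma T_norm_le:
  assumes "0 \<le> K" "\<And>f. f \<in> V \<Longrightarrow> N f \<le> 1 \<Longrightarrow> N (T a f) \<le> K"
  shows "norm a \<le> K"
  using T_attain[of K a] assms by (meson not_le)

text \<open>Uniform smoothness turns the contraction $e'$, for which $e'\xi \approx \xi$ while
  $e'(w - ew) \approx 0$, into near orthogonality of $\xi$ and $w - ew$.\<close>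

lemma pairing_approx_unit:
  assumes K: "0 < K" and \<epsilon>: "0 < \<epsilon>"
  shows "\<exists>\<eta>>0. \<forall>\<xi> w e e'. \<xi> \<in> V \<and> w \<in> V \<and> N \<xi> \<le> K \<and> N w \<le> K \<and> norm e \<le> 1 \<and> norm e' \<le> 1
    \<and> norm (e' - e' * e) \<le> \<eta> \<and> N (\<lambda>x. T e' \<xi> x - \<xi> x) \<le> \<eta>
    \<longrightarrow> cmod (pairing (\<lambda>x. w x - T e w x) \<xi>) \<le> \<epsilon>"
proof -
  define C where "C = p * K powr (p - 1) * (1 + K) + K powr p + (2 * K) powr p"
  have C: "0 < C" unfolding C_def using p_gt_1 K by (intro add_nonneg_pos) auto
  define \<epsilon>' where "\<epsilon>' = p * \<epsilon> / C"
  have \<epsilon>': "0 < \<epsilon>'" using p_gt_1 \<epsilon> C by (simp add: \<epsilon>'_def)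
  obtain \<tau>0 where \<tau>0: "\<tau>0 > 0" and ex: "\<And>\<tau> \<xi> w. 0 < \<tau> \<Longrightarrow> \<tau> \<le> \<tau>0 \<Longrightarrow> \<xi> \<in> V \<Longrightarrow> w \<in> V \<Longrightarrow>
    \<bar>N (\<lambda>x. \<xi> x + of_real \<tau> * w x) powr p - N \<xi> powr p - p * \<tau> * Re (pairing w \<xi>)\<bar>
      \<le> \<epsilon>' * \<tau> * (N \<xi> powr p + N w powr p)"
    using N_expansion[OF \<epsilon>'] by blast
  define \<tau> where "\<tau> = min \<tau>0 1"
  have \<tau>: "0 < \<tau>" "\<tau> \<le> \<tau>0" "\<tau> \<le> 1" using \<tau>0 by (auto simp: \<tau>_def)
  \<comment> \<open>The error of the units is compared with a first-order term of size \<tau>, so it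
    has to be small relative to \<tau>.\<close>
  define \<eta> where "\<eta> = \<epsilon>' * \<tau>"
  have \<eta>: "0 < \<eta>" using \<epsilon>' \<tau> by (simp add: \<eta>_def)
  have "cmod (pairing (\<lambda>x. w x - T e w x) \<xi>) \<le> \<epsilon>"
    if V: "\<xi> \<in> V" "w \<in> V" and NK: "N \<xi> \<le> K" "N w \<le> K" and e: "norm e \<le> 1" "norm e' \<le> 1"
      and ee: "norm (e' - e' * e) \<le> \<eta>" and e\<xi>: "N (\<lambda>x. T e' \<xi> x - \<xi> x) \<le> \<eta>" for \<xi> w e e'
  proof -
    define w' where "w' = (\<lambda>x. w x - T e w x)"
    have w'V: "w' \<in> V" unfolding w'_def by (intro V_diff V T_V)
    have "N (T e w) \<le> 1 * K" using T_bound[OF V(2), of e] e NK N_nonneg[of w] by (intro order_trans[OF T_bound[OF V(2)]] mult_mono) auto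
    then have Nw': "N w' \<le> 2 * K"
      using N_triangle_diff(1)[OF V(2) T_V[OF V(2)], of e] NK by (simp add: w'_def)
    have "AE x in M. T e' w' x = T (e' - e' * e) w x"
      using T_fun_diff[OF V(2) T_V[OF V(2)], of e' e] T_mult[OF V(2), of e' e] T_diff[OF V(2), of e' "e' * e"]
      by (auto simp: w'_def elim!: AE_mp)
    then have "N (T e' w') = N (T (e' - e' * e) w)" by (intro N_cong_AE T_V w'V V)
    also have "\<dots> \<le> \<eta> * K"
      using ee NK N_nonneg[of w] \<eta> by (intro order_trans[OF T_bound[OF V(2)]] mult_mono) auto
    finally have Tw': "N (T e' w') \<le> \<eta> * K" .
    \<comment> \<open>Moving \<xi> by \<tau> in the direction \<open>- u w'\<close> would lower the
      p-th power of the norm at the rate \<open>p * Re (u * pairing w' \<xi>)\<close>. But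
      \<open>e'\<close> almost fixes \<xi> and almost annihilates \<open>w'\<close>, so as a
      contraction it sends the moved vector back near \<xi>, and the norm cannot drop. The phase
      \<open>u\<close> is arbitrary.\<close>
    have re: "Re (u * pairing w' \<xi>) \<le> \<epsilon>" if u: "cmod u = 1" for u
    proof -
      define v where "v = (\<lambda>x. (- u) * w' x)"
      have vV: "v \<in> V" unfolding v_def by (intro V_scale w'V)
      have Nv: "N v \<le> 2 * K" using N_scale[OF w'V, of "- u"] u Nw' by (simp add: v_def)
      define \<zeta> where "\<zeta> = (\<lambda>x. \<xi> x + of_real \<tau> * v x)"
      have \<tau>v: "(\<lambda>x. of_real \<tau> * v x) \<in> V" by (intro V_scale vV)
      have \<zeta>V: "\<zeta> \<in> V" unfolding \<zeta>_def by (intro V_add V \<tau>v)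
      define c where "c = - of_real \<tau> * u"
      have cv: "(\<lambda>x. of_real \<tau> * v x) = (\<lambda>x. c * w' x)" by (simp add: v_def c_def mult.assoc)
      have "AE x in M. T e' \<zeta> x = T e' \<xi> x + c * T e' w' x"
        using T_fun_add[OF V(1) \<tau>v, of e'] T_fun_scale[OF w'V, of e' c] unfolding \<zeta>_def cv
        by (auto elim!: AE_mp)
      then have "AE x in M. \<xi> x = T e' \<zeta> x - ((T e' \<xi> x - \<xi> x) + c * T e' w' x)"
        by (auto elim!: AE_mp)
      then have "N \<xi> = N (\<lambda>x. T e' \<zeta> x - ((T e' \<xi> x - \<xi> x) + c * T e' w' x))"
        by (intro N_cong_AE V V_diff V_add V_scale T_V w'V \<zeta>V) auto
      also have "\<dots> \<le> N (T e' \<zeta>) + N (\<lambda>x. (T e' \<xi> x - \<xi> x) + c * T e' w' x)"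
        by (intro N_triangle_diff V V_diff V_add V_scale T_V w'V \<zeta>V)
      also have "N (\<lambda>x. (T e' \<xi> x - \<xi> x) + c * T e' w' x) \<le> N (\<lambda>x. T e' \<xi> x - \<xi> x) + N (\<lambda>x. c * T e' w' x)"
        by (intro N_triangle V V_diff V_scale T_V w'V)
      also have "N (\<lambda>x. c * T e' w' x) = \<tau> * N (T e' w')"
        using N_scale[OF T_V[OF w'V, of e'], of c] u \<tau> by (simp add: c_def norm_mult)
      also have "\<tau> * N (T e' w') \<le> 1 * (\<eta> * K)" using Tw' \<tau> N_nonneg by (intro mult_mono) auto
      also have "N (T e' \<zeta>) \<le> 1 * N \<zeta>"
        using e N_nonneg by (intro order_trans[OF T_bound[OF \<zeta>V]] mult_right_mono) auto
      finally have "N \<xi> \<le> N \<zeta> + \<eta> * (1 + K)" using e\<xi> by (simp add: algebra_simps)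
      then have 1: "N \<xi> powr p \<le> N \<zeta> powr p + p * K powr (p - 1) * (\<eta> * (1 + K))"
        using N_nonneg K \<eta> NK p_gt_1 by (intro powr_diff_le) auto
      have pr: "pairing v \<xi> = - (u * pairing w' \<xi>)" unfolding v_def pairing_scale by simp
      have 2: "N \<zeta> powr p - N \<xi> powr p + p * \<tau> * Re (u * pairing w' \<xi>) \<le> \<epsilon>' * \<tau> * (N \<xi> powr p + N v powr p)"
        using abs_le_D1[OF ex[OF \<tau>(1,2) V(1) vV]] unfolding \<zeta>_def pr
        by (simp only: uminus_complex.sel mult_minus_right diff_minus_eq_add)
      have "N \<xi> powr p + N v powr p \<le> K powr p + (2 * K) powr p"
        using N_nonneg NK Nv p_gt_1 by (intro add_mono powr_mono2) auto
      then have 3: "\<epsilon>' * \<tau> * (N \<xi> powr p + N v powr p) \<le> \<epsilon>' * \<tau> * (K powr p + (2 * K) powr p)"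
        using \<epsilon>' \<tau> by (intro mult_left_mono) auto
      have "p * \<tau> * Re (u * pairing w' \<xi>) \<le> \<epsilon>' * \<tau> * C"
        using 1 2 3 by (simp add: C_def \<eta>_def algebra_simps)
      also have "\<dots> = p * \<tau> * \<epsilon>" using C by (simp add: \<epsilon>'_def)
      finally show ?thesis using p_gt_1 \<tau> by (simp add: mult_le_cancel_left)
    qed
    show ?thesis
    proof (cases "pairing w' \<xi> = 0")
      case True
      then show ?thesis using \<epsilon> by (simp add: w'_def)
    next
      case False
      have "cmod (cnj (sgn (pairing w' \<xi>))) = 1" using False by (simp add: norm_sgn)
      from re[OF this] have "Re (cnj (sgn (pairing w' \<xi>)) * pairing w' \<xi>) \<le> \<epsilon>" .
      moreover have "cnj (sgn z) * z = of_real (cmod z)" for z :: complex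
        using mult_duality[of 2 z] by (cases "z = 0") (simp_all add: sgn_eq duality_def power2_eq_square mult.commute)
      ultimately show ?thesis by (simp add: w'_def)
    qed
  qed
  then show ?thesis using \<eta> by blast
qed

text \<open>Applied to a vector, \<open>a c\<close> gives a \<xi> almost fixed by \<open>e'\<close>
  and \<open>b\<close> gives a \<open>w\<close>; by near orthogonality the first-order term in the
  expansion of the norm disappears. The factor \<open>c\<close> allows the estimate to be read as a
  bound for a multiplier norm. What is said here about the algebra alone suffices for the study of
  the bidual.\<close>

lemma smooth_approx_unit:
  assumes \<epsilon>: "0 < \<epsilon>"
  shows "\<exists>\<tau>>0. \<exists>\<eta>>0. \<forall>(a::'a) e e'. norm a \<le> 1 \<and> norm e \<le> 1 \<and> norm e' \<le> 1 \<and> norm (e' * a - a) \<le> \<eta> \<and> norm (e' - e' * e) \<le> \<eta>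
    \<longrightarrow> (\<forall>b c. norm b \<le> 1 \<and> norm c \<le> 1 \<longrightarrow> norm (a * c + \<tau> *\<^sub>R (b - e * b)) \<le> 1 + \<epsilon> * \<tau>)"
proof -
  define C where "C = p + 1 + 2 powr p"
  have C: "0 < C" using p_gt_1 by (simp add: C_def add_pos_nonneg)
  define \<epsilon>' where "\<epsilon>' = \<epsilon> / C"
  have \<epsilon>': "0 < \<epsilon>'" using \<epsilon> C by (simp add: \<epsilon>'_def)
  obtain \<tau> where \<tau>: "\<tau> > 0" and ex0: "\<And>\<tau>' \<xi> w. 0 < \<tau>' \<Longrightarrow> \<tau>' \<le> \<tau> \<Longrightarrow> \<xi> \<in> V \<Longrightarrow> w \<in> V \<Longrightarrow>
    \<bar>N (\<lambda>x. \<xi> x + of_real \<tau>' * w x) powr p - N \<xi> powr p - p * \<tau>' * Re (pairing w \<xi>)\<bar>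
      \<le> \<epsilon>' * \<tau>' * (N \<xi> powr p + N w powr p)"
    using N_expansion[OF \<epsilon>'] by blast
  note ex = ex0[OF \<tau> order_refl]
  obtain \<eta> where \<eta>: "\<eta> > 0" and pr: "\<And>\<xi> w e e'. \<xi> \<in> V \<Longrightarrow> w \<in> V \<Longrightarrow> N \<xi> \<le> 1 \<Longrightarrow> N w \<le> 1 \<Longrightarrow> norm e \<le> 1 \<Longrightarrow>
    norm e' \<le> 1 \<Longrightarrow> norm (e' - e' * e) \<le> \<eta> \<Longrightarrow> N (\<lambda>x. T e' \<xi> x - \<xi> x) \<le> \<eta>
    \<Longrightarrow> cmod (pairing (\<lambda>x. w x - T e w x) \<xi>) \<le> \<epsilon>'"
    using pairing_approx_unit[OF zero_less_one \<epsilon>'] by blast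
  have "norm (a * c + \<tau> *\<^sub>R (b - e * b)) \<le> 1 + \<epsilon> * \<tau>"
    if a: "norm a \<le> 1" and e: "norm e \<le> 1" "norm e' \<le> 1" and ea: "norm (e' * a - a) \<le> \<eta>"
      and ee: "norm (e' - e' * e) \<le> \<eta>" and b: "norm b \<le> 1" and c: "norm c \<le> 1" for a e e' b c :: 'a
  proof (rule T_norm_le)
    fix \<zeta> assume \<zeta>: "\<zeta> \<in> V" "N \<zeta> \<le> 1"
    have small: "N (T d \<zeta>) \<le> r" if "norm d \<le> r" for d r
    proof -
      have "N (T d \<zeta>) \<le> r * 1"
        using \<zeta> N_nonneg that order_trans[OF norm_ge_zero that]
        by (intro order_trans[OF T_bound] mult_mono) auto
      then show ?thesis by simp
    qed
    have ac: "norm (a * c) \<le> 1" using norm_mult_ineq[of a c] a c mult_le_one[of "norm a" "norm c"] by simp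
    define \<xi> w where "\<xi> = T (a * c) \<zeta>" and "w = T b \<zeta>"
    have V: "\<xi> \<in> V" "w \<in> V" by (auto simp: \<xi>_def w_def intro: T_V \<zeta>)
    have N1: "N \<xi> \<le> 1" "N w \<le> 1" unfolding \<xi>_def w_def using ac b by (auto intro: small)
    have "norm ((e' * a - a) * c) \<le> \<eta> * 1"
      using ea c \<eta> by (intro order_trans[OF norm_mult_ineq] mult_mono) auto
    moreover have "AE x in M. T e' \<xi> x - \<xi> x = T ((e' * a - a) * c) \<zeta> x"
      using T_mult[OF \<zeta>(1), of e' "a * c"] T_diff[OF \<zeta>(1), of "e' * (a * c)" "a * c"]
      by (auto simp: \<xi>_def left_diff_distrib mult.assoc elim!: AE_mp)
    then have "N (\<lambda>x. T e' \<xi> x - \<xi> x) = N (T ((e' * a - a) * c) \<zeta>)"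
      by (intro N_cong_AE V_diff T_V V \<zeta>)
    ultimately have "N (\<lambda>x. T e' \<xi> x - \<xi> x) \<le> \<eta>" using small[of "(e' * a - a) * c" \<eta>] by simp
    from pr[OF V N1 e ee this] have P: "cmod (pairing (\<lambda>x. w x - T e w x) \<xi>) \<le> \<epsilon>'" .
    define w' where "w' = (\<lambda>x. w x - T e w x)"
    have w'V: "w' \<in> V" unfolding w'_def by (intro V_diff V T_V)
    have "N (T e w) \<le> 1 * 1" using e N1 N_nonneg by (intro order_trans[OF T_bound[OF V(2)]] mult_mono) auto
    then have Nw': "N w' \<le> 2" using N_triangle_diff(1)[OF V(2) T_V[OF V(2)], of e] N1 by (simp add: w'_def)
    have "AE x in M. T (a * c + \<tau> *\<^sub>R (b - e * b)) \<zeta> x = \<xi> x + of_real \<tau> * w' x"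
      using T_add[OF \<zeta>(1), of "a * c" "\<tau> *\<^sub>R (b - e * b)"] T_scale[OF \<zeta>(1), of "of_real \<tau>" "b - e * b"]
        T_diff[OF \<zeta>(1), of b "e * b"] T_mult[OF \<zeta>(1), of e b]
      by (auto simp: \<xi>_def w'_def w_def scaleR_scaleC elim!: AE_mp)
    then have "N (T (a * c + \<tau> *\<^sub>R (b - e * b)) \<zeta>) = N (\<lambda>x. \<xi> x + of_real \<tau> * w' x)"
      by (intro N_cong_AE V_add V_scale T_V V \<zeta> w'V)
    also have "\<dots> \<le> 1 + \<epsilon> * \<tau>"
    proof -
      have "N (\<lambda>x. \<xi> x + of_real \<tau> * w' x) powr p
          \<le> N \<xi> powr p + p * \<tau> * Re (pairing w' \<xi>) + \<epsilon>' * \<tau> * (N \<xi> powr p + N w' powr p)"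
        using abs_le_D1[OF ex[OF V(1) w'V]] by linarith
      also have "\<dots> \<le> 1 powr p + p * \<tau> * \<epsilon>' + \<epsilon>' * \<tau> * (1 powr p + 2 powr p)"
        using N1 Nw' N_nonneg p_gt_1 \<tau> \<epsilon>' P complex_Re_le_cmod[of "pairing w' \<xi>"]
        by (intro add_mono mult_left_mono powr_mono2) (auto simp: w'_def)
      also have "\<dots> = 1 + (\<epsilon>' * C) * \<tau>" by (simp add: C_def algebra_simps)
      also have "\<epsilon>' * C = \<epsilon>" using C by (simp add: \<epsilon>'_def)
      also have "1 + \<epsilon> * \<tau> \<le> (1 + \<epsilon> * \<tau>) powr p"
        using powr_mono[of 1 p "1 + \<epsilon> * \<tau>"] p_gt_1 \<epsilon> \<tau> by simp
      finally show ?thesis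
        using p_gt_1 \<epsilon> \<tau> N_nonneg powr_less_mono2[of p "1 + \<epsilon> * \<tau>" "N (\<lambda>x. \<xi> x + of_real \<tau> * w' x)"]
        by (smt (verit) mult_nonneg_nonneg)
    qed
    finally show "N (T (a * c + \<tau> *\<^sub>R (b - e * b)) \<zeta>) \<le> 1 + \<epsilon> * \<tau>" .
  qed (use \<epsilon> \<tau> in simp)
  then show ?thesis using \<tau> \<eta> by blast
qed

end

section \<open>Operators on classes as an action on functions\<close>

context Lp_setting
begin

abbreviation "cls \<equiv> Lp_class p M"

lemma cls_iff: "g \<in> cls f \<longleftrightarrow> g \<in> V \<and> (AE x in M. g x = f x)"
  by (auto simp: Lp_class_def)

lemma cls_eq_iff:
  assumes "f \<in> V" "g \<in> V"
  shows "cls f = cls g \<longleftrightarrow> (AE x in M. f x = g x)"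
proof
  assume "cls f = cls g"
  then have "f \<in> cls g" using assms cls_iff[of f f] by simp
  then show "AE x in M. f x = g x" by (simp add: cls_iff)
next
  assume "AE x in M. f x = g x"
  then show "cls f = cls g" unfolding Lp_class_def by (intro Collect_cong conj_cong refl) (auto elim: AE_mp)
qed

lemma cls_in_space: "f \<in> V \<Longrightarrow> cls f \<in> Lp_space p M"
  by (simp add: Lp_space_def)

lemma Lp_norm_cls:
  assumes f: "f \<in> V"
  shows "Lp_norm p M (cls f) = N f"
  unfolding Lp_norm_def
proof (rule the_equality)
  have "f \<in> cls f" using f by (simp add: cls_iff)
  then show "\<exists>g\<in>cls f. N f = (LINT x|M. cmod (g x) powr p) powr (1 / p)"
    by (auto simp: Lp_seminorm_def)
next
  fix r assume "\<exists>g\<in>cls f. r = (LINT x|M. cmod (g x) powr p) powr (1 / p)"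
  then obtain g where "g \<in> cls f" "r = N g" by (auto simp: Lp_seminorm_def)
  then show "r = N f" using f N_cong_AE[of g f] by (auto simp: cls_iff)
qed

lemma Lp_add_cls:
  assumes f: "f \<in> V" and g: "g \<in> V"
  shows "Lp_add p M (cls f) (cls g) = cls (\<lambda>x. f x + g x)"
proof -
  have "(\<exists>f'\<in>cls f. \<exists>g'\<in>cls g. AE x in M. h x = f' x + g' x) \<longleftrightarrow> (AE x in M. h x = f x + g x)" for h
  proof
    assume "\<exists>f'\<in>cls f. \<exists>g'\<in>cls g. AE x in M. h x = f' x + g' x"
    then obtain f' g' where *: "AE x in M. f' x = f x" "AE x in M. g' x = g x" "AE x in M. h x = f' x + g' x"
      by (auto simp: cls_iff)
    then show "AE x in M. h x = f x + g x" by (auto elim: AE_mp)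
  next
    assume "AE x in M. h x = f x + g x"
    then show "\<exists>f'\<in>cls f. \<exists>g'\<in>cls g. AE x in M. h x = f' x + g' x"
      using f g by (intro bexI[of _ f] bexI[of _ g]) (auto simp: cls_iff)
  qed
  then show ?thesis unfolding Lp_add_def by (simp add: Lp_class_def)
qed

lemma Lp_scale_cls:
  assumes f: "f \<in> V"
  shows "Lp_scale p M c (cls f) = cls (\<lambda>x. c * f x)"
proof -
  have "(\<exists>f'\<in>cls f. AE x in M. h x = c * f' x) \<longleftrightarrow> (AE x in M. h x = c * f x)" for h
  proof
    assume "\<exists>f'\<in>cls f. AE x in M. h x = c * f' x"
    then obtain f' where *: "AE x in M. f' x = f x" "AE x in M. h x = c * f' x"
      by (auto simp: cls_iff)
    then show "AE x in M. h x = c * f x" by (auto elim: AE_mp)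
  next
    assume "AE x in M. h x = c * f x"
    then show "\<exists>f'\<in>cls f. AE x in M. h x = c * f' x"
      using f by (intro bexI[of _ f]) (auto simp: cls_iff)
  qed
  then show ?thesis unfolding Lp_scale_def by (simp add: Lp_class_def)
qed

end

text \<open>Choosing a representative of each image class turns operator identities into identities
  almost everywhere.\<close>

lemma Lp_operator_algebra_action:
  fixes M :: "'x measure"
  assumes p: "1 < p" and A: "Lp_operator_algebra p M TYPE('a::complex_banach_algebra)"
  obtains T :: "'a::complex_banach_algebra \<Rightarrow> ('x \<Rightarrow> complex) \<Rightarrow> ('x \<Rightarrow> complex)" where "Lp_action p M T"
proof -
  interpret Lp_setting p M by standard (rule p)
  obtain B and \<pi> :: "'a::complex_banach_algebra \<Rightarrow> 'x Lp_map" where B: "closed_operator_subalgebra p M B" "bij_betw \<pi> UNIV B"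
    and add: "\<And>a b. \<pi> (a + b) = op_add p M (\<pi> a) (\<pi> b)"
    and scale: "\<And>c a. \<pi> (c *\<^sub>C a) = op_scale p M c (\<pi> a)"
    and mult: "\<And>a b. \<pi> (a * b) = op_mult p M (\<pi> a) (\<pi> b)"
    and nrm: "\<And>a. op_norm p M (\<pi> a) = norm a"
    using A unfolding Lp_operator_algebra_def by blast
  have op: "\<pi> a \<in> Lp_operators p M" for a
    using B by (auto simp: closed_operator_subalgebra_def bij_betw_def)
  define T where "T a f = (SOME g. g \<in> \<pi> a (cls f))" for a f
  have T: "T a f \<in> V" "cls (T a f) = \<pi> a (cls f)" if f: "f \<in> V" for a f
  proof -
    have "\<pi> a (cls f) \<in> Lp_space p M"
      using op[of a] cls_in_space[OF f] by (auto simp: Lp_operators_def)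
    then obtain g where g: "g \<in> V" "\<pi> a (cls f) = cls g" by (auto simp: Lp_space_def)
    then have "g \<in> \<pi> a (cls f)" by (simp add: cls_iff)
    then have "T a f \<in> \<pi> a (cls f)" unfolding T_def by (rule someI[of "\<lambda>g. g \<in> \<pi> a (cls f)"])
    then have *: "T a f \<in> V" "AE x in M. T a f x = g x" by (auto simp: g cls_iff)
    show "T a f \<in> V" by (rule *)
    show "cls (T a f) = \<pi> a (cls f)" using * g cls_eq_iff by simp
  qed
  have nT: "Lp_norm p M (\<pi> a (cls f)) = N (T a f)" if "f \<in> V" for a f
    using Lp_norm_cls[OF T(1)[OF that], of a] T(2)[OF that, of a] by simp
  have bound: "N (T a f) \<le> norm a * N f" and bdd: "bdd_above ((\<lambda>u. Lp_norm p M (\<pi> a u)) ` {u \<in> Lp_space p M. Lp_norm p M u \<le> 1})"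
    if f: "f \<in> V" for a f
  proof -
    obtain K where K: "\<And>u. u \<in> Lp_space p M \<Longrightarrow> Lp_norm p M (\<pi> a u) \<le> K * Lp_norm p M u"
      using op[of a] unfolding Lp_operators_def by blast
    have KN: "N (T a g) \<le> K * N g" if "g \<in> V" for g
      using K[OF cls_in_space[OF that]] by (simp add: Lp_norm_cls nT that)
    show bdd: "bdd_above ((\<lambda>u. Lp_norm p M (\<pi> a u)) ` {u \<in> Lp_space p M. Lp_norm p M u \<le> 1})"
    proof (rule bdd_aboveI2)
      fix u assume u: "u \<in> {u \<in> Lp_space p M. Lp_norm p M u \<le> 1}"
      then obtain g where g: "g \<in> V" "u = cls g" by (auto simp: Lp_space_def)
      have "K * N g \<le> \<bar>K\<bar> * 1" using u g N_nonneg[of g] by (intro mult_mono) (auto simp: Lp_norm_cls)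
      then show "Lp_norm p M (\<pi> a u) \<le> \<bar>K\<bar>" using K[of u] u g by (simp add: Lp_norm_cls)
    qed
    show "N (T a f) \<le> norm a * N f"
    \<comment> \<open>The supremum over the unit ball bounds the image only after \<open>f\<close>
      has been normalised; for a null vector the a priori bound of the operator gives 0.\<close>
    proof (cases "N f = 0")
      case True
      then show ?thesis using KN[OF f] by simp
    next
      case False
      then have Nf: "0 < N f" using N_nonneg[of f] by simp
      define g where "g = (\<lambda>x. of_real (1 / N f) * f x)"
      have g: "g \<in> V" "N g = 1" using f Nf unfolding g_def by (simp_all only: V_scale N_scale) (simp add: norm_divide)
      have "Lp_norm p M (\<pi> a (cls g)) \<le> op_norm p M (\<pi> a)"
        unfolding op_norm_def using g by (intro cSUP_upper bdd) (simp add: Lp_norm_cls cls_in_space)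
      then have 1: "N (T a g) \<le> norm a" by (simp add: nrm nT g)
      have "\<pi> a (Lp_scale p M (of_real (1 / N f)) (cls f)) = Lp_scale p M (of_real (1 / N f)) (\<pi> a (cls f))"
        using op[of a] cls_in_space[OF f] by (simp add: Lp_operators_def)
      then have "cls (T a g) = cls (\<lambda>x. of_real (1 / N f) * T a f x)"
        unfolding T(2)[OF f, symmetric] Lp_scale_cls[OF f] Lp_scale_cls[OF T(1)[OF f]] g_def[symmetric] T(2)[OF g(1), symmetric] .
      then have "N (T a g) = N (\<lambda>x. of_real (1 / N f) * T a f x)"
        using Lp_norm_cls[OF T(1)[OF g(1)], of a] Lp_norm_cls[OF V_scale[OF T(1)[OF f]], of "of_real (1 / N f)" a] by simp
      then have "N (T a g) = N (T a f) / N f" using Nf unfolding N_scale[OF T(1)[OF f]] by (simp add: norm_divide)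
      with 1 show ?thesis using Nf by (simp add: field_simps)
    qed
  qed
  have "Lp_action p M T"
  proof unfold_locales
    fix f a assume f: "f \<in> V"
    show "T a f \<in> V" by (rule T[OF f])
    show "N (T a f) \<le> norm a * N f" by (rule bound[OF f])
    show "AE x in M. T (a + b) f x = T a f x + T b f x" for b
      using T[OF f] cls_in_space[OF f]
      by (subst cls_eq_iff[symmetric]) (auto simp: V_add add op_add_def Lp_add_cls[symmetric])
    show "AE x in M. T (c *\<^sub>C a) f x = c * T a f x" for c
      using T[OF f] cls_in_space[OF f]
      by (subst cls_eq_iff[symmetric]) (auto simp: V_scale scale op_scale_def Lp_scale_cls[symmetric])
    show "AE x in M. T (a * b) f x = T a (T b f) x" for b
      using T[OF f] T[OF T(1)[OF f]] cls_in_space[OF f]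
      by (subst cls_eq_iff[symmetric]) (auto simp: mult op_mult_def compose_def)
    show "AE x in M. T a (\<lambda>x. c * f x) x = c * T a f x" for c
      using T[OF f] T[OF V_scale[OF f]] cls_in_space[OF f] op[of a]
      by (subst cls_eq_iff[symmetric]) (auto simp: V_scale Lp_operators_def Lp_scale_cls[symmetric] f)
    show "AE x in M. T a (\<lambda>x. f x + g x) x = T a f x + T a g x" if g: "g \<in> V" for g
      using T[OF f] T[OF g] T[OF V_add[OF f g]] cls_in_space[OF f] cls_in_space[OF g] op[of a]
      by (subst cls_eq_iff[symmetric]) (auto simp: V_add Lp_operators_def Lp_add_cls[symmetric] f g)
  next
    fix r and a :: "'a::complex_banach_algebra" assume "r < norm a"
    then have "r < (SUP u\<in>{u \<in> Lp_space p M. Lp_norm p M u \<le> 1}. Lp_norm p M (\<pi> a u))"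
      by (simp add: op_norm_def flip: nrm)
    moreover have "cls (\<lambda>x. 0) \<in> {u \<in> Lp_space p M. Lp_norm p M u \<le> 1}"
      using V_zero by (simp add: cls_in_space Lp_norm_cls Lp_seminorm_def)
    ultimately obtain u where u: "u \<in> Lp_space p M" "Lp_norm p M u \<le> 1" "r < Lp_norm p M (\<pi> a u)"
      using less_cSUP_iff[OF _ bdd[OF V_zero]] by blast
    then obtain f where f: "f \<in> V" "u = cls f" by (auto simp: Lp_space_def)
    show "\<exists>f\<in>V. N f \<le> 1 \<and> r < N (T a f)"
      using u f by (intro bexI[of _ f]) (auto simp: Lp_norm_cls nT)
  qed
  then show thesis by (rule that)
qed

section \<open>Functionals, states and weak* density\<close>

lemma scaleC_one [simp]: "1 *\<^sub>C x = (x::'a::complex_vector)"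
  using scaleR_scaleC[of 1 x] by simp

lemma scaleC_zero_left [simp]: "0 *\<^sub>C x = (0::'a::complex_vector)"
  using scaleR_scaleC[of 0 x] by simp

lemma scaleC_zero_right [simp]: "c *\<^sub>C 0 = (0::'a::complex_vector)"
  using scaleC_add_right[of c 0 0] by simp

lemma scaleC_minus_right [simp]: "c *\<^sub>C (- x) = - (c *\<^sub>C (x::'a::complex_vector))"
  using scaleC_add_right[of c x "- x"] by (simp add: eq_neg_iff_add_eq_0 add.commute)

lemma scaleC_minus_left [simp]: "(- c) *\<^sub>C x = - (c *\<^sub>C (x::'a::complex_vector))"
  using scaleC_add_left[of c "- c" x] by (simp add: eq_neg_iff_add_eq_0 add.commute)

lemma scaleC_diff_right: "c *\<^sub>C (x - y) = c *\<^sub>C x - c *\<^sub>C (y::'a::complex_vector)"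
  using scaleC_add_right[of c x "- y"] by simp

lemma scaleC_diff_left: "(c - d) *\<^sub>C x = c *\<^sub>C x - d *\<^sub>C (x::'a::complex_vector)"
  using scaleC_add_left[of c "- d" x] by simp

lemma scaleC_of_real: "complex_of_real r *\<^sub>C x = r *\<^sub>R (x::'a::complex_vector)"
  by (simp add: scaleR_scaleC)

lemma scaleR_scaleC_commute: "r *\<^sub>R (c *\<^sub>C x) = c *\<^sub>C (r *\<^sub>R (x::'a::complex_vector))"
  by (simp add: scaleR_scaleC scaleC_scaleC mult.commute)

lemma clinearD:
  assumes "clinear F"
  shows "F (x + y) = F x + F y" "F (c *\<^sub>C x) = c * F x" "F (r *\<^sub>R x) = of_real r * F x"
    "F 0 = 0" "F (- x) = - F x" "F (x - y) = F x - F y"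
proof -
  show add: "F (x + y) = F x + F y" and sc: "F (c *\<^sub>C x) = c * F x" for x y c
    using assms by (auto simp: clinear_def)
  show "F (r *\<^sub>R x) = of_real r * F x" by (simp add: scaleR_scaleC sc)
  show "F 0 = 0" using sc[of 0 0] by simp
  show m: "F (- x) = - F x" for x using sc[of "-1" x] by simp
  show "F (x - y) = F x - F y" using add[of x "- y"] m[of y] by simp
qed

text \<open>A predicate rather than a class, since one space carries several seminorms: the
  multiplier norm, multiples of the norm, and finite sums of evaluations.\<close>

definition cseminorm :: "('v::complex_vector \<Rightarrow> real) \<Rightarrow> bool"
  where "cseminorm \<nu> \<longleftrightarrow> (\<forall>x y. \<nu> (x + y) \<le> \<nu> x + \<nu> y) \<and> (\<forall>c x. \<nu> (c *\<^sub>C x) = cmod c * \<nu> x)"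

lemma cseminormD:
  assumes "cseminorm \<nu>"
  shows "\<nu> (x + y) \<le> \<nu> x + \<nu> y" "\<nu> (c *\<^sub>C x) = cmod c * \<nu> x" "\<nu> (r *\<^sub>R x) = \<bar>r\<bar> * \<nu> x"
    "\<nu> 0 = 0" "\<nu> (- x) = \<nu> x" "0 \<le> \<nu> x" "\<nu> (x - y) \<le> \<nu> x + \<nu> y" "\<nu> x \<le> \<nu> y + \<nu> (x - y)"
proof -
  show add: "\<nu> (x + y) \<le> \<nu> x + \<nu> y" and sc: "\<nu> (c *\<^sub>C x) = cmod c * \<nu> x" for x y c
    using assms by (auto simp: cseminorm_def)
  show "\<nu> (r *\<^sub>R x) = \<bar>r\<bar> * \<nu> x" by (simp add: scaleR_scaleC sc)
  show z: "\<nu> 0 = 0" using sc[of 0 0] by simp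
  show m: "\<nu> (- x) = \<nu> x" for x using sc[of "-1" x] by simp
  show "0 \<le> \<nu> x" using add[of x "- x"] z m by simp
  show "\<nu> (x - y) \<le> \<nu> x + \<nu> y" using add[of x "- y"] m by simp
  show "\<nu> x \<le> \<nu> y + \<nu> (x - y)" using add[of y "x - y"] by simp
qed

lemma cseminorm_norm: "cseminorm (norm :: 'a::complex_normed_vector \<Rightarrow> real)"
  by (simp add: cseminorm_def norm_scaleC norm_triangle_ineq)

lemma cseminorm_sublinear: "cseminorm \<nu> \<Longrightarrow> sublinear \<nu>"
  by (rule sublinearI) (simp_all add: cseminormD)

lemma cnj_sgn_mult: "cnj (sgn z) * z = of_real (cmod z)"
  using mult_duality[of 2 z] by (cases "z = 0") (simp_all add: sgn_eq duality_def power2_eq_square mult.commute)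

text \<open>Multiplying \<open>x\<close> by a unimodular number makes \<open>F x\<close> equal to
  its modulus without changing the seminorm.\<close>

lemma clinear_phase:
  assumes "clinear F" "\<And>x. Re (F x) \<le> \<nu> x" "cseminorm \<nu>"
  shows "cmod (F x) \<le> \<nu> x"
proof (cases "F x = 0")
  case False
  have "cmod (F x) = Re (F (cnj (sgn (F x)) *\<^sub>C x))"
    by (simp add: clinearD(2)[OF assms(1)] cnj_sgn_mult)
  also have "\<dots> \<le> \<nu> (cnj (sgn (F x)) *\<^sub>C x)" by (rule assms)
  also have "\<dots> = \<nu> x" using False by (simp add: cseminormD(2)[OF assms(3)] norm_sgn)
  finally show ?thesis .
qed (simp add: cseminormD(6)[OF assms(3)])

lemma complexification:
  fixes L :: "'v::complex_vector \<Rightarrow> real"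
  assumes L: "linear L"
  obtains F where "clinear F" "\<And>x. Re (F x) = L x"
proof -
  define F where "F x = Complex (L x) (- L (\<i> *\<^sub>C x))" for x
  have "clinear F"
    unfolding clinear_def
  proof (intro conjI allI)
    fix x y show "F (x + y) = F x + F y"
      by (simp add: F_def scaleC_add_right linear_add[OF L] complex_eq_iff)
  next
    fix c and x :: 'v
    have c: "c *\<^sub>C x = Re c *\<^sub>R x + Im c *\<^sub>R (\<i> *\<^sub>C x)"
      unfolding scaleR_scaleC scaleC_scaleC scaleC_add_left[symmetric]
      by (rule arg_cong[of _ _ "\<lambda>c. c *\<^sub>C x"]) (simp add: complex_eq_iff)
    have ic: "\<i> *\<^sub>C (c *\<^sub>C x) = Re c *\<^sub>R (\<i> *\<^sub>C x) - Im c *\<^sub>R x"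
      unfolding scaleR_scaleC scaleC_scaleC scaleC_diff_left[symmetric]
      by (rule arg_cong[of _ _ "\<lambda>c. c *\<^sub>C x"]) (simp add: complex_eq_iff)
    show "F (c *\<^sub>C x) = c * F x"
      unfolding F_def ic unfolding c
      by (simp add: linear_add[OF L] linear_diff[OF L] linear_scale[OF L] complex_eq_iff algebra_simps)
  qed
  then show thesis by (rule that) (simp add: F_def)
qed

theorem hahn_banach_complex:
  fixes \<nu> :: "'v::complex_vector \<Rightarrow> real"
  assumes "cseminorm \<nu>" "convex Y" "Y \<noteq> {}" "\<And>y. y \<in> Y \<Longrightarrow> d \<le> \<nu> y"
  obtains F where "clinear F" "\<And>x. cmod (F x) \<le> \<nu> x" "\<And>y. y \<in> Y \<Longrightarrow> d \<le> Re (F y)"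
proof -
  obtain L where L: "linear L" "\<And>x. L x \<le> \<nu> x" "\<And>y. y \<in> Y \<Longrightarrow> d \<le> L y"
    using hahn_banach_convex[OF cseminorm_sublinear[OF assms(1)] assms(2-4)] by metis
  obtain F where F: "clinear F" "\<And>x. Re (F x) = L x" using complexification[OF L(1)] by metis
  show thesis
    using L F by (intro that[of F] clinear_phase[OF F(1) _ assms(1)]) auto
qed

lemma cdual_clinear: "clinear (cdual_apply f)"
  using cdual_apply[of f] by auto

lemmas cdual_simps = clinearD[OF cdual_clinear]

lemma cdual_fun_simps:
  "cdual_apply (f + g) x = cdual_apply f x + cdual_apply g x"
  "cdual_apply (f - g) x = cdual_apply f x - cdual_apply g x"
  "cdual_apply (- f) x = - cdual_apply f x"
  "cdual_apply (c *\<^sub>C f) x = c * cdual_apply f x"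
  "cdual_apply (r *\<^sub>R f) x = of_real r * cdual_apply f x"
  "cdual_apply 0 x = 0"
  by (simp_all add: plus_cdual.rep_eq minus_cdual.rep_eq uminus_cdual.rep_eq scaleC_cdual.rep_eq
      scaleR_cdual.rep_eq zero_cdual.rep_eq scaleR_conv_of_real)

lemma cdual_eqI: "(\<And>x. cdual_apply f x = cdual_apply g x) \<Longrightarrow> f = g"
  using cdual_apply_inject by blast

lemma cdual_ex:
  fixes F :: "'a::complex_normed_vector \<Rightarrow> complex"
  assumes "clinear F" "\<And>x. cmod (F x) \<le> K * norm x"
  obtains f where "cdual_apply f = F"
proof -
  have "bounded_linear F"
    using assms(2) by (intro bounded_linear_intro[where K = K]) (simp_all add: clinearD[OF assms(1)] scaleR_conv_of_real mult.commute)
  then show thesis using assms(1) by (intro that[of "Abs_cdual F"]) (simp add: Abs_cdual_inverse)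
qed

lemma cdual_norm_le: "0 \<le> K \<Longrightarrow> (\<And>x. cmod (cdual_apply f x) \<le> K * norm x) \<Longrightarrow> norm f \<le> K"
  by (simp add: norm_cdual.rep_eq onorm_bound)

lemma cdual_norm_le_ball:
  fixes f :: "'a::complex_normed_vector cdual"
  assumes "\<And>x. norm x \<le> 1 \<Longrightarrow> Re (cdual_apply f x) \<le> K"
  shows "norm f \<le> K"
proof -
  have K: "0 \<le> K" using assms[of 0] by (simp add: cdual_simps)
  have s: "cseminorm (\<lambda>x::'a. K * norm x)"
    using K by (simp add: cseminorm_def norm_scaleC norm_triangle_ineq mult_left_mono flip: distrib_left)
  have "Re (cdual_apply f x) \<le> K * norm x" for x
  proof (cases "x = 0")
    case False
    have "Re (cdual_apply f ((1 / norm x) *\<^sub>R x)) \<le> K" by (rule assms) simp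
    then show ?thesis using False by (simp add: cdual_simps field_simps)
  qed (simp add: cdual_simps)
  then have "cmod (cdual_apply f x) \<le> K * norm x" for x
    by (rule clinear_phase[OF cdual_clinear _ s])
  then show ?thesis using K by (intro cdual_norm_le)
qed

lemma cdual_norm_attain:
  fixes f :: "'a::complex_normed_vector cdual"
  assumes "r < norm f"
  obtains a where "norm a \<le> 1" "r < Re (cdual_apply f a)"
  using cdual_norm_le_ball[of f r] assms by (meson not_le)

lemma norming_functional:
  fixes z :: "'a::complex_normed_vector"
  obtains f where "norm f \<le> 1" "cdual_apply f z = of_real (norm z)"
proof -
  obtain F where F: "clinear F" "\<And>x. cmod (F x) \<le> norm x" "norm z \<le> Re (F z)"
    using hahn_banach_complex[OF cseminorm_norm, of "{z}" "norm z"] by auto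
  obtain f where f: "cdual_apply f = F" using cdual_ex[OF F(1), of 1] F(2) by auto
  have "Re (F z) = norm z" using F(2)[of z] F(3) complex_Re_le_cmod[of "F z"] by linarith
  moreover have "Im (F z) = 0"
  proof -
    have "(Re (F z))\<^sup>2 + (Im (F z))\<^sup>2 \<le> (norm z)\<^sup>2"
      using power_mono[OF F(2)[of z], of 2] by (simp add: cmod_power2)
    then show ?thesis using \<open>Re (F z) = norm z\<close> by simp
  qed
  ultimately have "F z = of_real (norm z)" by (simp add: complex_eq_iff)
  moreover have "norm f \<le> 1" using F(2) by (intro cdual_norm_le) (auto simp: f)
  ultimately show thesis using f that by simp
qed

lemma canonical_embedding_apply [simp]: "cdual_apply (canonical_embedding a) f = cdual_apply f a"
  by (simp add: canonical_embedding.rep_eq)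

lemma norm_canonical_embedding: "norm (canonical_embedding a) = norm a"
proof (rule antisym)
  show "norm (canonical_embedding a) \<le> norm a"
    using cdual_apply_bound[of _ a] by (intro cdual_norm_le) (auto simp: mult.commute)
  obtain f where f: "norm f \<le> 1" "cdual_apply f a = of_real (norm a)" by (rule norming_functional)
  have "norm a \<le> norm (canonical_embedding a) * norm f"
    using cdual_apply_bound[of "canonical_embedding a" f] f by simp
  also have "\<dots> \<le> norm (canonical_embedding a) * 1" using f by (intro mult_left_mono) auto
  finally show "norm a \<le> norm (canonical_embedding a)" by simp
qed

lemma canonical_embedding_linear:
  "canonical_embedding (a + b) = canonical_embedding a + canonical_embedding b"
  "canonical_embedding (a - b) = canonical_embedding a - canonical_embedding b"
  "canonical_embedding (c *\<^sub>C a) = c *\<^sub>C canonical_embedding a"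
  "canonical_embedding (r *\<^sub>R a) = r *\<^sub>R canonical_embedding a"
  by (rule cdual_eqI, simp add: cdual_fun_simps cdual_simps)+

lemma weak_star_closure_Re_le:
  assumes m: "m \<in> weak_star closure_of S" and le: "\<And>s. s \<in> S \<Longrightarrow> Re (cdual_apply s f) \<le> c"
  shows "Re (cdual_apply m f) \<le> c"
proof (rule ccontr)
  assume "\<not> ?thesis"
  then have m': "c < Re (cdual_apply m f)" by simp
  have "open {g :: 'a \<Rightarrow> complex. c < Re (g f)}"
    by (intro open_Collect_less continuous_intros continuous_on_product_coordinates)
  then have "openin weak_star (cdual_apply -` {g. c < Re (g f)})"
    unfolding weak_star_def openin_pullback_topology by (auto intro!: exI[of _ "{g. c < Re (g f)}"])
  moreover have "m \<in> cdual_apply -` {g. c < Re (g f)}" using m' by simp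
  ultimately obtain s where "s \<in> S" "s \<in> cdual_apply -` {g. c < Re (g f)}"
    using m unfolding in_closure_of by (metis (no_types, lifting))
  then show False using le[of s] by simp
qed

text \<open>Induction on \<open>I\<close>. If some \<open>v\<close> is annihilated by the other
  evaluations and has value 1 at \<open>f\<close>, subtracting \<open>cdual_apply x f\<close> times
  \<open>v\<close> reduces to a functional determined by \<open>I\<close>; the coefficient of
  \<open>f\<close> is the complex number with real part \<open>L v\<close> and imaginary part
  \<open>- L (\<i> v)\<close>. Otherwise the condition at \<open>f\<close> follows from the
  others.\<close>

lemma finite_functional_span:
  fixes L :: "'v::complex_normed_vector cdual \<Rightarrow> real"
  assumes "finite I" "linear L" "\<And>x. (\<And>f. f \<in> I \<Longrightarrow> cdual_apply x f = 0) \<Longrightarrow> L x = 0"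
  shows "\<exists>g. \<forall>x. L x = Re (cdual_apply x g)"
  using assms
proof (induction I arbitrary: L rule: finite_induct)
  case empty
  then show ?case by (intro exI[of _ 0]) (simp add: cdual_simps)
next
  case (insert f I)
  note L = insert.prems(1)
  show ?case
  proof (cases "\<exists>v. (\<forall>g\<in>I. cdual_apply v g = 0) \<and> cdual_apply v f \<noteq> 0")
    case True
    then obtain v0 where v0: "\<And>g. g \<in> I \<Longrightarrow> cdual_apply v0 g = 0" "cdual_apply v0 f \<noteq> 0" by blast
    define v where "v = inverse (cdual_apply v0 f) *\<^sub>C v0"
    have v: "\<And>g. g \<in> I \<Longrightarrow> cdual_apply v g = 0" "cdual_apply v f = 1"
      using v0 by (auto simp: v_def cdual_fun_simps)
    define L' where "L' x = L (x - cdual_apply x f *\<^sub>C v)" for x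
    have "linear L'"
    proof (rule linearI)
      fix x y :: "'v cdual" and r :: real
      have "x + y - cdual_apply (x + y) f *\<^sub>C v = (x - cdual_apply x f *\<^sub>C v) + (y - cdual_apply y f *\<^sub>C v)"
        by (simp add: cdual_fun_simps scaleC_add_left)
      then show "L' (x + y) = L' x + L' y" unfolding L'_def by (simp only: linear_add[OF L])
      have "r *\<^sub>R x - cdual_apply (r *\<^sub>R x) f *\<^sub>C v = r *\<^sub>R (x - cdual_apply x f *\<^sub>C v)"
        by (simp add: cdual_fun_simps scaleR_scaleC scaleC_scaleC scaleC_diff_right)
      then show "L' (r *\<^sub>R x) = r *\<^sub>R L' x" unfolding L'_def by (simp only: linear_scale[OF L])
    qed
    moreover have "L' x = 0" if "\<And>g. g \<in> I \<Longrightarrow> cdual_apply x g = 0" for x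
      unfolding L'_def using that v by (intro insert.prems(2)) (auto simp: cdual_fun_simps)
    ultimately obtain g' where g': "\<And>x. L' x = Re (cdual_apply x g')" using insert.IH by blast
    define \<kappa> where "\<kappa> = Complex (L v) (- L (\<i> *\<^sub>C v))"
    have "L x = Re (cdual_apply x (g' + \<kappa> *\<^sub>C f))" for x
    proof -
      define c where "c = cdual_apply x f"
      have "c *\<^sub>C v = Re c *\<^sub>R v + Im c *\<^sub>R (\<i> *\<^sub>C v)"
        unfolding scaleR_scaleC scaleC_scaleC scaleC_add_left[symmetric]
        by (rule arg_cong[of _ _ "\<lambda>c. c *\<^sub>C v"]) (simp add: complex_eq_iff)
      then have "L (c *\<^sub>C v) = Re (\<kappa> * c)" by (simp add: linear_add[OF L] linear_scale[OF L] \<kappa>_def)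
      moreover have "L x = L' x + L (c *\<^sub>C v)" by (simp add: L'_def c_def linear_diff[OF L])
      ultimately show ?thesis by (simp add: g' cdual_simps c_def)
    qed
    then show ?thesis by blast
  next
    case False
    then have "L x = 0" if "\<And>g. g \<in> I \<Longrightarrow> cdual_apply x g = 0" for x
      using that by (intro insert.prems(2)) auto
    then show ?thesis using insert.IH[OF L] by blast
  qed
qed

text \<open>A weak* neighbourhood of \<open>m\<close> restricts only finitely many coordinates, and
  the sum \<open>q\<close> of the moduli of these coordinates is at least some \<epsilon> on
  \<open>S - m\<close>. A Hahn-Banach functional dominated by \<open>q\<close> sees only these
  coordinates, so it is the evaluation at one vector, and this vector violates the
  hypothesis.\<close>

lemma weak_star_closure_separation:
  fixes S :: "'v::complex_normed_vector cdual set"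
  assumes S: "convex S" "S \<noteq> {}"
    and sep: "\<And>f c. (\<And>s. s \<in> S \<Longrightarrow> Re (cdual_apply s f) \<le> c) \<Longrightarrow> Re (cdual_apply m f) \<le> c"
  shows "m \<in> weak_star closure_of S"
proof (rule ccontr)
  assume "m \<notin> weak_star closure_of S"
  moreover have "topspace (weak_star :: 'v cdual topology) = UNIV"
    by (simp add: weak_star_def topspace_pullback_topology)
  ultimately obtain U where U: "openin weak_star U" "m \<in> U" "U \<inter> S = {}"
    unfolding in_closure_of by blast
  obtain W where W: "open W" "U = cdual_apply -` W"
    using U(1) unfolding weak_star_def openin_pullback_topology by auto
  have "openin (product_topology (\<lambda>i. euclidean) UNIV) W" using W(1) by (simp add: open_fun_def)
  moreover have "cdual_apply m \<in> W" using U W by auto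
  ultimately obtain X where X: "cdual_apply m \<in> (\<Pi>\<^sub>E i\<in>UNIV. X i)" "\<And>i. open (X i)"
    "finite {i. X i \<noteq> UNIV}" "(\<Pi>\<^sub>E i\<in>UNIV. X i) \<subseteq> W"
    using product_topology_open_contains_basis[of "\<lambda>i::'v. euclidean :: complex topology" UNIV W "cdual_apply m"]
    by auto
  define I where "I = {i. X i \<noteq> UNIV}"
  have "\<exists>\<epsilon>>0. \<forall>z. dist z (cdual_apply m i) < \<epsilon> \<longrightarrow> z \<in> X i" for i
    using X(1,2) by (auto simp: open_dist)
  then obtain \<epsilon>i where \<epsilon>i: "\<And>i. \<epsilon>i i > 0" "\<And>i z. dist z (cdual_apply m i) < \<epsilon>i i \<Longrightarrow> z \<in> X i" by metis
  define \<epsilon> where "\<epsilon> = Min (insert 1 (\<epsilon>i ` I))"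
  have fin: "finite I" using X(3) by (simp add: I_def)
  have \<epsilon>: "\<epsilon> > 0" "\<And>i. i \<in> I \<Longrightarrow> \<epsilon> \<le> \<epsilon>i i" using fin \<epsilon>i(1) by (auto simp: \<epsilon>_def)
  define q where "q x = (\<Sum>i\<in>I. cmod (cdual_apply x i))" for x :: "'v cdual"
  have q: "cseminorm q"
    unfolding cseminorm_def q_def cdual_fun_simps norm_mult sum.distrib[symmetric] sum_distrib_left[symmetric]
    by (intro conjI allI sum_mono norm_triangle_ineq refl)
  define Y where "Y = (\<lambda>s. s - m) ` S"
  have "convex Y" unfolding Y_def using convex_translation[OF S(1), of "- m"] by simp
  moreover have "Y \<noteq> {}" using S by (simp add: Y_def)
  moreover have "\<epsilon> \<le> q y" if y: "y \<in> Y" for y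
  proof (rule ccontr)
    assume "\<not> \<epsilon> \<le> q y"
    obtain s where s: "s \<in> S" "y = s - m" using y by (auto simp: Y_def)
    have "cdual_apply s i \<in> X i" for i
    proof (cases "i \<in> I")
      case True
      have "cmod (cdual_apply y i) \<le> q y"
        unfolding q_def using fin True by (intro member_le_sum) auto
      then have "dist (cdual_apply s i) (cdual_apply m i) < \<epsilon>i i"
        using \<open>\<not> \<epsilon> \<le> q y\<close> \<epsilon>(2)[OF True] by (simp add: s dist_norm cdual_fun_simps)
      then show ?thesis by (rule \<epsilon>i)
    qed (simp add: I_def)
    then have "cdual_apply s \<in> W" using X(4) by auto
    then show False using s(1) W U by auto
  qed
  ultimately obtain F where F: "clinear F" "\<And>x. cmod (F x) \<le> q x" "\<And>y. y \<in> Y \<Longrightarrow> \<epsilon> \<le> Re (F y)"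
    using hahn_banach_complex[OF q] by metis
  have "linear (\<lambda>x. Re (F x))" by (rule linearI) (simp_all add: clinearD[OF F(1)])
  moreover have "Re (F x) = 0" if "\<And>f. f \<in> I \<Longrightarrow> cdual_apply x f = 0" for x
    using F(2)[of x] that by (simp add: q_def)
  ultimately obtain g where g: "\<And>x. Re (F x) = Re (cdual_apply x g)"
    using finite_functional_span[OF fin, of "\<lambda>x. Re (F x)"] by blast
  have "Re (cdual_apply m (- g)) \<le> - Re (cdual_apply m g) - \<epsilon>"
  proof (rule sep)
    fix s assume "s \<in> S"
    then have "\<epsilon> \<le> Re (cdual_apply (s - m) g)" using F(3)[of "s - m"] g by (simp add: Y_def)
    then show "Re (cdual_apply s (- g)) \<le> - Re (cdual_apply m g) - \<epsilon>"
      by (simp add: cdual_fun_simps cdual_simps)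
  qed
  then show False using \<epsilon>(1) by (simp add: cdual_simps)
qed

lemma weak_star_dense_iff:
  assumes "convex S" "S \<noteq> {}"
  shows "weak_star_dense S T \<longleftrightarrow> S \<subseteq> T \<and>
    (\<forall>f c. (\<forall>s\<in>S. Re (cdual_apply s f) \<le> c) \<longrightarrow> (\<forall>m\<in>T. Re (cdual_apply m f) \<le> c))"
  unfolding weak_star_dense_def
proof (intro conj_cong refl iffI allI impI ballI subsetI)
  fix f c m assume "T \<subseteq> weak_star closure_of S" "\<forall>s\<in>S. Re (cdual_apply s f) \<le> c" "m \<in> T"
  then show "Re (cdual_apply m f) \<le> c" by (intro weak_star_closure_Re_le[of m S]) auto
next
  fix m assume *: "\<forall>f c. (\<forall>s\<in>S. Re (cdual_apply s f) \<le> c) \<longrightarrow> (\<forall>m\<in>T. Re (cdual_apply m f) \<le> c)" and "m \<in> T"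
  show "m \<in> weak_star closure_of S"
    by (rule weak_star_closure_separation[OF assms]) (use * \<open>m \<in> T\<close> in blast)
qed

text \<open>Replaces the supremum over the unit ball by a pointwise bound. The supremum is exactly 1
  because \<open>u\<close> lies in the ball; adding \<open>e\<close> to \<open>\<nu> x\<close>
  handles vectors of seminorm 0.\<close>

lemma is_state_iff:
  fixes \<nu> :: "'v::complex_vector \<Rightarrow> real"
  assumes \<nu>: "cseminorm \<nu>" "\<nu> u \<le> 1"
  shows "is_state \<nu> u \<omega> \<longleftrightarrow> clinear \<omega> \<and> (\<forall>x. cmod (\<omega> x) \<le> \<nu> x) \<and> \<omega> u = 1"
proof
  assume s: "is_state \<nu> u \<omega>"
  then have lin: "clinear \<omega>" and u: "\<omega> u = 1" and bdd: "bdd_above ((\<lambda>x. cmod (\<omega> x)) ` {x. \<nu> x \<le> 1})"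
    and sup: "(SUP x\<in>{x. \<nu> x \<le> 1}. cmod (\<omega> x)) = 1"
    by (auto simp: is_state_def has_functional_norm_def)
  have le: "cmod (\<omega> x) \<le> 1" if "\<nu> x \<le> 1" for x
    using cSUP_upper[OF _ bdd, of x] that sup by simp
  have "cmod (\<omega> x) \<le> \<nu> x" for x
  proof (rule field_le_epsilon)
    fix e :: real assume e: "0 < e"
    define k where "k = \<nu> x + e"
    have k: "0 < k" "\<nu> x \<le> k" using e cseminormD(6)[OF \<nu>(1), of x] by (auto simp: k_def)
    have "cmod (\<omega> ((1 / k) *\<^sub>R x)) \<le> 1"
      using k by (intro le) (simp add: cseminormD(3)[OF \<nu>(1)])
    then have "cmod (\<omega> x) \<le> k"
      using k by (simp add: clinearD[OF lin] norm_mult norm_divide)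
    then show "cmod (\<omega> x) \<le> \<nu> x + e" by (simp add: k_def)
  qed
  then show "clinear \<omega> \<and> (\<forall>x. cmod (\<omega> x) \<le> \<nu> x) \<and> \<omega> u = 1" using lin u by blast
next
  assume s: "clinear \<omega> \<and> (\<forall>x. cmod (\<omega> x) \<le> \<nu> x) \<and> \<omega> u = 1"
  have bdd: "bdd_above ((\<lambda>x. cmod (\<omega> x)) ` {x. \<nu> x \<le> 1})"
    using s by (intro bdd_aboveI2[where M = 1]) (auto intro: order_trans)
  have "(SUP x\<in>{x. \<nu> x \<le> 1}. cmod (\<omega> x)) = 1"
  proof (rule antisym)
    show "(SUP x\<in>{x. \<nu> x \<le> 1}. cmod (\<omega> x)) \<le> 1"
      using s \<nu> by (intro cSUP_least) (auto intro: order_trans)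
    show "1 \<le> (SUP x\<in>{x. \<nu> x \<le> 1}. cmod (\<omega> x))"
      using cSUP_upper[OF _ bdd, of u] s \<nu> by simp
  qed
  then show "is_state \<nu> u \<omega>" using s bdd by (simp add: is_state_def has_functional_norm_def)
qed

text \<open>The functional $x \mapsto \lim_{\tau \to 0+} (\nu(u + \tau x) - 1)/\tau$ is sublinear, and the
  linear functionals below it are the real parts of states.\<close>

lemma states_separation:
  fixes \<nu> :: "'v::complex_vector \<Rightarrow> real"
  assumes \<nu>: "cseminorm \<nu>" "\<nu> u = 1" and Y: "convex Y" "Y \<noteq> {}"
    and ge: "\<And>y \<tau>. y \<in> Y \<Longrightarrow> 0 < \<tau> \<Longrightarrow> 1 + \<tau> * c \<le> \<nu> (u + \<tau> *\<^sub>R y)"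
  obtains \<omega> where "is_state \<nu> u \<omega>" "\<And>y. y \<in> Y \<Longrightarrow> c \<le> Re (\<omega> y)"
proof -
  note \<nu>D = cseminormD[OF \<nu>(1)]
  define D where "D x \<tau> = (\<nu> (u + \<tau> *\<^sub>R x) - 1) / \<tau>" for x \<tau>
  define q where "q x = (INF \<tau>\<in>{0<..}. D x \<tau>)" for x
  have low: "- \<nu> x \<le> D x \<tau>" "D x \<tau> \<le> \<nu> x" if "0 < \<tau>" for x \<tau>
  proof -
    have "\<nu> u \<le> \<nu> (u + \<tau> *\<^sub>R x) + \<nu> (\<tau> *\<^sub>R x)" using \<nu>D(7)[of "u + \<tau> *\<^sub>R x" "\<tau> *\<^sub>R x"] by simp
    then show "- \<nu> x \<le> D x \<tau>" using that by (simp add: D_def \<nu>D(3) \<nu>(2) field_simps)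
    have "\<nu> (u + \<tau> *\<^sub>R x) \<le> \<nu> u + \<nu> (\<tau> *\<^sub>R x)" by (rule \<nu>D(1))
    then show "D x \<tau> \<le> \<nu> x" using that by (simp add: D_def \<nu>D(3) \<nu>(2) field_simps)
  qed
  have bdd: "bdd_below (D x ` {0<..})" for x by (rule bdd_belowI2[where m = "- \<nu> x"]) (simp add: low)
  have qle: "q x \<le> D x \<tau>" if "0 < \<tau>" for x \<tau> unfolding q_def using that by (intro cINF_lower bdd) auto
  have qge: "z \<le> q x" if "\<And>\<tau>. 0 < \<tau> \<Longrightarrow> z \<le> D x \<tau>" for z x unfolding q_def using that by (intro cINF_greatest) auto
  \<comment> \<open>Difference quotients of a convex function increase with the step, so two
    different steps may both be replaced by the smaller one when subadditivity is proved.\<close>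
  have mono: "D x (s * \<tau>) \<le> D x \<tau>" if "0 < \<tau>" "0 < s" "s \<le> 1" for x s \<tau>
  proof -
    have "u + (s * \<tau>) *\<^sub>R x = (1 - s) *\<^sub>R u + s *\<^sub>R (u + \<tau> *\<^sub>R x)" by (simp add: algebra_simps)
    then have "\<nu> (u + (s * \<tau>) *\<^sub>R x) \<le> \<nu> ((1 - s) *\<^sub>R u) + \<nu> (s *\<^sub>R (u + \<tau> *\<^sub>R x))" by (simp only: \<nu>D(1))
    then have "\<nu> (u + (s * \<tau>) *\<^sub>R x) \<le> \<bar>1 - s\<bar> * 1 + \<bar>s\<bar> * \<nu> (u + \<tau> *\<^sub>R x)"
      by (simp only: \<nu>D(3) \<nu>(2))
    then have "\<nu> (u + (s * \<tau>) *\<^sub>R x) - 1 \<le> s * (\<nu> (u + \<tau> *\<^sub>R x) - 1)"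
      using that by (simp add: right_diff_distrib)
    then have "D x (s * \<tau>) \<le> s * (\<nu> (u + \<tau> *\<^sub>R x) - 1) / (s * \<tau>)"
      unfolding D_def using that by (intro divide_right_mono) auto
    then show ?thesis using that by (simp add: D_def)
  qed
  have sub: "sublinear q"
  proof (rule sublinearI)
    fix x y
    have "q (x + y) \<le> D x \<sigma> + D y \<tau>" if "0 < \<sigma>" "0 < \<tau>" for \<sigma> \<tau>
    proof -
      define \<rho> where "\<rho> = min \<sigma> \<tau>"
      have \<rho>: "0 < \<rho>" using that by (simp add: \<rho>_def)
      have "2 *\<^sub>R (u + (\<rho> / 2) *\<^sub>R (x + y)) = (u + \<rho> *\<^sub>R x) + (u + \<rho> *\<^sub>R y)" by (simp add: algebra_simps scaleR_2)
      then have "\<nu> (2 *\<^sub>R (u + (\<rho> / 2) *\<^sub>R (x + y))) \<le> \<nu> (u + \<rho> *\<^sub>R x) + \<nu> (u + \<rho> *\<^sub>R y)" by (simp only: \<nu>D(1))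
      then have "2 * \<nu> (u + (\<rho> / 2) *\<^sub>R (x + y)) \<le> \<nu> (u + \<rho> *\<^sub>R x) + \<nu> (u + \<rho> *\<^sub>R y)" by (simp add: \<nu>D(3) del: scaleR_add_right)
      then have "(2 * \<nu> (u + (\<rho> / 2) *\<^sub>R (x + y)) - 2) / \<rho> \<le> ((\<nu> (u + \<rho> *\<^sub>R x) - 1) + (\<nu> (u + \<rho> *\<^sub>R y) - 1)) / \<rho>"
        using \<rho> by (intro divide_right_mono) auto
      moreover have "D (x + y) (\<rho> / 2) = (2 * \<nu> (u + (\<rho> / 2) *\<^sub>R (x + y)) - 2) / \<rho>"
        using \<rho> unfolding D_def by (simp only: divide_divide_eq_right) (simp add: algebra_simps)
      ultimately have "D (x + y) (\<rho> / 2) \<le> D x \<rho> + D y \<rho>" by (simp only: D_def add_divide_distrib)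
      moreover have "q (x + y) \<le> D (x + y) (\<rho> / 2)" using \<rho> by (intro qle) simp
      moreover have "D x \<rho> \<le> D x \<sigma>" using mono[of \<sigma> "\<rho> / \<sigma>" x] that \<rho> by (simp add: \<rho>_def)
      moreover have "D y \<rho> \<le> D y \<tau>" using mono[of \<tau> "\<rho> / \<tau>" y] that \<rho> by (simp add: \<rho>_def)
      ultimately show ?thesis by linarith
    qed
    then have "q (x + y) - D x \<sigma> \<le> q y" if "0 < \<sigma>" for \<sigma> using that by (intro qge) (simp add: algebra_simps)
    then have "q (x + y) - q y \<le> q x" by (intro qge) (simp add: algebra_simps)
    then show "q (x + y) \<le> q x + q y" by simp
  next
    fix k :: real and x assume k: "0 < k"
    have "q (k *\<^sub>R x) / k \<le> q x"
    proof (rule qge)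
      fix \<tau> :: real assume \<tau>: "0 < \<tau>"
      have "q (k *\<^sub>R x) \<le> D (k *\<^sub>R x) (\<tau> / k)" using k \<tau> by (intro qle) simp
      also have "\<dots> = k * D x \<tau>" using k \<tau> by (simp add: D_def)
      finally show "q (k *\<^sub>R x) / k \<le> D x \<tau>" using k by (simp add: field_simps)
    qed
    then show "q (k *\<^sub>R x) \<le> k * q x" using k by (simp add: field_simps)
  next
    show "q 0 = 0" using qle[of 1 0] qge[of 0 0] by (simp add: D_def \<nu>(2))
  qed
  have cq: "c \<le> q y" if "y \<in> Y" for y
  proof (rule qge)
    fix \<tau> :: real assume "0 < \<tau>"
    then show "c \<le> D y \<tau>" using ge[OF that, of \<tau>] by (simp add: D_def field_simps)
  qed
  obtain L where L: "linear L" "\<And>x. L x \<le> q x" "\<And>y. y \<in> Y \<Longrightarrow> c \<le> L y"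
    using hahn_banach_convex[OF sub Y cq] by metis
  have L\<nu>: "L x \<le> \<nu> x" for x using L(2)[of x] qle[of 1 x] low(2)[of 1 x] by linarith
  \<comment> \<open>Already the quotient with step 1 is -1 at \<open>- u\<close>. This forces
    \<open>L u \<ge> 1\<close>, and domination by \<nu> gives equality.\<close>
  have "q (- u) \<le> -1" using qle[of 1 "- u"] by (simp add: D_def \<nu>D(4))
  then have "1 \<le> L u" using L(2)[of "- u"] by (simp add: linear_neg[OF L(1)])
  then have Lu: "L u = 1" using L\<nu>[of u] \<nu>(2) by simp
  obtain \<omega> where \<omega>: "clinear \<omega>" "\<And>x. Re (\<omega> x) = L x" using complexification[OF L(1)] by metis
  have le: "cmod (\<omega> x) \<le> \<nu> x" for x using L\<nu> \<omega> by (intro clinear_phase[OF \<omega>(1) _ \<nu>(1)]) simp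
  have "(Re (\<omega> u))\<^sup>2 + (Im (\<omega> u))\<^sup>2 \<le> 1"
    using power_mono[OF le[of u], of 2] \<nu>(2) by (simp add: cmod_power2)
  then have "\<omega> u = 1" using Lu \<omega>(2)[of u] by (simp add: complex_eq_iff)
  then have "is_state \<nu> u \<omega>" using is_state_iff[OF \<nu>(1), of u \<omega>] \<nu>(2) \<omega>(1) le by simp
  then show thesis using that L(3) \<omega>(2) by simp
qed

text \<open>If the inequality failed for every step, separation would give a state with real part at
  least \<open>c\<close> at \<open>y\<close>. One good step suffices, since convexity transfers the
  bound to all smaller steps. Through this, bounds on numerical ranges become estimates of
  norms.\<close>

lemma states_bound_imp_norm:
  fixes \<nu> :: "'v::complex_vector \<Rightarrow> real"
  assumes \<nu>: "cseminorm \<nu>" "\<nu> u = 1" and Re: "\<And>\<omega>. is_state \<nu> u \<omega> \<Longrightarrow> Re (\<omega> y) < c"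
  shows "\<exists>\<tau>0>0. \<forall>\<tau>. 0 < \<tau> \<and> \<tau> \<le> \<tau>0 \<longrightarrow> \<nu> (u + \<tau> *\<^sub>R y) \<le> 1 + \<tau> * c"
proof -
  have "\<exists>\<tau>0>0. \<nu> (u + \<tau>0 *\<^sub>R y) < 1 + \<tau>0 * c"
  proof (rule ccontr)
    assume "\<not> ?thesis"
    then have "1 + \<tau> * c \<le> \<nu> (u + \<tau> *\<^sub>R y')" if "y' \<in> {y}" "0 < \<tau>" for y' \<tau>
      using that by (auto simp: not_less dest!: spec[of _ \<tau>])
    then obtain \<omega> where "is_state \<nu> u \<omega>" "c \<le> Re (\<omega> y)"
      using states_separation[OF \<nu>, of "{y}" c] by auto
    then show False using Re by force
  qed
  then obtain \<tau>0 where \<tau>0: "0 < \<tau>0" "\<nu> (u + \<tau>0 *\<^sub>R y) < 1 + \<tau>0 * c" by blast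
  have "\<nu> (u + \<tau> *\<^sub>R y) \<le> 1 + \<tau> * c" if \<tau>: "0 < \<tau>" "\<tau> \<le> \<tau>0" for \<tau>
  proof -
    define s where "s = \<tau> / \<tau>0"
    have s: "0 < s" "s \<le> 1" "\<tau> = s * \<tau>0" using \<tau> \<tau>0 by (auto simp: s_def)
    have "u + \<tau> *\<^sub>R y = (1 - s) *\<^sub>R u + s *\<^sub>R (u + \<tau>0 *\<^sub>R y)" by (simp add: s(3) algebra_simps)
    then have "\<nu> (u + \<tau> *\<^sub>R y) \<le> \<nu> ((1 - s) *\<^sub>R u) + \<nu> (s *\<^sub>R (u + \<tau>0 *\<^sub>R y))" by (simp only: cseminormD(1)[OF \<nu>(1)])
    also have "\<dots> = (1 - s) + s * \<nu> (u + \<tau>0 *\<^sub>R y)" using s by (simp add: cseminormD(3)[OF \<nu>(1)] \<nu>(2))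
    also have "\<dots> \<le> (1 - s) + s * (1 + \<tau>0 * c)" using s \<tau>0 by simp
    also have "\<dots> = 1 + \<tau> * c" by (simp add: s(3) algebra_simps)
    finally show ?thesis .
  qed
  then show ?thesis using \<tau>0 by blast
qed

section \<open>The multiplier norm\<close>

text \<open>The left regular action of \<open>A^1\<close> on \<open>A\<close>;
  \<open>multiplier_norm\<close> is its operator norm.\<close>

definition unit_action :: "'a::complex_banach_algebra \<times> complex \<Rightarrow> 'a \<Rightarrow> 'a"
  where "unit_action x c = fst x * c + snd x *\<^sub>C c"

lemma unit_action_linear:
  "unit_action (x + y) c = unit_action x c + unit_action y c"
  "unit_action (x - y) c = unit_action x c - unit_action y c"
  "unit_action (k *\<^sub>C x) c = k *\<^sub>C unit_action x c"
  "unit_action x (c + d) = unit_action x c + unit_action x d"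
  "unit_action x (c - d) = unit_action x c - unit_action x d"
  "unit_action x (k *\<^sub>C c) = k *\<^sub>C unit_action x c"
  "unit_action x (c * d) = unit_action x c * d"
  by (simp_all add: unit_action_def scaleC_prod_def scaleC_complex_def algebra_simps scaleC_add_left scaleC_add_right
      scaleC_diff_left scaleC_diff_right scaleC_scaleC mult_scaleC_left mult_scaleC_right mult.commute)

lemma unit_action_bound: "norm (unit_action x c) \<le> (norm (fst x) + cmod (snd x)) * norm c"
  unfolding unit_action_def
  by (rule order_trans[OF norm_triangle_ineq]) (simp add: norm_scaleC norm_mult_ineq distrib_right add_mono)

lemma unit_action_bound_ball: "norm c \<le> 1 \<Longrightarrow> norm (unit_action x c) \<le> norm (fst x) + cmod (snd x)"
  using unit_action_bound[of x c] mult_left_le[of "norm c" "norm (fst x) + cmod (snd x)"] by simp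

lemma unit_action_le_multiplier_norm: "norm (unit_action x c) \<le> multiplier_norm x * norm c"
proof (cases "c = 0")
  case False
  have "norm (unit_action x c') \<le> multiplier_norm x" if "norm c' \<le> 1" for c'
    unfolding multiplier_norm_def unit_action_def[symmetric]
  proof (rule cSUP_upper)
    show "bdd_above ((\<lambda>c. norm (unit_action x c)) ` cball 0 1)"
      by (rule bdd_aboveI2[where M = "norm (fst x) + cmod (snd x)"])
        (auto intro: unit_action_bound_ball)
  qed (use that in simp)
  from this[of "of_real (1 / norm c) *\<^sub>C c"] show ?thesis
    using False by (simp only: unit_action_linear norm_scaleC) (simp add: norm_divide field_simps)
qed (simp add: unit_action_def)

lemma multiplier_norm_le:
  assumes "0 \<le> K" "\<And>c. norm c \<le> 1 \<Longrightarrow> norm (unit_action x c) \<le> K"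
  shows "multiplier_norm x \<le> K"
  unfolding multiplier_norm_def unit_action_def[symmetric] using assms by (intro cSUP_least) auto

lemma multiplier_norm_nonneg: "0 \<le> multiplier_norm x"
proof -
  have "norm (unit_action x 0) \<le> multiplier_norm x"
    unfolding multiplier_norm_def unit_action_def[symmetric]
    by (rule cSUP_upper, simp, rule bdd_aboveI2[where M = "norm (fst x) + cmod (snd x)"])
      (auto intro: unit_action_bound_ball)
  then show ?thesis by (meson norm_ge_zero order_trans)
qed

lemma cseminorm_multiplier_norm: "cseminorm (multiplier_norm :: 'a::complex_banach_algebra \<times> complex \<Rightarrow> real)"
  unfolding cseminorm_def
proof (intro conjI allI)
  fix x y :: "'a \<times> complex"
  show "multiplier_norm (x + y) \<le> multiplier_norm x + multiplier_norm y"
  proof (rule multiplier_norm_le)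
    fix c :: 'a assume c: "norm c \<le> 1"
    have "norm (unit_action (x + y) c) \<le> multiplier_norm x * norm c + multiplier_norm y * norm c"
      unfolding unit_action_linear
      by (intro order_trans[OF norm_triangle_ineq] add_mono unit_action_le_multiplier_norm)
    also have "\<dots> \<le> multiplier_norm x * 1 + multiplier_norm y * 1"
      using c by (intro add_mono mult_left_mono multiplier_norm_nonneg)
    finally show "norm (unit_action (x + y) c) \<le> multiplier_norm x + multiplier_norm y" by simp
  qed (simp add: multiplier_norm_nonneg)
  have le: "multiplier_norm (k *\<^sub>C x) \<le> cmod k * multiplier_norm x" for k and x :: "'a \<times> complex"
  proof (rule multiplier_norm_le)
    fix c :: 'a assume c: "norm c \<le> 1"
    have "norm (unit_action x c) \<le> multiplier_norm x * norm c" by (rule unit_action_le_multiplier_norm)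
    also have "\<dots> \<le> multiplier_norm x * 1" using c by (intro mult_left_mono multiplier_norm_nonneg)
    finally show "norm (unit_action (k *\<^sub>C x) c) \<le> cmod k * multiplier_norm x"
      by (simp add: unit_action_linear norm_scaleC mult_left_mono)
  qed (simp add: multiplier_norm_nonneg)
  fix k
  show "multiplier_norm (k *\<^sub>C x) = cmod k * multiplier_norm x"
  proof (cases "k = 0")
    case True
    then show ?thesis using le[of 0 x] multiplier_norm_nonneg[of "0 *\<^sub>C x"] by simp
  next
    case False
    have "multiplier_norm (inverse k *\<^sub>C (k *\<^sub>C x)) \<le> cmod (inverse k) * multiplier_norm (k *\<^sub>C x)" by (rule le)
    then have "cmod k * multiplier_norm x \<le> multiplier_norm (k *\<^sub>C x)"
      using False by (simp add: scaleC_scaleC norm_inverse norm_divide field_simps)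
    then show ?thesis using le[of k x] by simp
  qed
qed

lemmas multiplier_norm_simps = cseminormD[OF cseminorm_multiplier_norm]

lemma multiplier_norm_one_le: "multiplier_norm (0, 1) \<le> 1"
  by (rule multiplier_norm_le) (auto simp: unit_action_def)

lemma multiplier_norm_one: "(c::'a::complex_banach_algebra) \<noteq> 0 \<Longrightarrow> multiplier_norm (0 :: 'a, 1) = 1"
  using unit_action_le_multiplier_norm[of "(0, 1)" c] multiplier_norm_one_le[where 'a = 'a]
  by (simp add: unit_action_def)

section \<open>The identity of the bidual\<close>

text \<open>The filter generated by all sets of approximate units. Limits along it do not depend on
  the choice of an approximate identity.\<close>

definition unit_filter :: "'a::complex_banach_algebra filter"
  where "unit_filter = (INF (S, \<delta>)\<in>{(S, \<delta>). finite S \<and> 0 < \<delta>}. principal (approx_units S \<delta>))"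

lemma eventually_unit_filter:
  "eventually P unit_filter \<longleftrightarrow> (\<exists>S \<delta>. finite S \<and> 0 < \<delta> \<and> (\<forall>e\<in>approx_units S \<delta>. P e))"
proof -
  have "eventually P unit_filter \<longleftrightarrow> (\<exists>b\<in>{(S, \<delta>). finite S \<and> 0 < \<delta>}. eventually P (case b of (S, \<delta>) \<Rightarrow> principal (approx_units S \<delta>)))"
    unfolding unit_filter_def
  proof (rule eventually_INF_base)
    show "{(S::'a set, \<delta>::real). finite S \<and> 0 < \<delta>} \<noteq> {}" by (auto intro!: exI[of _ "{}"] exI[of _ 1])
    fix a b assume ab: "a \<in> {(S::'a set, \<delta>::real). finite S \<and> 0 < \<delta>}" "b \<in> {(S::'a set, \<delta>::real). finite S \<and> 0 < \<delta>}"
    obtain S \<delta> S' \<delta>' where eq: "a = (S, \<delta>)" "b = (S', \<delta>')" by (metis surj_pair)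
    have "approx_units (S \<union> S') (min \<delta> \<delta>') \<subseteq> approx_units S \<delta> \<inter> approx_units S' \<delta>'"
      by (intro Int_greatest approx_units_mono) auto
    then show "\<exists>x\<in>{(S::'a set, \<delta>). finite S \<and> 0 < \<delta>}. (case x of (S, \<delta>) \<Rightarrow> principal (approx_units S \<delta>))
        \<le> inf (case a of (S, \<delta>) \<Rightarrow> principal (approx_units S \<delta>)) (case b of (S, \<delta>) \<Rightarrow> principal (approx_units S \<delta>))"
      using ab unfolding eq by (intro bexI[of _ "(S \<union> S', min \<delta> \<delta>')"]) (simp_all add: inf_principal)
  qed
  then show ?thesis by (auto simp: eventually_principal)
qed

text \<open>The only trace of L^p that is kept for the theory of the bidual and of its
  identity.\<close>

definition smooth_units :: "'a::complex_banach_algebra itself \<Rightarrow> bool"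
  where "smooth_units _ \<longleftrightarrow> (\<forall>\<epsilon>>0. \<exists>\<tau>>0. \<exists>\<eta>>0. \<forall>(a::'a) e e'.
    norm a \<le> 1 \<and> norm e \<le> 1 \<and> norm e' \<le> 1 \<and> norm (e' * a - a) \<le> \<eta> \<and> norm (e' - e' * e) \<le> \<eta>
    \<longrightarrow> (\<forall>b c. norm b \<le> 1 \<and> norm c \<le> 1 \<longrightarrow> norm (a * c + \<tau> *\<^sub>R (b - e * b)) \<le> 1 + \<epsilon> * \<tau>))"

lemma smooth_unitsE:
  assumes "smooth_units TYPE('a::complex_banach_algebra)" "0 < \<epsilon>"
  obtains \<tau> \<eta> where "0 < \<tau>" "0 < \<eta>" "\<And>(a::'a) e e' b c. norm a \<le> 1 \<Longrightarrow> norm e \<le> 1 \<Longrightarrow> norm e' \<le> 1 \<Longrightarrow>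
    norm (e' * a - a) \<le> \<eta> \<Longrightarrow> norm (e' - e' * e) \<le> \<eta> \<Longrightarrow> norm b \<le> 1 \<Longrightarrow> norm c \<le> 1 \<Longrightarrow>
    norm (a * c + \<tau> *\<^sub>R (b - e * b)) \<le> 1 + \<epsilon> * \<tau>"
  using assms(1)[unfolded smooth_units_def, THEN spec, THEN mp, OF assms(2)]
proof (elim exE conjE)
  fix \<tau> \<eta> assume \<tau>: "0 < \<tau>" and \<eta>: "0 < \<eta>" and *: "\<forall>(a::'a) e e'.
    norm a \<le> 1 \<and> norm e \<le> 1 \<and> norm e' \<le> 1 \<and> norm (e' * a - a) \<le> \<eta> \<and> norm (e' - e' * e) \<le> \<eta>
    \<longrightarrow> (\<forall>b c. norm b \<le> 1 \<and> norm c \<le> 1 \<longrightarrow> norm (a * c + \<tau> *\<^sub>R (b - e * b)) \<le> 1 + \<epsilon> * \<tau>)"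
  show thesis by (rule that[OF \<tau> \<eta>]) (use * in blast)
qed

definition bidual_unit :: "'a::complex_banach_algebra cdual cdual"
  where "bidual_unit = (SOME E. \<forall>f. (cdual_apply f \<longlongrightarrow> cdual_apply E f) unit_filter)"

locale smooth_algebra =
  fixes A :: "'a::complex_banach_algebra itself"
  assumes approximately_unital: "approximately_unital TYPE('a)"
    and smooth_units: "smooth_units TYPE('a)"
begin

abbreviation "U \<equiv> (unit_filter :: 'a filter)"
abbreviation "E \<equiv> (bidual_unit :: 'a cdual cdual)"

lemma U_nontrivial: "U \<noteq> bot"
  unfolding trivial_limit_def eventually_unit_filter
  using approx_units_nonempty[OF approximately_unital] by blast

lemma eventually_approx_units: "finite S \<Longrightarrow> 0 < \<delta> \<Longrightarrow> \<forall>\<^sub>F e in U. e \<in> approx_units S \<delta>"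
  unfolding eventually_unit_filter by blast

lemma eventually_norm_le_1: "\<forall>\<^sub>F e in U. norm e \<le> 1"
  using eventually_approx_units[of "{}" 1] by (auto elim!: eventually_mono dest: approx_unitsD)

lemma unit_tendsto: "((\<lambda>e. e * a) \<longlongrightarrow> a) U" "((\<lambda>e. a * e) \<longlongrightarrow> a) U"
proof -
  have *: "\<forall>\<^sub>F e in U. norm (e * a - a) < \<epsilon> \<and> norm (a * e - a) < \<epsilon>" if "0 < \<epsilon>" for \<epsilon>
  proof (rule eventually_mono[OF eventually_approx_units[of "{a}" "\<epsilon> / 2"]])
    fix e assume "e \<in> approx_units {a} (\<epsilon> / 2)"
    then show "norm (e * a - a) < \<epsilon> \<and> norm (a * e - a) < \<epsilon>"
      using approx_unitsD(2,3)[of e "{a}" "\<epsilon> / 2" a] that by simp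
  qed (use that in auto)
  show "((\<lambda>e. e * a) \<longlongrightarrow> a) U" "((\<lambda>e. a * e) \<longlongrightarrow> a) U"
    by (rule tendstoI, unfold dist_norm, rule eventually_mono[OF *], assumption, simp)+
qed

lemma cdual_tendsto: "(g \<longlongrightarrow> l) F \<Longrightarrow> ((\<lambda>x. cdual_apply f (g x)) \<longlongrightarrow> cdual_apply f l) F"
  by (rule bounded_linear.tendsto[OF bounded_linear_cdual_apply])

lemma exists_unit:
  assumes "\<forall>\<^sub>F e in U. P e"
  obtains e where "P e"
  using assms U_nontrivial eventually_happens' by blast

text \<open>If \<open>f\<close> almost attains its norm at a product \<open>a c\<close> of
  contractions, then \<open>a c + \<tau> (b - e b)\<close> has norm at most
  \<open>1 + \<epsilon>' \<tau>\<close>, which leaves no room for \<open>f (b - e b)\<close> to be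
  large for any \<open>b\<close> in the ball. This convergence in norm gives both the existence of
  limits along the units and the left identity of the bidual.\<close>

lemma dual_act_unit:
  fixes f :: "'a cdual"
  assumes \<epsilon>: "0 < \<epsilon>"
  shows "\<forall>\<^sub>F e in U. norm (f - dual_act f e) \<le> \<epsilon>"
proof -
  define \<epsilon>' where "\<epsilon>' = \<epsilon> / (norm f + 1)"
  have f1: "0 < norm f + 1" by (simp add: add_nonneg_pos)
  then have \<epsilon>': "0 < \<epsilon>'" using \<epsilon> by (simp add: \<epsilon>'_def)
  obtain \<tau> \<eta> where \<tau>: "0 < \<tau>" and \<eta>: "0 < \<eta>" and sm: "\<And>(a::'a) e e' b c.
    norm a \<le> 1 \<Longrightarrow> norm e \<le> 1 \<Longrightarrow> norm e' \<le> 1 \<Longrightarrow> norm (e' * a - a) \<le> \<eta> \<Longrightarrow> norm (e' - e' * e) \<le> \<eta>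
    \<Longrightarrow> norm b \<le> 1 \<Longrightarrow> norm c \<le> 1 \<Longrightarrow> norm (a * c + \<tau> *\<^sub>R (b - e * b)) \<le> 1 + \<epsilon>' * \<tau>"
    by (rule smooth_unitsE[OF smooth_units \<epsilon>'], rule that)
  \<comment> \<open>The norm has to be attained up to a multiple of \<tau>, since the resulting
    inequality is divided by \<tau>.\<close>
  have "norm f - \<epsilon>' * \<tau> < norm f" using \<epsilon>' \<tau> by simp
  then obtain a where a: "norm a \<le> 1" "norm f - \<epsilon>' * \<tau> < Re (cdual_apply f a)" by (rule cdual_norm_attain)
  have "((\<lambda>c. Re (cdual_apply f (a * c))) \<longlongrightarrow> Re (cdual_apply f a)) U"
    by (intro tendsto_Re cdual_tendsto unit_tendsto)
  then have "\<forall>\<^sub>F c in U. norm f - \<epsilon>' * \<tau> < Re (cdual_apply f (a * c))"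
    using a(2) by (rule order_tendstoD)
  with eventually_norm_le_1 have "\<forall>\<^sub>F c in U. norm c \<le> 1 \<and> norm f - \<epsilon>' * \<tau> < Re (cdual_apply f (a * c))"
    by eventually_elim simp
  then obtain c where c: "norm c \<le> 1" "norm f - \<epsilon>' * \<tau> < Re (cdual_apply f (a * c))"
    by (rule exists_unit) blast
  obtain e' where e': "e' \<in> approx_units {a} \<eta>"
    by (rule exists_unit[OF eventually_approx_units[of "{a}" \<eta>]]) (use \<eta> in auto)
  have "norm (f - dual_act f e) \<le> \<epsilon>" if e: "e \<in> approx_units {e'} \<eta>" for e
  proof (rule cdual_norm_le_ball)
    fix b :: 'a assume b: "norm b \<le> 1"
    have "norm (a * c + \<tau> *\<^sub>R (b - e * b)) \<le> 1 + \<epsilon>' * \<tau>"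
      using a c b approx_unitsD[OF e] approx_unitsD[OF e'] by (intro sm[of a e e']) (auto simp: norm_minus_commute)
    then have "norm f * norm (a * c + \<tau> *\<^sub>R (b - e * b)) \<le> norm f * (1 + \<epsilon>' * \<tau>)" by (intro mult_left_mono) auto
    then have "Re (cdual_apply f (a * c + \<tau> *\<^sub>R (b - e * b))) \<le> norm f * (1 + \<epsilon>' * \<tau>)"
      using cdual_apply_bound[of f "a * c + \<tau> *\<^sub>R (b - e * b)"] complex_Re_le_cmod[of "cdual_apply f (a * c + \<tau> *\<^sub>R (b - e * b))"]
      by linarith
    then have "norm f - \<epsilon>' * \<tau> + \<tau> * Re (cdual_apply f (b - e * b)) \<le> norm f * (1 + \<epsilon>' * \<tau>)"
      using c(2) unfolding cdual_simps(1)[of f "a * c"] cdual_simps(3) by simp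
    then have "\<tau> * Re (cdual_apply f (b - e * b)) \<le> \<tau> * (\<epsilon>' * (norm f + 1))" by (simp add: algebra_simps)
    then have "Re (cdual_apply f (b - e * b)) \<le> \<epsilon>' * (norm f + 1)" using \<tau> by simp
    also have "\<dots> = \<epsilon>" using f1 by (simp add: \<epsilon>'_def)
    finally show "Re (cdual_apply (f - dual_act f e) b) \<le> \<epsilon>"
      by (simp add: cdual_fun_simps dual_act.rep_eq cdual_simps)
  qed
  then show ?thesis unfolding eventually_unit_filter using \<eta> by (intro exI[of _ "{e'}"] exI[of _ \<eta>]) auto
qed

text \<open>For a fixed unit \<open>e0\<close> with \<open>dual_act f e0\<close> near
  \<open>f\<close>, every later unit satisfies \<open>f e \<approx> f (e0 e) \<approx> f e0\<close>,
  so the values are Cauchy. The limit functional on the dual will be the identity of the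
  bidual.\<close>

lemma unit_limit_exists: "\<exists>l. (cdual_apply f \<longlongrightarrow> l) U"
proof -
  have "cauchy_filter (filtermap (cdual_apply f) U)"
    unfolding cauchy_filter_metric_filtermap
  proof (intro allI impI)
    fix r :: real assume r: "0 < r"
    define \<epsilon> where "\<epsilon> = r / 5"
    have \<epsilon>: "0 < \<epsilon>" using r by (simp add: \<epsilon>_def)
    obtain e0 where e0: "norm (f - dual_act f e0) \<le> \<epsilon>" using exists_unit[OF dual_act_unit[OF \<epsilon>]] by blast
    define \<delta> where "\<delta> = \<epsilon> / (norm f + 1)"
    have f1: "0 < norm f + 1" by (simp add: add_nonneg_pos)
    then have \<delta>: "0 < \<delta>" using \<epsilon> by (simp add: \<delta>_def)
    have near: "dist (cdual_apply f e) (cdual_apply f e0) \<le> 2 * \<epsilon>" if e: "e \<in> approx_units {e0} \<delta>" for e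
    proof -
      have "cmod (cdual_apply (f - dual_act f e0) e) \<le> norm (f - dual_act f e0) * norm e" by (rule cdual_apply_bound)
      also have "\<dots> \<le> \<epsilon> * 1" using e0 approx_unitsD(1)[OF e] \<epsilon> by (intro mult_mono) auto
      finally have 1: "cmod (cdual_apply f e - cdual_apply f (e0 * e)) \<le> \<epsilon>"
        by (simp add: cdual_fun_simps dual_act.rep_eq)
      have "cmod (cdual_apply f (e0 * e - e0)) \<le> norm f * norm (e0 * e - e0)" by (rule cdual_apply_bound)
      also have "\<dots> \<le> (norm f + 1) * \<delta>" using approx_unitsD(3)[OF e] by (intro mult_mono) auto
      also have "\<dots> = \<epsilon>" using f1 by (simp add: \<delta>_def)
      finally have 2: "cmod (cdual_apply f (e0 * e) - cdual_apply f e0) \<le> \<epsilon>" by (simp add: cdual_simps)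
      show ?thesis
        using norm_triangle_ineq[of "cdual_apply f e - cdual_apply f (e0 * e)" "cdual_apply f (e0 * e) - cdual_apply f e0"] 1 2
        by (simp add: dist_norm)
    qed
    show "\<exists>P. eventually P U \<and> (\<forall>x y. P x \<and> P y \<longrightarrow> dist (cdual_apply f x) (cdual_apply f y) < r)"
    proof (intro exI[of _ "\<lambda>e. e \<in> approx_units {e0} \<delta>"] conjI allI impI)
      show "\<forall>\<^sub>F e in U. e \<in> approx_units {e0} \<delta>" using \<delta> by (intro eventually_approx_units) auto
      fix x y assume "x \<in> approx_units {e0} \<delta> \<and> y \<in> approx_units {e0} \<delta>"
      then have "dist (cdual_apply f x) (cdual_apply f e0) \<le> 2 * \<epsilon>" "dist (cdual_apply f y) (cdual_apply f e0) \<le> 2 * \<epsilon>"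
        using near by auto
      then show "dist (cdual_apply f x) (cdual_apply f y) < r"
        using dist_triangle2[of "cdual_apply f x" "cdual_apply f y" "cdual_apply f e0"] r by (simp add: \<epsilon>_def)
    qed
  qed
  moreover have "filtermap (cdual_apply f) U \<noteq> bot" using U_nontrivial by (simp add: filtermap_bot_iff)
  ultimately have "\<exists>l. filtermap (cdual_apply f) U \<le> nhds l"
    using complete_UNIV[where 'a = complex] unfolding complete_uniform by (auto simp: le_principal)
  then show ?thesis by (simp add: filterlim_def)
qed

lemma unit_limit: "(cdual_apply f \<longlongrightarrow> cdual_apply E f) U"
proof -
  define F where "F f = Lim U (cdual_apply f)" for f :: "'a cdual"
  have F: "(cdual_apply f \<longlongrightarrow> F f) U" for f
    using unit_limit_exists[of f] tendsto_Lim[OF U_nontrivial] unfolding F_def by metis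
  have F_eq: "F f = l" if "(cdual_apply f \<longlongrightarrow> l) U" for f l
    by (rule tendsto_unique[OF U_nontrivial F that])
  have lin: "clinear F"
    unfolding clinear_def
  proof (intro conjI allI)
    fix f g :: "'a cdual" and c
    show "F (f + g) = F f + F g"
      by (rule F_eq) (auto intro!: tendsto_add F simp: plus_cdual.rep_eq)
    show "F (c *\<^sub>C f) = c * F f"
      by (rule F_eq) (auto intro!: tendsto_mult F simp: scaleC_cdual.rep_eq)
  qed
  have "cmod (F f) \<le> 1 * norm f" for f
  proof (rule tendsto_upperbound[OF tendsto_norm[OF F] _ U_nontrivial])
    show "\<forall>\<^sub>F e in U. cmod (cdual_apply f e) \<le> 1 * norm f"
      using eventually_norm_le_1
    proof eventually_elim
      case (elim e)
      have "cmod (cdual_apply f e) \<le> norm f * norm e" by (rule cdual_apply_bound)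
      also have "\<dots> \<le> norm f * 1" using elim by (intro mult_left_mono) auto
      finally show ?case by simp
    qed
  qed
  then obtain E' where "cdual_apply E' = F" using cdual_ex[OF lin] by metis
  then have "\<forall>f. (cdual_apply f \<longlongrightarrow> cdual_apply E' f) U" using F by simp
  then have "\<forall>f. (cdual_apply f \<longlongrightarrow> cdual_apply E f) U"
    unfolding bidual_unit_def by (rule someI[of "\<lambda>E. \<forall>f. (cdual_apply f \<longlongrightarrow> cdual_apply E f) unit_filter"])
  then show ?thesis ..
qed

lemma unit_limit_unique: "(cdual_apply f \<longlongrightarrow> l) U \<Longrightarrow> cdual_apply E f = l"
  by (rule tendsto_unique[OF U_nontrivial unit_limit])

text \<open>The two sides differ. For \<open>arens m E\<close> pointwise convergence
  \<open>f (a e) \<rightarrow> f a\<close> is enough, whereas \<open>arens E m\<close> is a limit of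
  \<open>m\<close> at \<open>dual_act f e\<close>, which requires convergence in the norm of the
  dual.\<close>

lemma is_identity_unit: "is_identity arens E"
  unfolding is_identity_def
proof (intro allI conjI)
  fix m :: "'a cdual cdual"
  have "bidual_act E f = f" for f
  proof (rule cdual_eqI)
    fix a
    have "(cdual_apply (dual_act f a) \<longlongrightarrow> cdual_apply f a) U"
      by (simp add: dual_act.rep_eq[abs_def]) (intro cdual_tendsto unit_tendsto)
    then show "cdual_apply (bidual_act E f) a = cdual_apply f a"
      by (simp add: bidual_act.rep_eq unit_limit_unique)
  qed
  then show "arens m E = m" by (intro cdual_eqI) (simp add: arens.rep_eq)
  show "arens E m = m"
  proof (rule cdual_eqI)
    fix f :: "'a cdual"
    have "((\<lambda>e. dual_act f e) \<longlongrightarrow> f) U"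
    proof (rule tendstoI)
      fix r :: real assume "0 < r"
      then show "\<forall>\<^sub>F e in U. dist (dual_act f e) f < r"
        using dual_act_unit[of "r / 2" f] by (auto simp: dist_norm norm_minus_commute elim!: eventually_mono)
    qed
    then have "(cdual_apply (bidual_act m f) \<longlongrightarrow> cdual_apply m f) U"
      unfolding bidual_act.rep_eq by (rule bounded_linear.tendsto[OF bounded_linear_cdual_apply])
    then show "cdual_apply (arens E m) f = cdual_apply m f"
      by (simp add: arens.rep_eq unit_limit_unique)
  qed
qed

lemma identity_of_arens: "identity_of arens = E"
  unfolding identity_of_def by (rule the_equality[where P = "is_identity arens", OF is_identity_unit]) (metis is_identity_def is_identity_unit)

lemma norm_E_le: "norm E \<le> 1"
proof (rule cdual_norm_le)
  fix f
  show "cmod (cdual_apply E f) \<le> 1 * norm f"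
  proof (rule tendsto_upperbound[OF tendsto_norm[OF unit_limit] _ U_nontrivial])
    show "\<forall>\<^sub>F e in U. cmod (cdual_apply f e) \<le> 1 * norm f"
      using eventually_norm_le_1
    proof eventually_elim
      case (elim e)
      have "cmod (cdual_apply f e) \<le> norm f * norm e" by (rule cdual_apply_bound)
      also have "\<dots> \<le> norm f * 1" using elim by (intro mult_left_mono) auto
      finally show ?case by simp
    qed
  qed
qed simp

end

section \<open>The unitization inside the bidual\<close>

lemma has_functional_norm_cdual: "has_functional_norm norm (cdual_apply f) (norm f)"
proof -
  have le: "cmod (cdual_apply f x) \<le> norm f" if "norm x \<le> 1" for x
    using cdual_apply_bound[of f x] mult_left_le[of "norm x" "norm f"] that by simp
  then have bdd: "bdd_above ((\<lambda>x. cmod (cdual_apply f x)) ` {x. norm x \<le> 1})"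
    by (intro bdd_aboveI2[where M = "norm f"]) simp
  have "(SUP x\<in>{x. norm x \<le> 1}. cmod (cdual_apply f x)) = norm f"
  proof (rule antisym)
    show "(SUP x\<in>{x. norm x \<le> 1}. cmod (cdual_apply f x)) \<le> norm f"
      using le by (intro cSUP_least) (auto intro: exI[of _ 0])
    show "norm f \<le> (SUP x\<in>{x. norm x \<le> 1}. cmod (cdual_apply f x))"
    proof (rule cdual_norm_le_ball)
      fix x :: 'a assume "norm x \<le> 1"
      then have "cmod (cdual_apply f x) \<le> (SUP x\<in>{x. norm x \<le> 1}. cmod (cdual_apply f x))"
        by (intro cSUP_upper bdd) simp
      then show "Re (cdual_apply f x) \<le> (SUP x\<in>{x. norm x \<le> 1}. cmod (cdual_apply f x))"
        using complex_Re_le_cmod order_trans by blast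
    qed
  qed
  then show ?thesis using bdd by (simp add: has_functional_norm_def)
qed

lemma has_functional_norm_unique: "has_functional_norm \<nu> \<omega> r \<Longrightarrow> has_functional_norm \<nu> \<omega> s \<Longrightarrow> r = s"
  by (simp add: has_functional_norm_def)

text \<open>Its value at the identity of the bidual is \<open>f c\<close>, so its normal extension
  recovers \<open>f\<close> on \<open>unit_action x c\<close>.\<close>

lift_definition right_shift :: "'a::complex_banach_algebra cdual \<Rightarrow> 'a \<Rightarrow> 'a cdual"
  is "\<lambda>f c b. f (b * c)"
proof -
  fix f :: "'a \<Rightarrow> complex" and c :: 'a
  assume "bounded_linear f \<and> clinear f"
  then show "bounded_linear (\<lambda>b. f (b * c)) \<and> clinear (\<lambda>b. f (b * c))"
    by (auto simp: clinear_def distrib_right mult_scaleC_left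
        intro: bounded_linear_compose[OF _ bounded_linear_mult_left])
qed

lemma norm_right_shift: "norm (right_shift f c) \<le> norm f * norm c"
proof (rule cdual_norm_le)
  fix x
  have "cmod (cdual_apply f (x * c)) \<le> norm f * (norm x * norm c)"
    by (rule order_trans[OF cdual_apply_bound]) (simp add: mult_left_mono norm_mult_ineq)
  then show "cmod (cdual_apply (right_shift f c) x) \<le> norm f * norm c * norm x"
    by (simp add: right_shift.rep_eq ac_simps)
qed simp

context smooth_algebra
begin

text \<open>The normal extension of \<open>f\<close> to \<open>A^1\<close>: the unit is sent to the
  limit of \<open>f\<close> along the approximate units.\<close>

definition ext :: "'a cdual \<Rightarrow> 'a \<times> complex \<Rightarrow> complex"
  where "ext f x = cdual_apply f (fst x) + snd x * cdual_apply E f"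

definition embed :: "'a \<times> complex \<Rightarrow> 'a cdual cdual"
  where "embed x = canonical_embedding (fst x) + snd x *\<^sub>C E"

lemma embed_apply [simp]: "cdual_apply (embed x) f = ext f x"
  by (simp add: embed_def ext_def cdual_fun_simps)

lemma embed_linear: "embed (x + y) = embed x + embed y" "embed (c *\<^sub>C x) = c *\<^sub>C embed x"
  by (rule cdual_eqI, simp add: ext_def cdual_fun_simps cdual_simps scaleC_prod_def scaleC_complex_def algebra_simps)+

lemma embed_unit: "embed (0, 1) = E" and embed_canonical: "embed (a, 0) = canonical_embedding a"
  by (rule cdual_eqI, simp add: ext_def cdual_simps)+

lemma clinear_ext: "clinear (ext f)"
  by (simp add: clinear_def ext_def cdual_simps scaleC_prod_def scaleC_complex_def algebra_simps)

lemma ext_tendsto: "((\<lambda>e. cdual_apply f (unit_action x e)) \<longlongrightarrow> ext f x) U"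
  unfolding unit_action_def ext_def cdual_simps
  by (intro tendsto_add tendsto_mult tendsto_const cdual_tendsto unit_tendsto unit_limit)

lemma ext_bound: "cmod (ext f x) \<le> norm f * multiplier_norm x"
proof (rule tendsto_upperbound[OF tendsto_norm[OF ext_tendsto] _ U_nontrivial])
  show "\<forall>\<^sub>F e in U. cmod (cdual_apply f (unit_action x e)) \<le> norm f * multiplier_norm x"
    using eventually_norm_le_1
  proof eventually_elim
    case (elim e)
    have "norm (unit_action x e) \<le> multiplier_norm x * norm e" by (rule unit_action_le_multiplier_norm)
    also have "\<dots> \<le> multiplier_norm x" using elim by (intro mult_left_le) (auto simp: multiplier_norm_nonneg)
    finally show ?case by (intro order_trans[OF cdual_apply_bound] mult_left_mono) auto
  qed
qed

text \<open>One direction is a limit along the units; for the other, a functional norming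
  \<open>unit_action x c\<close> is shifted by \<open>c\<close>. So the multiplier unitization sits
  isometrically in the bidual as the span of \<open>A\<close> and \<open>E\<close>, and the two
  cases of the definitions can be treated alike.\<close>

lemma norm_embed: "norm (embed x) = multiplier_norm x"
proof (rule antisym)
  show "norm (embed x) \<le> multiplier_norm x"
    using ext_bound by (intro cdual_norm_le) (auto simp: multiplier_norm_nonneg mult.commute)
  show "multiplier_norm x \<le> norm (embed x)"
  proof (rule multiplier_norm_le)
    fix c :: 'a assume c: "norm c \<le> 1"
    obtain f where f: "norm f \<le> 1" "cdual_apply f (unit_action x c) = of_real (norm (unit_action x c))"
      by (rule norming_functional)
    have "cdual_apply E (right_shift f c) = cdual_apply f c"
      by (rule unit_limit_unique) (simp add: right_shift.rep_eq[abs_def], intro cdual_tendsto unit_tendsto)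
    then have "ext (right_shift f c) x = of_real (norm (unit_action x c))"
      unfolding f(2)[symmetric] by (simp add: ext_def right_shift.rep_eq unit_action_def cdual_simps)
    then have "norm (unit_action x c) \<le> norm (embed x) * norm (right_shift f c)"
      using cdual_apply_bound[of "embed x" "right_shift f c"] by simp
    also have "norm (right_shift f c) \<le> 1"
      using norm_right_shift[of f c] f(1) c mult_le_one[of "norm f" "norm c"] by simp
    finally show "norm (unit_action x c) \<le> norm (embed x)" by (simp add: mult_left_mono)
  qed simp
qed

lemma multiplier_norm_embed: "multiplier_norm (a :: 'a, 0) = norm a"
  unfolding norm_embed[symmetric] embed_canonical by (rule norm_canonical_embedding)

lemma cdual_of_functional:
  fixes F :: "'a \<times> complex \<Rightarrow> complex"
  assumes "clinear F" "\<And>x. cmod (F x) \<le> multiplier_norm x"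
  obtains f where "\<And>a. cdual_apply f a = F (a, 0)" "norm f \<le> 1"
proof -
  have "clinear (\<lambda>a. F (a, 0))"
    unfolding clinear_def
  proof (intro conjI allI)
    fix a b :: 'a and c
    show "F (a + b, 0) = F (a, 0) + F (b, 0)" using clinearD(1)[OF assms(1), of "(a, 0)" "(b, 0)"] by simp
    show "F (c *\<^sub>C a, 0) = c * F (a, 0)" using clinearD(2)[OF assms(1), of c "(a, 0)"] by (simp add: scaleC_prod_def)
  qed
  moreover have "cmod (F (a, 0)) \<le> 1 * norm a" for a using assms(2)[of "(a, 0)"] by (simp add: multiplier_norm_embed)
  ultimately obtain f where f: "cdual_apply f = (\<lambda>a. F (a, 0))" using cdual_ex by metis
  show thesis
    using f assms(2) by (intro that[of f] cdual_norm_le) (auto simp flip: multiplier_norm_embed)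
qed

lemma cmod_E_le: "cmod (cdual_apply E f) \<le> norm f"
  using cdual_apply_bound[of E f] norm_E_le mult_right_mono[of "norm E" 1 "norm f"] by simp

lemma is_state_multiplier_iff:
  "is_state multiplier_norm (0 :: 'a, 1) \<omega> \<longleftrightarrow> clinear \<omega> \<and> (\<forall>x. cmod (\<omega> x) \<le> multiplier_norm x) \<and> \<omega> (0, 1) = 1"
  by (rule is_state_iff[OF cseminorm_multiplier_norm multiplier_norm_one_le])

lemma is_state_bidual_iff:
  "is_state norm E W \<longleftrightarrow> clinear W \<and> (\<forall>x. cmod (W x) \<le> norm x) \<and> W E = 1"
  by (rule is_state_iff[OF cseminorm_norm norm_E_le])

lemma is_state_ext:
  assumes "norm f \<le> 1" "cdual_apply E f = 1"
  shows "is_state multiplier_norm (0, 1) (ext f)"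
  unfolding is_state_multiplier_iff
proof (intro conjI allI clinear_ext)
  fix x
  show "cmod (ext f x) \<le> multiplier_norm x"
    using ext_bound[of f x] mult_right_mono[OF assms(1) multiplier_norm_nonneg[of x]] by simp
qed (simp add: ext_def cdual_simps assms)

text \<open>The singular part of a functional on the unitization is seen on $z(1 - e)$, and
  $\lVert a + z(1 - e) \rVert \le 1 + o(|z|)$ for $a$ in the unit ball.\<close>

lemma state_normal:
  fixes f :: "'a cdual"
  assumes \<omega>: "is_state multiplier_norm (0, 1) \<omega>" and f: "\<And>a. cdual_apply f a = \<omega> (a, 0)" "norm f = 1"
  shows "cdual_apply E f = 1"
proof -
  have lin: "clinear \<omega>" and bound: "\<And>x. cmod (\<omega> x) \<le> multiplier_norm x" and one: "\<omega> (0, 1) = 1"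
    using \<omega> by (auto simp: is_state_multiplier_iff)
  have "cmod (1 - cdual_apply E f) \<le> \<epsilon>" if \<epsilon>: "0 < \<epsilon>" for \<epsilon>
  proof -
    define \<epsilon>' where "\<epsilon>' = \<epsilon> / 2"
    have \<epsilon>': "0 < \<epsilon>'" using \<epsilon> by (simp add: \<epsilon>'_def)
    obtain \<tau> \<eta> where \<tau>: "0 < \<tau>" and \<eta>: "0 < \<eta>" and sm: "\<And>(a::'a) e e' b c.
      norm a \<le> 1 \<Longrightarrow> norm e \<le> 1 \<Longrightarrow> norm e' \<le> 1 \<Longrightarrow> norm (e' * a - a) \<le> \<eta> \<Longrightarrow> norm (e' - e' * e) \<le> \<eta>
      \<Longrightarrow> norm b \<le> 1 \<Longrightarrow> norm c \<le> 1 \<Longrightarrow> norm (a * c + \<tau> *\<^sub>R (b - e * b)) \<le> 1 + \<epsilon>' * \<tau>"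
      by (rule smooth_unitsE[OF smooth_units \<epsilon>'], rule that)
    have "1 - \<epsilon>' * \<tau> < norm f" using f(2) \<epsilon>' \<tau> by simp
    then obtain a where a: "norm a \<le> 1" "1 - \<epsilon>' * \<tau> < Re (cdual_apply f a)" by (rule cdual_norm_attain)
    obtain e' where e': "e' \<in> approx_units {a} \<eta>"
      by (rule exists_unit[OF eventually_approx_units[of "{a}" \<eta>]]) (use \<eta> in auto)
    have "cmod (1 - cdual_apply f e) \<le> \<epsilon>" if e: "e \<in> approx_units {e'} \<eta>" for e
    proof -
      define k where "k = (if cdual_apply f e = 1 then 1 else cnj (sgn (1 - cdual_apply f e)))"
      have k: "cmod k = 1" "k * (1 - cdual_apply f e) = of_real (cmod (1 - cdual_apply f e))"
        by (auto simp: k_def norm_sgn cnj_sgn_mult)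
      \<comment> \<open>Smoothness bounds its multiplier norm by
        \<open>1 + \<epsilon>' \<tau>\<close>, while the phase \<open>k\<close> makes \<omega> equal
        there to \<open>f a + \<tau> * cmod (1 - f e)\<close>, whose first term has real part almost
        1.\<close>
      define y where "y = (a, 0 :: complex) + (of_real \<tau> * k) *\<^sub>C ((0, 1) - (e, 0))"
      have "multiplier_norm y \<le> 1 + \<epsilon>' * \<tau>"
      proof (rule multiplier_norm_le)
        fix c :: 'a assume c: "norm c \<le> 1"
        have "norm (a * c + \<tau> *\<^sub>R (k *\<^sub>C c - e * (k *\<^sub>C c))) \<le> 1 + \<epsilon>' * \<tau>"
          using a c k approx_unitsD[OF e] approx_unitsD[OF e'] \<tau>
          by (intro sm[of a e e']) (auto simp: norm_minus_commute norm_scaleC)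
        moreover have "unit_action y c = a * c + \<tau> *\<^sub>R (k *\<^sub>C c - e * (k *\<^sub>C c))"
          unfolding y_def unit_action_linear
          by (simp add: unit_action_def scaleR_scaleC mult_scaleC_right scaleC_diff_right scaleC_scaleC)
        ultimately show "norm (unit_action y c) \<le> 1 + \<epsilon>' * \<tau>" by simp
      qed (use \<epsilon>' \<tau> in simp)
      then have "Re (\<omega> y) \<le> 1 + \<epsilon>' * \<tau>"
        using bound[of y] complex_Re_le_cmod[of "\<omega> y"] by linarith
      moreover have "\<omega> y = cdual_apply f a + of_real \<tau> * (k * (1 - cdual_apply f e))"
        unfolding y_def clinearD[OF lin] by (simp add: one f(1) mult.assoc)
      ultimately have "Re (cdual_apply f a) + \<tau> * cmod (1 - cdual_apply f e) \<le> 1 + \<epsilon>' * \<tau>"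
        unfolding k by simp
      then have "\<tau> * cmod (1 - cdual_apply f e) \<le> \<tau> * \<epsilon>" using a(2) by (simp add: \<epsilon>'_def algebra_simps)
      then show ?thesis using \<tau> by simp
    qed
    then have "\<forall>\<^sub>F e in U. cmod (1 - cdual_apply f e) \<le> \<epsilon>"
      unfolding eventually_unit_filter using \<eta> by (intro exI[of _ "{e'}"] exI[of _ \<eta>]) auto
    then show ?thesis
      by (rule tendsto_upperbound[OF tendsto_norm[OF tendsto_diff[OF tendsto_const unit_limit]] _ U_nontrivial])
  qed
  then have "cmod (1 - cdual_apply E f) \<le> 0" by (rule field_le_epsilon[of _ 0, simplified])
  then show ?thesis by simp
qed

text \<open>Left multiplication by \<open>b\<close> is a small perturbation of the identity, so
  \<open>b y = b\<close> is solvable by a fixed point. Injectivity of that multiplication yields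
  \<open>y c = c\<close>, and then the approximate units converge to \<open>y\<close>, which makes
  it a two-sided identity of norm 1.\<close>

lemma contraction_imp_unital:
  fixes b :: 'a
  assumes nz: "(c0::'a) \<noteq> 0" and \<theta>: "0 \<le> \<theta>" "\<theta> < 1" and contr: "\<And>c. norm (c - b * c) \<le> \<theta> * norm c"
  shows "unital TYPE('a)"
proof -
  have "\<exists>!y. b + y - b * y = y"
  proof (rule banach_fix_type[of \<theta> "\<lambda>y. b + y - b * y"])
    show "\<forall>x y. dist (b + x - b * x) (b + y - b * y) \<le> \<theta> * dist x y"
      using contr[of "x - y" for x y] by (simp add: dist_norm algebra_simps)
  qed (use \<theta> in auto)
  then obtain y where "b + y - b * y = y" by blast
  then have by': "b * y = b" by (simp add: algebra_simps)
  have left: "y * c = c" for c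
  proof -
    have "b * (y * c - c) = 0" by (simp add: right_diff_distrib mult.assoc[symmetric] by')
    then have "norm (y * c - c) \<le> \<theta> * norm (y * c - c)" using contr[of "y * c - c"] by simp
    then have "(1 - \<theta>) * norm (y * c - c) \<le> 0" by (simp add: algebra_simps)
    then have "norm (y * c - c) \<le> 0" using \<theta> by (simp add: mult_le_0_iff)
    then show ?thesis by simp
  qed
  have ey: "((\<lambda>e. e) \<longlongrightarrow> y) U" using unit_tendsto(2)[of y] by (simp add: left)
  have right: "c * y = c" for c
    by (rule tendsto_unique[OF U_nontrivial tendsto_mult[OF tendsto_const ey] unit_tendsto(2)])
  have "norm y \<le> 1"
    by (rule tendsto_upperbound[OF tendsto_norm[OF ey] eventually_norm_le_1 U_nontrivial])
  moreover have "1 \<le> norm y"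
  proof -
    have "norm c0 \<le> norm y * norm c0" using norm_mult_ineq[of y c0] by (simp add: left)
    then show ?thesis using nz by simp
  qed
  ultimately show ?thesis unfolding unital_def is_identity_def using left right by (intro exI[of _ y]) auto
qed

text \<open>Otherwise \<open>- fst x / snd x\<close> would act within a factor less than 1 of the
  identity and \<open>A\<close> would be unital. So the character of \<open>A^1\<close> that kills
  \<open>A\<close> is contractive, which makes it a state.\<close>

lemma cmod_snd_le:
  assumes nz: "(c0::'a) \<noteq> 0" and nu: "\<not> unital TYPE('a)"
  shows "cmod (snd x) \<le> multiplier_norm (x :: 'a \<times> complex)"
proof (rule ccontr)
  assume "\<not> ?thesis"
  then have lt: "multiplier_norm x < cmod (snd x)" by simp
  then have l0: "snd x \<noteq> 0" using multiplier_norm_nonneg[of x] by auto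
  define \<theta> where "\<theta> = multiplier_norm x / cmod (snd x)"
  define b where "b = - (inverse (snd x) *\<^sub>C fst x)"
  have "norm (c - b * c) \<le> \<theta> * norm c" for c
  proof -
    have "c - b * c = inverse (snd x) *\<^sub>C unit_action x c"
      using l0 by (simp add: b_def unit_action_def scaleC_add_right scaleC_scaleC mult_scaleC_left)
    then have "norm (c - b * c) = norm (unit_action x c) / cmod (snd x)"
      by (simp add: norm_scaleC norm_inverse divide_inverse mult.commute)
    also have "\<dots> \<le> multiplier_norm x * norm c / cmod (snd x)"
      by (intro divide_right_mono unit_action_le_multiplier_norm) simp
    finally show ?thesis by (simp add: \<theta>_def)
  qed
  moreover have "0 \<le> \<theta>" "\<theta> < 1" using lt l0 multiplier_norm_nonneg[of x] by (auto simp: \<theta>_def)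
  ultimately show False using contraction_imp_unital[OF nz, of \<theta> b] nu by blast
qed

end

section \<open>Density statements as inequalities between support functions\<close>

text \<open>Covers both meanings of \<open>A^1\<close>: the algebra itself with the canonical
  embedding, and the pairs with \<open>embed\<close>. In either case the norm is the one induced by
  the map \<kappa> into the bidual.\<close>

locale unitization = smooth_algebra A
  for A :: "'a::complex_banach_algebra itself" +
  fixes \<kappa> :: "'v::complex_vector \<Rightarrow> 'a cdual cdual" and u :: 'v and j :: "'a \<Rightarrow> 'v"
  assumes \<kappa>_add: "\<kappa> (x + y) = \<kappa> x + \<kappa> y" and \<kappa>_scale: "\<kappa> (c *\<^sub>C x) = c *\<^sub>C \<kappa> x"
    and \<kappa>_unit: "\<kappa> u = E" and \<kappa>_j: "\<kappa> (j a) = canonical_embedding a"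
    and j_add: "j (a + b) = j a + j b" and j_scale: "j (r *\<^sub>R a) = r *\<^sub>R j a"
begin

abbreviation "\<nu> x \<equiv> norm (\<kappa> x)"
abbreviation "R \<equiv> {a. real_positive \<nu> u (j a)}"
abbreviation "FF \<equiv> {a. \<nu> (u - j a) \<le> 1}"
abbreviation "RR \<equiv> r_set_bidual TYPE('a)"
abbreviation "FFF \<equiv> F_set_bidual TYPE('a)"

lemma \<kappa>_diff: "\<kappa> (x - y) = \<kappa> x - \<kappa> y"
  using \<kappa>_add[of x "- y"] \<kappa>_scale[of "-1" y] by simp

lemma cseminorm_\<nu>: "cseminorm \<nu>"
  by (simp add: cseminorm_def \<kappa>_add \<kappa>_scale norm_triangle_ineq norm_scaleC)

lemma is_state_\<nu>_iff: "is_state \<nu> u \<omega> \<longleftrightarrow> clinear \<omega> \<and> (\<forall>x. cmod (\<omega> x) \<le> \<nu> x) \<and> \<omega> u = 1"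
  by (rule is_state_iff[OF cseminorm_\<nu>]) (simp add: \<kappa>_unit norm_E_le)

lemma \<nu>_norm: "norm (E - canonical_embedding a) = \<nu> (u - j a)"
  by (simp add: \<kappa>_diff \<kappa>_unit \<kappa>_j)

lemma j_zero: "j 0 = 0"
  using j_scale[of 0 0] by simp

lemma RR_eq: "RR = {m. real_positive norm E m}" and FFF_eq: "FFF = {m. norm (E - m) \<le> 1}"
  by (simp_all add: r_set_bidual_def F_set_bidual_def identity_of_arens)

lemma R_cone: "0 \<in> R" "a \<in> R \<Longrightarrow> b \<in> R \<Longrightarrow> a + b \<in> R" "a \<in> R \<Longrightarrow> 0 \<le> r \<Longrightarrow> r *\<^sub>R a \<in> R"
  by (auto simp: real_positive_def is_state_\<nu>_iff j_zero j_add j_scale clinearD)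

lemma RR_scale: "m \<in> RR \<Longrightarrow> 0 \<le> r \<Longrightarrow> r *\<^sub>R m \<in> RR"
  unfolding RR_eq by (auto simp: real_positive_def is_state_bidual_iff clinearD)

lemma convex_R: "convex R"
  by (rule convexI) (intro R_cone)

lemma convex_FF: "convex FF"
proof (rule convexI)
  fix a b and s t :: real assume ab: "a \<in> FF" "b \<in> FF" and st: "0 \<le> s" "0 \<le> t" "s + t = 1"
  have "E - canonical_embedding (s *\<^sub>R a + t *\<^sub>R b)
      = s *\<^sub>R (E - canonical_embedding a) + t *\<^sub>R (E - canonical_embedding b)"
    using st by (simp add: canonical_embedding_linear algebra_simps flip: scaleR_add_left)
  then have "norm (E - canonical_embedding (s *\<^sub>R a + t *\<^sub>R b)) \<le> s * 1 + t * 1"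
    using st ab norm_triangle_ineq[of "s *\<^sub>R (E - canonical_embedding a)" "t *\<^sub>R (E - canonical_embedding b)"]
      mult_left_mono[of "norm (E - canonical_embedding a)" 1 s] mult_left_mono[of "norm (E - canonical_embedding b)" 1 t]
    by (simp add: \<nu>_norm)
  then show "s *\<^sub>R a + t *\<^sub>R b \<in> FF" using st by (simp add: \<nu>_norm)
qed

lemma zero_FF: "0 \<in> FF"
  by (simp add: j_zero \<kappa>_unit norm_E_le)

lemma FF_subset: "FF \<subseteq> R"
proof (clarsimp simp: real_positive_def)
  fix a \<omega> assume a: "\<nu> (u - j a) \<le> 1" and \<omega>: "is_state \<nu> u \<omega>"
  have "cmod (\<omega> (u - j a)) \<le> \<nu> (u - j a)" using \<omega> by (simp add: is_state_\<nu>_iff)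
  then have "cmod (\<omega> (u - j a)) \<le> 1" using a by linarith
  then have "cmod (1 - \<omega> (j a)) \<le> 1" using \<omega> by (simp add: is_state_\<nu>_iff clinearD)
  then show "0 \<le> Re (\<omega> (j a))" using complex_Re_le_cmod[of "1 - \<omega> (j a)"] by simp
qed

lemma canonical_R: "canonical_embedding ` R \<subseteq> RR"
proof (clarsimp simp: RR_eq real_positive_def)
  fix a W assume a: "\<forall>\<omega>. is_state \<nu> u \<omega> \<longrightarrow> 0 \<le> Re (\<omega> (j a))" and W: "is_state norm E W"
  have "is_state \<nu> u (\<lambda>x. W (\<kappa> x))"
    using W by (simp add: is_state_\<nu>_iff is_state_bidual_iff clinear_def \<kappa>_add \<kappa>_scale \<kappa>_unit)
  then have "0 \<le> Re (W (\<kappa> (j a)))" using a by blast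
  then show "0 \<le> Re (W (canonical_embedding a))" by (simp add: \<kappa>_j)
qed

lemma canonical_FF: "canonical_embedding ` FF \<subseteq> FFF"
  by (auto simp: FFF_eq \<nu>_norm)

lemma convex_canonical: "convex S \<Longrightarrow> convex (canonical_embedding ` S)"
  by (rule convex_linear_image) (auto intro!: linearI simp: canonical_embedding_linear)

text \<open>Since both sets are cones, a finite bound for \<open>f\<close> on the smaller one can be
  sharpened to 0.\<close>

lemma dense_R_iff: "weak_star_dense (canonical_embedding ` R) RR \<longleftrightarrow>
  (\<forall>f. (\<forall>a\<in>R. Re (cdual_apply f a) \<le> 0) \<longrightarrow> (\<forall>m\<in>RR. Re (cdual_apply m f) \<le> 0))" (is "?D \<longleftrightarrow> ?P")
proof
  assume D: ?D
  show ?P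
  proof (intro allI impI ballI)
    fix f m assume f: "\<forall>a\<in>R. Re (cdual_apply f a) \<le> 0" and "m \<in> RR"
    then have "m \<in> weak_star closure_of canonical_embedding ` R" using D by (auto simp: weak_star_dense_def)
    then show "Re (cdual_apply m f) \<le> 0" by (rule weak_star_closure_Re_le) (use f in auto)
  qed
next
  assume P: ?P
  have "\<forall>m\<in>RR. Re (cdual_apply m f) \<le> c" if c: "\<forall>s\<in>canonical_embedding ` R. Re (cdual_apply s f) \<le> c" for f c
  proof -
    have c0: "0 \<le> c" using c R_cone(1) by (force simp: cdual_simps)
    have "Re (cdual_apply f a) \<le> 0" if a: "a \<in> R" for a
    proof (rule ccontr)
      assume "\<not> ?thesis"
      then have pos: "0 < Re (cdual_apply f a)" by simp
      define r where "r = (c + 1) / Re (cdual_apply f a)"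
      have "r *\<^sub>R a \<in> R" using pos c0 by (intro R_cone a) (simp add: r_def)
      then have "Re (cdual_apply f (r *\<^sub>R a)) \<le> c" using c by auto
      then show False using pos by (simp add: cdual_simps r_def)
    qed
    then show ?thesis using P c0 by force
  qed
  moreover have "canonical_embedding ` R \<noteq> {}" using R_cone(1) by blast
  ultimately show ?D using weak_star_dense_iff[OF convex_canonical[OF convex_R]] canonical_R by blast
qed

lemma dense_R_ball_iff: "weak_star_dense (canonical_embedding ` (R \<inter> cball 0 1)) (RR \<inter> cball 0 1) \<longleftrightarrow>
  (\<forall>f c. (\<forall>a\<in>R \<inter> cball 0 1. Re (cdual_apply f a) \<le> c) \<longrightarrow> (\<forall>m\<in>RR \<inter> cball 0 1. Re (cdual_apply m f) \<le> c))"
proof -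
  have "canonical_embedding ` (R \<inter> cball 0 1) \<subseteq> RR \<inter> cball 0 1"
    using canonical_R by (auto simp: norm_canonical_embedding)
  moreover have "canonical_embedding ` (R \<inter> cball 0 1) \<noteq> {}" using R_cone(1) by auto
  moreover have "convex (canonical_embedding ` (R \<inter> cball 0 1))"
    by (intro convex_canonical convex_Int convex_R convex_cball)
  ultimately show ?thesis by (subst weak_star_dense_iff) simp_all
qed

text \<open>The larger set is the ball of radius 1 about \<open>E\<close>, so the supremum of
  \<open>f\<close> over it is \<open>Re (E f) + norm f\<close>, attained at \<open>E + y\<close> for
  a norming \<open>y\<close> in the bidual.\<close>

lemma dense_F_iff: "weak_star_dense (canonical_embedding ` FF) FFF \<longleftrightarrow>
  (\<forall>f c. (\<forall>a\<in>FF. Re (cdual_apply f a) \<le> c) \<longrightarrow> Re (cdual_apply E f) + norm f \<le> c)"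
proof -
  have "(\<forall>m\<in>FFF. Re (cdual_apply m f) \<le> c) \<longleftrightarrow> Re (cdual_apply E f) + norm f \<le> c" for f c
  proof
    assume *: "\<forall>m\<in>FFF. Re (cdual_apply m f) \<le> c"
    obtain y where y: "norm y \<le> 1" "cdual_apply y f = of_real (norm f)" by (rule norming_functional)
    have "E + y \<in> FFF" using y by (simp add: FFF_eq)
    then show "Re (cdual_apply E f) + norm f \<le> c" using * y by (force simp: cdual_fun_simps)
  next
    assume *: "Re (cdual_apply E f) + norm f \<le> c"
    show "\<forall>m\<in>FFF. Re (cdual_apply m f) \<le> c"
    proof
      fix m assume "m \<in> FFF"
      then have "norm (m - E) \<le> 1" by (simp add: FFF_eq norm_minus_commute)
      then have "cmod (cdual_apply (m - E) f) \<le> norm f"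
        using cdual_apply_bound[of "m - E" f] mult_right_mono[of "norm (m - E)" 1 "norm f"] by simp
      then have "Re (cdual_apply (m - E) f) \<le> norm f" using complex_Re_le_cmod order_trans by blast
      then show "Re (cdual_apply m f) \<le> c" using * by (simp add: cdual_fun_simps)
    qed
  qed
  then show ?thesis
    using canonical_FF zero_FF by (subst weak_star_dense_iff[OF convex_canonical[OF convex_FF]]) auto
qed

lemma dense_R_ball_imp_dense_R:
  assumes "weak_star_dense (canonical_embedding ` (R \<inter> cball 0 1)) (RR \<inter> cball 0 1)"
  shows "weak_star_dense (canonical_embedding ` R) RR"
  unfolding dense_R_iff
proof (intro allI impI ballI)
  fix f m assume f: "\<forall>a\<in>R. Re (cdual_apply f a) \<le> 0" and m: "m \<in> RR"
  define r where "r = 1 / (norm m + 1)"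
  have r: "0 < r" "r * norm m \<le> 1" by (auto simp: r_def add_nonneg_pos divide_le_eq)
  have "r *\<^sub>R m \<in> RR \<inter> cball 0 1" using RR_scale[OF m, of r] r by simp
  then have "Re (cdual_apply (r *\<^sub>R m) f) \<le> 0"
    using assms[unfolded dense_R_ball_iff, rule_format, of f 0] f by auto
  then show "Re (cdual_apply m f) \<le> 0" using r by (simp add: cdual_fun_simps mult_le_0_iff)
qed

text \<open>The polar of the cone R intersected with the unit ball is the sum of the polars.\<close>

lemma dense_R_imp_dense_R_ball:
  assumes "weak_star_dense (canonical_embedding ` R) RR"
  shows "weak_star_dense (canonical_embedding ` (R \<inter> cball 0 1)) (RR \<inter> cball 0 1)"
  unfolding dense_R_ball_iff
proof (intro allI impI ballI)
  fix f c m assume f: "\<forall>a\<in>R \<inter> cball 0 1. Re (cdual_apply f a) \<le> c" and m: "m \<in> RR \<inter> cball 0 1"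
  have "0 \<in> R \<inter> cball 0 1" using R_cone(1) by simp
  then have "Re (cdual_apply f 0) \<le> c" using f by blast
  then have c: "0 \<le> c" by (simp add: cdual_simps)
  \<comment> \<open>The extra real coordinate records the value of \<open>f\<close>. A linear
    functional below \<open>q\<close> and nonnegative on \<open>Y\<close> restricts on
    \<open>A\<close> to some \<open>h\<close> with \<open>f \<le> h\<close> on the cone and
    \<open>h \<le> c\<close> times the norm, which is the required splitting of
    \<open>f\<close>.\<close>
  define q where "q = (\<lambda>(x::'a, r::real). c * norm x + r)"
  have q: "sublinear q"
  proof (rule sublinearI)
    fix x y :: "'a \<times> real"
    have "c * norm (fst x + fst y) \<le> c * (norm (fst x) + norm (fst y))" by (intro mult_left_mono c norm_triangle_ineq)
    then show "q (x + y) \<le> q x + q y" by (simp add: q_def split_beta algebra_simps)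
  qed (auto simp: q_def split_beta algebra_simps)
  define Y where "Y = (\<lambda>b. (b, - Re (cdual_apply f b))) ` R"
  have "convex Y"
    unfolding Y_def by (intro convex_linear_image convex_R) (auto intro!: linearI simp: cdual_simps)
  moreover have "Y \<noteq> {}" using R_cone(1) unfolding Y_def by blast
  moreover have "0 \<le> q y" if yY: "y \<in> Y" for y
  proof -
    obtain b where b: "b \<in> R" "y = (b, - Re (cdual_apply f b))" using yY by (auto simp: Y_def)
    show ?thesis
    proof (cases "b = 0")
      case False
      have "(1 / norm b) *\<^sub>R b \<in> R \<inter> cball 0 1" using R_cone(3)[OF b(1), of "1 / norm b"] False by simp
      then have "Re (cdual_apply f ((1 / norm b) *\<^sub>R b)) \<le> c" using f by blast
      then show ?thesis using False by (simp add: b(2) q_def cdual_simps field_simps)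
    qed (simp add: b(2) q_def cdual_simps)
  qed
  ultimately obtain L where L: "linear L" "\<And>x. L x \<le> q x" "\<And>y. y \<in> Y \<Longrightarrow> 0 \<le> L y"
    using hahn_banach_convex[OF q] by metis
  define h where "h x = L (x, 0)" for x
  have h: "linear h"
  proof (rule linearI)
    show "h (x + y) = h x + h y" for x y using linear_add[OF L(1), of "(x, 0)" "(y, 0)"] by (simp add: h_def)
    show "h (r *\<^sub>R x) = r *\<^sub>R h x" for r x using linear_scale[OF L(1), of r "(x, 0)"] by (simp add: h_def)
  qed
  have L01: "L (0, r) = r" for r
    using L(2)[of "(0, r)"] L(2)[of "(0, - r)"] linear_neg[OF L(1), of "(0, r)"] by (simp add: q_def)
  have hb: "h x \<le> c * norm x" for x using L(2)[of "(x, 0)"] by (simp add: h_def q_def)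
  have hf: "Re (cdual_apply f b) \<le> h b" if "b \<in> R" for b
  proof -
    have "0 \<le> L (b, - Re (cdual_apply f b))" using that by (intro L) (auto simp: Y_def)
    also have "(b, - Re (cdual_apply f b)) = (b, 0) + (0, - Re (cdual_apply f b))" by simp
    also have "L \<dots> = h b - Re (cdual_apply f b)" by (simp only: linear_add[OF L(1)] L01 h_def)
    finally show ?thesis by simp
  qed
  obtain H where H: "clinear H" "\<And>x. Re (H x) = h x" using complexification[OF h] by metis
  have s: "cseminorm (\<lambda>x::'a. c * norm x)"
    using c by (simp add: cseminorm_def norm_scaleC norm_triangle_ineq mult_left_mono flip: distrib_left)
  have Hb: "cmod (H x) \<le> c * norm x" for x
    using hb H by (intro clinear_phase[OF H(1) _ s]) simp
  obtain g where g: "cdual_apply g = H" using cdual_ex[OF H(1) Hb] by metis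
  have ng: "norm g \<le> c" using Hb c by (intro cdual_norm_le) (auto simp: g)
  have "\<forall>a\<in>R. Re (cdual_apply (f - g) a) \<le> 0" using hf H(2) by (auto simp: cdual_fun_simps g)
  then have "Re (cdual_apply m (f - g)) \<le> 0" using assms m unfolding dense_R_iff by blast
  then have "Re (cdual_apply m f) \<le> Re (cdual_apply m g)" by (simp add: cdual_simps)
  also have "\<dots> \<le> norm m * norm g" using complex_Re_le_cmod cdual_apply_bound order_trans by blast
  also have "\<dots> \<le> 1 * c" using m ng by (intro mult_mono) auto
  finally show "Re (cdual_apply m f) \<le> c" by simp
qed

text \<open>If \<open>f \<le> 0\<close> on the cone, density with bound 0 forces
  \<open>E f = - norm f\<close>. Hence evaluation at \<open>- f / norm f\<close> is a state of the
  bidual and is nonnegative on its accretive elements.\<close>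

lemma dense_F_imp_dense_R:
  assumes "weak_star_dense (canonical_embedding ` FF) FFF"
  shows "weak_star_dense (canonical_embedding ` R) RR"
  unfolding dense_R_iff
proof (intro allI impI ballI)
  fix f m assume f: "\<forall>a\<in>R. Re (cdual_apply f a) \<le> 0" and m: "m \<in> RR"
  have "\<forall>a\<in>FF. Re (cdual_apply f a) \<le> 0" using f FF_subset by blast
  then have le: "Re (cdual_apply E f) + norm f \<le> 0" using assms unfolding dense_F_iff by blast
  show "Re (cdual_apply m f) \<le> 0"
  proof (cases "f = 0")
    case False
    have "Re (cdual_apply E f) = - norm f" and "Im (cdual_apply E f) = 0"
    proof -
      have E: "cmod (cdual_apply E f) \<le> norm f" by (rule cmod_E_le)
      then show *: "Re (cdual_apply E f) = - norm f" using le abs_Re_le_cmod[of "cdual_apply E f"] by linarith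
      have "(Re (cdual_apply E f))\<^sup>2 + (Im (cdual_apply E f))\<^sup>2 \<le> (norm f)\<^sup>2"
        using power_mono[OF E, of 2] by (simp add: cmod_power2)
      then show "Im (cdual_apply E f) = 0" by (simp add: *)
    qed
    then have E: "cdual_apply E f = - of_real (norm f)" by (simp add: complex_eq_iff)
    define W where "W x = - cdual_apply x f / of_real (norm f)" for x
    have "is_state norm E W"
      unfolding is_state_bidual_iff
    proof (intro conjI allI)
      show "clinear W" by (simp add: clinear_def W_def cdual_fun_simps add_divide_distrib diff_divide_distrib)
      show "cmod (W x) \<le> norm x" for x
        using cdual_apply_bound[of x f] False by (simp add: W_def norm_divide field_simps)
      show "W E = 1" using False by (simp add: W_def E)
    qed
    then have "0 \<le> Re (W m)" using m by (auto simp: RR_eq real_positive_def)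
    then show ?thesis using False by (simp add: W_def zero_le_divide_iff divide_le_0_iff)
  qed (simp add: cdual_simps)
qed

end

section \<open>Almost hermitian units and approximate resolvents\<close>

text \<open>Inequality up to a null sequence; neither side is assumed to converge.\<close>

definition lim_le :: "(nat \<Rightarrow> real) \<Rightarrow> (nat \<Rightarrow> real) \<Rightarrow> bool"  (infix "\<lessapprox>" 50)
  where "f \<lessapprox> g \<longleftrightarrow> (\<forall>\<epsilon>>0. \<forall>\<^sub>F n in sequentially. f n \<le> g n + \<epsilon>)"

lemma lim_leI: "(\<And>\<epsilon>. 0 < \<epsilon> \<Longrightarrow> \<forall>\<^sub>F n in sequentially. f n \<le> g n + \<epsilon>) \<Longrightarrow> f \<lessapprox> g"
  by (simp add: lim_le_def)

lemma lim_leD: "f \<lessapprox> g \<Longrightarrow> 0 < \<epsilon> \<Longrightarrow> \<forall>\<^sub>F n in sequentially. f n \<le> g n + \<epsilon>"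
  by (simp add: lim_le_def)

lemma lim_le_error:
  assumes "e \<longlonglongrightarrow> 0" "\<And>n. f n \<le> g n + e n"
  shows "f \<lessapprox> g"
proof (rule lim_leI)
  fix \<epsilon> :: real assume "0 < \<epsilon>"
  then have "\<forall>\<^sub>F n in sequentially. e n < \<epsilon>" using assms(1) by (auto dest: order_tendstoD(2))
  then show "\<forall>\<^sub>F n in sequentially. f n \<le> g n + \<epsilon>"
    by eventually_elim (use assms(2) in \<open>smt (verit)\<close>)
qed

lemma lim_le_refl: "(\<And>n. f n \<le> g n) \<Longrightarrow> f \<lessapprox> g"
  by (rule lim_le_error[where e = "\<lambda>_. 0"]) auto

lemma lim_le_trans [trans]:
  assumes "f \<lessapprox> g" "g \<lessapprox> h"
  shows "f \<lessapprox> h"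
proof (rule lim_leI)
  fix \<epsilon> :: real assume "0 < \<epsilon>"
  then have "0 < \<epsilon> / 2" by simp
  from lim_leD[OF assms(1) this] lim_leD[OF assms(2) this]
  show "\<forall>\<^sub>F n in sequentially. f n \<le> h n + \<epsilon>" by eventually_elim simp
qed

lemma lim_le_add:
  assumes "f \<lessapprox> g" "f' \<lessapprox> g'"
  shows "(\<lambda>n. f n + f' n) \<lessapprox> (\<lambda>n. g n + g' n)"
proof (rule lim_leI)
  fix \<epsilon> :: real assume "0 < \<epsilon>"
  then have "0 < \<epsilon> / 2" by simp
  from lim_leD[OF assms(1) this] lim_leD[OF assms(2) this]
  show "\<forall>\<^sub>F n in sequentially. f n + f' n \<le> g n + g' n + \<epsilon>" by eventually_elim simp
qed

lemma lim_le_tendsto: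
  assumes "f \<lessapprox> g" "g \<lessapprox> f"
  shows "(\<lambda>n. f n - g n) \<longlonglongrightarrow> 0"
proof (rule tendstoI)
  fix \<epsilon> :: real assume "0 < \<epsilon>"
  then have "0 < \<epsilon> / 2" by simp
  from lim_leD[OF assms(1) this] lim_leD[OF assms(2) this]
  show "\<forall>\<^sub>F n in sequentially. dist (f n - g n) 0 < \<epsilon>"
    by eventually_elim (use \<open>0 < \<epsilon>\<close> in \<open>auto simp: dist_real_def\<close>)
qed

lemma tendsto_0_le:
  fixes f :: "nat \<Rightarrow> real"
  assumes "g \<longlonglongrightarrow> 0" "\<And>n. 0 \<le> f n" "\<And>n. f n \<le> g n"
  shows "f \<longlonglongrightarrow> 0"
  using tendsto_sandwich[OF _ _ tendsto_const assms(1), of f] assms(2,3) by auto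

section \<open>Multiplication in the unitization and seminorms on pairs\<close>

definition umul :: "'a::complex_banach_algebra \<times> complex \<Rightarrow> 'a \<times> complex \<Rightarrow> 'a \<times> complex"
  where "umul x y = (fst x * fst y + snd x *\<^sub>C fst y + snd y *\<^sub>C fst x, snd x * snd y)"

lemma unit_action_umul: "unit_action (umul x y) c = unit_action x (unit_action y c)"
  by (simp add: unit_action_def umul_def distrib_left distrib_right mult_scaleC_left mult_scaleC_right
      scaleC_add_right scaleC_scaleC mult.assoc)

lemma umul_linear:
  "umul x (y + z) = umul x y + umul x z" "umul x (y - z) = umul x y - umul x z"
  "umul x (c *\<^sub>C y) = c *\<^sub>C umul x y" "umul x (0, 1) = x"
  by (simp_all add: umul_def prod_eq_iff scaleC_prod_def scaleC_complex_def distrib_left right_diff_distrib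
      scaleC_add_left scaleC_add_right scaleC_diff_right scaleC_diff_left scaleC_scaleC mult_scaleC_right mult.commute)

lemma multiplier_norm_umul: "multiplier_norm (umul x y) \<le> multiplier_norm x * multiplier_norm y"
proof (rule multiplier_norm_le)
  fix c :: 'a assume c: "norm c \<le> 1"
  have "norm (unit_action (umul x y) c) \<le> multiplier_norm x * norm (unit_action y c)"
    unfolding unit_action_umul by (rule unit_action_le_multiplier_norm)
  also have "\<dots> \<le> multiplier_norm x * (multiplier_norm y * norm c)"
    by (intro mult_left_mono unit_action_le_multiplier_norm multiplier_norm_nonneg)
  also have "\<dots> \<le> multiplier_norm x * (multiplier_norm y * 1)"
    using c by (intro mult_left_mono multiplier_norm_nonneg)
  finally show "norm (unit_action (umul x y) c) \<le> multiplier_norm x * multiplier_norm y" by simp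
qed (simp add: multiplier_norm_nonneg)

text \<open>Abstracts \<open>y \<mapsto> N (T (fst y) \<zeta> + T (snd y) w)\<close>: with a base
  vector \<zeta> and a direction \<open>w\<close>, a pair of algebra elements describes a point and
  a displacement. Left multiplication acts on both at once.\<close>

definition module_seminorm :: "('a::complex_banach_algebra \<times> 'a \<Rightarrow> real) \<Rightarrow> real \<Rightarrow> bool"
  where "module_seminorm \<mu> K \<longleftrightarrow> cseminorm \<mu> \<and> (\<forall>y. \<mu> y \<le> K * (norm (fst y) + norm (snd y))) \<and>
    (\<forall>a y. \<mu> (a * fst y, a * snd y) \<le> norm a * \<mu> y)"

lemma scaleC_Pair: "c *\<^sub>C (a, b) = (c *\<^sub>C a, c *\<^sub>C b)"
  and fst_scaleC: "fst (c *\<^sub>C x) = c *\<^sub>C fst x" and snd_scaleC: "snd (c *\<^sub>C x) = c *\<^sub>C snd x"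
  by (simp_all add: scaleC_prod_def)

definition act2 :: "'a::complex_banach_algebra \<times> complex \<Rightarrow> 'a \<times> 'a \<Rightarrow> 'a \<times> 'a"
  where "act2 x y = (unit_action x (fst y), unit_action x (snd y))"

lemma act2_linear:
  "act2 (x + x') y = act2 x y + act2 x' y" "act2 (c *\<^sub>C x) y = c *\<^sub>C act2 x y"
  "act2 x (y + z) = act2 x y + act2 x z" "act2 x (y - z) = act2 x y - act2 x z"
  "act2 x (c *\<^sub>C y) = c *\<^sub>C act2 x y" "act2 (0, 1) y = y"
  by (simp_all add: act2_def unit_action_linear scaleC_Pair fst_scaleC snd_scaleC) (simp_all add: unit_action_def)

context smooth_algebra
begin

text \<open>On the two given components \<open>x\<close> acts almost like its compression
  \<open>unit_action x e\<close>, which lies in \<open>A\<close> and has norm at most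
  \<open>multiplier_norm x\<close>; the bound by \<open>K\<close> absorbs the difference.\<close>

lemma module_seminorm_act2:
  assumes \<mu>: "module_seminorm \<mu> K" and K: "0 \<le> K"
  shows "\<mu> (act2 x y) \<le> multiplier_norm (x :: 'a \<times> complex) * \<mu> y"
proof (rule field_le_epsilon)
  fix r :: real assume r: "0 < r"
  have s: "cseminorm \<mu>" and bd: "\<And>y. \<mu> y \<le> K * (norm (fst y) + norm (snd y))"
    and md: "\<And>a y. \<mu> (a * fst y, a * snd y) \<le> norm a * \<mu> y"
    using \<mu> by (auto simp: module_seminorm_def)
  have lim: "((\<lambda>e. norm (unit_action x (c - e * c))) \<longlongrightarrow> 0) U" for c
  proof -
    have "((\<lambda>e. (norm (fst x) + cmod (snd x)) * norm (c - e * c)) \<longlongrightarrow> (norm (fst x) + cmod (snd x)) * norm (c - c)) U"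
      by (intro tendsto_intros unit_tendsto)
    then have "((\<lambda>e. (norm (fst x) + cmod (snd x)) * norm (c - e * c)) \<longlongrightarrow> 0) U" by simp
    then show ?thesis
      by (rule tendsto_sandwich[OF _ _ tendsto_const, rotated 2]) (auto intro!: always_eventually unit_action_bound)
  qed
  have "((\<lambda>e. K * (norm (unit_action x (fst y - e * fst y)) + norm (unit_action x (snd y - e * snd y)))) \<longlongrightarrow> K * (0 + 0)) U"
    by (intro tendsto_intros lim)
  then have "\<forall>\<^sub>F e in U. K * (norm (unit_action x (fst y - e * fst y)) + norm (unit_action x (snd y - e * snd y))) < r"
    using r by (auto dest: order_tendstoD(2))
  with eventually_norm_le_1
  have "\<forall>\<^sub>F e in U. norm e \<le> 1 \<and> K * (norm (unit_action x (fst y - e * fst y)) + norm (unit_action x (snd y - e * snd y))) < r"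
    by eventually_elim simp
  then obtain e where e: "norm e \<le> 1" "K * (norm (unit_action x (fst y - e * fst y)) + norm (unit_action x (snd y - e * snd y))) < r"
    by (rule exists_unit) blast
  define b where "b = unit_action x e"
  have nb: "norm b \<le> multiplier_norm x"
    using unit_action_le_multiplier_norm[of x e] e(1) mult_left_le[of "norm e" "multiplier_norm x"]
    by (simp add: b_def multiplier_norm_nonneg)
  have "\<mu> (act2 x y) \<le> \<mu> (b * fst y, b * snd y) + \<mu> (act2 x y - (b * fst y, b * snd y))"
    by (rule cseminormD(8)[OF s])
  also have "act2 x y - (b * fst y, b * snd y) = (unit_action x (fst y - e * fst y), unit_action x (snd y - e * snd y))"
    by (simp add: act2_def b_def unit_action_linear)
  also have "\<mu> \<dots> \<le> K * (norm (unit_action x (fst y - e * fst y)) + norm (unit_action x (snd y - e * snd y)))"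
    using bd[of "(unit_action x (fst y - e * fst y), unit_action x (snd y - e * snd y))"] by simp
  also have "\<mu> (b * fst y, b * snd y) \<le> multiplier_norm x * \<mu> y"
    using md[of b y] mult_right_mono[OF nb cseminormD(6)[OF s]] by (rule order_trans)
  finally show "\<mu> (act2 x y) \<le> multiplier_norm x * \<mu> y + r" using e(2) by linarith
qed

lemma exp_i_error:
  fixes \<tau> :: real
  shows "cmod (exp (\<i> * of_real \<tau>) - 1 - \<i> * of_real \<tau>) \<le> \<tau>\<^sup>2"
  using Taylor_exp[of "\<i> * of_real \<tau>" 1] by (simp add: norm_mult power2_eq_square diff_diff_eq)

text \<open>If $h$ were a hermitian idempotent, $e^{i\theta h}$ would be an isometry mapping $y + z$ to
  $e^{i\theta} y + z$; here the rotation is carried out in small steps $1 + i\tau h$.\<close>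

lemma quarter_turn:
  fixes h :: 'a
  assumes nz: "(c0::'a) \<noteq> 0" and \<mu>: "module_seminorm \<mu> K" and K: "0 \<le> K" and \<delta>: "0 < \<delta>"
    and h: "\<And>\<omega>. is_state multiplier_norm (0, 1) \<omega> \<Longrightarrow> Re (\<omega> (\<i> *\<^sub>C h, 0)) < \<delta>"
  shows "\<mu> (\<i> *\<^sub>C y + z) \<le> exp (2 * \<delta>) * (\<mu> (y + z) + 2 * (\<mu> (act2 (h, 0) y - y) + \<mu> (act2 (h, 0) z)))"
proof (rule field_le_epsilon)
  fix r :: real assume r: "0 < r"
  have s: "cseminorm \<mu>" using \<mu> by (simp add: module_seminorm_def)
  note \<mu>D = cseminormD[OF s]
  have "\<exists>\<tau>0>0. \<forall>\<tau>. 0 < \<tau> \<and> \<tau> \<le> \<tau>0 \<longrightarrow>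
      multiplier_norm ((0, 1) + \<tau> *\<^sub>R (\<i> *\<^sub>C h, 0)) \<le> 1 + \<tau> * \<delta>"
    by (rule states_bound_imp_norm[OF cseminorm_multiplier_norm multiplier_norm_one[OF nz]]) (rule h)
  then obtain \<tau>0 where \<tau>0: "\<tau>0 > 0" and nu: "\<And>\<tau>. 0 < \<tau> \<Longrightarrow> \<tau> \<le> \<tau>0 \<Longrightarrow>
      multiplier_norm ((0, 1) + \<tau> *\<^sub>R (\<i> *\<^sub>C h, 0)) \<le> 1 + \<tau> * \<delta>"
    by blast
  define k where "k = \<mu> (act2 (h, 0) y - y) + \<mu> (act2 (h, 0) z)"
  have k0: "0 \<le> k" by (simp add: k_def \<mu>D(6))
  \<comment> \<open>Bounds the second-order errors accumulated over all steps, divided by \<tau>;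
    the steps are then made so short that their total contribution is at most
    \<open>r\<close>.\<close>
  define C where "C = exp (2 * \<delta>) * (2 * \<mu> y)"
  have C0: "0 \<le> C" by (simp add: C_def \<mu>D(6))
  define b where "b = min \<tau>0 (r / (C + 1))"
  have b: "0 < b" using \<tau>0 r C0 by (simp add: b_def)
  obtain m :: nat where m: "pi / 2 / b < real m" using reals_Archimedean2 by blast
  have m0: "0 < m" using m b pi_gt_zero by (intro Nat.gr0I) (auto simp: divide_less_0_iff)
  define \<tau> where "\<tau> = pi / 2 / real m"
  have \<tau>: "0 < \<tau>" "\<tau> \<le> b" "real m * \<tau> = pi / 2"
    using m m0 b by (auto simp: \<tau>_def field_simps)
  have \<tau>': "\<tau> \<le> \<tau>0" "\<tau> * (C + 1) \<le> r" using \<tau>(2) C0 by (auto simp: b_def field_simps add_nonneg_pos)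
  define c where "c j = exp (\<i> * of_real (real j * \<tau>))" for j
  have c1: "cmod (c j) = 1" for j by (simp add: c_def)
  have cs: "c (Suc j) = exp (\<i> * of_real \<tau>) * c j" for j
    by (simp add: c_def exp_add[symmetric] algebra_simps)
  define G where "G j = \<mu> (c j *\<^sub>C y + z)" for j
  have step: "G (Suc j) \<le> (1 + \<tau> * \<delta>) * G j + \<tau> * (k + \<tau> * \<mu> y)" for j
  proof -
    define x where "x = (0, 1) + \<tau> *\<^sub>R (\<i> *\<^sub>C h, 0 :: complex)"
    have x: "act2 x v = v + (of_real \<tau> * \<i>) *\<^sub>C act2 (h, 0) v" for v
      by (simp add: x_def act2_def unit_action_def prod_eq_iff scaleC_prod_def scaleR_scaleC scaleC_scaleC mult_scaleC_left)
    \<comment> \<open>The exact rotation differs from \<open>1 + \<i> \<tau> h\<close> by the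
      quadratic error of the exponential, by the failure of \<open>h\<close> to fix
      \<open>y\<close>, and by its failure to annihilate \<open>z\<close>.\<close>
    define t1 t2 t3 where "t1 = ((exp (\<i> * of_real \<tau>) - 1 - \<i> * of_real \<tau>) * c j) *\<^sub>C y"
      and "t2 = (of_real \<tau> * \<i> * c j) *\<^sub>C (act2 (h, 0) y - y)" and "t3 = (of_real \<tau> * \<i>) *\<^sub>C act2 (h, 0) z"
    have "c (Suc j) *\<^sub>C y + z = act2 x (c j *\<^sub>C y + z) + (t1 - t2 - t3)"
      by (simp add: x cs act2_linear t1_def t2_def t3_def scaleC_add_right scaleC_diff_right scaleC_scaleC
          scaleC_diff_left scaleC_add_left algebra_simps)
    then have "G (Suc j) \<le> \<mu> (act2 x (c j *\<^sub>C y + z)) + \<mu> (t1 - t2 - t3)"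
      unfolding G_def by (simp only: \<mu>D(1))
    also have "\<mu> (act2 x (c j *\<^sub>C y + z)) \<le> multiplier_norm x * G j"
      unfolding G_def by (rule module_seminorm_act2[OF \<mu> K])
    also have "\<dots> \<le> (1 + \<tau> * \<delta>) * G j"
      unfolding x_def G_def using nu[OF \<tau>(1) \<tau>'(1)] by (intro mult_right_mono \<mu>D(6))
    also have "\<mu> (t1 - t2 - t3) \<le> \<mu> t1 + \<mu> t2 + \<mu> t3"
      using \<mu>D(7)[of "t1 - t2" t3] \<mu>D(7)[of t1 t2] by linarith
    also have "\<mu> t1 \<le> \<tau>\<^sup>2 * \<mu> y"
      unfolding t1_def \<mu>D(2) using exp_i_error[of \<tau>] by (intro mult_right_mono \<mu>D(6)) (simp add: norm_mult c1)
    also have "\<mu> t2 = \<tau> * \<mu> (act2 (h, 0) y - y)" unfolding t2_def \<mu>D(2) using \<tau> by (simp add: norm_mult c1)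
    also have "\<mu> t3 = \<tau> * \<mu> (act2 (h, 0) z)" unfolding t3_def \<mu>D(2) using \<tau> by (simp add: norm_mult)
    finally show ?thesis by (simp add: k_def power2_eq_square algebra_simps)
  qed
  have "G j \<le> (1 + \<tau> * \<delta>) ^ j * (G 0 + real j * \<tau> * (k + \<tau> * \<mu> y))" for j
  proof (induction j)
    case (Suc j)
    have ge1: "1 \<le> (1 + \<tau> * \<delta>) ^ Suc j" using \<tau> \<delta> by (intro one_le_power) simp
    have nn: "0 \<le> \<tau> * (k + \<tau> * \<mu> y)" using \<tau> k0 \<mu>D(6) by simp
    have "G (Suc j) \<le> (1 + \<tau> * \<delta>) * ((1 + \<tau> * \<delta>) ^ j * (G 0 + real j * \<tau> * (k + \<tau> * \<mu> y))) + 1 * (\<tau> * (k + \<tau> * \<mu> y))"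
      using step[of j] mult_left_mono[OF Suc.IH, of "1 + \<tau> * \<delta>"] \<tau> \<delta> by simp
    also have "\<dots> \<le> (1 + \<tau> * \<delta>) ^ Suc j * (G 0 + real j * \<tau> * (k + \<tau> * \<mu> y)) + (1 + \<tau> * \<delta>) ^ Suc j * (\<tau> * (k + \<tau> * \<mu> y))"
      using mult_right_mono[OF ge1 nn] by simp
    also have "\<dots> = (1 + \<tau> * \<delta>) ^ Suc j * (G 0 + real (Suc j) * \<tau> * (k + \<tau> * \<mu> y))"
      by (simp add: algebra_simps)
    finally show ?case .
  qed simp
  from this[of m] have "G m \<le> (1 + \<tau> * \<delta>) ^ m * (G 0 + pi / 2 * (k + \<tau> * \<mu> y))" by (simp only: \<tau>(3))
  also have "(1 + \<tau> * \<delta>) ^ m \<le> exp (\<tau> * \<delta>) ^ m" using \<tau> \<delta> by (intro power_mono exp_ge_add_one_self) auto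
  also have "exp (\<tau> * \<delta>) ^ m = exp (pi / 2 * \<delta>)"
    unfolding exp_of_nat_mult[symmetric] \<tau>(3)[symmetric] by (simp add: mult.assoc)
  \<comment> \<open>The total angle is pi/2 < 2; this is the origin of both factors 2 in the
    conclusion.\<close>
  also have "exp (pi / 2 * \<delta>) \<le> exp (2 * \<delta>)" using pi_half_less_two \<delta> by simp
  also have "G 0 + pi / 2 * (k + \<tau> * \<mu> y) \<le> G 0 + 2 * (k + \<tau> * \<mu> y)"
    using pi_half_less_two k0 \<tau> \<mu>D(6) by (intro add_left_mono mult_right_mono) auto
  finally have "G m \<le> exp (2 * \<delta>) * (G 0 + 2 * (k + \<tau> * \<mu> y))"
    using k0 \<tau> \<mu>D(6) by (simp add: G_def mult_left_mono mult_right_mono)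
  moreover have "c m = \<i>"
  proof -
    have "c m = cis (pi / 2)" by (simp only: c_def \<tau>(3) cis_conv_exp)
    then show ?thesis by simp
  qed
  then have "G m = \<mu> (\<i> *\<^sub>C y + z)" by (simp add: G_def)
  moreover have "G 0 = \<mu> (y + z)" by (simp add: G_def c_def)
  ultimately have "\<mu> (\<i> *\<^sub>C y + z) \<le> exp (2 * \<delta>) * (\<mu> (y + z) + 2 * k) + \<tau> * C"
    by (simp add: C_def algebra_simps)
  also have "\<tau> * C \<le> r" using \<tau>'(2) \<tau>(1) by (simp add: algebra_simps)
  finally show "\<mu> (\<i> *\<^sub>C y + z) \<le> exp (2 * \<delta>) * (\<mu> (y + z) + 2 * (\<mu> (act2 (h, 0) y - y) + \<mu> (act2 (h, 0) z))) + r"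
    by (simp add: k_def)
qed

text \<open>A minimax argument: were there a bad state for every unit in the convex set, separation
  would give one state bad for all of them, and passing to the limit along the units would
  contradict the inequality at \<open>E\<close>. So an inequality valid at \<open>E\<close> for each
  state is achieved, up to \<delta>0, by one unit uniformly in the states.\<close>

lemma select_unit:
  assumes nz: "(c0::'a) \<noteq> 0" and S: "finite S" "0 < \<delta>" and \<delta>0: "0 < \<delta>0"
    and le: "\<And>\<omega> f. is_state multiplier_norm (0, 1) \<omega> \<Longrightarrow> (\<And>a. cdual_apply f a = \<omega> (a, 0)) \<Longrightarrow>
      Re (z * cdual_apply E f + cdual_apply f x0) \<le> 0"
  shows "\<exists>h\<in>approx_units S \<delta>. \<forall>\<omega>. is_state multiplier_norm (0, 1) \<omega> \<longrightarrow> Re (\<omega> (z *\<^sub>C h + x0, 0)) \<le> \<delta>0"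
proof (rule ccontr)
  assume "\<not> ?thesis"
  then have no: "\<exists>\<omega>. is_state multiplier_norm (0, 1) \<omega> \<and> \<delta>0 < Re (\<omega> (z *\<^sub>C h + x0, 0))" if "h \<in> approx_units S \<delta>" for h
    using that by (auto simp: not_le)
  define Y where "Y = (\<lambda>h. (z *\<^sub>C h + x0, 0 :: complex)) ` approx_units S \<delta>"
  have "convex Y"
  proof (rule convexI)
    fix a b and s t :: real assume "a \<in> Y" "b \<in> Y" and st: "0 \<le> s" "0 \<le> t" "s + t = 1"
    then obtain h h' where h: "h \<in> approx_units S \<delta>" "a = (z *\<^sub>C h + x0, 0)" "h' \<in> approx_units S \<delta>" "b = (z *\<^sub>C h' + x0, 0)"
      by (auto simp: Y_def)
    have "s *\<^sub>R h + t *\<^sub>R h' \<in> approx_units S \<delta>" using h st by (intro convexD[OF convex_approx_units]) auto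
    moreover have "s *\<^sub>R a + t *\<^sub>R b = (z *\<^sub>C (s *\<^sub>R h + t *\<^sub>R h') + x0, 0)"
    proof -
      have "s *\<^sub>R (z *\<^sub>C h + x0) + t *\<^sub>R (z *\<^sub>C h' + x0) = z *\<^sub>C (s *\<^sub>R h + t *\<^sub>R h') + (s *\<^sub>R x0 + t *\<^sub>R x0)"
        by (simp add: scaleC_add_right scaleR_scaleC_commute scaleR_add_right)
      moreover have "s *\<^sub>R x0 + t *\<^sub>R x0 = x0" using st by (simp flip: scaleR_add_left)
      ultimately show ?thesis by (simp add: h)
    qed
    ultimately show "s *\<^sub>R a + t *\<^sub>R b \<in> Y" unfolding Y_def by blast
  qed
  moreover have "Y \<noteq> {}" using approx_units_nonempty[OF approximately_unital S] by (auto simp: Y_def)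
  moreover have "1 + \<tau> * \<delta>0 \<le> multiplier_norm ((0, 1) + \<tau> *\<^sub>R y)" if y: "y \<in> Y" "0 < \<tau>" for y \<tau>
  proof -
    obtain \<omega> where \<omega>: "is_state multiplier_norm (0, 1) \<omega>" "\<delta>0 < Re (\<omega> y)" using y(1) no by (auto simp: Y_def)
    then have w: "clinear \<omega>" "cmod (\<omega> ((0, 1) + \<tau> *\<^sub>R y)) \<le> multiplier_norm ((0, 1) + \<tau> *\<^sub>R y)" "\<omega> (0, 1) = 1"
      unfolding is_state_multiplier_iff by blast+
    have "1 + \<tau> * \<delta>0 \<le> Re (\<omega> ((0, 1) + \<tau> *\<^sub>R y))"
      using \<omega>(2) y(2) unfolding clinearD[OF w(1)] w(3) by simp
    then show ?thesis using w(2) complex_Re_le_cmod[of "\<omega> ((0, 1) + \<tau> *\<^sub>R y)"] by linarith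
  qed
  ultimately obtain \<omega> where \<omega>: "is_state multiplier_norm (0, 1) \<omega>" "\<And>y. y \<in> Y \<Longrightarrow> \<delta>0 \<le> Re (\<omega> y)"
    using states_separation[OF cseminorm_multiplier_norm multiplier_norm_one[OF nz], of Y \<delta>0] by metis
  have lin: "clinear \<omega>" and b: "\<And>x. cmod (\<omega> x) \<le> multiplier_norm x" using \<omega>(1) by (auto simp: is_state_multiplier_iff)
  obtain f where f: "\<And>a. cdual_apply f a = \<omega> (a, 0)" using cdual_of_functional[OF lin b] by metis
  have "((\<lambda>e. Re (z * cdual_apply f e + cdual_apply f x0)) \<longlongrightarrow> Re (z * cdual_apply E f + cdual_apply f x0)) U"
    by (intro tendsto_intros unit_limit)
  moreover have "\<forall>\<^sub>F e in U. \<delta>0 \<le> Re (z * cdual_apply f e + cdual_apply f x0)"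
    using eventually_approx_units[OF S]
  proof eventually_elim
    case (elim e)
    then have "\<delta>0 \<le> Re (\<omega> (z *\<^sub>C e + x0, 0))" by (intro \<omega>(2)) (simp add: Y_def)
    also have "\<omega> (z *\<^sub>C e + x0, 0) = z * cdual_apply f e + cdual_apply f x0"
      by (simp only: f[symmetric] cdual_simps)
    finally show ?case .
  qed
  ultimately have "\<delta>0 \<le> Re (z * cdual_apply E f + cdual_apply f x0)"
    by (rule tendsto_lowerbound[OF _ _ U_nontrivial])
  then show False using le[OF \<omega>(1) f] \<delta>0 by simp
qed

text \<open>Partial sums of the Neumann series of $(1 + td)^{-1} = \frac{1}{1 + tm} \bigl(1 - \frac{t(m - d)}{1 + tm}\bigr)^{-1}$,
  where $\lVert m - d \rVert \le m + \delta$ for large $m$ because $d$ is almost accretive.\<close>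

lemma approximate_resolvent:
  fixes d :: 'a
  assumes nz: "(c0::'a) \<noteq> 0" and t: "0 < t" "t * \<delta> < 1" and \<eta>: "0 < \<eta>"
    and d: "\<And>\<omega>. is_state multiplier_norm (0, 1) \<omega> \<Longrightarrow> Re (\<omega> (- d, 0)) < \<delta>"
  obtains R where "multiplier_norm R \<le> 1 / (1 - t * \<delta>)" "fst R * d = d * fst R"
    "multiplier_norm (R + of_real t *\<^sub>C umul (d, 0) R - (0, 1)) \<le> \<eta>"
proof -
  have "\<exists>\<tau>0>0. \<forall>\<tau>. 0 < \<tau> \<and> \<tau> \<le> \<tau>0 \<longrightarrow>
      multiplier_norm ((0, 1) + \<tau> *\<^sub>R (- d, 0)) \<le> 1 + \<tau> * \<delta>"
    by (rule states_bound_imp_norm[OF cseminorm_multiplier_norm multiplier_norm_one[OF nz]]) (rule d)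
  then obtain \<tau>0 where \<tau>0: "\<tau>0 > 0" and nu: "\<And>\<tau>. 0 < \<tau> \<Longrightarrow> \<tau> \<le> \<tau>0 \<Longrightarrow>
      multiplier_norm ((0, 1) + \<tau> *\<^sub>R (- d, 0)) \<le> 1 + \<tau> * \<delta>"
    by blast
  \<comment> \<open>The bound on \<open>1 - \<tau>0 d\<close> supplied by almost accretivity,
    multiplied by \<open>m\<close>, reads \<open>norm (m - d) \<le> m + \<delta>\<close>.\<close>
  define m where "m = 1 / \<tau>0"
  have m: "0 < m" using \<tau>0 by (simp add: m_def)
  define k where "k = 1 + t * m"
  have k: "0 < k" using m t by (simp add: k_def add_pos_pos)
  define Y where "Y = of_real (t / k) *\<^sub>C (of_real m *\<^sub>C (0, 1) - (d, 0 :: complex))"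
  define \<theta> where "\<theta> = 1 - (1 - t * \<delta>) / k"
  have \<theta>1: "\<theta> < 1" using t k by (simp add: \<theta>_def)
  have "multiplier_norm Y \<le> \<theta>"
  proof -
    have "of_real m *\<^sub>C (0, 1) - (d, 0 :: complex) = m *\<^sub>R ((0, 1) + \<tau>0 *\<^sub>R (- d, 0))"
      using \<tau>0 by (simp add: m_def scaleC_prod_def scaleC_complex_def scaleR_conv_of_real)
    then have "multiplier_norm Y = t / k * (m * multiplier_norm ((0, 1) + \<tau>0 *\<^sub>R (- d, 0)))"
      unfolding Y_def using m t k by (simp only: multiplier_norm_simps(2,3)) (simp add: norm_divide)
    also have "\<dots> \<le> t / k * (m * (1 + \<tau>0 * \<delta>))"
      using nu[OF \<tau>0 order_refl] m t k by (intro mult_left_mono) auto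
    also have "m * (1 + \<tau>0 * \<delta>) = m + \<delta>" using \<tau>0 by (simp add: m_def field_simps)
    also have "t / k * (m + \<delta>) = (k - (1 - t * \<delta>)) / k" by (simp add: k_def algebra_simps)
    also have "\<dots> = \<theta>" using k by (simp add: \<theta>_def diff_divide_distrib)
    finally show ?thesis .
  qed
  note Y\<theta> = this
  have \<theta>0: "0 \<le> \<theta>" using Y\<theta> multiplier_norm_nonneg[of Y] by simp
  have Ym: "multiplier_norm (umul Y x) \<le> \<theta> * multiplier_norm x" for x
    by (rule order_trans[OF multiplier_norm_umul]) (intro mult_right_mono Y\<theta> multiplier_norm_nonneg)
  have Yd: "x + of_real t *\<^sub>C umul (d, 0) x = of_real k *\<^sub>C (x - umul Y x)" for x
  proof -
    have "umul Y x = of_real (t / k) *\<^sub>C (of_real m *\<^sub>C x - umul (d, 0) x)"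
      by (simp add: Y_def umul_def prod_eq_iff scaleC_prod_def scaleC_complex_def mult_scaleC_left
          scaleC_diff_right scaleC_diff_left scaleC_add_right scaleC_scaleC algebra_simps)
    then have "of_real k *\<^sub>C (x - umul Y x) = of_real k *\<^sub>C x - of_real t *\<^sub>C (of_real m *\<^sub>C x - umul (d, 0) x)"
      using k by (simp add: scaleC_diff_right scaleC_scaleC)
    also have "\<dots> = of_real k *\<^sub>C x - of_real (t * m) *\<^sub>C x + of_real t *\<^sub>C umul (d, 0) x"
      by (simp add: scaleC_diff_right scaleC_scaleC)
    also have "of_real k *\<^sub>C x - of_real (t * m) *\<^sub>C x = x"
      by (simp add: k_def scaleC_add_left)
    finally show ?thesis by simp
  qed
  define s where "s = complex_of_real (1 / k)"
  have sk: "s * of_real k = 1" "cmod s = 1 / k" using k by (auto simp: s_def norm_divide)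
  \<comment> \<open>Its bound \<open>1 / (1 - t * \<delta>)\<close> is the fixed point of
    \<open>r \<mapsto> 1 / k + \<theta> * r\<close>, and each iterate is a polynomial in
    \<open>d\<close>, hence commutes with it.\<close>
  define R where "R n = ((\<lambda>x. s *\<^sub>C (0, 1) + umul Y x) ^^ n) 0" for n
  have R0: "R 0 = 0" and RS: "R (Suc n) = s *\<^sub>C (0, 1) + umul Y (R n)" for n by (simp_all add: R_def)
  have Rn: "multiplier_norm (R n) \<le> 1 / (1 - t * \<delta>)" for n
  proof (induction n)
    case 0
    then show ?case using t by (simp add: R0 multiplier_norm_simps(4))
  next
    case (Suc n)
    have "multiplier_norm (R (Suc n)) \<le> multiplier_norm (s *\<^sub>C (0 :: 'a, 1 :: complex)) + multiplier_norm (umul Y (R n))"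
      unfolding RS by (rule multiplier_norm_simps)
    also have "\<dots> \<le> 1 / k + \<theta> * (1 / (1 - t * \<delta>))"
      using Ym[of "R n"] mult_left_mono[OF Suc.IH \<theta>0]
      by (simp add: multiplier_norm_simps(2) multiplier_norm_one[OF nz] sk)
    also have "\<dots> = 1 / (1 - t * \<delta>)" using t k by (simp add: \<theta>_def field_simps)
    finally show ?case .
  qed
  have comm: "fst (R n) * d = d * fst (R n)" for n
    by (induction n) (simp_all add: R0 RS umul_def Y_def scaleC_prod_def mult_scaleC_left mult_scaleC_right
        left_diff_distrib right_diff_distrib distrib_left distrib_right mult.assoc)
  \<comment> \<open>The residual is the n-th power of \<open>Y\<close>, as for any geometric
    series.\<close>
  have err: "multiplier_norm ((0, 1) - of_real k *\<^sub>C (R n - umul Y (R n))) \<le> \<theta> ^ n" for n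
  proof (induction n)
    case 0
    then show ?case by (simp add: R0 umul_def prod_eq_iff zero_prod_def[symmetric] multiplier_norm_one[OF nz])
  next
    case (Suc n)
    have "of_real k *\<^sub>C (R (Suc n) - umul Y (R (Suc n)))
        = (of_real k * s) *\<^sub>C (0, 1) - (of_real k * s) *\<^sub>C Y + umul Y (of_real k *\<^sub>C (R n - umul Y (R n)))"
      by (simp add: RS umul_linear scaleC_add_right scaleC_diff_right scaleC_scaleC algebra_simps)
    also have "of_real k * s = 1" using sk by (simp add: mult.commute)
    also have "1 *\<^sub>C (0, 1) - 1 *\<^sub>C Y + umul Y (of_real k *\<^sub>C (R n - umul Y (R n)))
        = (0, 1) - umul Y ((0, 1) - of_real k *\<^sub>C (R n - umul Y (R n)))"
      by (simp only: umul_linear scaleC_one) simp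
    finally have "(0, 1) - of_real k *\<^sub>C (R (Suc n) - umul Y (R (Suc n)))
        = umul Y ((0, 1) - of_real k *\<^sub>C (R n - umul Y (R n)))" by simp
    then have "multiplier_norm ((0, 1) - of_real k *\<^sub>C (R (Suc n) - umul Y (R (Suc n))))
        \<le> \<theta> * multiplier_norm ((0, 1) - of_real k *\<^sub>C (R n - umul Y (R n)))" by (simp only: Ym)
    also have "\<dots> \<le> \<theta> * \<theta> ^ n" by (intro mult_left_mono Suc.IH \<theta>0)
    finally show ?case by simp
  qed
  obtain n where n: "\<theta> ^ n < \<eta>" using real_arch_pow_inv[OF \<eta> \<theta>1] by blast
  have "R n + of_real t *\<^sub>C umul (d, 0) (R n) - (0, 1) = - ((0, 1) - of_real k *\<^sub>C (R n - umul Y (R n)))"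
    unfolding Yd by simp
  then have "multiplier_norm (R n + of_real t *\<^sub>C umul (d, 0) (R n) - (0, 1)) \<le> \<eta>"
    using err[of n] n by (simp only: multiplier_norm_simps(5))
  then show thesis using that[of "R n"] Rn comm by blast
qed

end

section \<open>Asymptotic disjointness in $L^p$\<close>

lemma lim_le_powr:
  assumes p: "1 < p" and K: "0 \<le> K" and le: "f \<lessapprox> g" and f: "\<And>n. 0 \<le> f n" "\<And>n. f n \<le> K" and g: "\<And>n. 0 \<le> g n"
  shows "(\<lambda>n. f n powr p) \<lessapprox> (\<lambda>n. g n powr p)"
proof (rule lim_leI)
  fix \<epsilon> :: real assume \<epsilon>: "0 < \<epsilon>"
  define D where "D = p * K powr (p - 1) + 1"
  have D: "0 < D" using p by (simp add: D_def add_nonneg_pos)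
  from lim_leD[OF le, of "\<epsilon> / D"] \<epsilon> D have "\<forall>\<^sub>F n in sequentially. f n \<le> g n + \<epsilon> / D" by simp
  then show "\<forall>\<^sub>F n in sequentially. f n powr p \<le> g n powr p + \<epsilon>"
  proof eventually_elim
    case (elim n)
    have "f n powr p \<le> g n powr p + p * K powr (p - 1) * (\<epsilon> / D)"
      using p f g K \<epsilon> D elim by (intro powr_diff_le) auto
    also have "p * K powr (p - 1) * (\<epsilon> / D) \<le> D * (\<epsilon> / D)"
      using \<epsilon> D by (intro mult_right_mono) (auto simp: D_def)
    finally show ?case using D by simp
  qed
qed

text \<open>The phases \<open>c\<close> and \<open>- c\<close> turn the one-sided estimate into a
  two-sided one; \<open>c = 1\<close> and \<open>c = - \<i>\<close> then give the real and the
  imaginary part. So it suffices everywhere to compare norms in one direction.\<close>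

lemma lim_le_complex:
  assumes "\<And>c. cmod c = 1 \<Longrightarrow> (\<lambda>n. Re (c * a n)) \<lessapprox> (\<lambda>n. Re (c * b n))"
  shows "(\<lambda>n. a n - b n) \<longlonglongrightarrow> 0"
proof -
  have "(\<lambda>n. Re (c * (a n - b n))) \<longlonglongrightarrow> 0" if c: "cmod c = 1" for c
  proof -
    have "(\<lambda>n. Re (c * a n)) \<lessapprox> (\<lambda>n. Re (c * b n))" using c by (rule assms)
    moreover have "(\<lambda>n. Re (c * b n)) \<lessapprox> (\<lambda>n. Re (c * a n))"
    proof (rule lim_leI)
      fix \<epsilon> :: real assume "0 < \<epsilon>"
      moreover have "(\<lambda>n. Re (- c * a n)) \<lessapprox> (\<lambda>n. Re (- c * b n))" using c by (intro assms) simp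
      ultimately have "\<forall>\<^sub>F n in sequentially. Re (- c * a n) \<le> Re (- c * b n) + \<epsilon>" by (intro lim_leD)
      then show "\<forall>\<^sub>F n in sequentially. Re (c * b n) \<le> Re (c * a n) + \<epsilon>" by eventually_elim simp
    qed
    ultimately have "(\<lambda>n. Re (c * a n) - Re (c * b n)) \<longlonglongrightarrow> 0" by (rule lim_le_tendsto)
    then show ?thesis by (simp add: right_diff_distrib)
  qed
  from this[of 1] this[of "- \<i>"] show ?thesis by (simp add: tendsto_complex_iff)
qed

context Lp_setting
begin

text \<open>The norms are compared along \<open>\<xi> + \<tau> w\<close> for each fixed \<tau> and
  in reverse at the base points; dividing the difference by \<tau> compares the derivatives. Because
  the expansion is uniform, \<tau> can be fixed before \<open>n\<close> tends to infinity.\<close>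

lemma pairing_compare:
  assumes V: "\<And>n. \<xi> n \<in> V" "\<And>n. \<xi>' n \<in> V" "\<And>n. w n \<in> V" "\<And>n. w' n \<in> V" and K: "0 \<le> K"
    and N: "\<And>n. N (\<xi> n) \<le> K" "\<And>n. N (\<xi>' n) \<le> K" "\<And>n. N (w n) \<le> K" "\<And>n. N (w' n) \<le> K"
    and A: "\<And>\<tau>. 0 < \<tau> \<Longrightarrow> (\<lambda>n. N (\<lambda>x. \<xi> n x + of_real \<tau> * w n x)) \<lessapprox> (\<lambda>n. N (\<lambda>x. \<xi>' n x + of_real \<tau> * w' n x))"
    and B: "(\<lambda>n. N (\<xi>' n)) \<lessapprox> (\<lambda>n. N (\<xi> n))"
  shows "(\<lambda>n. Re (pairing (w n) (\<xi> n))) \<lessapprox> (\<lambda>n. Re (pairing (w' n) (\<xi>' n)))"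
proof (rule lim_leI)
  fix \<epsilon> :: real assume \<epsilon>: "0 < \<epsilon>"
  define \<epsilon>' where "\<epsilon>' = p * \<epsilon> / (8 * (K powr p + 1))"
  have K1: "0 < K powr p + 1" by (simp add: add_nonneg_pos)
  have \<epsilon>': "0 < \<epsilon>'" unfolding \<epsilon>'_def using p_gt_1 \<epsilon> K1 by (intro divide_pos_pos mult_pos_pos) auto
  obtain \<tau> where \<tau>: "\<tau> > 0" and ex: "\<forall>\<tau>' \<xi> w. 0 < \<tau>' \<and> \<tau>' \<le> \<tau> \<and> \<xi> \<in> V \<and> w \<in> V \<longrightarrow>
    \<bar>N (\<lambda>x. \<xi> x + of_real \<tau>' * w x) powr p - N \<xi> powr p - p * \<tau>' * Re (pairing w \<xi>)\<bar>
      \<le> \<epsilon>' * \<tau>' * (N \<xi> powr p + N w powr p)"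
    using N_expansion[OF \<epsilon>'] by blast
  have ex: "\<bar>N (\<lambda>x. \<xi> x + of_real \<tau> * w x) powr p - N \<xi> powr p - p * \<tau> * Re (pairing w \<xi>)\<bar> \<le> p * \<tau> * \<epsilon> / 4"
    if v: "\<xi> \<in> V" "w \<in> V" "N \<xi> \<le> K" "N w \<le> K" for \<xi> w
  proof -
    have "\<epsilon>' * \<tau> * (N \<xi> powr p + N w powr p) \<le> \<epsilon>' * \<tau> * ((K powr p + 1) + (K powr p + 1))"
      using \<epsilon>' \<tau> v N_nonneg p_gt_1 powr_mono2[of p "N \<xi>" K] powr_mono2[of p "N w" K] by (intro mult_left_mono add_mono) auto
    also have "\<dots> = (\<epsilon>' * (8 * (K powr p + 1))) * \<tau> / 4" by simp
    also have "\<epsilon>' * (8 * (K powr p + 1)) = p * \<epsilon>" using K1 by (simp only: \<epsilon>'_def) simp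
    finally have "\<epsilon>' * \<tau> * (N \<xi> powr p + N w powr p) \<le> p * \<tau> * \<epsilon> / 4" by (simp add: ac_simps)
    then show ?thesis using ex[rule_format, of \<tau> \<xi> w] v \<tau> by linarith
  qed
  have bnd: "N (\<lambda>x. \<xi> n x + of_real \<tau> * w n x) \<le> K + \<tau> * K" for n
  proof -
    have "N (\<lambda>x. of_real \<tau> * w n x) = \<tau> * N (w n)" using N_scale[OF V(3), of "of_real \<tau>" n] \<tau> by simp
    moreover have "\<tau> * N (w n) \<le> \<tau> * K" using \<tau> N(3) by (intro mult_left_mono) auto
    ultimately show ?thesis using N_triangle[OF V(1) V_scale[OF V(3)], of n "of_real \<tau>" n] N(1)[of n] by linarith
  qed
  have "(\<lambda>n. N (\<lambda>x. \<xi> n x + of_real \<tau> * w n x) powr p) \<lessapprox> (\<lambda>n. N (\<lambda>x. \<xi>' n x + of_real \<tau> * w' n x) powr p)"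
    using \<tau> K by (intro lim_le_powr[OF p_gt_1 _ A[OF \<tau>] N_nonneg bnd N_nonneg]) simp
  moreover have "(\<lambda>n. N (\<xi>' n) powr p) \<lessapprox> (\<lambda>n. N (\<xi> n) powr p)"
    by (intro lim_le_powr[OF p_gt_1 K B N_nonneg N(2) N_nonneg])
  ultimately have "(\<lambda>n. N (\<lambda>x. \<xi> n x + of_real \<tau> * w n x) powr p + N (\<xi>' n) powr p)
      \<lessapprox> (\<lambda>n. N (\<lambda>x. \<xi>' n x + of_real \<tau> * w' n x) powr p + N (\<xi> n) powr p)" by (rule lim_le_add)
  from lim_leD[OF this, of "p * \<tau> * \<epsilon> / 2"] \<tau> \<epsilon> p_gt_1
  have "\<forall>\<^sub>F n in sequentially. N (\<lambda>x. \<xi> n x + of_real \<tau> * w n x) powr p + N (\<xi>' n) powr p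
      \<le> N (\<lambda>x. \<xi>' n x + of_real \<tau> * w' n x) powr p + N (\<xi> n) powr p + p * \<tau> * \<epsilon> / 2" by simp
  then show "\<forall>\<^sub>F n in sequentially. Re (pairing (w n) (\<xi> n)) \<le> Re (pairing (w' n) (\<xi>' n)) + \<epsilon>"
  proof eventually_elim
    case (elim n)
    have "p * \<tau> * Re (pairing (w n) (\<xi> n)) \<le> p * \<tau> * Re (pairing (w' n) (\<xi>' n)) + p * \<tau> * \<epsilon>"
      using elim ex[OF V(1) V(3) N(1) N(3), of n n] ex[OF V(2) V(4) N(2) N(4), of n n] by linarith
    then have "(p * \<tau>) * Re (pairing (w n) (\<xi> n)) \<le> (p * \<tau>) * (Re (pairing (w' n) (\<xi>' n)) + \<epsilon>)"
      by (simp add: algebra_simps)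
    then show ?case using p_gt_1 \<tau> by (simp add: mult_le_cancel_left)
  qed
qed

end

locale Lp_algebra = Lp_action p M T
  for p :: real and M :: "'x measure" and T :: "'a::complex_banach_algebra \<Rightarrow> ('x \<Rightarrow> complex) \<Rightarrow> ('x \<Rightarrow> complex)" +
  assumes approx_unital: "approximately_unital TYPE('a)"

sublocale Lp_algebra \<subseteq> smooth_algebra "TYPE('a)"
proof
  show "approximately_unital TYPE('a)" by (rule approx_unital)
  show "smooth_units TYPE('a)" unfolding smooth_units_def using smooth_approx_unit by blast
qed

context Lp_algebra
begin

definition mu :: "('x \<Rightarrow> complex) \<Rightarrow> ('x \<Rightarrow> complex) \<Rightarrow> 'a \<times> 'a \<Rightarrow> real"
  where "mu \<zeta> w y = N (\<lambda>x. T (fst y) \<zeta> x + T (snd y) w x)"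

lemma N_T_le: "f \<in> V \<Longrightarrow> N f \<le> K \<Longrightarrow> N (T a f) \<le> norm a * K"
  by (rule order_trans[OF T_bound]) (auto intro: mult_left_mono)

lemma module_seminorm_mu:
  assumes V: "\<zeta> \<in> V" "w \<in> V" and K: "N \<zeta> \<le> K" "N w \<le> K"
  shows "module_seminorm (mu \<zeta> w) K"
  unfolding module_seminorm_def
proof (intro conjI allI)
  note VT = T_V[OF V(1)] T_V[OF V(2)]
  show "cseminorm (mu \<zeta> w)"
    unfolding cseminorm_def
  proof (intro conjI allI)
    fix y z :: "'a \<times> 'a" and c
    have "AE x in M. T (fst (y + z)) \<zeta> x + T (snd (y + z)) w x
        = (T (fst y) \<zeta> x + T (snd y) w x) + (T (fst z) \<zeta> x + T (snd z) w x)"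
      using T_add[OF V(1), of "fst y" "fst z"] T_add[OF V(2), of "snd y" "snd z"] by (auto elim!: AE_mp)
    then have "mu \<zeta> w (y + z) = N (\<lambda>x. (T (fst y) \<zeta> x + T (snd y) w x) + (T (fst z) \<zeta> x + T (snd z) w x))"
      unfolding mu_def by (intro N_cong_AE V_add VT)
    also have "\<dots> \<le> mu \<zeta> w y + mu \<zeta> w z" unfolding mu_def by (intro N_triangle V_add VT)
    finally show "mu \<zeta> w (y + z) \<le> mu \<zeta> w y + mu \<zeta> w z" .
    have "AE x in M. T (fst (c *\<^sub>C y)) \<zeta> x + T (snd (c *\<^sub>C y)) w x = c * (T (fst y) \<zeta> x + T (snd y) w x)"
      using T_scale[OF V(1), of c "fst y"] T_scale[OF V(2), of c "snd y"]
      by (auto simp: fst_scaleC snd_scaleC distrib_left elim!: AE_mp)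
    then have "mu \<zeta> w (c *\<^sub>C y) = N (\<lambda>x. c * (T (fst y) \<zeta> x + T (snd y) w x))"
      unfolding mu_def by (intro N_cong_AE V_add V_scale VT)
    also have "\<dots> = cmod c * mu \<zeta> w y" unfolding mu_def by (intro N_scale V_add VT)
    finally show "mu \<zeta> w (c *\<^sub>C y) = cmod c * mu \<zeta> w y" .
  qed
  fix y :: "'a \<times> 'a" and a :: 'a
  have "mu \<zeta> w y \<le> N (T (fst y) \<zeta>) + N (T (snd y) w)" unfolding mu_def by (intro N_triangle VT)
  also have "\<dots> \<le> norm (fst y) * K + norm (snd y) * K" by (intro add_mono N_T_le V K)
  finally show "mu \<zeta> w y \<le> K * (norm (fst y) + norm (snd y))" by (simp add: algebra_simps)
  have "AE x in M. T (a * fst y) \<zeta> x + T (a * snd y) w x = T a (\<lambda>x. T (fst y) \<zeta> x + T (snd y) w x) x"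
    using T_mult[OF V(1), of a "fst y"] T_mult[OF V(2), of a "snd y"] T_fun_add[OF T_V[OF V(1), of "fst y"] T_V[OF V(2), of "snd y"], of a]
    by (auto elim!: AE_mp)
  then have "mu \<zeta> w (a * fst y, a * snd y) = N (T a (\<lambda>x. T (fst y) \<zeta> x + T (snd y) w x))"
    unfolding mu_def fst_conv snd_conv by (intro N_cong_AE V_add T_V VT)
  also have "\<dots> \<le> norm a * mu \<zeta> w y" unfolding mu_def by (intro T_bound V_add VT)
  finally show "mu \<zeta> w (a * fst y, a * snd y) \<le> norm a * mu \<zeta> w y" .
qed

lemma mu_expand:
  assumes V: "\<zeta> \<in> V" "w \<in> V"
  shows "N (\<lambda>x. T a \<zeta> x + of_real \<tau> * T c w x) = mu \<zeta> w (a, of_real \<tau> *\<^sub>C c)"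
proof -
  have "AE x in M. T a \<zeta> x + of_real \<tau> * T c w x = T a \<zeta> x + T (of_real \<tau> *\<^sub>C c) w x"
    using T_scale[OF V(2), of "of_real \<tau>" c] by (auto elim!: AE_mp)
  then show ?thesis unfolding mu_def fst_conv snd_conv by (intro N_cong_AE V_add V_scale T_V V)
qed

lemma T_zero: "f \<in> V \<Longrightarrow> AE x in M. T 0 f x = 0"
  using T_add[of f 0 0] by (auto elim: AE_mp)

lemma mu_single:
  assumes V: "\<zeta> \<in> V" "w \<in> V"
  shows "N (T a \<zeta>) = mu \<zeta> w (a, 0)"
proof -
  have "AE x in M. T a \<zeta> x = T a \<zeta> x + T 0 w x" using T_zero[OF V(2)] by (auto elim!: AE_mp)
  then show ?thesis unfolding mu_def fst_conv snd_conv by (intro N_cong_AE V_add T_V V)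
qed

lemma pairing_T_scale:
  assumes "w \<in> V" "\<xi> \<in> V"
  shows "pairing (T (c *\<^sub>C a) w) \<xi> = c * pairing (T a w) \<xi>"
  unfolding pairing_scale[symmetric] using assms
  by (intro pairing_cong_AE T_scale T_V V_scale)

lemma pairing_T_add:
  assumes "w \<in> V" "\<xi> \<in> V"
  shows "pairing (T (a + b) w) \<xi> = pairing (T a w) \<xi> + pairing (T b w) \<xi>"
  by (subst pairing_add[symmetric]) (use assms in \<open>auto intro!: pairing_cong_AE T_add T_V V_add\<close>)

end

text \<open>\<open>R n\<close> is a resolvent of \<open>l n - h n\<close>. It almost fixes the vectors on which \<open>h n\<close> and \<open>l n\<close>
  agree, and on its range \<open>h n\<close> is almost idempotent.\<close>

locale unit_sequence = Lp_algebra p M T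
  for p :: real and M :: "'x measure" and T :: "'a::complex_banach_algebra \<Rightarrow> ('x \<Rightarrow> complex) \<Rightarrow> ('x \<Rightarrow> complex)" +
  fixes h l :: "nat \<Rightarrow> 'a" and R :: "nat \<Rightarrow> 'a \<times> complex" and \<delta> \<kappa> :: "nat \<Rightarrow> real" and c0 :: 'a
  assumes c0: "c0 \<noteq> 0" and h1: "norm (h n) \<le> 1" and l1: "norm (l n) \<le> 1"
    and \<delta>_pos: "0 < \<delta> n" and \<delta>_lim: "\<delta> \<longlonglongrightarrow> 0"
    and herm: "is_state multiplier_norm (0, 1) \<omega> \<Longrightarrow> Re (\<omega> (\<i> *\<^sub>C h n, 0)) < \<delta> n"
    and \<kappa>_nonneg: "0 \<le> \<kappa> n" and \<kappa>1: "\<kappa> n \<le> 1" and \<kappa>_lim: "\<kappa> \<longlonglongrightarrow> 0"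
    and R_norm: "multiplier_norm (R n) \<le> 1 + \<kappa> n"
    and idem: "norm (h n * (h n * unit_action (R n) c) - h n * unit_action (R n) c) \<le> \<kappa> n * norm c"
    and kill: "norm (h n * (unit_action (R n) c - l n * unit_action (R n) c)) \<le> \<kappa> n * norm c"
    and split: "norm (l n * unit_action (R n) c - h n * unit_action (R n) c) \<le> \<kappa> n * norm c"
begin

lemma rotation_step:
  assumes \<mu>: "\<And>n. module_seminorm (\<mu> n) K" and K: "0 \<le> K"
    and y: "(\<lambda>n. \<mu> n (act2 (h n, 0) (y n) - y n)) \<longlonglongrightarrow> 0" and z: "(\<lambda>n. \<mu> n (act2 (h n, 0) (z n))) \<longlonglongrightarrow> 0"
    and B: "\<And>n. \<mu> n (y n) \<le> B" "\<And>n. \<mu> n (z n) \<le> B"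
  shows "(\<lambda>n. \<mu> n (\<i> *\<^sub>C y n + z n)) \<lessapprox> (\<lambda>n. \<mu> n (y n + z n))"
proof -
  have s: "cseminorm (\<mu> n)" for n using \<mu> by (simp add: module_seminorm_def)
  define k where "k n = \<mu> n (act2 (h n, 0) (y n) - y n) + \<mu> n (act2 (h n, 0) (z n))" for n
  have k: "k \<longlonglongrightarrow> 0" unfolding k_def[abs_def] using tendsto_add[OF y z] by simp
  have k0: "0 \<le> k n" for n by (simp add: k_def cseminormD(6)[OF s])
  have "(\<lambda>n. (exp (2 * \<delta> n) - 1) * (2 * B + 2 * k n) + 2 * k n) \<longlonglongrightarrow> (exp (2 * 0) - 1) * (2 * B + 2 * 0) + 2 * 0"
    by (intro tendsto_intros k \<delta>_lim)
  then have "(\<lambda>n. (exp (2 * \<delta> n) - 1) * (2 * B + 2 * k n) + 2 * k n) \<longlonglongrightarrow> 0" by simp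
  then show ?thesis
  proof (rule lim_le_error)
    fix n
    have "\<mu> n (\<i> *\<^sub>C y n + z n) \<le> exp (2 * \<delta> n) * (\<mu> n (y n + z n) + 2 * k n)"
      unfolding k_def by (rule quarter_turn[OF c0 \<mu> K \<delta>_pos]) (rule herm)
    also have "\<dots> = \<mu> n (y n + z n) + ((exp (2 * \<delta> n) - 1) * (\<mu> n (y n + z n) + 2 * k n) + 2 * k n)"
      by (simp add: algebra_simps)
    also have "(exp (2 * \<delta> n) - 1) * (\<mu> n (y n + z n) + 2 * k n) \<le> (exp (2 * \<delta> n) - 1) * (2 * B + 2 * k n)"
      using cseminormD(1)[OF s, of n "y n" "z n"] B[of n] \<delta>_pos[of n] by (intro mult_left_mono) auto
    finally show "\<mu> n (\<i> *\<^sub>C y n + z n) \<le> \<mu> n (y n + z n) + ((exp (2 * \<delta> n) - 1) * (2 * B + 2 * k n) + 2 * k n)"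
      by simp
  qed
qed

text \<open>A quarter turn is controlled in one direction only, but four of them compose to the
  identity, so \<open>k\<close> can be reached from \<open>m\<close> by \<open>k + 3 * m\<close>
  further turns. Hence the norms agree asymptotically.\<close>

lemma rotation:
  assumes \<mu>: "\<And>n. module_seminorm (\<mu> n) K" and K: "0 \<le> K"
    and y: "(\<lambda>n. \<mu> n (act2 (h n, 0) (y n) - y n)) \<longlonglongrightarrow> 0" and z: "(\<lambda>n. \<mu> n (act2 (h n, 0) (z n))) \<longlonglongrightarrow> 0"
    and B: "\<And>n. \<mu> n (y n) \<le> B" "\<And>n. \<mu> n (z n) \<le> B"
  shows "(\<lambda>n. \<mu> n (\<i> ^ k *\<^sub>C y n + z n)) \<lessapprox> (\<lambda>n. \<mu> n (\<i> ^ m *\<^sub>C y n + z n))"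
proof -
  have s: "cseminorm (\<mu> n)" for n using \<mu> by (simp add: module_seminorm_def)
  define f where "f k = (\<lambda>n. \<mu> n (\<i> ^ k *\<^sub>C y n + z n))" for k
  have step: "f (Suc k) \<lessapprox> f k" for k
  proof -
    have "\<mu> n (act2 (h n, 0) (\<i> ^ k *\<^sub>C y n) - \<i> ^ k *\<^sub>C y n) = \<mu> n (act2 (h n, 0) (y n) - y n)" for n
      by (simp add: act2_linear scaleC_diff_right[symmetric] cseminormD(2)[OF s] norm_power)
    then have "(\<lambda>n. \<mu> n (\<i> *\<^sub>C (\<i> ^ k *\<^sub>C y n) + z n)) \<lessapprox> (\<lambda>n. \<mu> n (\<i> ^ k *\<^sub>C y n + z n))"
      using y z B by (intro rotation_step[OF \<mu> K, where B = B]) (simp_all add: cseminormD(2)[OF s] norm_power)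
    then show ?thesis by (simp add: f_def scaleC_scaleC)
  qed
  have le: "f (k + j) \<lessapprox> f k" for k j
    by (induction j) (auto intro: lim_le_refl lim_le_trans[OF step])
  have "\<i> ^ (k + 4 * m) = \<i> ^ k" by (simp add: power_add power_mult)
  then have "f k = f (m + (k + 3 * m))" by (simp add: f_def algebra_simps)
  then show ?thesis using le[of m "k + 3 * m"] by (simp add: f_def)
qed

text \<open>The approximate form of \<alpha> lying in the range and \<beta> in the kernel of a
  hermitian idempotent; in addition the resolvents almost fix both.\<close>

definition adapted :: "(nat \<Rightarrow> 'a) \<Rightarrow> (nat \<Rightarrow> 'a) \<Rightarrow> real \<Rightarrow> bool"
  where "adapted \<alpha> \<beta> K \<longleftrightarrow> (\<forall>n. norm (\<alpha> n) \<le> K) \<and> (\<forall>n. norm (\<beta> n) \<le> K) \<and>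
    (\<lambda>n. norm (h n * \<alpha> n - \<alpha> n)) \<longlonglongrightarrow> 0 \<and> (\<lambda>n. norm (h n * \<beta> n)) \<longlonglongrightarrow> 0 \<and>
    (\<lambda>n. norm (unit_action (R n) (\<alpha> n) - \<alpha> n)) \<longlonglongrightarrow> 0 \<and> (\<lambda>n. norm (unit_action (R n) (\<beta> n) - \<beta> n)) \<longlonglongrightarrow> 0"

end

section \<open>The mode gap against bounded test functions\<close>

context unit_sequence
begin

lemma norm_R: "norm (unit_action (R n) c) \<le> 2 * norm c"
  using unit_action_le_multiplier_norm[of "R n" c] mult_right_mono[of "multiplier_norm (R n)" 2 "norm c"]
    R_norm[of n] \<kappa>1[of n] by simp

text \<open>The test direction \<open>w\<close> is replaced by its image under an approximate unit
  and then under the resolvent of that unit. This image splits into a part that turns with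
  \<open>h\<close>, a part that \<open>h\<close> annihilates, and a null sequence. By invariance
  under quarter turns the pairing at \<open>\<i>^k \<alpha> + \<beta>\<close> becomes
  \<open>(-\<i>)^k G + H\<close>, and the alternating sum over \<open>k\<close> detects neither
  mode.\<close>

lemma mode_gap_weak:
  assumes ad: "adapted \<alpha> \<beta> K" and K: "0 \<le> K" and \<zeta>: "\<And>n. \<zeta> n \<in> V" "\<And>n. N (\<zeta> n) \<le> 1"
    and w: "\<And>n. w n \<in> V" "\<And>n. N (w n) \<le> W"
  shows "(\<lambda>n. \<Sum>k<4. (-1) ^ k * pairing (w n) (T (\<i> ^ k *\<^sub>C \<alpha> n + \<beta> n) (\<zeta> n))) \<longlonglongrightarrow> 0"
proof -
  have nab: "norm (\<alpha> n) \<le> K" "norm (\<beta> n) \<le> K" for n using ad by (auto simp: adapted_def)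
  have lims: "(\<lambda>n. norm (h n * \<alpha> n - \<alpha> n)) \<longlonglongrightarrow> 0" "(\<lambda>n. norm (h n * \<beta> n)) \<longlonglongrightarrow> 0"
    "(\<lambda>n. norm (unit_action (R n) (\<alpha> n) - \<alpha> n)) \<longlonglongrightarrow> 0" "(\<lambda>n. norm (unit_action (R n) (\<beta> n) - \<beta> n)) \<longlonglongrightarrow> 0"
    using ad by (auto simp: adapted_def)
  have W: "0 \<le> W" using N_nonneg[of "w 0"] w(2)[of 0] by linarith
  define x where "x k n = \<i> ^ k *\<^sub>C \<alpha> n + \<beta> n" for k n
  define \<xi> where "\<xi> k n = T (x k n) (\<zeta> n)" for k n
  define \<mu> where "\<mu> n = mu (\<zeta> n) (w n)" for n
  define K0 where "K0 = 1 + W"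
  have K0: "0 \<le> K0" using W by (simp add: K0_def)
  have \<mu>: "module_seminorm (\<mu> n) K0" for n
    unfolding \<mu>_def using \<zeta> w W order_trans[OF \<zeta>(2)] order_trans[OF w(2)]
    by (intro module_seminorm_mu) (auto simp: K0_def)
  have s: "cseminorm (\<mu> n)" and \<mu>b: "\<mu> n y \<le> K0 * (norm (fst y) + norm (snd y))" for n y
    using \<mu>[of n] unfolding module_seminorm_def by blast+
  have xb: "norm (x k n) \<le> 2 * K" for k n
    using norm_triangle_ineq[of "\<i> ^ k *\<^sub>C \<alpha> n" "\<beta> n"] nab[of n] by (simp add: x_def norm_scaleC norm_power)
  have \<xi>V: "\<xi> k n \<in> V" for k n unfolding \<xi>_def by (intro T_V \<zeta>)
  have \<xi>N: "N (\<xi> k n) \<le> 2 * K" for k n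
    unfolding \<xi>_def using N_T_le[OF \<zeta>(1) \<zeta>(2), of "x k n" n] xb[of k n] by simp
  have TwN: "N (T c (w n)) \<le> norm c * W" for c n by (intro N_T_le w)
  \<comment> \<open>One unit serves all four base points: \<open>e'\<close> is a unit for \<alpha>
    and \<beta>, hence for every combination \<open>\<i>^k \<alpha> + \<beta>\<close>, and
    \<open>e\<close> is a unit for \<open>e'\<close>.\<close>
  have "\<exists>e. norm e \<le> 1 \<and> (\<forall>k<4. cmod (pairing (\<lambda>y. w n y - T e (w n) y) (\<xi> k n)) \<le> 1 / real (Suc n))" for n
  proof -
    define KK where "KK = 2 * K + W + 1"
    have KK: "0 < KK" using K W by (simp add: KK_def)
    have "\<exists>\<eta>>0. \<forall>\<xi> w e e'. \<xi> \<in> V \<and> w \<in> V \<and> N \<xi> \<le> KK \<and> N w \<le> KK \<and> norm e \<le> 1 \<and> norm e' \<le> 1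
      \<and> norm (e' - e' * e) \<le> \<eta> \<and> N (\<lambda>x. T e' \<xi> x - \<xi> x) \<le> \<eta>
      \<longrightarrow> cmod (pairing (\<lambda>x. w x - T e w x) \<xi>) \<le> 1 / real (Suc n)"
      using pairing_approx_unit[OF KK, of "1 / real (Suc n)"] by simp
    then obtain \<eta> where \<eta>: "0 < \<eta>" and ap: "\<forall>\<xi> w e e'. \<xi> \<in> V \<and> w \<in> V \<and> N \<xi> \<le> KK \<and> N w \<le> KK \<and> norm e \<le> 1 \<and> norm e' \<le> 1
      \<and> norm (e' - e' * e) \<le> \<eta> \<and> N (\<lambda>x. T e' \<xi> x - \<xi> x) \<le> \<eta>
      \<longrightarrow> cmod (pairing (\<lambda>x. w x - T e w x) \<xi>) \<le> 1 / real (Suc n)" by (elim exE conjE)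
    obtain e' where e': "e' \<in> approx_units {\<alpha> n, \<beta> n} (\<eta> / 2)"
      using approx_units_nonempty[OF approx_unital, of "{\<alpha> n, \<beta> n}" "\<eta> / 2"] \<eta> by auto
    obtain e where e: "e \<in> approx_units {e'} \<eta>"
      using approx_units_nonempty[OF approx_unital, of "{e'}" \<eta>] \<eta> by auto
    have "cmod (pairing (\<lambda>y. w n y - T e (w n) y) (\<xi> k n)) \<le> 1 / real (Suc n)" for k
    proof -
      have "AE y in M. T e' (\<xi> k n) y - \<xi> k n y = T (e' * x k n - x k n) (\<zeta> n) y"
        using T_mult[OF \<zeta>(1), of e' "x k n" n] T_diff[OF \<zeta>(1), of "e' * x k n" "x k n" n]
        by (auto simp: \<xi>_def elim!: AE_mp)
      then have "N (\<lambda>y. T e' (\<xi> k n) y - \<xi> k n y) = N (T (e' * x k n - x k n) (\<zeta> n))"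
        by (intro N_cong_AE V_diff T_V \<xi>V \<zeta>)
      also have "\<dots> \<le> norm (e' * x k n - x k n)" using N_T_le[OF \<zeta>(1) \<zeta>(2), of "e' * x k n - x k n" n] by simp
      also have "e' * x k n - x k n = \<i> ^ k *\<^sub>C (e' * \<alpha> n - \<alpha> n) + (e' * \<beta> n - \<beta> n)"
        by (simp add: x_def distrib_left mult_scaleC_right scaleC_diff_right)
      also have "norm \<dots> \<le> \<eta> / 2 + \<eta> / 2"
        using approx_unitsD(2)[OF e'] by (intro order_trans[OF norm_triangle_ineq] add_mono) (auto simp: norm_scaleC norm_power)
      finally have 1: "N (\<lambda>y. T e' (\<xi> k n) y - \<xi> k n y) \<le> \<eta>" by simp
      have "norm (e' - e' * e) \<le> \<eta>" using approx_unitsD(3)[OF e] by (simp add: norm_minus_commute)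
      moreover have "N (\<xi> k n) \<le> KK" "N (w n) \<le> KK" using \<xi>N[of k n] w(2)[of n] K W by (auto simp: KK_def)
      ultimately show ?thesis
        using ap[rule_format, of "\<xi> k n" "w n" e e'] 1 \<xi>V w(1) approx_unitsD(1)[OF e] approx_unitsD(1)[OF e'] by blast
    qed
    then show ?thesis using approx_unitsD(1)[OF e] by blast
  qed
  then obtain e where e1: "\<And>n. norm (e n) \<le> 1"
    and eD: "\<And>n k. k < 4 \<Longrightarrow> cmod (pairing (\<lambda>y. w n y - T (e n) (w n) y) (\<xi> k n)) \<le> 1 / real (Suc n)"
    by metis
  define \<gamma> where "\<gamma> n = unit_action (R n) (e n)" for n
  have \<gamma>2: "norm (\<gamma> n) \<le> 2" for n using norm_R[of n "e n"] e1[of n] by (simp add: \<gamma>_def)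
  have \<kappa>e: "\<kappa> n * norm (e n) \<le> \<kappa> n" for n using \<kappa>_nonneg[of n] e1[of n] by (simp add: mult_left_le)
  define g where "g k c n = pairing (T c (w n)) (\<xi> k n)" for k c n
  have g_scale: "g k (c *\<^sub>C a) n = c * g k a n" and g_add: "g k (a + b) n = g k a n + g k b n" for k a b c n
    unfolding g_def by (intro pairing_T_scale pairing_T_add w \<xi>V)+
  define G where "G = W * (1 + (2 * K) powr p)"
  have g_bound: "cmod (g k c n) \<le> norm c * G" for k c n
  proof -
    have "cmod (g k c n) \<le> N (T c (w n)) * (1 + N (\<xi> k n) powr p)"
      unfolding g_def by (intro pairing_bound T_V w \<xi>V)
    also have "\<dots> \<le> (norm c * W) * (1 + (2 * K) powr p)"
      using TwN[of c n] \<xi>N[of k n] N_nonneg p_gt_1 W by (intro mult_mono add_mono powr_mono2) auto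
    finally show ?thesis by (simp add: G_def mult.assoc)
  qed
  define KK where "KK = 2 * K + 10 * W"
  have KK: "0 \<le> KK" and \<xi>KK: "N (\<xi> k n) \<le> KK" for k n using K W \<xi>N[of k n] by (auto simp: KK_def)
  have TKK: "N (T c (w n)) \<le> KK" if "norm c \<le> 10" for c n
    using TwN[of c n] mult_right_mono[OF that W] K by (simp add: KK_def)
  \<comment> \<open>The resolvent is almost contractive and almost fixes the base point, so applying
    it to point and displacement together cannot raise the norm by more than a null sequence. The
    phase \<open>c\<close> makes this one inequality sufficient.\<close>
  have resolvent: "(\<lambda>n. g k (\<gamma> n) n - g k (e n) n) \<longlonglongrightarrow> 0" for k
  proof (rule lim_le_complex)
    fix c :: complex assume c: "cmod c = 1"
    have "(\<lambda>n. Re (pairing (T (c *\<^sub>C \<gamma> n) (w n)) (\<xi> k n))) \<lessapprox> (\<lambda>n. Re (pairing (T (c *\<^sub>C e n) (w n)) (\<xi> k n)))"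
    proof (rule pairing_compare[OF \<xi>V \<xi>V T_V[OF w(1)] T_V[OF w(1)] KK \<xi>KK \<xi>KK])
      fix \<tau> :: real assume \<tau>: "0 < \<tau>"
      define er where "er n = \<kappa> n * (K0 * (2 * K + \<tau>)) + K0 * (norm (unit_action (R n) (\<alpha> n) - \<alpha> n) + norm (unit_action (R n) (\<beta> n) - \<beta> n))" for n
      have "er \<longlonglongrightarrow> 0 * (K0 * (2 * K + \<tau>)) + K0 * (0 + 0)"
        unfolding er_def[abs_def] by (intro tendsto_intros \<kappa>_lim lims)
      then have "er \<longlonglongrightarrow> 0" by simp
      then have "(\<lambda>n. \<mu> n (x k n, of_real \<tau> *\<^sub>C (c *\<^sub>C \<gamma> n))) \<lessapprox> (\<lambda>n. \<mu> n (x k n, of_real \<tau> *\<^sub>C (c *\<^sub>C e n)))"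
      proof (rule lim_le_error)
        fix n
        define Z where "Z = (x k n, of_real \<tau> *\<^sub>C (c *\<^sub>C e n))"
        have "\<mu> n Z \<le> K0 * (norm (x k n) + \<tau> * norm (e n))"
          using \<mu>b[of n Z] \<tau> c by (simp add: Z_def norm_scaleC)
        also have "\<dots> \<le> K0 * (2 * K + \<tau>)"
          using xb[of k n] e1[of n] \<tau> by (intro mult_left_mono K0 add_mono) (auto simp: mult_left_le)
        finally have Z: "\<kappa> n * \<mu> n Z \<le> \<kappa> n * (K0 * (2 * K + \<tau>))" by (intro mult_left_mono \<kappa>_nonneg)
        have "x k n - unit_action (R n) (x k n)
            = - (\<i> ^ k *\<^sub>C (unit_action (R n) (\<alpha> n) - \<alpha> n) + (unit_action (R n) (\<beta> n) - \<beta> n))"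
          by (simp add: x_def unit_action_linear scaleC_diff_right)
        then have "norm (x k n - unit_action (R n) (x k n))
            \<le> norm (\<i> ^ k *\<^sub>C (unit_action (R n) (\<alpha> n) - \<alpha> n)) + norm (unit_action (R n) (\<beta> n) - \<beta> n)"
          by (simp only: norm_minus_cancel norm_triangle_ineq)
        then have "norm (x k n - unit_action (R n) (x k n)) \<le> norm (unit_action (R n) (\<alpha> n) - \<alpha> n) + norm (unit_action (R n) (\<beta> n) - \<beta> n)"
          by (simp add: norm_scaleC norm_power)
        then have D: "K0 * norm (x k n - unit_action (R n) (x k n))
            \<le> K0 * (norm (unit_action (R n) (\<alpha> n) - \<alpha> n) + norm (unit_action (R n) (\<beta> n) - \<beta> n))"
          by (intro mult_left_mono K0)
        have "(x k n, of_real \<tau> *\<^sub>C (c *\<^sub>C \<gamma> n)) = act2 (R n) Z + (x k n - unit_action (R n) (x k n), 0)"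
          by (simp add: act2_def Z_def unit_action_linear \<gamma>_def)
        then have "\<mu> n (x k n, of_real \<tau> *\<^sub>C (c *\<^sub>C \<gamma> n)) \<le> \<mu> n (act2 (R n) Z) + \<mu> n (x k n - unit_action (R n) (x k n), 0)"
          by (simp only: cseminormD(1)[OF s])
        moreover have "\<mu> n (act2 (R n) Z) \<le> multiplier_norm (R n) * \<mu> n Z" by (rule module_seminorm_act2[OF \<mu> K0])
        moreover have "multiplier_norm (R n) * \<mu> n Z \<le> (1 + \<kappa> n) * \<mu> n Z" by (intro mult_right_mono R_norm cseminormD(6)[OF s])
        moreover have "\<mu> n (x k n - unit_action (R n) (x k n), 0) \<le> K0 * norm (x k n - unit_action (R n) (x k n))"
          using \<mu>b[of n "(x k n - unit_action (R n) (x k n), 0)"] by simp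
        ultimately show "\<mu> n (x k n, of_real \<tau> *\<^sub>C (c *\<^sub>C \<gamma> n)) \<le> \<mu> n (x k n, of_real \<tau> *\<^sub>C (c *\<^sub>C e n)) + er n"
          using Z D unfolding er_def Z_def[symmetric] distrib_right mult_1 by linarith
      qed
      then show "(\<lambda>n. N (\<lambda>y. \<xi> k n y + of_real \<tau> * T (c *\<^sub>C \<gamma> n) (w n) y)) \<lessapprox> (\<lambda>n. N (\<lambda>y. \<xi> k n y + of_real \<tau> * T (c *\<^sub>C e n) (w n) y))"
        unfolding \<xi>_def \<mu>_def by (simp only: mu_expand[OF \<zeta>(1) w(1)])
    qed (use c \<gamma>2 e1 order_trans[OF \<gamma>2] order_trans[OF e1] in \<open>auto intro!: TKK lim_le_refl simp: norm_scaleC\<close>)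
    then show "(\<lambda>n. Re (c * g k (\<gamma> n) n)) \<lessapprox> (\<lambda>n. Re (c * g k (e n) n))"
      unfolding g_def[symmetric] g_scale .
  qed
  \<comment> \<open>Point and displacement are turned together, since \<open>h\<close> acts on both
    components of the pair; comparing derivatives of the asymptotically equal norms gives the
    claim.\<close>
  have turn: "(\<lambda>n. Re (g k (\<i> ^ k *\<^sub>C b n + b' n) n)) \<lessapprox> (\<lambda>n. Re (g m (\<i> ^ m *\<^sub>C b n + b' n) n))"
    if b: "\<And>n. norm (b n) \<le> 5" "\<And>n. norm (b' n) \<le> 5" and hb: "(\<lambda>n. norm (h n * b n - b n)) \<longlonglongrightarrow> 0" "(\<lambda>n. norm (h n * b' n)) \<longlonglongrightarrow> 0"
    for k m b b'
  proof -
    have rot: "(\<lambda>n. \<mu> n (x k n, of_real \<tau> *\<^sub>C (\<i> ^ k *\<^sub>C b n + b' n))) \<lessapprox> (\<lambda>n. \<mu> n (x m n, of_real \<tau> *\<^sub>C (\<i> ^ m *\<^sub>C b n + b' n)))"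
      if \<tau>: "0 \<le> \<tau>" for \<tau> :: real and k m
    proof -
      have eq: "(x k n, of_real \<tau> *\<^sub>C (\<i> ^ k *\<^sub>C b n + b' n)) = \<i> ^ k *\<^sub>C (\<alpha> n, of_real \<tau> *\<^sub>C b n) + (\<beta> n, of_real \<tau> *\<^sub>C b' n)" for k n
        by (simp add: x_def scaleC_Pair scaleC_add_right scaleC_scaleC mult.commute)
      show ?thesis
        unfolding eq
      proof (rule rotation[OF \<mu> K0, where B = "K0 * (K + \<tau> * 5)"])
        show "(\<lambda>n. \<mu> n (act2 (h n, 0) (\<alpha> n, of_real \<tau> *\<^sub>C b n) - (\<alpha> n, of_real \<tau> *\<^sub>C b n))) \<longlonglongrightarrow> 0"
        proof (rule tendsto_0_le)
          have "(\<lambda>n. K0 * (norm (h n * \<alpha> n - \<alpha> n) + \<tau> * norm (h n * b n - b n))) \<longlonglongrightarrow> K0 * (0 + \<tau> * 0)"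
            by (intro tendsto_intros lims hb)
          then show "(\<lambda>n. K0 * (norm (h n * \<alpha> n - \<alpha> n) + \<tau> * norm (h n * b n - b n))) \<longlonglongrightarrow> 0" by simp
          fix n
          have "act2 (h n, 0) (\<alpha> n, of_real \<tau> *\<^sub>C b n) - (\<alpha> n, of_real \<tau> *\<^sub>C b n) = (h n * \<alpha> n - \<alpha> n, of_real \<tau> *\<^sub>C (h n * b n - b n))"
            by (simp add: act2_def unit_action_def mult_scaleC_right scaleC_diff_right)
          then show "\<mu> n (act2 (h n, 0) (\<alpha> n, of_real \<tau> *\<^sub>C b n) - (\<alpha> n, of_real \<tau> *\<^sub>C b n))
              \<le> K0 * (norm (h n * \<alpha> n - \<alpha> n) + \<tau> * norm (h n * b n - b n))"
            using \<mu>b[of n "(h n * \<alpha> n - \<alpha> n, of_real \<tau> *\<^sub>C (h n * b n - b n))"] \<tau> by (simp add: norm_scaleC)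
        qed (rule cseminormD(6)[OF s])
        show "(\<lambda>n. \<mu> n (act2 (h n, 0) (\<beta> n, of_real \<tau> *\<^sub>C b' n))) \<longlonglongrightarrow> 0"
        proof (rule tendsto_0_le)
          have "(\<lambda>n. K0 * (norm (h n * \<beta> n) + \<tau> * norm (h n * b' n))) \<longlonglongrightarrow> K0 * (0 + \<tau> * 0)"
            by (intro tendsto_intros lims hb)
          then show "(\<lambda>n. K0 * (norm (h n * \<beta> n) + \<tau> * norm (h n * b' n))) \<longlonglongrightarrow> 0" by simp
          fix n
          have "act2 (h n, 0) (\<beta> n, of_real \<tau> *\<^sub>C b' n) = (h n * \<beta> n, of_real \<tau> *\<^sub>C (h n * b' n))"
            by (simp add: act2_def unit_action_def mult_scaleC_right)
          then show "\<mu> n (act2 (h n, 0) (\<beta> n, of_real \<tau> *\<^sub>C b' n)) \<le> K0 * (norm (h n * \<beta> n) + \<tau> * norm (h n * b' n))"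
            using \<mu>b[of n "(h n * \<beta> n, of_real \<tau> *\<^sub>C (h n * b' n))"] \<tau> by (simp add: norm_scaleC)
        qed (rule cseminormD(6)[OF s])
        fix n
        have "\<mu> n (a, of_real \<tau> *\<^sub>C c) \<le> K0 * (K + \<tau> * 5)" if "norm a \<le> K" "norm c \<le> 5" for a c
          using \<tau> that by (intro order_trans[OF \<mu>b] mult_left_mono K0) (simp add: norm_scaleC add_mono mult_left_mono)
        then show "\<mu> n (\<alpha> n, of_real \<tau> *\<^sub>C b n) \<le> K0 * (K + \<tau> * 5)" "\<mu> n (\<beta> n, of_real \<tau> *\<^sub>C b' n) \<le> K0 * (K + \<tau> * 5)"
          using nab b by auto
      qed
    qed
    have b10: "norm (\<i> ^ k *\<^sub>C b n + b' n) \<le> 10" for k n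
      using norm_triangle_ineq[of "\<i> ^ k *\<^sub>C b n" "b' n"] b[of n] by (simp add: norm_scaleC norm_power)
    show ?thesis
      unfolding g_def
    proof (rule pairing_compare[OF \<xi>V \<xi>V T_V[OF w(1)] T_V[OF w(1)] KK \<xi>KK \<xi>KK TKK[OF b10] TKK[OF b10]])
      fix \<tau> :: real assume "0 < \<tau>"
      then show "(\<lambda>n. N (\<lambda>y. \<xi> k n y + of_real \<tau> * T (\<i> ^ k *\<^sub>C b n + b' n) (w n) y))
          \<lessapprox> (\<lambda>n. N (\<lambda>y. \<xi> m n y + of_real \<tau> * T (\<i> ^ m *\<^sub>C b n + b' n) (w n) y))"
        using rot[of \<tau> k m] unfolding \<xi>_def \<mu>_def by (simp only: mu_expand[OF \<zeta>(1) w(1)] less_imp_le)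
    next
      show "(\<lambda>n. N (\<xi> m n)) \<lessapprox> (\<lambda>n. N (\<xi> k n))"
      proof -
        have "N (\<xi> k n) = \<mu> n (x k n, 0)" for k n unfolding \<xi>_def \<mu>_def by (rule mu_single[OF \<zeta>(1) w(1)])
        then show ?thesis using rot[of 0 m k] by simp
      qed
    qed
  qed
  \<comment> \<open>On the range of the resolvent \<open>h\<close> is almost idempotent and
    \<open>l - h\<close> is small, so \<gamma> is the sum of \<open>y\<close>, which
    \<open>h\<close> almost fixes, of \<open>v\<close>, which it almost annihilates, and of the
    negligible \<open>r\<close>.\<close>
  define y where "y n = h n * \<gamma> n" for n
  define v where "v n = \<gamma> n - l n * \<gamma> n" for n
  define r where "r n = l n * \<gamma> n - h n * \<gamma> n" for n
  have y2: "norm (y n) \<le> 2" for n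
    using norm_mult_ineq[of "h n" "\<gamma> n"] mult_mono[OF h1[of n] \<gamma>2[of n]] by (simp add: y_def)
  have l2: "norm (l n * \<gamma> n) \<le> 2" for n
    using norm_mult_ineq[of "l n" "\<gamma> n"] mult_mono[OF l1[of n] \<gamma>2[of n]] by simp
  have v4: "norm (v n) \<le> 4" for n
    using norm_triangle_ineq4[of "\<gamma> n" "l n * \<gamma> n"] \<gamma>2[of n] l2[of n] unfolding v_def by linarith
  have hy: "(\<lambda>n. norm (h n * y n - y n)) \<longlonglongrightarrow> 0"
    using order_trans[OF idem \<kappa>e] by (intro tendsto_0_le[OF \<kappa>_lim]) (auto simp: y_def \<gamma>_def)
  have hv: "(\<lambda>n. norm (h n * v n)) \<longlonglongrightarrow> 0"
    using order_trans[OF kill \<kappa>e] by (intro tendsto_0_le[OF \<kappa>_lim]) (auto simp: v_def \<gamma>_def)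
  have rr: "(\<lambda>n. norm (r n)) \<longlonglongrightarrow> 0"
    using order_trans[OF split \<kappa>e] by (intro tendsto_0_le[OF \<kappa>_lim]) (auto simp: r_def \<gamma>_def)
  have gy: "(\<lambda>n. \<i> ^ k * g k (y n) n - g 0 (y n) n) \<longlonglongrightarrow> 0" for k
  proof (rule lim_le_complex)
    fix c :: complex assume c: "cmod c = 1"
    have g0: "g k 0 n = 0" for k n using g_scale[of k 0 0 n] by simp
    have "(\<lambda>n. Re (g k (\<i> ^ k *\<^sub>C (c *\<^sub>C y n) + 0) n)) \<lessapprox> (\<lambda>n. Re (g 0 (\<i> ^ 0 *\<^sub>C (c *\<^sub>C y n) + 0) n))"
    proof (rule turn)
      show "norm (c *\<^sub>C y n) \<le> 5" for n using y2[of n] c by (simp add: norm_scaleC)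
      show "(\<lambda>n. norm (h n * (c *\<^sub>C y n) - c *\<^sub>C y n)) \<longlonglongrightarrow> 0"
        using hy c by (simp add: mult_scaleC_right norm_scaleC flip: scaleC_diff_right)
    qed simp_all
    then show "(\<lambda>n. Re (c * (\<i> ^ k * g k (y n) n))) \<lessapprox> (\<lambda>n. Re (c * g 0 (y n) n))"
      unfolding g_add g_scale g0 power_0 by (simp add: mult.left_commute)
  qed
  have gv: "(\<lambda>n. g k (v n) n - g 0 (v n) n) \<longlonglongrightarrow> 0" for k
  proof (rule lim_le_complex)
    fix c :: complex assume c: "cmod c = 1"
    have g0: "g k 0 n = 0" for k n using g_scale[of k 0 0 n] by simp
    have "(\<lambda>n. Re (g k (\<i> ^ k *\<^sub>C 0 + c *\<^sub>C v n) n)) \<lessapprox> (\<lambda>n. Re (g 0 (\<i> ^ 0 *\<^sub>C 0 + c *\<^sub>C v n) n))"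
    proof (rule turn)
      show "norm (c *\<^sub>C v n) \<le> 5" for n using v4[of n] c by (simp add: norm_scaleC)
      show "(\<lambda>n. norm (h n * (c *\<^sub>C v n))) \<longlonglongrightarrow> 0" using hv c by (simp add: mult_scaleC_right norm_scaleC)
    qed simp_all
    then show "(\<lambda>n. Re (c * g k (v n) n)) \<lessapprox> (\<lambda>n. Re (c * g 0 (v n) n))"
      unfolding g_add g_scale g0 by simp
  qed
  \<comment> \<open>The power is inverse because it is the pairing of \<open>\<i>^k y\<close> with
    the k-th base point that does not depend on \<open>k\<close>.\<close>
  define t where "t k n = pairing (w n) (\<xi> k n) - ((- \<i>) ^ k * g 0 (y n) n + g 0 (v n) n)" for k n
  have t: "t k \<longlonglongrightarrow> 0" if k: "k < 4" for k
  proof -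
    have 1: "(\<lambda>n. pairing (\<lambda>y. w n y - T (e n) (w n) y) (\<xi> k n)) \<longlonglongrightarrow> 0"
      by (rule Lim_null_comparison[OF _ LIMSEQ_inverse_real_of_nat]) (use eD[OF k] in \<open>auto simp: inverse_eq_divide intro: always_eventually\<close>)
    have 2: "(\<lambda>n. g k (r n) n) \<longlonglongrightarrow> 0"
    proof (rule Lim_null_comparison)
      show "\<forall>\<^sub>F n in sequentially. cmod (g k (r n) n) \<le> norm (r n) * G" by (intro always_eventually allI g_bound)
      show "(\<lambda>n. norm (r n) * G) \<longlonglongrightarrow> 0" using tendsto_mult_right[OF rr, of G] by simp
    qed
    have i: "(- \<i>) ^ k * \<i> ^ k = 1" by (simp flip: power_mult_distrib)
    have dec: "\<gamma> n = y n + v n + r n" for n by (simp add: y_def v_def r_def)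
    have gdec: "g k (\<gamma> n) n = g k (y n) n + g k (v n) n + g k (r n) n" for n unfolding dec g_add ..
    have teq: "t k n = pairing (\<lambda>y. w n y - T (e n) (w n) y) (\<xi> k n) - (g k (\<gamma> n) n - g k (e n) n) + g k (r n) n
        + (- \<i>) ^ k * (\<i> ^ k * g k (y n) n - g 0 (y n) n) + (g k (v n) n - g 0 (v n) n)" for n
    proof -
      have "pairing (\<lambda>y. w n y - T (e n) (w n) y) (\<xi> k n) = pairing (w n) (\<xi> k n) - g k (e n) n"
        unfolding g_def by (intro pairing_diff w T_V \<xi>V)
      moreover have "(- \<i>) ^ k * (\<i> ^ k * g k (y n) n - g 0 (y n) n) = g k (y n) n - (- \<i>) ^ k * g 0 (y n) n"
        unfolding right_diff_distrib mult.assoc[symmetric] i by simp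
      ultimately show ?thesis unfolding t_def gdec by simp
    qed
    have fin: "(\<lambda>n. pairing (\<lambda>y. w n y - T (e n) (w n) y) (\<xi> k n) - (g k (\<gamma> n) n - g k (e n) n) + g k (r n) n
        + (- \<i>) ^ k * (\<i> ^ k * g k (y n) n - g 0 (y n) n) + (g k (v n) n - g 0 (v n) n)) \<longlonglongrightarrow> 0 - 0 + 0 + (- \<i>) ^ k * 0 + 0"
      by (intro tendsto_intros 1 2 resolvent gy gv)
    show ?thesis using fin unfolding teq[symmetric] by simp
  qed
  \<comment> \<open>Both modes cancel: the sums of \<open>(-1)^k\<close> and of
    \<open>(-1)^k * (-\<i>)^k = \<i>^k\<close> over four consecutive \<open>k\<close> are 0.\<close>
  have "(\<lambda>n. \<Sum>k<4. (-1) ^ k * t k n) \<longlonglongrightarrow> (\<Sum>k<4. (-1) ^ k * 0)"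
    by (intro tendsto_sum tendsto_mult tendsto_const t) auto
  moreover have "(\<Sum>k<4. (-1) ^ k * t k n) = (\<Sum>k<4. (-1) ^ k * pairing (w n) (\<xi> k n))" for n
    by (simp add: t_def eval_nat_numeral algebra_simps)
  ultimately show ?thesis by (simp add: \<xi>_def x_def)
qed

end

section \<open>Strong convergence of the mode gap and disjointness\<close>

context Lp_setting
begin

lemma pairing_cong_AE2:
  assumes "AE x in M. \<xi> x = \<xi>' x" "w \<in> V" "\<xi> \<in> V" "\<xi>' \<in> V"
  shows "pairing w \<xi> = pairing w \<xi>'"
proof -
  have [measurable]: "w \<in> borel_measurable M" "\<xi> \<in> borel_measurable M" "\<xi>' \<in> borel_measurable M"
    using assms by (auto dest: V_D)
  show ?thesis unfolding pairing_def using assms(1) by (intro integral_cong_AE) auto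
qed

lemma mode_gap_sum: "mode_gap p a b = (\<Sum>k<4. (-1) ^ k * duality p (\<i> ^ k * a + b))"
  by (simp add: mode_gap_def eval_nat_numeral)

lemma norm_mode_gap_le:
  "cmod (mode_gap p a b) powr (p / (p - 1)) \<le> 4 powr (p / (p - 1)) * (\<Sum>k<4. cmod (\<i> ^ k * a + b) powr p)"
proof -
  define q where "q = p / (p - 1)"
  have q: "1 < q" "p * (1 / q) = p - 1" using p_gt_1 by (auto simp: q_def)
  define s where "s = (\<Sum>k<4. cmod (\<i> ^ k * a + b) powr p)"
  have s0: "0 \<le> s" unfolding s_def by (intro sum_nonneg) simp
  have "cmod (mode_gap p a b) \<le> (\<Sum>k<4. cmod ((-1) ^ k * duality p (\<i> ^ k * a + b)))"
    unfolding mode_gap_sum by (rule norm_sum)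
  also have "\<dots> = (\<Sum>k<4. cmod (\<i> ^ k * a + b) powr (p - 1))" by (simp add: norm_mult norm_power norm_duality)
  also have "\<dots> \<le> (\<Sum>k<(4::nat). s powr (1 / q))"
  proof (rule sum_mono)
    fix k :: nat assume "k \<in> {..<4}"
    then have "cmod (\<i> ^ k * a + b) powr p \<le> s" unfolding s_def by (intro member_le_sum) auto
    then have "(cmod (\<i> ^ k * a + b) powr p) powr (1 / q) \<le> s powr (1 / q)" using q by (intro powr_mono2) auto
    then show "cmod (\<i> ^ k * a + b) powr (p - 1) \<le> s powr (1 / q)" by (simp only: powr_powr q(2))
  qed
  also have "\<dots> = 4 * s powr (1 / q)" by simp
  finally have "cmod (mode_gap p a b) powr q \<le> (4 * s powr (1 / q)) powr q" using q by (intro powr_mono2) auto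
  also have "\<dots> = 4 powr q * s" using q s0 by (simp add: powr_mult powr_powr)
  finally show ?thesis by (simp add: s_def q_def)
qed

lemma mode_gap_integrable:
  assumes "u \<in> V" "v \<in> V"
  shows "integrable M (\<lambda>x. 4 powr (p / (p - 1)) * (\<Sum>k<4. cmod (\<i> ^ k * u x + v x) powr p))"
    and "(\<lambda>x. mode_gap p (u x) (v x)) \<in> borel_measurable M"
    and "integrable M (\<lambda>x. cmod (mode_gap p (u x) (v x)) powr (p / (p - 1)))"
proof -
  show 1: "integrable M (\<lambda>x. 4 powr (p / (p - 1)) * (\<Sum>k<4. cmod (\<i> ^ k * u x + v x) powr p))"
    by (intro integrable_mult_right Bochner_Integration.integrable_sum V_D(2) V_add V_scale assms)
  have [measurable]: "u \<in> borel_measurable M" "v \<in> borel_measurable M" using assms by (auto dest: V_D)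
  show [measurable]: "(\<lambda>x. mode_gap p (u x) (v x)) \<in> borel_measurable M" unfolding mode_gap_def by measurable
  show "integrable M (\<lambda>x. cmod (mode_gap p (u x) (v x)) powr (p / (p - 1)))"
    by (rule Bochner_Integration.integrable_bound[OF 1])
      (auto intro!: AE_I2 order_trans[OF norm_mode_gap_le abs_ge_self])
qed

end

context unit_sequence
begin

text \<open>The mode gap \<open>H\<close> lies in the dual space, with exponent \<open>q\<close>.
  Testing with \<open>w = duality q H\<close> is legitimate because \<open>|w|^p = |H|^q\<close> is
  bounded in mean, and the pairing with \<open>H\<close> then is the integral of
  \<open>|H|^q\<close> itself.\<close>

lemma mode_gap_strong:
  assumes ad: "adapted \<alpha> \<beta> K" and K: "0 \<le> K" and \<zeta>: "\<And>n. \<zeta> n \<in> V" "\<And>n. N (\<zeta> n) \<le> 1"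
  shows "(\<lambda>n. LINT x|M. cmod (mode_gap p (T (\<alpha> n) (\<zeta> n) x) (T (\<beta> n) (\<zeta> n) x)) powr (p / (p - 1))) \<longlonglongrightarrow> 0"
proof -
  define q where "q = p / (p - 1)"
  have q: "1 < q" "(q - 1) * p = q" using p_gt_1 by (auto simp: q_def field_simps)
  define u v where "u n = T (\<alpha> n) (\<zeta> n)" and "v n = T (\<beta> n) (\<zeta> n)" for n
  have uV: "u n \<in> V" and vV: "v n \<in> V" for n by (auto simp: u_def v_def intro: T_V \<zeta>)
  have uN: "N (u n) \<le> K" and vN: "N (v n) \<le> K" for n
    using ad N_T_le[OF \<zeta>(1) \<zeta>(2), of "\<alpha> n" n] N_T_le[OF \<zeta>(1) \<zeta>(2), of "\<beta> n" n]
    by (auto simp: u_def v_def adapted_def intro: order_trans)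
  define z where "z k n = (\<lambda>x. \<i> ^ k * u n x + v n x)" for k n
  have zV: "z k n \<in> V" for k n unfolding z_def by (intro V_add V_scale uV vV)
  have zN: "N (z k n) \<le> 2 * K" for k n
    using N_triangle[OF V_scale[OF uV] vV, of "\<i> ^ k" n n] N_scale[OF uV, of "\<i> ^ k" n] uN[of n] vN[of n]
    by (simp add: z_def norm_power)
  have [measurable]: "u n \<in> borel_measurable M" "v n \<in> borel_measurable M" "z k n \<in> borel_measurable M" for k n
    using V_D(1)[OF uV] V_D(1)[OF vV] V_D(1)[OF zV] by auto
  define H where "H n x = mode_gap p (u n x) (v n x)" for n x
  have Hz: "H n x = (\<Sum>k<4. (-1) ^ k * duality p (z k n x))" for n x
    by (simp add: H_def z_def mode_gap_sum)
  have Hm [measurable]: "H n \<in> borel_measurable M" for n unfolding H_def[abs_def] by (rule mode_gap_integrable(2)[OF uV vV])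
  have Hq: "cmod (H n x) powr q \<le> 4 powr q * (\<Sum>k<4. cmod (z k n x) powr p)" for n x
    unfolding H_def z_def q_def by (rule norm_mode_gap_le)
  define w where "w n = (\<lambda>x. duality q (H n x))" for n
  have wp: "cmod (w n x) powr p = cmod (H n x) powr q" for n x by (simp add: w_def norm_duality powr_powr q)
  have [measurable]: "w n \<in> borel_measurable M" for n
    unfolding w_def by (rule measurable_compose[OF Hm borel_measurable_continuous_onI[OF continuous_duality[OF q(1)]]])
  define g where "g n x = 4 powr q * (\<Sum>k<4. cmod (z k n x) powr p)" for n x
  have gI: "integrable M (g n)" for n
    unfolding g_def[abs_def] z_def q_def by (rule mode_gap_integrable(1)[OF uV vV])
  have wV: "w n \<in> V" for n
    by (rule V_dominated[OF _ gI]) (auto simp: wp g_def intro: Hq)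
  define I where "I = 4 powr q * (\<Sum>k<(4::nat). (2 * K) powr p)"
  have I0: "0 \<le> I" by (simp add: I_def)
  define W where "W = I powr (1 / p)"
  have wN: "N (w n) \<le> W" for n
  proof -
    have "(LINT x|M. cmod (w n x) powr p) \<le> (LINT x|M. g n x)"
      using Hq by (intro integral_mono V_D wV gI) (simp add: wp g_def)
    also have "\<dots> = 4 powr q * (\<Sum>k<4. N (z k n) powr p)"
      unfolding g_def N_powr by (simp add: Bochner_Integration.integral_sum V_D(2)[OF zV])
    also have "\<dots> \<le> I" unfolding I_def using zN N_nonneg p_gt_1 by (intro mult_left_mono sum_mono powr_mono2) auto
    also have "I = W powr p" using p_gt_1 I0 by (simp add: W_def powr_powr)
    finally show ?thesis by (subst N_le_iff) (auto simp: W_def)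
  qed
  have "(\<lambda>n. \<Sum>k<4. (-1) ^ k * pairing (w n) (T (\<i> ^ k *\<^sub>C \<alpha> n + \<beta> n) (\<zeta> n))) \<longlonglongrightarrow> 0"
    by (rule mode_gap_weak[OF ad K \<zeta> wV wN])
  moreover have "(\<Sum>k<4. (-1) ^ k * pairing (w n) (T (\<i> ^ k *\<^sub>C \<alpha> n + \<beta> n) (\<zeta> n))) = of_real (LINT x|M. cmod (H n x) powr q)" for n
  proof -
    have "pairing (w n) (T (\<i> ^ k *\<^sub>C \<alpha> n + \<beta> n) (\<zeta> n)) = pairing (w n) (z k n)" for k
    proof (rule pairing_cong_AE2)
      show "AE x in M. T (\<i> ^ k *\<^sub>C \<alpha> n + \<beta> n) (\<zeta> n) x = z k n x"
        using T_add[OF \<zeta>(1), of "\<i> ^ k *\<^sub>C \<alpha> n" "\<beta> n" n] T_scale[OF \<zeta>(1), of "\<i> ^ k" "\<alpha> n" n]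
        by (auto simp: z_def u_def v_def elim!: AE_mp)
    qed (intro wV zV T_V \<zeta>)+
    then have "(\<Sum>k<4. (-1) ^ k * pairing (w n) (T (\<i> ^ k *\<^sub>C \<alpha> n + \<beta> n) (\<zeta> n)))
        = (\<Sum>k<4. (LINT x|M. (-1) ^ k * (w n x * duality p (z k n x))))" by (simp add: pairing_def)
    also have "\<dots> = (LINT x|M. (\<Sum>k<4. (-1) ^ k * (w n x * duality p (z k n x))))"
      by (intro Bochner_Integration.integral_sum[symmetric] integrable_mult_right pairing_integrable wV zV)
    also have "(\<lambda>x. \<Sum>k<4. (-1) ^ k * (w n x * duality p (z k n x))) = (\<lambda>x. complex_of_real (cmod (H n x) powr q))"
    proof
      fix x
      have "(\<Sum>k<4. (-1) ^ k * (w n x * duality p (z k n x))) = H n x * duality q (H n x)"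
        unfolding Hz[of n x] w_def sum_distrib_right by (intro sum.cong) (simp_all add: Hz mult.assoc mult.commute)
      then show "(\<Sum>k<4. (-1) ^ k * (w n x * duality p (z k n x))) = of_real (cmod (H n x) powr q)"
        by (simp add: mult_duality[OF q(1)])
    qed
    also have "(LINT x|M. complex_of_real (cmod (H n x) powr q)) = of_real (LINT x|M. cmod (H n x) powr q)"
      by (rule integral_complex_of_real)
    finally show ?thesis .
  qed
  ultimately have "(\<lambda>n. complex_of_real (LINT x|M. cmod (H n x) powr q)) \<longlonglongrightarrow> of_real 0" by simp
  then have "(\<lambda>n. LINT x|M. cmod (H n x) powr q) \<longlonglongrightarrow> 0" by (simp only: tendsto_of_real_iff)
  then show ?thesis by (simp add: H_def u_def v_def q_def)
qed

text \<open>For \<open>p \<noteq> 2\<close> the pointwise failure of additivity of p-th powers is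
  dominated by the mode gap up to an arbitrarily small multiple of the powers themselves, so
  vanishing of the mode gap in mean gives additivity in the limit.\<close>

theorem asymptotic_disjointness:
  assumes ad: "adapted \<alpha> \<beta> K" and K: "0 \<le> K" and \<zeta>: "\<And>n. \<zeta> n \<in> V" "\<And>n. N (\<zeta> n) \<le> 1"
  shows "(\<lambda>n. N (T (\<alpha> n + \<beta> n) (\<zeta> n)) powr p - N (T (\<alpha> n) (\<zeta> n)) powr p - N (T (\<beta> n) (\<zeta> n)) powr p) \<longlonglongrightarrow> 0"
proof -
  have nab: "norm (\<alpha> n) \<le> K" "norm (\<beta> n) \<le> K" for n using ad by (auto simp: adapted_def)
  define u v where "u n = T (\<alpha> n) (\<zeta> n)" and "v n = T (\<beta> n) (\<zeta> n)" for n
  have uV: "u n \<in> V" and vV: "v n \<in> V" for n by (auto simp: u_def v_def intro: T_V \<zeta>)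
  have uN: "N (u n) \<le> K" and vN: "N (v n) \<le> K" for n
    using nab N_T_le[OF \<zeta>(1) \<zeta>(2), of "\<alpha> n" n] N_T_le[OF \<zeta>(1) \<zeta>(2), of "\<beta> n" n]
    by (auto simp: u_def v_def intro: order_trans)
  have Npm: "N (T (c *\<^sub>C \<alpha> n + \<beta> n) (\<zeta> n)) = N (\<lambda>x. c * u n x + v n x)" for c n
  proof (rule N_cong_AE)
    show "AE x in M. T (c *\<^sub>C \<alpha> n + \<beta> n) (\<zeta> n) x = c * u n x + v n x"
      using T_add[OF \<zeta>(1), of "c *\<^sub>C \<alpha> n" "\<beta> n" n] T_scale[OF \<zeta>(1), of c "\<alpha> n" n]
      by (auto simp: u_def v_def elim!: AE_mp)
  qed (intro V_add V_scale T_V \<zeta> uV vV)+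
  have Np: "N (T (\<alpha> n + \<beta> n) (\<zeta> n)) = N (\<lambda>x. u n x + v n x)" for n using Npm[of 1 n] by simp
  show ?thesis
  proof (cases "p = 2")
    \<comment> \<open>Here the duality map is conjugation and the mode gap is identically 0. Instead
      the half turn equates the norms of \<open>u + v\<close> and \<open>- u + v\<close>
      asymptotically, and the parallelogram law gives additivity.\<close>
    case True
    define \<mu> where "\<mu> n = mu (\<zeta> n) (\<zeta> n)" for n
    have \<mu>: "module_seminorm (\<mu> n) 1" for n unfolding \<mu>_def by (intro module_seminorm_mu \<zeta>)
    have s: "cseminorm (\<mu> n)" and \<mu>b: "\<mu> n y \<le> 1 * (norm (fst y) + norm (snd y))" for n y
      using \<mu>[of n] unfolding module_seminorm_def by blast+
    have rot: "(\<lambda>n. \<mu> n (\<i> ^ k *\<^sub>C (\<alpha> n, 0) + (\<beta> n, 0))) \<lessapprox> (\<lambda>n. \<mu> n (\<i> ^ m *\<^sub>C (\<alpha> n, 0) + (\<beta> n, 0)))" for k m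
    proof (rule rotation[OF \<mu>, where B = K])
      show "(\<lambda>n. \<mu> n (act2 (h n, 0) (\<alpha> n, 0) - (\<alpha> n, 0))) \<longlonglongrightarrow> 0"
      proof (rule tendsto_0_le)
        show "(\<lambda>n. norm (h n * \<alpha> n - \<alpha> n)) \<longlonglongrightarrow> 0" using ad by (simp add: adapted_def)
        show "\<mu> n (act2 (h n, 0) (\<alpha> n, 0) - (\<alpha> n, 0)) \<le> norm (h n * \<alpha> n - \<alpha> n)" for n
          using \<mu>b[of n "act2 (h n, 0) (\<alpha> n, 0) - (\<alpha> n, 0)"] by (simp add: act2_def unit_action_def)
      qed (rule cseminormD(6)[OF s])
      show "(\<lambda>n. \<mu> n (act2 (h n, 0) (\<beta> n, 0))) \<longlonglongrightarrow> 0"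
      proof (rule tendsto_0_le)
        show "(\<lambda>n. norm (h n * \<beta> n)) \<longlonglongrightarrow> 0" using ad by (simp add: adapted_def)
        show "\<mu> n (act2 (h n, 0) (\<beta> n, 0)) \<le> norm (h n * \<beta> n)" for n
          using \<mu>b[of n "act2 (h n, 0) (\<beta> n, 0)"] by (simp add: act2_def unit_action_def)
      qed (rule cseminormD(6)[OF s])
      show "\<mu> n (\<alpha> n, 0) \<le> K" "\<mu> n (\<beta> n, 0) \<le> K" for n
        using \<mu>b[of n "(\<alpha> n, 0)"] \<mu>b[of n "(\<beta> n, 0)"] nab[of n] by auto
    qed simp
    define P where "P k n = N (\<lambda>x. \<i> ^ k * u n x + v n x)" for k n
    have P: "P k n = \<mu> n (\<i> ^ k *\<^sub>C (\<alpha> n, 0) + (\<beta> n, 0))" for k n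
      unfolding P_def Npm[symmetric] \<mu>_def by (simp add: mu_single[OF \<zeta>(1) \<zeta>(1)] scaleC_Pair)
    have PK: "P k n \<le> 2 * K" for k n
      using N_triangle[OF V_scale[OF uV] vV, of "\<i> ^ k" n n] N_scale[OF uV, of "\<i> ^ k" n] uN[of n] vN[of n]
      by (simp add: P_def norm_power)
    have "(\<lambda>n. P k n powr p) \<lessapprox> (\<lambda>n. P m n powr p)" for k m
      using K rot[of k m] PK by (intro lim_le_powr[OF p_gt_1, where K = "2 * K"]) (auto simp: P[symmetric] simp: P_def N_nonneg)
    then have lim: "(\<lambda>n. P 0 n powr p - P 2 n powr p) \<longlonglongrightarrow> 0" by (intro lim_le_tendsto)
    have par: "P 0 n powr p + P 2 n powr p = 2 * N (u n) powr p + 2 * N (v n) powr p" for n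
    proof -
      have pl: "cmod (a + b) powr 2 + cmod (- a + b) powr 2 = 2 * cmod a powr 2 + 2 * cmod b powr 2" for a b
        by (simp add: powr_numeral cmod_power2) (simp add: power2_eq_square algebra_simps)
      have "P 0 n powr p + P 2 n powr p = (LINT x|M. cmod (u n x + v n x) powr p + cmod (- u n x + v n x) powr p)"
        using V_D(2)[OF V_add[OF uV[of n] vV[of n]]] V_D(2)[OF V_add[OF V_scale[OF uV[of n], of "-1"] vV[of n]]]
        unfolding P_def N_powr by (simp add: Bochner_Integration.integral_add)
      also have "\<dots> = (LINT x|M. 2 * cmod (u n x) powr p + 2 * cmod (v n x) powr p)" unfolding True pl ..
      also have "\<dots> = 2 * N (u n) powr p + 2 * N (v n) powr p"
        using V_D(2)[OF uV[of n]] V_D(2)[OF vV[of n]] unfolding N_powr by simp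
      finally show ?thesis .
    qed
    have half: "P 0 n powr p - N (u n) powr p - N (v n) powr p = (1 / 2) * (P 0 n powr p - P 2 n powr p)" for n
      using par[of n] by simp
    have "(\<lambda>n. P 0 n powr p - N (u n) powr p - N (v n) powr p) \<longlonglongrightarrow> 0"
      unfolding half using tendsto_mult_left[OF lim, of "1 / 2"] by simp
    then show ?thesis unfolding Np by (simp add: P_def u_def v_def)
  next
    case False
    show ?thesis
    proof (rule tendstoI)
      fix \<epsilon> :: real assume \<epsilon>: "0 < \<epsilon>"
      define \<epsilon>' where "\<epsilon>' = \<epsilon> / (4 * (K powr p + 1))"
      have K1: "0 < K powr p + 1" by (simp add: add_nonneg_pos)
      have \<epsilon>': "0 < \<epsilon>'" using \<epsilon> K1 by (simp add: \<epsilon>'_def)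
      obtain r C where r: "r > 0" and C: "0 \<le> C" and def: "\<And>a b. \<bar>cmod (a + b) powr p - cmod a powr p - cmod b powr p\<bar>
          \<le> \<epsilon>' * (cmod a powr p + cmod b powr p) + C * cmod (mode_gap p (of_real r * a) b) powr (p / (p - 1))"
        using norm_powr_add_defect[OF p_gt_1 False \<epsilon>'] by blast
      \<comment> \<open>The defect estimate involves \<open>r\<close> times the first argument of
        the mode gap; being adapted survives scaling one of the two sequences by a constant.\<close>
      define \<alpha>' where "\<alpha>' n = of_real r *\<^sub>C \<alpha> n" for n
      have "adapted \<alpha>' \<beta> ((r + 1) * K)"
        unfolding adapted_def
      proof (intro conjI allI)
        show "norm (\<alpha>' n) \<le> (r + 1) * K" for n
        proof -
          have "norm (\<alpha>' n) = r * norm (\<alpha> n)" using r by (simp add: \<alpha>'_def norm_scaleC)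
          moreover have "r * norm (\<alpha> n) \<le> r * K" using nab(1)[of n] r by (intro mult_left_mono) auto
          ultimately show ?thesis unfolding distrib_right using K by linarith
        qed
        show "norm (\<beta> n) \<le> (r + 1) * K" for n
          using nab(2)[of n] r K by (simp add: distrib_right add_increasing)
        have "norm (h n * \<alpha>' n - \<alpha>' n) = r * norm (h n * \<alpha> n - \<alpha> n)" for n
          using r by (simp add: \<alpha>'_def mult_scaleC_right norm_scaleC flip: scaleC_diff_right)
        then show "(\<lambda>n. norm (h n * \<alpha>' n - \<alpha>' n)) \<longlonglongrightarrow> 0"
          using ad tendsto_mult_left[of "\<lambda>n. norm (h n * \<alpha> n - \<alpha> n)" 0 sequentially r] by (simp add: adapted_def)
        have "norm (unit_action (R n) (\<alpha>' n) - \<alpha>' n) = r * norm (unit_action (R n) (\<alpha> n) - \<alpha> n)" for n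
          using r by (simp add: \<alpha>'_def unit_action_linear norm_scaleC flip: scaleC_diff_right)
        then show "(\<lambda>n. norm (unit_action (R n) (\<alpha>' n) - \<alpha>' n)) \<longlonglongrightarrow> 0"
          using ad tendsto_mult_left[of "\<lambda>n. norm (unit_action (R n) (\<alpha> n) - \<alpha> n)" 0 sequentially r] by (simp add: adapted_def)
      qed (use ad in \<open>auto simp: adapted_def\<close>)
      then have "(\<lambda>n. LINT x|M. cmod (mode_gap p (T (\<alpha>' n) (\<zeta> n) x) (v n x)) powr (p / (p - 1))) \<longlonglongrightarrow> 0"
        unfolding v_def using r K by (intro mode_gap_strong[OF _ _ \<zeta>, where K = "(r + 1) * K"]) auto
      moreover have "(LINT x|M. cmod (mode_gap p (T (\<alpha>' n) (\<zeta> n) x) (v n x)) powr (p / (p - 1)))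
          = (LINT x|M. cmod (mode_gap p (of_real r * u n x) (v n x)) powr (p / (p - 1)))" for n
      proof -
        have [measurable]: "u n \<in> borel_measurable M" "v n \<in> borel_measurable M" "T (\<alpha>' n) (\<zeta> n) \<in> borel_measurable M"
          using V_D(1)[OF uV[of n]] V_D(1)[OF vV[of n]] V_D(1)[OF T_V[OF \<zeta>(1)], of "\<alpha>' n" n] by auto
        have "AE x in M. T (\<alpha>' n) (\<zeta> n) x = of_real r * u n x"
          unfolding \<alpha>'_def u_def by (rule T_scale[OF \<zeta>(1)])
        then show ?thesis unfolding mode_gap_def by (intro integral_cong_AE) (auto elim!: AE_mp)
      qed
      ultimately have lim: "(\<lambda>n. LINT x|M. cmod (mode_gap p (of_real r * u n x) (v n x)) powr (p / (p - 1))) \<longlonglongrightarrow> 0" by simp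
      have intg: "integrable M (\<lambda>x. cmod (mode_gap p (of_real r * u n x) (v n x)) powr (p / (p - 1)))" for n
        by (rule mode_gap_integrable(3)[OF V_scale[OF uV] vV])
      have bound: "\<bar>N (\<lambda>x. u n x + v n x) powr p - N (u n) powr p - N (v n) powr p\<bar>
          \<le> \<epsilon> / 2 + C * (LINT x|M. cmod (mode_gap p (of_real r * u n x) (v n x)) powr (p / (p - 1)))" for n
      proof -
        note [simp] = V_D(2)[OF uV] V_D(2)[OF vV] V_D(2)[OF V_add[OF uV vV]] intg
        have "\<bar>N (\<lambda>x. u n x + v n x) powr p - N (u n) powr p - N (v n) powr p\<bar>
            = \<bar>LINT x|M. cmod (u n x + v n x) powr p - cmod (u n x) powr p - cmod (v n x) powr p\<bar>"
          by (simp add: N_powr)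
        also have "\<dots> \<le> (LINT x|M. \<bar>cmod (u n x + v n x) powr p - cmod (u n x) powr p - cmod (v n x) powr p\<bar>)"
          by (rule integral_abs_bound)
        also have "\<dots> \<le> (LINT x|M. \<epsilon>' * (cmod (u n x) powr p + cmod (v n x) powr p)
            + C * cmod (mode_gap p (of_real r * u n x) (v n x)) powr (p / (p - 1)))"
          by (intro integral_mono def) auto
        also have "\<dots> = \<epsilon>' * (N (u n) powr p + N (v n) powr p)
            + C * (LINT x|M. cmod (mode_gap p (of_real r * u n x) (v n x)) powr (p / (p - 1)))"
          by (simp add: N_powr)
        also have "\<epsilon>' * (N (u n) powr p + N (v n) powr p) \<le> \<epsilon>' * ((K powr p + 1) + (K powr p + 1))"
          using \<epsilon>' uN[of n] vN[of n] N_nonneg p_gt_1 powr_mono2[of p "N (u n)" K] powr_mono2[of p "N (v n)" K]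
          by (intro mult_left_mono add_mono) auto
        also have "\<dots> = (\<epsilon>' * (4 * (K powr p + 1))) / 2" by simp
        also have "\<epsilon>' * (4 * (K powr p + 1)) = \<epsilon>" using K1 by (simp only: \<epsilon>'_def) simp
        finally show ?thesis by simp
      qed
      have "(\<lambda>n. C * (LINT x|M. cmod (mode_gap p (of_real r * u n x) (v n x)) powr (p / (p - 1)))) \<longlonglongrightarrow> 0"
        using tendsto_mult_left[OF lim, of C] by simp
      then have "\<forall>\<^sub>F n in sequentially. C * (LINT x|M. cmod (mode_gap p (of_real r * u n x) (v n x)) powr (p / (p - 1))) < \<epsilon> / 2"
        by (rule order_tendstoD(2)) (use \<epsilon> in simp)
      then have "\<forall>\<^sub>F n in sequentially. \<bar>N (\<lambda>x. u n x + v n x) powr p - N (u n) powr p - N (v n) powr p\<bar> < \<epsilon>"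
      proof eventually_elim
        case (elim n)
        then show ?case using bound[of n] by linarith
      qed
      then show "\<forall>\<^sub>F n in sequentially. dist (N (T (\<alpha> n + \<beta> n) (\<zeta> n)) powr p - N (T (\<alpha> n) (\<zeta> n)) powr p - N (T (\<beta> n) (\<zeta> n)) powr p) 0 < \<epsilon>"
        unfolding Np by (simp add: u_def v_def)
    qed
  qed
qed

end

section \<open>Almost norming elements of the unitization\<close>

context smooth_algebra
begin

text \<open>Approximately the inverse of \<open>1 + t d\<close>. The product
  \<open>2 * t * \<theta>\<close> in the bound comes from the defect of accretivity of
  \<open>d\<close>, which will be below \<open>2 * \<theta>\<close>.\<close>

definition resolvent :: "'a \<Rightarrow> real \<Rightarrow> real \<Rightarrow> 'a \<times> complex \<Rightarrow> bool"
  where "resolvent d t \<theta> P \<longleftrightarrow> multiplier_norm P \<le> 1 / (1 - 2 * t * \<theta>) \<and> fst P * d = d * fst P \<and>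
    multiplier_norm (P + of_real t *\<^sub>C umul (d, 0) P - (0, 1)) \<le> \<theta>"

text \<open>Everything is read off \<open>P c + t d P c = c + error\<close>, with error at most
  \<open>\<theta> * norm c\<close>. The resolvent makes \<open>d\<close> of order
  \<open>1 / t\<close> on its range, almost fixes \<open>c\<close> when
  \<open>t * norm (d * c)\<close> is small, and is almost absorbed by \<open>b\<close> when
  \<open>t * norm (b * d)\<close> is small.\<close>

lemma resolventD:
  assumes P: "resolvent d t \<theta> P" and t: "0 < t" "2 * t * \<theta> \<le> 1 / 2" and \<theta>: "0 \<le> \<theta>" "\<theta> \<le> 1"
  shows "multiplier_norm P \<le> 1 + 4 * t * \<theta>"
    and "norm (unit_action P c) \<le> 2 * norm c"
    and "norm (d * unit_action P c) \<le> 4 / t * norm c"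
    and "norm (unit_action P c - c) \<le> 2 * t * norm (d * c) + \<theta> * norm c"
    and "norm (b * unit_action P c - b * c) \<le> norm b * \<theta> * norm c + t * norm (b * d) * (2 * norm c)"
proof -
  have nP: "multiplier_norm P \<le> 1 / (1 - 2 * t * \<theta>)" and comm: "fst P * d = d * fst P"
    and err: "multiplier_norm (P + of_real t *\<^sub>C umul (d, 0) P - (0, 1)) \<le> \<theta>"
    using P by (auto simp: resolvent_def)
  define s where "s = 2 * t * \<theta>"
  have s: "0 \<le> s" "s \<le> 1 / 2" using t \<theta> by (auto simp: s_def)
  have "1 / (1 - s) \<le> 1 + 2 * s"
  proof -
    have "1 \<le> (1 + 2 * s) * (1 - s)" using s mult_left_mono[of s "1 / 2" s] by (simp add: algebra_simps)
    then show ?thesis using s by (simp add: divide_le_eq)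
  qed
  then show n1: "multiplier_norm P \<le> 1 + 4 * t * \<theta>" using nP by (simp add: s_def)
  have n2: "multiplier_norm P \<le> 2" using n1 t by simp
  show Pc: "norm (unit_action P c) \<le> 2 * norm c" for c
    using unit_action_le_multiplier_norm[of P c] mult_right_mono[OF n2, of "norm c"] by simp
  define e where "e = unit_action (P + of_real t *\<^sub>C umul (d, 0) P - (0, 1)) c"
  have e: "norm e \<le> \<theta> * norm c"
    unfolding e_def by (rule order_trans[OF unit_action_le_multiplier_norm]) (simp add: err mult_right_mono)
  have e_eq: "e = unit_action P c + t *\<^sub>R (d * unit_action P c) - c"
    unfolding e_def unit_action_linear unit_action_umul by (simp add: unit_action_def scaleC_of_real)
  have "t *\<^sub>R (d * unit_action P c) = e + c - unit_action P c" using e_eq by simp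
  then have "norm (t *\<^sub>R (d * unit_action P c)) \<le> norm e + norm c + norm (unit_action P c)"
    using norm_triangle_ineq4[of "e + c" "unit_action P c"] norm_triangle_ineq[of e c] by simp
  also have "\<dots> \<le> \<theta> * norm c + norm c + 2 * norm c" using e Pc[of c] by simp
  also have "\<dots> \<le> 4 * norm c" using mult_right_mono[OF \<theta>(2), of "norm c"] by simp
  finally show "norm (d * unit_action P c) \<le> 4 / t * norm c" using t by (simp add: field_simps)
  have "d * unit_action P c = unit_action P (d * c)"
    by (simp add: unit_action_def distrib_left mult_scaleC_right comm mult.assoc[symmetric])
  then have dP: "norm (d * unit_action P c) \<le> 2 * norm (d * c)" using Pc[of "d * c"] by simp
  have "unit_action P c - c = e - t *\<^sub>R (d * unit_action P c)" using e_eq by simp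
  then have "norm (unit_action P c - c) \<le> norm e + norm (t *\<^sub>R (d * unit_action P c))"
    using norm_triangle_ineq4 by metis
  also have "norm (t *\<^sub>R (d * unit_action P c)) \<le> t * (2 * norm (d * c))"
    using dP t by (simp add: mult_left_mono)
  finally show "norm (unit_action P c - c) \<le> 2 * t * norm (d * c) + \<theta> * norm c" using e by simp
  have "b * unit_action P c - b * c = b * e - t *\<^sub>R ((b * d) * unit_action P c)"
    unfolding e_eq by (simp add: algebra_simps mult_scaleR_right)
  then have "norm (b * unit_action P c - b * c) \<le> norm (b * e) + norm (t *\<^sub>R ((b * d) * unit_action P c))"
    using norm_triangle_ineq4 by metis
  also have "norm (b * e) \<le> norm b * (\<theta> * norm c)"
    by (rule order_trans[OF norm_mult_ineq]) (simp add: e mult_left_mono)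
  also have "norm (t *\<^sub>R ((b * d) * unit_action P c)) \<le> t * (norm (b * d) * (2 * norm c))"
  proof -
    have "norm ((b * d) * unit_action P c) \<le> norm (b * d) * (2 * norm c)"
      by (rule order_trans[OF norm_mult_ineq]) (simp add: Pc mult_left_mono)
    then show ?thesis using t by (simp add: mult_left_mono)
  qed
  finally show "norm (b * unit_action P c - b * c) \<le> norm b * \<theta> * norm c + t * norm (b * d) * (2 * norm c)"
    by (simp add: mult.assoc)
qed

text \<open>A product with an element of \<open>A\<close> has scalar part 0, so the deviation is the
  scalar part of the residual, and the character of \<open>A^1\<close> is contractive.\<close>

lemma resolvent_snd:
  assumes "resolvent d t \<theta> P" and "(c0::'a) \<noteq> 0" "\<not> unital TYPE('a)"
  shows "cmod (snd P - 1) \<le> \<theta>"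
proof -
  have "snd P - 1 = snd (P + of_real t *\<^sub>C umul (d, 0) P - (0, 1))"
    by (simp add: umul_def scaleC_prod_def scaleC_complex_def)
  then show ?thesis
    using cmod_snd_le[OF assms(2,3), of "P + of_real t *\<^sub>C umul (d, 0) P - (0, 1)"] assms(1)
    by (simp add: resolvent_def)
qed

text \<open>The two resolvent parameters separate two scales: \<open>Q\<close> makes \<open>l - h\<close> of size \<open>1 / k\<^sup>2\<close>, which the
  resolvent \<open>R\<close> with parameter \<open>k\<close> no longer sees, and the error \<open>1 / k ^ 4\<close> survives multiplication
  by either parameter.\<close>

definition stage :: "'a set \<Rightarrow> real \<Rightarrow> 'a \<Rightarrow> 'a \<Rightarrow> 'a \<times> complex \<Rightarrow> 'a \<times> complex \<Rightarrow> bool"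
  where "stage S k h l R Q \<longleftrightarrow> h \<in> approx_units S (1 / k ^ 4) \<and> l \<in> approx_units (insert h S) (1 / k ^ 4) \<and>
    (\<forall>\<omega>. is_state multiplier_norm (0, 1) \<omega> \<longrightarrow> Re (\<omega> (\<i> *\<^sub>C h, 0)) < 2 / k ^ 4) \<and>
    resolvent (l - h) k (1 / k ^ 4) R \<and> resolvent (l - h) (k\<^sup>2) (1 / k ^ 4) Q"

text \<open>Scaledness in the form in which it is used: a restricted state attains its norm at the
  identity of the bidual.\<close>

definition scaled_states :: bool
  where "scaled_states \<longleftrightarrow> (\<forall>\<omega> f. is_state multiplier_norm (0 :: 'a, 1) \<omega> \<longrightarrow>
    (\<forall>a. cdual_apply f a = \<omega> (a, 0)) \<longrightarrow> cdual_apply E f = of_real (norm f))"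

lemma stage_exists:
  assumes nz: "(c0::'a) \<noteq> 0" and sc: "scaled_states" and S: "finite S" and k: "6 \<le> k"
  shows "\<exists>h l R Q. stage S k h l R Q"
proof -
  define \<theta> where "\<theta> = 1 / k ^ 4"
  have k4: "k * 6 ^ 3 \<le> k ^ 4" "k\<^sup>2 * 6\<^sup>2 \<le> k ^ 4"
  proof -
    have "k * 6 ^ 3 \<le> k * k ^ 3" using k by (intro mult_left_mono power_mono) auto
    then show "k * 6 ^ 3 \<le> k ^ 4" by (simp add: eval_nat_numeral)
    have "k\<^sup>2 * 6\<^sup>2 \<le> k\<^sup>2 * k\<^sup>2" using k by (intro mult_left_mono power_mono) auto
    then show "k\<^sup>2 * 6\<^sup>2 \<le> k ^ 4" by (simp flip: power_add)
  qed
  have \<theta>: "0 < \<theta>" using k by (simp add: \<theta>_def)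
  have t: "k * (2 * \<theta>) < 1" "k\<^sup>2 * (2 * \<theta>) < 1"
    using k k4 by (auto simp: \<theta>_def divide_less_eq)
  have E: "cdual_apply E f = of_real (norm f)"
    if "is_state multiplier_norm (0, 1) \<omega>" "\<And>a. cdual_apply f a = \<omega> (a, 0)" for \<omega> f
    using sc that unfolding scaled_states_def by blast
  \<comment> \<open>The value at \<open>E\<close> is real for restricted states, so its product with
    \<open>\<i>\<close> has real part 0; this selects an almost hermitian unit.\<close>
  have "\<exists>h\<in>approx_units S \<theta>. \<forall>\<omega>. is_state multiplier_norm (0, 1) \<omega> \<longrightarrow> Re (\<omega> (\<i> *\<^sub>C h + 0, 0)) \<le> \<theta>"
    by (rule select_unit[OF nz S \<theta> \<theta>]) (simp add: E cdual_simps)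
  then obtain h where h: "h \<in> approx_units S \<theta>"
    and hi: "\<And>\<omega>. is_state multiplier_norm (0, 1) \<omega> \<Longrightarrow> Re (\<omega> (\<i> *\<^sub>C h, 0)) \<le> \<theta>" by auto
  \<comment> \<open>Since \<open>norm h \<le> 1\<close>, the real part of \<open>f h\<close> is at
    most \<open>norm f = E f\<close>. So in the limit the identity dominates \<open>h\<close> in
    every state, and some unit for \<open>h\<close> already does so up to \<theta>.\<close>
  have "\<exists>l\<in>approx_units (insert h S) \<theta>. \<forall>\<omega>. is_state multiplier_norm (0, 1) \<omega> \<longrightarrow> Re (\<omega> ((-1) *\<^sub>C l + h, 0)) \<le> \<theta>"
  proof (rule select_unit[OF nz _ \<theta> \<theta>])
    fix \<omega> f assume "is_state multiplier_norm (0 :: 'a, 1) \<omega>" "\<And>a. cdual_apply f a = \<omega> (a, 0)"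
    then have "cdual_apply E f = of_real (norm f)" by (rule E)
    moreover have "Re (cdual_apply f h) \<le> norm f * norm h"
      using complex_Re_le_cmod cdual_apply_bound order_trans by blast
    moreover have "norm f * norm h \<le> norm f" using approx_unitsD(1)[OF h] by (intro mult_left_le) auto
    ultimately show "Re (-1 * cdual_apply E f + cdual_apply f h) \<le> 0" by simp
  qed (use S in simp)
  then obtain l where l: "l \<in> approx_units (insert h S) \<theta>"
    and ls: "\<And>\<omega>. is_state multiplier_norm (0, 1) \<omega> \<Longrightarrow> Re (\<omega> ((-1) *\<^sub>C l + h, 0)) \<le> \<theta>" by blast
  have d: "Re (\<omega> (- (l - h), 0)) < 2 * \<theta>" if "is_state multiplier_norm (0, 1) \<omega>" for \<omega>
    using ls[OF that] \<theta> by simp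
  have "\<exists>P. resolvent (l - h) s \<theta> P" if s: "0 < s" "s * (2 * \<theta>) < 1" for s
  proof -
    obtain P where "multiplier_norm P \<le> 1 / (1 - s * (2 * \<theta>))" "fst P * (l - h) = (l - h) * fst P"
      "multiplier_norm (P + of_real s *\<^sub>C umul (l - h, 0) P - (0, 1)) \<le> \<theta>"
      by (rule approximate_resolvent[OF nz s \<theta>, where d = "l - h"]) (erule d, erule (2) that)
    then show ?thesis unfolding resolvent_def by (intro exI[of _ P]) (simp add: ac_simps)
  qed
  from this[OF _ t(1)] this[OF _ t(2)] k obtain R Q
    where "resolvent (l - h) k \<theta> R" "resolvent (l - h) (k\<^sup>2) \<theta> Q" by force
  moreover have "Re (\<omega> (\<i> *\<^sub>C h, 0)) < 2 * \<theta>" if "is_state multiplier_norm (0, 1) \<omega>" for \<omega>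
    using hi[OF that] \<theta> by simp
  ultimately have "stage S k h l R Q" using h l unfolding stage_def by (simp add: \<theta>_def)
  then show ?thesis by blast
qed

end

lemma norm_diff_le: "x = a - b \<Longrightarrow> norm a \<le> A \<Longrightarrow> norm b \<le> B \<Longrightarrow> norm x \<le> A + B"
  for a b :: "'b::real_normed_vector"
  using norm_triangle_ineq4[of a b] by simp

lemma norm_diff_add_le: "x = a - b + c \<Longrightarrow> norm a \<le> A \<Longrightarrow> norm b \<le> B \<Longrightarrow> norm c \<le> C \<Longrightarrow> norm x \<le> A + B + C"
  for a b c :: "'b::real_normed_vector"
  using norm_triangle_ineq4[of a b] norm_triangle_ineq[of "a - b" c] by simp

lemma norm_mult_le: "norm a \<le> A \<Longrightarrow> norm b \<le> B \<Longrightarrow> norm (a * b) \<le> A * B"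
  for a b :: "'b::real_normed_algebra"
  using norm_mult_ineq[of a b] mult_mono[of "norm a" A "norm b" B] norm_ge_zero[of a] order_trans[of 0 "norm a" A]
  by (meson norm_ge_zero order_trans)

context Lp_algebra
begin

lemma N_T_add_le:
  assumes "f \<in> V" "N f \<le> 1"
  shows "N (T a f) \<le> N (T b f) + norm (a - b)"
proof -
  have "module_seminorm (mu f f) 1" by (intro module_seminorm_mu assms)
  then have s: "cseminorm (mu f f)" by (simp add: module_seminorm_def)
  have "mu f f (a, 0) \<le> mu f f (b, 0) + mu f f ((a, 0) - (b, 0))" by (rule cseminormD(8)[OF s])
  then have "N (T a f) \<le> N (T b f) + N (T (a - b) f)" by (simp add: mu_single[OF assms(1) assms(1)])
  then show ?thesis using N_T_le[OF assms, of "a - b"] by simp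
qed

lemma near_maximal:
  assumes "0 < \<epsilon>"
  shows "\<exists>c \<zeta>. norm c \<le> 1 \<and> \<zeta> \<in> V \<and> N \<zeta> \<le> 1 \<and> multiplier_norm x \<le> N (T (unit_action x c) \<zeta>) + \<epsilon>"
proof (rule ccontr)
  assume "\<not> ?thesis"
  then have lt: "N (T (unit_action x c) \<zeta>) < multiplier_norm x - \<epsilon>" if "norm c \<le> 1" "\<zeta> \<in> V" "N \<zeta> \<le> 1" for c \<zeta>
    using that by (meson less_diff_eq not_le)
  obtain \<zeta> where "\<zeta> \<in> V" "N \<zeta> \<le> 1" using T_attain[of "-1" "0 :: 'a"] by auto
  from lt[of 0 \<zeta>] this have pos: "0 \<le> multiplier_norm x - \<epsilon>" using N_nonneg[of "T (unit_action x 0) \<zeta>"] by simp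
  have "multiplier_norm x \<le> multiplier_norm x - \<epsilon>"
    by (rule multiplier_norm_le[OF pos T_norm_le[OF pos less_imp_le[OF lt]]])
  then show False using assms by simp
qed

text \<open>Disjointness is applied twice, with the same \<beta>: to \<alpha> and to
  \<open>\<alpha>0 = b0 \<alpha>\<close>. Splitting the p-th power, using that \<open>b0\<close> is
  a contraction, and reassembling replaces \<open>\<alpha>0 + \<beta>\<close> by
  \<open>\<alpha> + \<beta>\<close>, which is almost the image under the almost contractive
  \<open>Q\<close>.\<close>

theorem near_norming:
  fixes f :: "'a cdual"
  assumes nz: "(c0::'a) \<noteq> 0" and nu: "\<not> unital TYPE('a)" and sc: scaled_states and \<epsilon>: "0 < \<epsilon>"
  shows "\<exists>x. multiplier_norm x \<le> 1 + \<epsilon> \<and> cmod (snd x - 1) \<le> \<epsilon> \<and> Re (ext f x) \<le> - norm f + \<epsilon>"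
proof -
  have "norm f - \<epsilon> / 4 < norm (- f)" using \<epsilon> by simp
  then obtain b0 where b0: "norm b0 \<le> 1" "norm f - \<epsilon> / 4 < Re (cdual_apply (- f) b0)" by (rule cdual_norm_attain)
  \<comment> \<open>Placing \<open>e0\<close> among the elements for which \<open>l\<close> is a
    unit makes \<open>e0 (1 - l)\<close> small, so \<open>f\<close> nearly vanishes on the range of
    \<open>1 - l\<close> and the added summand does not disturb its value.\<close>
  obtain e0 where e0: "norm (f - dual_act f e0) \<le> \<epsilon> / 16 \<and> norm e0 \<le> 1"
    by (rule exists_unit[OF eventually_conj[OF dual_act_unit[of "\<epsilon> / 16" f] eventually_norm_le_1]]) (use \<epsilon> in auto)
  \<comment> \<open>The offset 6 meets the threshold of \<open>stage_exists\<close> and keeps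
    \<open>2 * (k n)\<^sup>2 * \<theta> n\<close> below 1/2, as \<open>resolventD\<close>
    demands.\<close>
  define k where "k n = real n + 6" for n
  have k6: "6 \<le> k n" for n by (simp add: k_def)
  define S where "S = {b0, e0}"
  have "\<forall>n. \<exists>h l R Q. stage S (k n) h l R Q"
    using stage_exists[OF nz sc _ k6] by (simp add: S_def)
  then obtain h where "\<forall>n. \<exists>l R Q. stage S (k n) (h n) l R Q" by (rule choice[THEN exE])
  then obtain l where "\<forall>n. \<exists>R Q. stage S (k n) (h n) (l n) R Q" by (rule choice[THEN exE])
  then obtain R where "\<forall>n. \<exists>Q. stage S (k n) (h n) (l n) (R n) Q" by (rule choice[THEN exE])
  then obtain Q where st: "\<forall>n. stage S (k n) (h n) (l n) (R n) (Q n)" by (rule choice[THEN exE])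
  \<comment> \<open>\<iota> is the size of \<open>l - h\<close> on the range of \<open>Q\<close>;
    the parameter of \<open>R\<close> multiplies it to \<open>1 / k\<close>, still a null sequence.
    \<theta> is the error of all choices, and even the larger parameter only enlarges it to
    \<iota>.\<close>
  define \<theta> \<iota> where "\<theta> n = 1 / k n ^ 4" and "\<iota> n = 1 / (k n)\<^sup>2" for n
  have \<theta>0: "0 < \<theta> n" and \<iota>0: "0 < \<iota> n" for n using k6[of n] by (auto simp: \<theta>_def \<iota>_def)
  have k\<iota>: "k n * \<iota> n = 1 / k n" for n using k6[of n] by (simp add: \<iota>_def power2_eq_square)
  have k\<theta>: "(k n)\<^sup>2 * \<theta> n = \<iota> n" for n using k6[of n] by (simp add: \<theta>_def \<iota>_def eval_nat_numeral)
  have \<iota>36: "\<iota> n \<le> 1 / 36" for n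
    using power_mono[OF k6[of n], of 2] by (simp add: \<iota>_def divide_le_eq)
  have \<theta>\<iota>: "36 * \<theta> n \<le> \<iota> n" "6 * (k n * \<theta> n) \<le> \<iota> n" "\<iota> n \<le> 1 / k n" for n
  proof -
    have "6\<^sup>2 * \<theta> n \<le> (k n)\<^sup>2 * \<theta> n" using k6[of n] \<theta>0[of n] by (intro mult_right_mono power_mono) auto
    then show "36 * \<theta> n \<le> \<iota> n" by (simp add: k\<theta>)
    have "6 * (k n * \<theta> n) \<le> k n * (k n * \<theta> n)" using k6[of n] \<theta>0[of n] by (intro mult_right_mono) auto
    also have "\<dots> = \<iota> n" by (simp add: power2_eq_square mult.assoc flip: k\<theta>)
    finally show "6 * (k n * \<theta> n) \<le> \<iota> n" .
    show "\<iota> n \<le> 1 / k n" unfolding k\<iota>[symmetric] using k6[of n] \<iota>0[of n] by (simp add: mult_le_cancel_right1)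
  qed
  have \<theta>1: "\<theta> n \<le> 1" and \<theta>_small: "2 * k n * \<theta> n \<le> 1 / 2" "2 * (k n)\<^sup>2 * \<theta> n \<le> 1 / 2" for n
    using \<theta>\<iota>[of n] \<iota>36[of n] \<theta>0[of n] k\<theta>[of n] by (auto simp: mult.assoc)
  have lim_k: "(\<lambda>n. C / k n) \<longlonglongrightarrow> 0" for C unfolding k_def by real_asymp
  have lim_\<iota>: "\<iota> \<longlonglongrightarrow> 0" unfolding \<iota>_def k_def by real_asymp
  have lim_\<theta>: "(\<lambda>n. 2 * \<theta> n) \<longlonglongrightarrow> 0" unfolding \<theta>_def k_def by real_asymp
  define d where "d n = l n - h n" for n
  have hS: "h n \<in> approx_units S (\<theta> n)" and lS: "l n \<in> approx_units (insert (h n) S) (\<theta> n)"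
    and Rr: "resolvent (d n) (k n) (\<theta> n) (R n)" and Qr: "resolvent (d n) ((k n)\<^sup>2) (\<theta> n) (Q n)"
    and herm: "is_state multiplier_norm (0, 1) \<omega> \<Longrightarrow> Re (\<omega> (\<i> *\<^sub>C h n, 0)) < 2 * \<theta> n" for n \<omega>
    using st[rule_format, of n] by (auto simp: stage_def \<theta>_def d_def)
  have kp: "0 < k n" "0 < (k n)\<^sup>2" for n using k6[of n] by auto
  note RD = resolventD[OF Rr kp(1) \<theta>_small(1) less_imp_le[OF \<theta>0] \<theta>1]
  note QD = resolventD[OF Qr kp(2) \<theta>_small(2) less_imp_le[OF \<theta>0] \<theta>1]
  have h1: "norm (h n) \<le> 1" and l1: "norm (l n) \<le> 1"
    and hl: "norm (h n * l n - h n) \<le> \<theta> n" and lh: "norm (l n * h n - h n) \<le> \<theta> n" for n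
    using approx_unitsD[OF hS] approx_unitsD[OF lS] by auto
  have hb: "norm (h n * b0 - b0) \<le> \<theta> n" and lb: "norm (l n * b0 - b0) \<le> \<theta> n"
    and bh: "norm (b0 * h n - b0) \<le> \<theta> n" and bl: "norm (b0 * l n - b0) \<le> \<theta> n"
    and el: "norm (e0 * l n - e0) \<le> \<theta> n" for n
    using approx_unitsD[OF hS] approx_unitsD[OF lS] by (auto simp: S_def)
  have hh: "norm (h n * (h n * w) - h n * w) \<le> \<theta> n * norm w + norm (d n * w)" for n w
  proof (rule norm_diff_le)
    show "h n * (h n * w) - h n * w = (h n * l n - h n) * w - h n * (d n * w)"
      by (simp add: d_def algebra_simps)
    show "norm ((h n * l n - h n) * w) \<le> \<theta> n * norm w" by (intro norm_mult_le hl order_refl)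
    show "norm (h n * (d n * w)) \<le> norm (d n * w)" using norm_mult_le[OF h1[of n] order_refl, of "d n * w"] by simp
  qed
  have hk: "norm (h n * (w - l n * w)) \<le> \<theta> n * norm w" for n w
  proof -
    have "h n * (w - l n * w) = - ((h n * l n - h n) * w)" by (simp add: algebra_simps)
    then show ?thesis using norm_mult_le[OF hl[of n] order_refl, of w] by (simp only: norm_minus_cancel)
  qed
  \<comment> \<open>In \<open>6 / k n\<close> a part \<open>4 / k n\<close> is the size of
    \<open>d\<close> on the range of \<open>R\<close>, and \<open>2 / k n\<close> bounds the error
    of \<open>l\<close> as a unit for \<open>h\<close> there.\<close>
  interpret US: unit_sequence p M T h l R "\<lambda>n. 2 * \<theta> n" "\<lambda>n. 6 / k n" c0
  proof (unfold_locales)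
    fix n c
    show "multiplier_norm (R n) \<le> 1 + 6 / k n" proof -
      have "4 * k n * \<theta> n \<le> 1 / k n" using \<theta>\<iota>[of n] \<iota>0[of n] by simp
      also have "\<dots> \<le> 6 / k n" using kp(1)[of n] by (simp add: divide_right_mono)
      finally show ?thesis using RD(1)[of n] by linarith
    qed
    show "norm (h n * (h n * unit_action (R n) c) - h n * unit_action (R n) c) \<le> 6 / k n * norm c"
    proof -
      have "\<theta> n * norm (unit_action (R n) c) \<le> \<theta> n * (2 * norm c)" using \<theta>0 RD(2) by (intro mult_left_mono) (auto intro: less_imp_le)
      also have "\<dots> \<le> 1 / k n * (2 * norm c)" using \<theta>\<iota>[of n] \<theta>0[of n] by (intro mult_right_mono) auto
      finally have "\<theta> n * norm (unit_action (R n) c) \<le> 2 / k n * norm c" by simp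
      moreover have "4 / k n * norm c + 2 / k n * norm c = 6 / k n * norm c" by (simp flip: distrib_right add_divide_distrib)
      ultimately show ?thesis using hh[of n "unit_action (R n) c"] RD(3)[of n c] by linarith
    qed
    show "norm (h n * (unit_action (R n) c - l n * unit_action (R n) c)) \<le> 6 / k n * norm c"
    proof -
      have "\<theta> n * norm (unit_action (R n) c) \<le> \<theta> n * (2 * norm c)" using \<theta>0 RD(2) by (intro mult_left_mono) (auto intro: less_imp_le)
      also have "\<dots> \<le> 1 / k n * (2 * norm c)" using \<theta>\<iota>[of n] \<theta>0[of n] by (intro mult_right_mono) auto
      also have "\<dots> \<le> 6 / k n * norm c" using kp(1)[of n] by (simp add: divide_right_mono)
      finally show ?thesis using hk[of n "unit_action (R n) c"] by linarith
    qed
    have "l n * unit_action (R n) c - h n * unit_action (R n) c = d n * unit_action (R n) c" by (simp add: d_def left_diff_distrib)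
    moreover have "4 / k n * norm c \<le> 6 / k n * norm c" using kp(1)[of n] by (intro mult_right_mono divide_right_mono) auto
    ultimately show "norm (l n * unit_action (R n) c - h n * unit_action (R n) c) \<le> 6 / k n * norm c"
      using RD(3)[of n c] by simp
  qed (use nz h1 l1 \<theta>0 herm k6 kp lim_\<theta> lim_k in \<open>auto simp: less_imp_le divide_le_eq\<close>)
  define x where "x n = umul (b0 - l n, 1) (Q n)" for n
  have xw: "unit_action (x n) c = b0 * unit_action (Q n) c + (unit_action (Q n) c - l n * unit_action (Q n) c)" for n c
    by (simp add: x_def unit_action_umul) (simp add: unit_action_def left_diff_distrib)
  have snd_x: "cmod (snd (x n) - 1) \<le> \<theta> n" for n
    using resolvent_snd[OF Qr nz nu] by (simp add: x_def umul_def)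
  have ext_x: "Re (ext f (x n)) \<le> - norm f + \<epsilon> / 2 + 8 * norm f * \<iota> n" for n
  proof (rule tendsto_upperbound[OF tendsto_Re[OF ext_tendsto] _ U_nontrivial])
    have "\<forall>\<^sub>F e in U. e \<in> approx_units {b0} (\<theta> n)" by (intro eventually_approx_units) (auto simp: \<theta>0)
    then show "\<forall>\<^sub>F e in U. Re (cdual_apply f (unit_action (x n) e)) \<le> - norm f + \<epsilon> / 2 + 8 * norm f * \<iota> n"
    proof eventually_elim
      case (elim e)
      define w where "w = unit_action (Q n) e"
      have e1: "norm e \<le> 1" and be: "norm (b0 * e - b0) \<le> \<theta> n" using approx_unitsD[OF elim] by auto
      have w2: "norm w \<le> 2" using QD(2)[of n e] e1 by (simp add: w_def)
      have bd: "norm (b0 * d n) \<le> \<theta> n + \<theta> n"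
        by (rule norm_diff_le[OF _ bl bh]) (simp add: d_def algebra_simps)
      \<comment> \<open>Since \<open>h\<close> and \<open>l\<close> are both units for
        \<open>b0\<close>, the product \<open>b0 d\<close> is at most \<open>2 * \<theta>\<close>;
        multiplied by the parameter \<open>k\<^sup>2\<close> this is \<open>2 * \<iota>\<close>. So
        \<open>Q\<close> almost disappears behind \<open>b0\<close>.\<close>
      have "norm (b0 * w - b0 * e) \<le> norm b0 * \<theta> n * norm e + (k n)\<^sup>2 * norm (b0 * d n) * (2 * norm e)"
        unfolding w_def by (rule QD(5))
      also have "\<dots> \<le> 1 * \<theta> n * 1 + (k n)\<^sup>2 * (\<theta> n + \<theta> n) * (2 * 1)"
        using b0(1) e1 bd \<theta>0[of n] by (intro add_mono mult_mono) auto
      also have "\<dots> = \<theta> n + 4 * \<iota> n" by (simp flip: k\<theta>)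
      finally have bw: "norm (b0 * w - b0 * e) \<le> \<theta> n + 4 * \<iota> n" .
      have "norm (b0 * w - b0) \<le> \<theta> n + 4 * \<iota> n + \<theta> n"
        using norm_triangle_ineq[of "b0 * w - b0 * e" "b0 * e - b0"] bw be by simp
      then have fb: "cmod (cdual_apply f (b0 * w - b0)) \<le> norm f * (\<theta> n + 4 * \<iota> n + \<theta> n)"
        by (intro order_trans[OF cdual_apply_bound] mult_left_mono) auto
      define v where "v = w - l n * w"
      have "norm (l n * w) \<le> 1 * 2" by (intro norm_mult_le l1 w2)
      then have v4: "norm v \<le> 4" using norm_triangle_ineq4[of w "l n * w"] w2 by (simp add: v_def)
      have "e0 * v = - ((e0 * l n - e0) * w)" by (simp add: v_def algebra_simps)
      moreover have "norm ((e0 * l n - e0) * w) \<le> \<theta> n * 2" by (intro norm_mult_le el w2)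
      ultimately have "norm (e0 * v) \<le> 2 * \<theta> n" by simp
      then have fe: "cmod (cdual_apply f (e0 * v)) \<le> norm f * (2 * \<theta> n)"
        by (intro order_trans[OF cdual_apply_bound] mult_left_mono) auto
      have "norm (f - dual_act f e0) * norm v \<le> \<epsilon> / 16 * 4" using e0 v4 \<epsilon> by (intro mult_mono) auto
      then have fd: "cmod (cdual_apply (f - dual_act f e0) v) \<le> \<epsilon> / 4"
        using cdual_apply_bound[of "f - dual_act f e0" v] by simp
      have "unit_action (x n) e = b0 * w + v" by (simp add: xw w_def v_def)
      then have "cdual_apply f (unit_action (x n) e) = cdual_apply f (b0 * w - b0) + cdual_apply f b0
          + (cdual_apply (f - dual_act f e0) v + cdual_apply f (e0 * v))"
        by (simp add: cdual_fun_simps dual_act.rep_eq cdual_simps)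
      moreover have "norm f * (\<theta> n + 4 * \<iota> n + \<theta> n) + norm f * (2 * \<theta> n) \<le> 8 * norm f * \<iota> n"
      proof -
        have "norm f * (\<theta> n + 4 * \<iota> n + \<theta> n) + norm f * (2 * \<theta> n) = norm f * (4 * \<theta> n + 4 * \<iota> n)" by (simp add: algebra_simps)
        also have "\<dots> \<le> norm f * (8 * \<iota> n)" using \<theta>\<iota>(1)[of n] \<theta>0[of n] by (intro mult_left_mono) auto
        finally show ?thesis by simp
      qed
      moreover have "Re (cdual_apply f b0) < - norm f + \<epsilon> / 4" using b0(2) by (simp add: cdual_fun_simps)
      ultimately show ?case
        using fb fe fd complex_Re_le_cmod[of "cdual_apply f (b0 * w - b0)"] complex_Re_le_cmod[of "cdual_apply f (e0 * v)"]
          complex_Re_le_cmod[of "cdual_apply (f - dual_act f e0) v"] by simp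
    qed
  qed
  \<comment> \<open>Almost maximising \<open>c\<close> and \<zeta> for each \<open>n\<close> reduces
    the norm of \<open>x n\<close> to one sequence of vectors, to which the asymptotic statements
    apply.\<close>
  have "\<forall>n. \<exists>c \<zeta>. norm c \<le> 1 \<and> \<zeta> \<in> V \<and> N \<zeta> \<le> 1 \<and> multiplier_norm (x n) \<le> N (T (unit_action (x n) c) \<zeta>) + \<iota> n"
    using near_maximal[OF \<iota>0] by blast
  then obtain c where "\<forall>n. \<exists>\<zeta>. norm (c n) \<le> 1 \<and> \<zeta> \<in> V \<and> N \<zeta> \<le> 1 \<and> multiplier_norm (x n) \<le> N (T (unit_action (x n) (c n)) \<zeta>) + \<iota> n"
    by (rule choice[THEN exE])
  then obtain \<zeta> where c\<zeta>: "\<forall>n. norm (c n) \<le> 1 \<and> \<zeta> n \<in> V \<and> N (\<zeta> n) \<le> 1 \<and> multiplier_norm (x n) \<le> N (T (unit_action (x n) (c n)) (\<zeta> n)) + \<iota> n"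
    by (rule choice[THEN exE])
  then have c1: "norm (c n) \<le> 1" and \<zeta>: "\<zeta> n \<in> V" "N (\<zeta> n) \<le> 1"
    and near: "multiplier_norm (x n) \<le> N (T (unit_action (x n) (c n)) (\<zeta> n)) + \<iota> n" for n by auto
  define u where "u n = unit_action (Q n) (c n)" for n
  have u2: "norm (u n) \<le> 2" for n using QD(2)[of n "c n"] c1[of n] by (simp add: u_def)
  have du: "norm (d n * u n) \<le> 4 * \<iota> n" for n
  proof -
    have "4 / (k n)\<^sup>2 * norm (c n) \<le> 4 / (k n)\<^sup>2 * 1" using c1 by (intro mult_left_mono) auto
    then show ?thesis using QD(3)[of n "c n"] by (simp add: u_def \<iota>_def)
  qed
  have u1: "norm (u n) \<le> 1 + 4 * \<iota> n" for n
  proof -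
    have "norm (u n) \<le> multiplier_norm (Q n) * norm (c n)" unfolding u_def by (rule unit_action_le_multiplier_norm)
    also have "\<dots> \<le> multiplier_norm (Q n)" using c1 by (intro mult_left_le multiplier_norm_nonneg)
    also have "\<dots> \<le> 1 + 4 * (k n)\<^sup>2 * \<theta> n" by (rule QD(1))
    finally show ?thesis by (simp add: mult.assoc k\<theta>)
  qed
  have d2: "norm (d n) \<le> 2" for n using norm_diff_le[OF d_def l1 h1] by simp
  define \<alpha> \<beta> \<alpha>0 where "\<alpha> n = h n * u n" and "\<beta> n = u n - l n * u n" and "\<alpha>0 n = b0 * \<alpha> n" for n
  have a2: "norm (\<alpha> n) \<le> 2" and b4: "norm (\<beta> n) \<le> 4" and a02: "norm (\<alpha>0 n) \<le> 2" for n
  proof -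
    show a2: "norm (\<alpha> n) \<le> 2" using norm_mult_le[OF h1[of n] u2[of n]] by (simp add: \<alpha>_def)
    show "norm (\<alpha>0 n) \<le> 2" using norm_mult_le[OF b0(1) a2] by (simp add: \<alpha>0_def)
    show "norm (\<beta> n) \<le> 4" using norm_diff_le[OF \<beta>_def[of n] u2[of n] norm_mult_le[OF l1[of n] u2[of n]]] by simp
  qed
  have \<theta>2: "\<theta> n * norm w \<le> 2 * \<theta> n" if "norm w \<le> 2" for n and w :: 'a
    using mult_left_mono[OF that, of "\<theta> n"] \<theta>0[of n] by simp
  \<comment> \<open>\<open>d\<close> and \<open>h\<close> commute up to \<theta>, because
    \<open>l\<close> is a two-sided unit for \<open>h\<close>; hence the smallness of
    \<open>d u\<close> is inherited by \<open>h u\<close>.\<close>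
  have da: "norm (d n * \<alpha> n) \<le> 8 * \<iota> n" for n
  proof -
    have "norm (d n * \<alpha> n) \<le> \<theta> n * 2 + \<theta> n * 2 + 1 * (4 * \<iota> n)"
    proof (rule norm_diff_add_le)
      show "d n * \<alpha> n = (l n * h n - h n) * u n - (h n * l n - h n) * u n + h n * (d n * u n)"
        by (simp add: d_def \<alpha>_def algebra_simps)
    qed (intro norm_mult_le lh hl h1 u2 du)+
    then show ?thesis using \<theta>\<iota>(1)[of n] \<theta>0[of n] by simp
  qed
  have db: "norm (d n * \<beta> n) \<le> 20 * \<iota> n" for n
  proof -
    have "norm (d n * \<beta> n) \<le> 4 * \<iota> n + 8 * \<iota> n + 2 * (4 * \<iota> n)"
    proof (rule norm_diff_add_le[OF _ du da])
      show "d n * \<beta> n = d n * u n - d n * \<alpha> n + d n * - (d n * u n)"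
        by (simp add: d_def \<alpha>_def \<beta>_def algebra_simps)
      show "norm (d n * - (d n * u n)) \<le> 2 * (4 * \<iota> n)"
        by (intro norm_mult_le d2) (simp add: du)
    qed
    then show ?thesis by simp
  qed
  have da0: "norm (d n * \<alpha>0 n) \<le> 4 * \<iota> n" for n
  proof -
    have "norm (d n * \<alpha>0 n) \<le> \<theta> n * 2 + \<theta> n * 2"
    proof (rule norm_diff_le)
      show "d n * \<alpha>0 n = (l n * b0 - b0) * \<alpha> n - (h n * b0 - b0) * \<alpha> n"
        by (simp add: d_def \<alpha>0_def algebra_simps)
    qed (intro norm_mult_le lb hb a2)+
    then show ?thesis using \<theta>\<iota>(1)[of n] \<theta>0[of n] by simp
  qed
  have null: "(\<lambda>n. norm (g n)) \<longlonglongrightarrow> 0" if "\<And>n. norm (g n) \<le> 6 * \<iota> n" for g :: "nat \<Rightarrow> 'a"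
    by (rule Lim_null_comparison[OF _ tendsto_mult_right_zero[OF lim_\<iota>, of 6]]) (use that in auto)
  have ha: "norm (h n * \<alpha> n - \<alpha> n) \<le> 6 * \<iota> n" for n
    using hh[of n "u n"] \<theta>2[OF u2[of n], of n] du[of n] \<theta>\<iota>(1)[of n] \<theta>0[of n] unfolding \<alpha>_def by linarith
  have hb': "norm (h n * \<beta> n) \<le> 6 * \<iota> n" for n
    using hk[of n "u n"] \<theta>2[OF u2[of n], of n] \<theta>\<iota>(1)[of n] \<theta>0[of n] unfolding \<beta>_def by linarith
  have ha0: "norm (h n * \<alpha>0 n - \<alpha>0 n) \<le> 6 * \<iota> n" for n
  proof -
    have "h n * \<alpha>0 n - \<alpha>0 n = (h n * b0 - b0) * \<alpha> n" by (simp add: \<alpha>0_def algebra_simps)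
    then show ?thesis using norm_mult_le[OF hb[of n] a2[of n]] \<theta>\<iota>(1)[of n] \<theta>0[of n] by simp
  qed
  have adR: "(\<lambda>n. norm (unit_action (R n) (g n) - g n)) \<longlonglongrightarrow> 0"
    if g: "\<And>n. norm (g n) \<le> 4" "\<And>n. norm (d n * g n) \<le> 20 * \<iota> n" for g
  proof (rule Lim_null_comparison[OF _ lim_k[of 44]])
    have "norm (unit_action (R n) (g n) - g n) \<le> 44 / k n" for n
    proof -
      have "2 * k n * norm (d n * g n) \<le> 2 * k n * (20 * \<iota> n)" using g(2) kp(1)[of n] by (intro mult_left_mono) auto
      also have "\<dots> = 40 * (k n * \<iota> n)" by simp
      finally have "2 * k n * norm (d n * g n) \<le> 40 * (1 / k n)" unfolding k\<iota> .
      moreover have "\<theta> n * norm (g n) \<le> 1 / k n * 4" using \<theta>\<iota>[of n] \<theta>0[of n] g(1) kp(1)[of n] by (intro mult_mono) auto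
      ultimately show ?thesis using RD(4)[of n "g n"] by simp
    qed
    then show "\<forall>\<^sub>F n in sequentially. norm (norm (unit_action (R n) (g n) - g n)) \<le> 44 / k n" by simp
  qed
  have a4: "norm (\<alpha> n) \<le> 4" "norm (\<alpha>0 n) \<le> 4" and da20: "norm (d n * \<alpha> n) \<le> 20 * \<iota> n" "norm (d n * \<alpha>0 n) \<le> 20 * \<iota> n" for n
    using a2[of n] a02[of n] da[of n] da0[of n] \<iota>0[of n] by linarith+
  have ad: "US.adapted \<alpha> \<beta> 4" "US.adapted \<alpha>0 \<beta> 4"
    unfolding US.adapted_def
    using a4 b4 null[of "\<lambda>n. h n * \<alpha> n - \<alpha> n", OF ha] null[of "\<lambda>n. h n * \<alpha>0 n - \<alpha>0 n", OF ha0] null[of "\<lambda>n. h n * \<beta> n", OF hb']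
      adR[of \<alpha>, OF a4(1) da20(1)] adR[of \<alpha>0, OF a4(2) da20(2)] adR[of \<beta>, OF b4 db] by blast+
  define A B where "A n = N (T (\<alpha> n + \<beta> n) (\<zeta> n)) powr p - N (T (\<alpha> n) (\<zeta> n)) powr p - N (T (\<beta> n) (\<zeta> n)) powr p"
    and "B n = N (T (\<alpha>0 n + \<beta> n) (\<zeta> n)) powr p - N (T (\<alpha>0 n) (\<zeta> n)) powr p - N (T (\<beta> n) (\<zeta> n)) powr p" for n
  have AB: "A \<longlonglongrightarrow> 0" "B \<longlonglongrightarrow> 0"
    unfolding A_def B_def by (intro US.asymptotic_disjointness[OF ad(1) _ \<zeta>] US.asymptotic_disjointness[OF ad(2) _ \<zeta>]; simp)+
  have main: "N (T (\<alpha>0 n + \<beta> n) (\<zeta> n)) powr p \<le> (1 + 8 * \<iota> n) powr p + B n - A n" for n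
  proof -
    have "N (T (\<alpha>0 n) (\<zeta> n)) = N (T b0 (T (\<alpha> n) (\<zeta> n)))"
      unfolding \<alpha>0_def by (intro N_cong_AE T_mult T_V \<zeta>)
    also have "\<dots> \<le> norm b0 * N (T (\<alpha> n) (\<zeta> n))" by (intro T_bound T_V \<zeta>)
    also have "\<dots> \<le> N (T (\<alpha> n) (\<zeta> n))" using b0(1) by (intro mult_left_le_one_le N_nonneg) auto
    finally have "N (T (\<alpha>0 n) (\<zeta> n)) powr p \<le> N (T (\<alpha> n) (\<zeta> n)) powr p"
      using p_gt_1 by (intro powr_mono2 N_nonneg) auto
    moreover have "norm (\<alpha> n + \<beta> n) \<le> (1 + 4 * \<iota> n) + 4 * \<iota> n"
      by (rule norm_diff_le[OF _ u1 du]) (simp add: \<alpha>_def \<beta>_def d_def algebra_simps)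
    then have "N (T (\<alpha> n + \<beta> n) (\<zeta> n)) \<le> 1 + 8 * \<iota> n"
      using N_T_le[OF \<zeta>, of "\<alpha> n + \<beta> n" n] by simp
    then have "N (T (\<alpha> n + \<beta> n) (\<zeta> n)) powr p \<le> (1 + 8 * \<iota> n) powr p"
      using p_gt_1 by (intro powr_mono2 N_nonneg) auto
    ultimately show ?thesis by (simp add: A_def B_def)
  qed
  have "(\<lambda>n. (1 + 8 * \<iota> n) powr p + B n - A n) \<longlonglongrightarrow> (1 + 8 * 0) powr p + 0 - 0"
    by (intro tendsto_intros AB lim_\<iota>) auto
  moreover have "(1 + 8 * 0) powr p + 0 - 0 < (1 + \<epsilon> / 4) powr p"
    using powr_less_mono2[of p 1 "1 + \<epsilon> / 4"] p_gt_1 \<epsilon> by simp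
  ultimately have "\<forall>\<^sub>F n in sequentially. (1 + 8 * \<iota> n) powr p + B n - A n < (1 + \<epsilon> / 4) powr p"
    by (rule order_tendstoD(2))
  moreover have "\<forall>\<^sub>F n in sequentially. \<iota> n < min (\<epsilon> / 4) (\<epsilon> / (16 * (norm f + 1)))"
    using \<epsilon> by (intro order_tendstoD(2)[OF lim_\<iota>]) (auto intro!: divide_pos_pos mult_pos_pos add_nonneg_pos)
  ultimately have "\<forall>\<^sub>F n in sequentially. multiplier_norm (x n) \<le> 1 + \<epsilon> \<and> cmod (snd (x n) - 1) \<le> \<epsilon> \<and> Re (ext f (x n)) \<le> - norm f + \<epsilon>"
  proof eventually_elim
    case (elim n)
    have \<iota>\<epsilon>: "\<iota> n < \<epsilon> / 4" and "\<iota> n < \<epsilon> / (16 * (norm f + 1))" using elim(2) by auto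
    then have "16 * (norm f + 1) * \<iota> n \<le> \<epsilon>"
      by (simp add: pos_less_divide_eq add_nonneg_pos mult.commute less_imp_le)
    then have f\<iota>: "8 * norm f * \<iota> n \<le> \<epsilon> / 2" using \<iota>0[of n] by (simp add: algebra_simps)
    have "N (T (\<alpha>0 n + \<beta> n) (\<zeta> n)) < 1 + \<epsilon> / 4"
    proof (rule ccontr)
      assume "\<not> ?thesis"
      then have "(1 + \<epsilon> / 4) powr p \<le> N (T (\<alpha>0 n + \<beta> n) (\<zeta> n)) powr p"
        using p_gt_1 \<epsilon> by (intro powr_mono2) auto
      then show False using main[of n] elim(1) by linarith
    qed
    moreover have "norm (unit_action (x n) (c n) - (\<alpha>0 n + \<beta> n)) \<le> 2 * \<theta> n"
    proof -
      have "unit_action (x n) (c n) - (\<alpha>0 n + \<beta> n) = - ((b0 * h n - b0) * u n)"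
        by (simp add: xw u_def \<alpha>0_def \<alpha>_def \<beta>_def algebra_simps)
      then show ?thesis using norm_mult_le[OF bh[of n] u2[of n]] by simp
    qed
    ultimately have "multiplier_norm (x n) \<le> 1 + \<epsilon>"
      using near[of n] N_T_add_le[OF \<zeta>, of "unit_action (x n) (c n)" n "\<alpha>0 n + \<beta> n"] \<iota>\<epsilon> \<theta>\<iota>(1)[of n] \<theta>0[of n] by linarith
    then show ?case using snd_x[of n] ext_x[of n] f\<iota> \<iota>\<epsilon> \<theta>\<iota>(1)[of n] \<theta>0[of n] \<epsilon> by auto
  qed
  then show ?thesis using eventually_happens' sequentially_bot by fast
qed

end

section \<open>Scaled algebras\<close>

context smooth_algebra
begin

text \<open>From here on only this property is used, not how the elements were found. Applied to
  multiples of \<open>f\<close> by phases, it says that \<open>f\<close> almost attains its norm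
  with any prescribed phase at elements whose scalar part is almost 1.\<close>

definition near_normed :: bool
  where "near_normed \<longleftrightarrow> (\<forall>(f :: 'a cdual) \<epsilon>. 0 < \<epsilon> \<longrightarrow>
    (\<exists>x. multiplier_norm x \<le> 1 + \<epsilon> \<and> cmod (snd x - 1) \<le> \<epsilon> \<and> Re (ext f x) \<le> - norm f + \<epsilon>))"

text \<open>Asymptotically, a contractive functional on \<open>A\<^sup>1\<close> splits into a normal and a singular part whose
  norms add up; the phase \<open>k\<close> below aligns the two.\<close>

lemma functional_split:
  fixes F :: "'a \<times> complex \<Rightarrow> complex"
  assumes D: near_normed and F: "clinear F" "\<And>x. cmod (F x) \<le> multiplier_norm x"
    and f: "\<And>a. cdual_apply f a = F (a, 0)"
  shows "norm f + cmod (F (0, 1) - cdual_apply E f) \<le> 1"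
proof -
  define c where "c = F (0, 1) - cdual_apply E f"
  have Fx: "F x = ext f x + snd x * c" for x
  proof -
    have "x = (fst x, 0) + snd x *\<^sub>C (0, 1)" by (simp add: prod_eq_iff scaleC_prod_def scaleC_complex_def)
    then have "F x = F (fst x, 0) + snd x * F (0, 1)" by (metis clinearD(1,2)[OF F(1)])
    then show ?thesis by (simp add: ext_def c_def f algebra_simps)
  qed
  define k where "k = (if c = 0 then 1 else cnj (sgn c))"
  have k: "cmod k = 1" "k * c = of_real (cmod c)" by (auto simp: k_def norm_sgn cnj_sgn_mult)
  have "norm f + cmod c \<le> 1 + \<epsilon>" if \<epsilon>: "0 < \<epsilon>" for \<epsilon>
  proof -
    define \<epsilon>' where "\<epsilon>' = \<epsilon> / (2 + cmod c)"
    have c2: "0 < 2 + cmod c" by (simp add: add_pos_nonneg)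
    then have \<epsilon>': "0 < \<epsilon>'" "\<epsilon>' * (2 + cmod c) = \<epsilon>" using \<epsilon> by (auto simp: \<epsilon>'_def)
    obtain x where x: "multiplier_norm x \<le> 1 + \<epsilon>'" "cmod (snd x - 1) \<le> \<epsilon>'"
      "Re (ext (- (k *\<^sub>C f)) x) \<le> - norm (- (k *\<^sub>C f)) + \<epsilon>'"
      using D \<epsilon>' unfolding near_normed_def by blast
    have "ext (- (k *\<^sub>C f)) x = - (k * ext f x)" by (simp add: ext_def cdual_fun_simps cdual_simps algebra_simps)
    then have 1: "norm f - \<epsilon>' \<le> Re (k * ext f x)" using x(3) by (simp add: norm_scaleC k)
    have "\<bar>Re (snd x - 1)\<bar> \<le> \<epsilon>'" using abs_Re_le_cmod[of "snd x - 1"] x(2) by linarith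
    then have "1 - \<epsilon>' \<le> Re (snd x)" by simp
    then have 2: "(1 - \<epsilon>') * cmod c \<le> Re (snd x) * cmod c" by (intro mult_right_mono) auto
    have "k * F x = k * ext f x + snd x * (k * c)" by (simp add: Fx algebra_simps)
    then have "Re (k * F x) = Re (k * ext f x) + Re (snd x) * cmod c" by (simp add: k)
    moreover have "Re (k * F x) \<le> 1 + \<epsilon>'"
      using complex_Re_le_cmod[of "k * F x"] F(2)[of x] x(1) by (simp add: norm_mult k)
    ultimately have "norm f + cmod c \<le> 1 + \<epsilon>' * (2 + cmod c)" using 1 2 by (simp add: algebra_simps)
    then show ?thesis by (simp only: \<epsilon>'(2))
  qed
  then show ?thesis unfolding c_def by (rule field_le_epsilon)
qed

text \<open>If no correction worked, some \<open>F\<close> would be at least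
  \<open>1 + \<epsilon>'\<close> on the whole ball of radius \<open>2 * \<epsilon>\<close> about
  \<open>x\<close>. Additivity of the norms of its parts bounds \<open>Re (F x)\<close> by
  \<open>1 + norm f * \<epsilon>\<close>, because only the normal part sees the excess; but moving
  inside the ball lowers \<open>F\<close> by nearly \<open>2 * \<epsilon> * norm f\<close>.\<close>

lemma correction_step:
  assumes D: near_normed and x: "snd (x :: 'a \<times> complex) = 1" "multiplier_norm x \<le> 1 + \<epsilon>" and \<epsilon>: "0 \<le> \<epsilon>" "0 < \<epsilon>'"
  shows "\<exists>y. norm y \<le> 2 * \<epsilon> \<and> multiplier_norm (x - (y, 0)) \<le> 1 + \<epsilon>'"
proof (rule ccontr)
  assume "\<not> ?thesis"
  then have neg: "1 + \<epsilon>' \<le> multiplier_norm (x - (y, 0))" if "norm y \<le> 2 * \<epsilon>" for y using that by (meson less_imp_le not_le)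
  define Y where "Y = (\<lambda>y. x - (y, 0 :: complex)) ` cball 0 (2 * \<epsilon>)"
  have "Y = (+) x ` (\<lambda>y. (- y, 0 :: complex)) ` cball 0 (2 * \<epsilon>)" unfolding Y_def image_image by (rule image_cong) (simp_all add: prod_eq_iff)
  moreover have "convex ((\<lambda>y::'a. (- y, 0 :: complex)) ` cball 0 (2 * \<epsilon>))"
    by (intro convex_linear_image convex_cball) (auto intro!: linearI)
  ultimately have "convex Y" by (simp add: convex_translation)
  moreover have "Y \<noteq> {}" using \<epsilon> by (simp add: Y_def)
  moreover have "1 + \<epsilon>' \<le> multiplier_norm y" if "y \<in> Y" for y using that neg by (auto simp: Y_def)
  ultimately obtain F where F: "clinear F" "\<And>x. cmod (F x) \<le> multiplier_norm x" "\<And>y. y \<in> Y \<Longrightarrow> 1 + \<epsilon>' \<le> Re (F y)"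
    using hahn_banach_complex[OF cseminorm_multiplier_norm, of Y "1 + \<epsilon>'"] by metis
  obtain f where f: "\<And>a. cdual_apply f a = F (a, 0)" by (rule cdual_of_functional[OF F(1,2)]) (rule that)
  define c where "c = F (0, 1) - cdual_apply E f"
  have sp: "norm f + cmod c \<le> 1" unfolding c_def by (rule functional_split[OF D F(1,2) f])
  have Fx: "F x = ext f x + c"
  proof -
    have "x = (fst x, 0) + (0, 1)" by (simp add: prod_eq_iff x)
    then have "F x = F (fst x, 0) + F (0, 1)" by (metis clinearD(1)[OF F(1)])
    then show ?thesis by (simp add: ext_def c_def f x)
  qed
  have "cmod (ext f x) \<le> norm f * (1 + \<epsilon>)"
    by (rule order_trans[OF ext_bound]) (simp add: x mult_left_mono)
  then have Re: "Re (F x) \<le> 1 + norm f * \<epsilon>"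
    using complex_Re_le_cmod[of "ext f x"] complex_Re_le_cmod[of c] sp unfolding Fx by (simp add: algebra_simps)
  have "norm f * (2 * \<epsilon>) \<le> Re (F x) - (1 + \<epsilon>')"
  proof (cases "\<epsilon> = 0")
    case True
    then show ?thesis using F(3)[of x] by (simp add: Y_def image_iff flip: zero_prod_def)
  next
    case False
    have "norm f \<le> (Re (F x) - (1 + \<epsilon>')) / (2 * \<epsilon>)"
    proof (rule cdual_norm_le_ball)
      fix y :: 'a assume y: "norm y \<le> 1"
      then have "x - ((2 * \<epsilon>) *\<^sub>R y, 0) \<in> Y" unfolding Y_def using \<epsilon> mult_left_mono[OF y, of "2 * \<epsilon>"] by (intro imageI) auto
      from F(3)[OF this] have "1 + \<epsilon>' \<le> Re (F x) - 2 * \<epsilon> * Re (cdual_apply f y)"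
        by (simp add: clinearD[OF F(1)] cdual_simps flip: f)
      then show "Re (cdual_apply f y) \<le> (Re (F x) - (1 + \<epsilon>')) / (2 * \<epsilon>)"
        using \<epsilon> False by (simp add: pos_le_divide_eq mult.commute)
    qed
    then show ?thesis using \<epsilon> False by (simp add: pos_le_divide_eq)
  qed
  then have "2 * (norm f * \<epsilon>) \<le> Re (F x) - (1 + \<epsilon>')" by (simp add: mult.left_commute)
  then show False using Re \<epsilon> mult_nonneg_nonneg[of "norm f" \<epsilon>] norm_ge_zero[of f] by linarith
qed

text \<open>Each step halves the excess \<epsilon>' n over 1 at the cost of a displacement of at
  most \<open>2 * \<epsilon>' n\<close>; these displacements sum to \<open>4 * \<epsilon>\<close>,
  and by completeness the limit has no excess.\<close>

lemma correction:
  assumes D: near_normed and x: "snd (x :: 'a \<times> complex) = 1" "multiplier_norm x \<le> 1 + \<epsilon>" and \<epsilon>: "0 < \<epsilon>"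
  shows "\<exists>z. norm z \<le> 4 * \<epsilon> \<and> multiplier_norm (x - (z, 0)) \<le> 1"
proof -
  define \<epsilon>' where "\<epsilon>' n = \<epsilon> * (1 / 2) ^ n" for n :: nat
  have \<epsilon>': "0 < \<epsilon>' n" for n using \<epsilon> by (simp add: \<epsilon>'_def)
  have "\<exists>z. \<forall>n. multiplier_norm (x - (z n, 0)) \<le> 1 + \<epsilon>' n \<and> (n = 0 \<longrightarrow> z n = 0) \<and> norm (z (Suc n) - z n) \<le> 2 * \<epsilon>' n"
  proof (rule dependent_nat_choice[where P = "\<lambda>n z. multiplier_norm (x - (z, 0)) \<le> 1 + \<epsilon>' n \<and> (n = 0 \<longrightarrow> z = 0)"
        and Q = "\<lambda>n z z'. norm (z' - z) \<le> 2 * \<epsilon>' n", simplified conj_assoc])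
    show "\<exists>z. multiplier_norm (x - (z, 0)) \<le> 1 + \<epsilon>' 0 \<and> (0 = (0::nat) \<longrightarrow> z = 0)"
      using x by (intro exI[of _ 0]) (simp add: \<epsilon>'_def flip: zero_prod_def)
    fix z n assume z: "multiplier_norm (x - (z, 0)) \<le> 1 + \<epsilon>' n \<and> (n = 0 \<longrightarrow> z = 0)"
    have "snd (x - (z, 0)) = 1" using x by simp
    from correction_step[OF D this conjunct1[OF z] less_imp_le[OF \<epsilon>'] \<epsilon>'[of "Suc n"]]
    obtain y where y: "norm y \<le> 2 * \<epsilon>' n" "multiplier_norm (x - (z, 0) - (y, 0)) \<le> 1 + \<epsilon>' (Suc n)" by blast
    then show "\<exists>z'. multiplier_norm (x - (z', 0)) \<le> 1 + \<epsilon>' (Suc n) \<and> (Suc n = 0 \<longrightarrow> z' = 0) \<and> norm (z' - z) \<le> 2 * \<epsilon>' n"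
      by (intro exI[of _ "z + y"]) (simp add: diff_diff_eq)
  qed
  then obtain z where z: "\<And>n. multiplier_norm (x - (z n, 0)) \<le> 1 + \<epsilon>' n" "z 0 = 0" "\<And>n. norm (z (Suc n) - z n) \<le> 2 * \<epsilon>' n"
    by metis
  have geo: "(\<lambda>n. 2 * \<epsilon>' n) sums (4 * \<epsilon>)"
    using sums_mult[OF geometric_sums[of "1 / 2 :: real"], of "2 * \<epsilon>"] by (simp add: \<epsilon>'_def mult.assoc)
  define w where "w n = z (Suc n) - z n" for n
  have nw: "summable (\<lambda>n. norm (w n))"
    by (rule summable_comparison_test'[OF sums_summable[OF geo], of 0]) (simp add: w_def z)
  have ws: "summable w" by (rule summable_norm_cancel[OF nw])
  have zn: "z = (\<lambda>n. \<Sum>i<n. w i)" by (rule ext) (simp add: w_def sum_lessThan_telescope z(2))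
  have lim: "z \<longlonglongrightarrow> suminf w" unfolding zn by (rule summable_LIMSEQ[OF ws])
  have "norm (suminf w) \<le> (\<Sum>n. norm (w n))" by (rule summable_norm[OF nw])
  also have "\<dots> \<le> (\<Sum>n. 2 * \<epsilon>' n)" by (intro suminf_le nw sums_summable[OF geo]) (simp add: w_def z)
  also have "\<dots> = 4 * \<epsilon>" using geo by (rule sums_unique[symmetric])
  finally have "norm (suminf w) \<le> 4 * \<epsilon>" .
  moreover have "multiplier_norm (x - (suminf w, 0)) \<le> 1"
  proof (rule LIMSEQ_le_const)
    have "\<epsilon>' \<longlonglongrightarrow> 0" unfolding \<epsilon>'_def[abs_def] by real_asymp
    then have "(\<lambda>n. 1 + \<epsilon>' n + norm (z n - suminf w)) \<longlonglongrightarrow> 1 + 0 + norm (suminf w - suminf w)"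
      by (intro tendsto_intros lim)
    then show "(\<lambda>n. 1 + \<epsilon>' n + norm (z n - suminf w)) \<longlonglongrightarrow> 1" by simp
    have "multiplier_norm (x - (suminf w, 0)) \<le> 1 + \<epsilon>' n + norm (z n - suminf w)" for n
    proof -
      have "multiplier_norm (x - (suminf w, 0)) = multiplier_norm ((x - (z n, 0)) + (z n - suminf w, 0))"
        by (rule arg_cong[where f = multiplier_norm]) (simp add: prod_eq_iff)
      also have "\<dots> \<le> multiplier_norm (x - (z n, 0)) + multiplier_norm (z n - suminf w, 0 :: complex)"
        by (rule multiplier_norm_simps(1))
      finally show ?thesis using z(1)[of n] by (simp add: multiplier_norm_embed)
    qed
    then show "\<exists>N. \<forall>n\<ge>N. multiplier_norm (x - (suminf w, 0)) \<le> 1 + \<epsilon>' n + norm (z n - suminf w)" by blast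
  qed
  ultimately show ?thesis by blast
qed

lemma near_normed_imp_F:
  fixes f :: "'a cdual"
  assumes D: near_normed and f: "\<And>a. multiplier_norm ((0, 1) - (a, 0)) \<le> 1 \<Longrightarrow> Re (cdual_apply f a) \<le> c"
  shows "Re (cdual_apply E f) + norm f \<le> c"
proof (rule field_le_epsilon)
  fix \<delta> :: real assume \<delta>: "0 < \<delta>"
  \<comment> \<open>Of the 9 multiples of \<open>norm f\<close>, 8 come from the correction
    \<open>z\<close>, whose starting excess is \<open>2 * \<epsilon>\<close>, and one from making
    the scalar part exactly 1; the single \<open>\<epsilon>\<close> is the defect in
    norming.\<close>
  define \<epsilon> where "\<epsilon> = \<delta> / (1 + 9 * norm f)"
  have "0 < 1 + 9 * norm f" by (simp add: add_pos_nonneg)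
  then have \<epsilon>: "0 < \<epsilon>" "\<epsilon> * (1 + 9 * norm f) = \<delta>" using \<delta> by (auto simp: \<epsilon>_def)
  obtain x where x: "multiplier_norm x \<le> 1 + \<epsilon>" "cmod (snd x - 1) \<le> \<epsilon>" "Re (ext f x) \<le> - norm f + \<epsilon>"
    using D \<epsilon>(1) unfolding near_normed_def by blast
  define x1 where "x1 = x + (0, 1 - snd x)"
  have "multiplier_norm (0 :: 'a, 1 - snd x) = cmod (1 - snd x) * multiplier_norm (0 :: 'a, 1)"
    using multiplier_norm_simps(2)[of "1 - snd x" "(0 :: 'a, 1)"] by (simp add: scaleC_prod_def scaleC_complex_def)
  also have "\<dots> \<le> \<epsilon> * 1" using x(2) multiplier_norm_one_le \<epsilon> by (intro mult_mono) (auto simp: norm_minus_commute multiplier_norm_nonneg)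
  finally have "multiplier_norm x1 \<le> 1 + 2 * \<epsilon>"
    unfolding x1_def using multiplier_norm_simps(1)[of x "(0, 1 - snd x)"] x(1) by linarith
  moreover have "snd x1 = 1" by (simp add: x1_def)
  ultimately obtain z where z: "norm z \<le> 4 * (2 * \<epsilon>)" "multiplier_norm (x1 - (z, 0)) \<le> 1"
    using correction[OF D, of x1 "2 * \<epsilon>"] \<epsilon> by auto
  have "x1 - (z, 0) = (0, 1) - (z - fst x, 0)" by (simp add: x1_def prod_eq_iff)
  then have "Re (cdual_apply f (z - fst x)) \<le> c" using z(2) by (intro f) simp
  then have 1: "Re (cdual_apply f z) - Re (cdual_apply f (fst x)) \<le> c" by (simp add: cdual_simps)
  have "cmod (cdual_apply f z) \<le> norm f * (8 * \<epsilon>)"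
    by (rule order_trans[OF cdual_apply_bound]) (use z(1) in \<open>simp add: mult_left_mono\<close>)
  then have 2: "- (norm f * (8 * \<epsilon>)) \<le> Re (cdual_apply f z)" using abs_Re_le_cmod[of "cdual_apply f z"] by linarith
  have "cmod ((snd x - 1) * cdual_apply E f) \<le> \<epsilon> * norm f"
    unfolding norm_mult using x(2) cmod_E_le \<epsilon> by (intro mult_mono) auto
  then have 3: "- (\<epsilon> * norm f) \<le> Re ((snd x - 1) * cdual_apply E f)"
    using abs_Re_le_cmod[of "(snd x - 1) * cdual_apply E f"] by linarith
  have "ext f x = cdual_apply f (fst x) + cdual_apply E f + (snd x - 1) * cdual_apply E f"
    by (simp add: ext_def left_diff_distrib)
  then have "Re (ext f x) = Re (cdual_apply f (fst x)) + Re (cdual_apply E f) + Re ((snd x - 1) * cdual_apply E f)" by simp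
  then have "Re (cdual_apply E f) + norm f \<le> c + \<epsilon> * (1 + 9 * norm f)" using 1 2 3 x(3) by (simp add: algebra_simps)
  then show "Re (cdual_apply E f) + norm f \<le> c + \<delta>" by (simp only: \<epsilon>(2))
qed

end

lemma (in Lp_algebra) scaled_states_imp_near_normed:
  assumes "(c0::'a) \<noteq> 0" "\<not> unital TYPE('a)" scaled_states
  shows near_normed
  unfolding near_normed_def using near_norming[OF assms] by blast

section \<open>Scaledness and normal functionals\<close>

context smooth_algebra
begin

text \<open>A quasistate is a multiple of a restricted state of norm exactly 1, and such a
  functional has no singular part.\<close>

lemma scaled_imp_scaled_states:
  assumes nu: "\<not> unital TYPE('a)" and sc: "scaled TYPE('a)"
  shows scaled_states
  unfolding scaled_states_def
proof (intro allI impI)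
  fix \<omega> f assume \<omega>: "is_state multiplier_norm (0 :: 'a, 1) \<omega>" and f: "\<forall>a. cdual_apply f a = \<omega> (a, 0)"
  have "(\<lambda>a. \<omega> (a, 0)) \<in> quasistates TYPE('a)"
    using sc nu \<omega> unfolding scaled_def restricted_states_def by auto
  then obtain t \<phi> where t: "0 \<le> t" "t \<le> 1" and \<phi>: "\<phi> \<in> states TYPE('a)" and eq: "(\<lambda>a. \<omega> (a, 0)) = (\<lambda>a. complex_of_real t * \<phi> a)"
    unfolding quasistates_def by auto
  obtain \<omega>' where \<omega>': "is_state multiplier_norm (0 :: 'a, 1) \<omega>'" "\<phi> = (\<lambda>a. \<omega>' (a, 0))" and n1: "has_functional_norm norm \<phi> 1"
    using \<phi> nu unfolding states_def restricted_states_def by auto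
  have "clinear \<omega>'" "\<And>x. cmod (\<omega>' x) \<le> multiplier_norm x" using \<omega>'(1) by (auto simp: is_state_multiplier_iff)
  then obtain g where g: "\<And>a. cdual_apply g a = \<omega>' (a, 0)" by (rule cdual_of_functional) (rule that)
  have "cdual_apply g = \<phi>" by (rule ext) (simp add: g \<omega>')
  then have "norm g = 1" using has_functional_norm_unique[OF has_functional_norm_cdual[of g]] n1 by simp
  moreover from this have "cdual_apply E g = 1" by (rule state_normal[OF \<omega>'(1) g])
  moreover have "f = of_real t *\<^sub>C g"
    by (rule cdual_eqI) (use fun_cong[OF eq] in \<open>simp add: f cdual_fun_simps g \<omega>'(2)\<close>)
  ultimately show "cdual_apply E f = of_real (norm f)" using t by (simp add: cdual_simps norm_scaleC)
qed

lemma normal_functional_in_states: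
  assumes nu: "\<not> unital TYPE('a)" and g: "norm g = 1" "cdual_apply E g = 1"
  shows "cdual_apply g \<in> states TYPE('a)"
proof -
  have "is_state multiplier_norm (0, 1) (ext g)" by (rule is_state_ext) (simp_all add: g)
  moreover have "cdual_apply g = (\<lambda>a. ext g (a, 0))" by (simp add: ext_def)
  ultimately have "cdual_apply g \<in> restricted_states TYPE('a)" using nu unfolding restricted_states_def by auto
  then show ?thesis using has_functional_norm_cdual[of g] g unfolding states_def by simp
qed

text \<open>For \<open>f\<close> norming \<open>c0\<close>, the functional
  \<open>b \<mapsto> f (b c0) / norm c0\<close> is contractive and takes the value 1 at
  \<open>E\<close>.\<close>

lemma normal_functional_exists:
  assumes nz: "(c0::'a) \<noteq> 0"
  shows "\<exists>g. norm g = 1 \<and> cdual_apply E g = 1"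
proof -
  obtain f where f: "norm f \<le> 1" "cdual_apply f c0 = of_real (norm c0)" by (rule norming_functional)
  define g where "g = of_real (1 / norm c0) *\<^sub>C right_shift f c0"
  have "cdual_apply E (right_shift f c0) = cdual_apply f c0"
    by (rule unit_limit_unique) (simp add: right_shift.rep_eq[abs_def], intro cdual_tendsto unit_tendsto)
  then have 1: "cdual_apply E g = 1" using nz by (simp add: g_def cdual_simps f(2))
  have "norm (right_shift f c0) \<le> 1 * norm c0"
    by (rule order_trans[OF norm_right_shift mult_right_mono[OF f(1)]]) simp
  then have "norm g \<le> 1" using nz by (simp add: g_def norm_scaleC norm_divide)
  moreover have "1 \<le> norm g" using cmod_E_le[of g] 1 by simp
  ultimately show ?thesis using 1 by auto
qed

text \<open>The missing mass \<open>1 - t\<close> is put on the character of \<open>A^1\<close> that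
  vanishes on \<open>A\<close>, which is a state in the nonunital case.\<close>

lemma quasistates_subset:
  assumes nz: "(c0::'a) \<noteq> 0" and nu: "\<not> unital TYPE('a)"
  shows "quasistates TYPE('a) \<subseteq> restricted_states TYPE('a)"
proof
  fix \<psi> assume "\<psi> \<in> quasistates TYPE('a)"
  then obtain t \<phi> where t: "0 \<le> t" "t \<le> 1" and \<phi>: "\<phi> \<in> states TYPE('a)" "\<psi> = (\<lambda>a. complex_of_real t * \<phi> a)"
    unfolding quasistates_def by auto
  obtain \<omega> where \<omega>: "is_state multiplier_norm (0 :: 'a, 1) \<omega>" "\<phi> = (\<lambda>a. \<omega> (a, 0))"
    using \<phi>(1) nu unfolding states_def restricted_states_def by auto
  define \<omega>' where "\<omega>' x = of_real t * \<omega> x + of_real (1 - t) * snd x" for x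
  have lin: "clinear \<omega>" and b: "cmod (\<omega> x) \<le> multiplier_norm x" and one: "\<omega> (0, 1) = 1" for x
    using \<omega>(1) unfolding is_state_multiplier_iff by blast+
  have "is_state multiplier_norm (0, 1) \<omega>'"
    unfolding is_state_multiplier_iff
  proof (intro conjI allI)
    show "clinear \<omega>'"
      unfolding clinear_def \<omega>'_def clinearD[OF lin] by (simp add: scaleC_prod_def scaleC_complex_def algebra_simps)
    show "cmod (\<omega>' x) \<le> multiplier_norm x" for x
    proof -
      have "cmod (\<omega>' x) \<le> cmod (of_real t * \<omega> x) + cmod (of_real (1 - t) * snd x)"
        unfolding \<omega>'_def by (rule norm_triangle_ineq)
      also have "\<dots> = t * cmod (\<omega> x) + (1 - t) * cmod (snd x)"
        unfolding norm_mult norm_of_real using t by simp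
      also have "\<dots> \<le> t * multiplier_norm x + (1 - t) * multiplier_norm x"
        using t by (intro add_mono mult_left_mono b cmod_snd_le[OF nz nu]) auto
      finally show ?thesis by (simp add: algebra_simps)
    qed
    show "\<omega>' (0, 1) = 1" by (simp add: \<omega>'_def one)
  qed
  moreover have "\<psi> = (\<lambda>a. \<omega>' (a, 0))" by (simp add: \<phi>(2) \<omega>(2) \<omega>'_def)
  ultimately show "\<psi> \<in> restricted_states TYPE('a)" using nu unfolding restricted_states_def by auto
qed

text \<open>For a restricted state \<open>f\<close>, the functional \<open>- f\<close> is
  nonpositive on the cone of \<open>A\<close>, hence by density on that of the bidual. Testing at
  \<open>E - y\<close> with \<open>y\<close> norming \<open>f\<close> gives
  \<open>norm f \<le> Re (E f)\<close>, so \<open>f\<close> is a multiple of a normal state.\<close>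

lemma dense_imp_scaled:
  assumes nz: "(c0::'a) \<noteq> 0" and nu: "\<not> unital TYPE('a)"
    and D: "\<And>f. (\<And>a. real_positive multiplier_norm (0, 1) (a, 0) \<Longrightarrow> Re (cdual_apply f a) \<le> 0)
      \<Longrightarrow> (\<And>m. real_positive norm E m \<Longrightarrow> Re (cdual_apply m f) \<le> 0)"
  shows "scaled TYPE('a)"
proof -
  have "restricted_states TYPE('a) \<subseteq> quasistates TYPE('a)"
  proof
    fix \<psi> assume "\<psi> \<in> restricted_states TYPE('a)"
    then obtain \<omega> where \<omega>: "is_state multiplier_norm (0 :: 'a, 1) \<omega>" "\<psi> = (\<lambda>a. \<omega> (a, 0))"
      using nu unfolding restricted_states_def by auto
    have "clinear \<omega>" "\<And>x. cmod (\<omega> x) \<le> multiplier_norm x" using \<omega>(1) by (auto simp: is_state_multiplier_iff)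
    then obtain f where f: "\<And>a. cdual_apply f a = \<omega> (a, 0)" "norm f \<le> 1" by (rule cdual_of_functional) (rule that)
    have neg: "Re (cdual_apply (- f) a) \<le> 0" if "real_positive multiplier_norm (0, 1) (a, 0)" for a
      using that \<omega>(1) by (simp add: real_positive_def cdual_fun_simps f(1))
    obtain y where y: "norm y \<le> 1" "cdual_apply y f = of_real (norm f)" by (rule norming_functional)
    have rp: "real_positive norm E (E - y)"
      unfolding real_positive_def
    proof (intro allI impI)
      fix W assume W: "is_state norm E W"
      then have "cmod (W y) \<le> 1" using y(1) order_trans unfolding is_state_bidual_iff by blast
      moreover have "W (E - y) = 1 - W y" using W by (simp add: is_state_bidual_iff clinearD)
      ultimately show "0 \<le> Re (W (E - y))" using complex_Re_le_cmod[of "W y"] by simp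
    qed
    have "Re (cdual_apply (E - y) (- f)) \<le> 0" by (rule D[of "- f" "E - y"]) (erule neg, rule rp)
    then have "norm f \<le> Re (cdual_apply E f)" by (simp add: cdual_fun_simps cdual_simps y(2))
    moreover have "Re (cdual_apply E f) \<le> norm f"
      using complex_Re_le_cmod cmod_E_le order_trans by blast
    ultimately have re: "Re (cdual_apply E f) = norm f" by simp
    have "(Re (cdual_apply E f))\<^sup>2 + (Im (cdual_apply E f))\<^sup>2 \<le> (norm f)\<^sup>2"
      using power_mono[OF cmod_E_le[of f], of 2] by (simp add: cmod_power2)
    then have E: "cdual_apply E f = of_real (norm f)" by (simp add: re complex_eq_iff)
    \<comment> \<open>The zero functional is the multiple 0 of a state, which requires that some
      normal state exists.\<close>
    obtain g where g: "norm g = 1" "cdual_apply E g = 1" and fg: "f = of_real (norm f) *\<^sub>C g"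
    proof (cases "f = 0")
      case True
      then show ?thesis using normal_functional_exists[OF nz] that by auto
    next
      case False
      then show ?thesis
        by (intro that[of "of_real (1 / norm f) *\<^sub>C f"]) (simp_all add: norm_scaleC norm_divide cdual_simps E scaleC_scaleC)
    qed
    have "\<psi> = (\<lambda>a. of_real (norm f) * cdual_apply g a)"
    proof
      fix a
      have "\<psi> a = cdual_apply f a" by (simp add: \<omega>(2) f(1))
      also have "\<dots> = of_real (norm f) * cdual_apply g a" by (subst fg) (simp add: cdual_fun_simps)
      finally show "\<psi> a = of_real (norm f) * cdual_apply g a" .
    qed
    moreover have "norm f \<in> {0..1}" using f(2) by simp
    ultimately show "\<psi> \<in> quasistates TYPE('a)"
      using normal_functional_in_states[OF nu g] unfolding quasistates_def by blast
  qed
  then show ?thesis using quasistates_subset[OF nz nu] unfolding scaled_def by blast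
qed

text \<open>In the zero algebra the formal unit has multiplier norm 0, so there are no states and
  both sets are empty.\<close>

lemma zero_algebra_scaled:
  assumes z: "\<And>c::'a. c = 0"
  shows "scaled TYPE('a)"
proof -
  have nu: "\<not> unital TYPE('a)" using z unfolding unital_def by (metis norm_zero zero_neq_one)
  have "unit_action (0 :: 'a, 1) c = 0" for c by (rule z)
  then have "multiplier_norm (0 :: 'a, 1) \<le> 0" by (intro multiplier_norm_le) auto
  then have "\<not> is_state multiplier_norm (0 :: 'a, 1) \<omega>" for \<omega>
    unfolding is_state_multiplier_iff by (metis norm_one not_one_le_zero order_trans)
  then have "restricted_states TYPE('a) = {}" using nu by (simp add: restricted_states_def)
  then show ?thesis unfolding scaled_def quasistates_def states_def by auto
qed

section \<open>Density in the unital and in the nonunital case\<close>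

text \<open>Here \<open>E\<close> is the image of the identity \<open>e\<close>, and the set for
  \<open>A\<close> is the translated ball \<open>e + y\<close> with \<open>norm y \<le> 1\<close>.
  Its support function is already that of the corresponding ball of the bidual, as in Goldstine's
  theorem; the other two densities follow from this one.\<close>

lemma unital_dense:
  assumes un: "unital TYPE('a)"
  shows "weak_star_dense (canonical_embedding ` r_set TYPE('a)) (r_set_bidual TYPE('a))"
    and "weak_star_dense (canonical_embedding ` (r_set TYPE('a) \<inter> cball 0 1)) (r_set_bidual TYPE('a) \<inter> cball 0 1)"
    and "weak_star_dense (canonical_embedding ` F_set TYPE('a)) (F_set_bidual TYPE('a))"
proof -
  obtain e :: 'a where e: "is_identity (*) e" using un unfolding unital_def by blast
  have id: "identity_of (*) = e"
    unfolding identity_of_def by (rule the_equality[of _ e]) (use e in \<open>auto simp: is_identity_def, metis\<close>)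
  have E: "canonical_embedding e = E"
  proof (rule cdual_eqI)
    fix f
    have "cdual_apply E f = cdual_apply f e"
      by (rule unit_limit_unique) (use cdual_tendsto[OF unit_tendsto(1)[of e], of f] e in \<open>simp add: is_identity_def\<close>)
    then show "cdual_apply (canonical_embedding e) f = cdual_apply E f" by simp
  qed
  interpret UN: unitization "TYPE('a)" canonical_embedding e "\<lambda>a. a"
    by unfold_locales (simp_all add: canonical_embedding_linear E)
  have R: "r_set TYPE('a) = UN.R" and F: "F_set TYPE('a) = UN.FF"
    using un by (simp_all add: r_set_def F_set_def id norm_canonical_embedding)
  have 3: "weak_star_dense (canonical_embedding ` UN.FF) (F_set_bidual TYPE('a))"
    unfolding UN.dense_F_iff
  proof (intro allI impI)
    fix f c assume f: "\<forall>a\<in>UN.FF. Re (cdual_apply f a) \<le> c"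
    have Ef: "cdual_apply E f = cdual_apply f e" unfolding E[symmetric] by simp
    have "norm f \<le> c - Re (cdual_apply f e)"
    proof (rule cdual_norm_le_ball)
      fix y :: 'a assume "norm y \<le> 1"
      then have "e + y \<in> UN.FF" by (simp add: norm_canonical_embedding)
      then have "Re (cdual_apply f (e + y)) \<le> c" using f by blast
      then show "Re (cdual_apply f y) \<le> c - Re (cdual_apply f e)" by (simp add: cdual_simps)
    qed
    then show "Re (cdual_apply E f) + norm f \<le> c" by (simp add: Ef)
  qed
  then show "weak_star_dense (canonical_embedding ` F_set TYPE('a)) (F_set_bidual TYPE('a))" unfolding F .
  have 1: "weak_star_dense (canonical_embedding ` UN.R) (r_set_bidual TYPE('a))" by (rule UN.dense_F_imp_dense_R[OF 3])
  then show "weak_star_dense (canonical_embedding ` r_set TYPE('a)) (r_set_bidual TYPE('a))" unfolding R .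
  show "weak_star_dense (canonical_embedding ` (r_set TYPE('a) \<inter> cball 0 1)) (r_set_bidual TYPE('a) \<inter> cball 0 1)"
    unfolding R by (rule UN.dense_R_imp_dense_R_ball[OF 1])
qed

lemma nonunital_dense:
  assumes nu: "\<not> unital TYPE('a)"
  shows "weak_star_dense (canonical_embedding ` r_set TYPE('a)) (r_set_bidual TYPE('a)) \<longleftrightarrow>
      weak_star_dense (canonical_embedding ` (r_set TYPE('a) \<inter> cball 0 1)) (r_set_bidual TYPE('a) \<inter> cball 0 1)" (is "?P \<longleftrightarrow> ?Q")
    and "weak_star_dense (canonical_embedding ` F_set TYPE('a)) (F_set_bidual TYPE('a)) \<Longrightarrow>
      weak_star_dense (canonical_embedding ` r_set TYPE('a)) (r_set_bidual TYPE('a))"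
    and "weak_star_dense (canonical_embedding ` r_set TYPE('a)) (r_set_bidual TYPE('a)) \<Longrightarrow> scaled TYPE('a)"
    and "near_normed \<Longrightarrow> weak_star_dense (canonical_embedding ` F_set TYPE('a)) (F_set_bidual TYPE('a))"
proof -
  interpret UN: unitization "TYPE('a)" embed "(0, 1)" "\<lambda>a. (a, 0)"
    by unfold_locales (simp_all add: embed_linear embed_unit embed_canonical)
  have R: "r_set TYPE('a) = UN.R" and F: "F_set TYPE('a) = UN.FF"
    using nu by (simp_all add: r_set_def F_set_def norm_embed)
  show "?P \<longleftrightarrow> ?Q" unfolding R using UN.dense_R_imp_dense_R_ball UN.dense_R_ball_imp_dense_R by blast
  show "weak_star_dense (canonical_embedding ` F_set TYPE('a)) (F_set_bidual TYPE('a)) \<Longrightarrow>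
      weak_star_dense (canonical_embedding ` r_set TYPE('a)) (r_set_bidual TYPE('a))"
    unfolding R F by (rule UN.dense_F_imp_dense_R)
  show "weak_star_dense (canonical_embedding ` F_set TYPE('a)) (F_set_bidual TYPE('a))" if near_normed
    unfolding F UN.dense_F_iff
  proof (intro allI impI)
    fix f c assume f: "\<forall>a\<in>UN.FF. Re (cdual_apply f a) \<le> c"
    show "Re (cdual_apply E f) + norm f \<le> c"
      by (rule near_normed_imp_F[OF that]) (use f in \<open>simp add: norm_embed\<close>)
  qed
  show "scaled TYPE('a)" if 1: "weak_star_dense (canonical_embedding ` r_set TYPE('a)) (r_set_bidual TYPE('a))"
  proof (cases "\<exists>c0::'a. c0 \<noteq> 0")
    case True
    then obtain c0 :: 'a where nz: "c0 \<noteq> 0" by blast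
    note crit = 1[unfolded R UN.dense_R_iff, rule_format]
    show ?thesis
    proof (rule dense_imp_scaled[OF nz nu])
      fix f :: "'a cdual" and m assume f: "\<And>a. real_positive multiplier_norm (0, 1) (a, 0) \<Longrightarrow> Re (cdual_apply f a) \<le> 0"
        and m: "real_positive norm E m"
      show "Re (cdual_apply m f) \<le> 0"
        by (rule crit) (use f m in \<open>simp_all add: norm_embed UN.RR_eq\<close>)
    qed
  next
    case False
    then show ?thesis by (intro zero_algebra_scaled) blast
  qed
qed

lemma zero_algebra_near_normed:
  assumes z: "\<And>c::'a. c = 0"
  shows near_normed
  unfolding near_normed_def
proof (intro allI impI)
  fix f :: "'a cdual" and \<epsilon> :: real assume \<epsilon>: "0 < \<epsilon>"
  have "f = 0"
  proof (rule cdual_eqI)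
    show "cdual_apply f x = cdual_apply 0 x" for x by (subst z[of x]) (simp add: cdual_simps cdual_fun_simps)
  qed
  then have "Re (ext f (0, 1)) \<le> - norm f + \<epsilon>" using \<epsilon> by (simp add: ext_def cdual_simps cdual_fun_simps)
  moreover have "multiplier_norm (0 :: 'a, 1) \<le> 1 + \<epsilon>" by (rule order_trans[OF multiplier_norm_one_le]) (use \<epsilon> in simp)
  ultimately show "\<exists>x. multiplier_norm x \<le> 1 + \<epsilon> \<and> cmod (snd x - 1) \<le> \<epsilon> \<and> Re (ext f x) \<le> - norm f + \<epsilon>"
    using \<epsilon> by (intro exI[of _ "(0, 1)"]) simp
qed

end

lemma (in Lp_algebra) scaled_imp_near_normed:
  assumes nu: "\<not> unital TYPE('a)" and sc: "scaled TYPE('a)"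
  shows near_normed
proof (cases "\<exists>c0::'a. c0 \<noteq> 0")
  case True
  then show ?thesis using scaled_states_imp_near_normed[OF _ nu scaled_imp_scaled_states[OF nu sc]] by blast
next
  case False
  then show ?thesis by (intro zero_algebra_near_normed) blast
qed

theorem proposition7p1:
  fixes p :: real and M :: "'x measure"
  assumes "1 < p"
    and "Lp_operator_algebra p M TYPE('a::complex_banach_algebra)"
    and "approximately_unital TYPE('a)"
  shows "(weak_star_dense (canonical_embedding ` r_set TYPE('a)) (r_set_bidual TYPE('a))
      \<longleftrightarrow> weak_star_dense (canonical_embedding ` (r_set TYPE('a) \<inter> cball 0 1))
            (r_set_bidual TYPE('a) \<inter> cball 0 1)) \<and>
    (weak_star_dense (canonical_embedding ` (r_set TYPE('a) \<inter> cball 0 1))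
            (r_set_bidual TYPE('a) \<inter> cball 0 1)
      \<longleftrightarrow> weak_star_dense (canonical_embedding ` F_set TYPE('a)) (F_set_bidual TYPE('a))) \<and>
    (weak_star_dense (canonical_embedding ` F_set TYPE('a)) (F_set_bidual TYPE('a))
      \<longleftrightarrow> scaled TYPE('a))"
proof -
  obtain T :: "'a \<Rightarrow> ('x \<Rightarrow> complex) \<Rightarrow> ('x \<Rightarrow> complex)" where "Lp_action p M T"
    by (rule Lp_operator_algebra_action[OF assms(1,2)])
  then interpret Lp_algebra p M T
    using assms(3) by (simp add: Lp_algebra_def Lp_algebra_axioms_def)
  show ?thesis
  proof (cases "unital TYPE('a)")
    case True
    then show ?thesis using unital_dense[OF True] by (simp add: scaled_def)
  next
    case False
    then show ?thesis using nonunital_dense[OF False] scaled_imp_near_normed[OF False] by blast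
  qed
qed

end
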